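(* Let $(\Gamma,\epsilon)$ be a finite orientifold group, $X$ an orientifold for $(\Gamma,\epsilon)$, and $V\to X$ a real oriented $\Gamma$-equivariant vector bundle of rank $n$ on which $\Gamma$ acts by orientation-preserving isometries of an invariant fibre metric. If $V$ is $\mathrm{Spin}^\kappa$-oriented (i.e. has a $\mathrm{Spin}^\kappa$-structure), then the (isomorphism classes of) $\mathrm{Spin}^\kappa$-structures on $V$ are in bijective correspondence with the elements of $H^2_\Gamma(X,(\mathbb Z,\iota_\epsilon))$.
   Context: An orientifold group $(\Gamma,\epsilon)$ is a Lie group $\Gamma$ with a non-trivial homomorphism $\epsilon:\Gamma\to\mathbb Z_2=\{\pm1\}$. An orientifold is a compact smooth manifold with a smooth action of a finite orientifold group. A $\Gamma$-group $(G,\theta)$ is a Lie group $G$ with an action $\theta$ of $\Gamma$ by automorphisms, written $\gamma g$. $\mathrm{id}_\epsilon$ is the trivial action; $\kappa_\epsilon$ on $U(1)$ is complex conjugation if $\epsilon(\gamma)=-1$ and the identity otherwise; $\iota_\epsilon$ on $\mathbb Z$ is $\gamma t=\epsilon(\gamma)t$. $\mathrm{Spin}^c(n)=(\mathrm{Spin}(n)\times U(1))/\{\pm(1,1)\}$ carries the action $\kappa_\epsilon[g,z]=[g,\kappa_\epsilon(z)]$, and $\mathrm{Ad}^c[g,z]=\mathrm{Ad}(g)\in SO(n)$, with $\mathrm{Ad}:\mathrm{Spin}(n)\to SO(n)$ the double cover. A $\Gamma$-semi-equivariant principal $(G,\theta)$-bundle over $X$ is a smooth principal $G$-bundle $P\to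 X$ with a left $\Gamma$-action covering that on $X$ with $\gamma(pg)=(\gamma p)(\gamma g)$. $\mathrm{Fr}(V)$ is the bundle of oriented orthonormal frames of $V$, a $\Gamma$-semi-equivariant principal $(SO(n),\mathrm{id}_\epsilon)$-bundle. A $\mathrm{Spin}^\kappa$-structure for $V$ is a $\Gamma$-semi-equivariant principal $(\mathrm{Spin}^c(n),\kappa_\epsilon)$-bundle $P$ with a $\Gamma$-equivariant smooth map $\varphi:P\to\mathrm{Fr}(V)$ over $\mathrm{id}_X$ with $\varphi(pg)=\varphi(p)\mathrm{Ad}^c(g)$; an isomorphism of $\mathrm{Spin}^\kappa$-structures is a $\Gamma$-equivariant isomorphism of principal $\mathrm{Spin}^c(n)$-bundles commuting with the maps to $\mathrm{Fr}(V)$. For an abelian $\Gamma$-group $(A,\theta)$ and an open cover $\{U_a\}$ of $X$, a $p$-cochain is a family of smooth functions $c_{a_p\cdots a_0}(\gamma_p,\dots,\gamma_1,x)\in A$ defined when $x\in U_{a_0}$, $\gamma_1x\in U_{a_1}$, ..., $\gamma_p\cdots\gamma_1x\in U_{a_p}$ (locally constant if $A$ is discrete). The coboundary, written multiplicatively, is $(\partial c)_{a_{p+1}\cdots a_0}(\gamma_{p+1},\dots,\gamma_1,x)=c_{a_{p+1}\cdots a_1}(\gamma_{p+1},\dots,\gamma_2,\gamma_1x)\prod_{i=1}^{p}c_{\cdots\widehat{a_i}\cdots}(\dots,\gamma_{i+1}\gamma_i,\dots,x)^{(-1)^i}\,(\gamma_{p+1}c_{a_p\cdots a_0}(\gamma_p,\dots,\gamma_1,x))^{(-1)^{p+1}}$,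 and $H^p_\Gamma(X,(A,\theta))$ is its cohomology in the direct limit over covers. *)

theory Defs
  imports "HOL-Analysis.Analysis" "HOL-Algebra.Algebra" "Jordan_Normal_Form.Determinant"
begin

section \<open>Smooth maps between open subsets of Euclidean spaces\<close>

text \<open>The model spaces are \<^term>\<open>Euclidean_space d\<close>, i.e. the sequences
  supported on the first \<open>d\<close> coordinates, so that the dimension is an ordinary number and
  may be \<open>0\<close>.  A function is smooth if all iterated partial derivatives exist and are
  continuous.\<close>

fun Ck :: "nat \<Rightarrow> nat \<Rightarrow> ((nat \<Rightarrow> real) \<Rightarrow> real) \<Rightarrow> (nat \<Rightarrow> real) set \<Rightarrow> bool" where
  "Ck 0 d f D \<longleftrightarrow> continuous_map (subtopology (Euclidean_space d) D) euclideanreal f"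
| "Ck (Suc k) d f D \<longleftrightarrow>
     continuous_map (subtopology (Euclidean_space d) D) euclideanreal f \<and>
     (\<forall>i<d. (\<forall>x\<in>D. (\<lambda>t. f (x(i := t))) field_differentiable at (x i)) \<and>
            Ck k d (\<lambda>x. deriv (\<lambda>t. f (x(i := t))) (x i)) D)"

definition smooth_real :: "nat \<Rightarrow> ((nat \<Rightarrow> real) \<Rightarrow> real) \<Rightarrow> (nat \<Rightarrow> real) set \<Rightarrow> bool" where
  "smooth_real d f D \<longleftrightarrow> (\<forall>k. Ck k d f D)"

definition smooth_vec ::
    "nat \<Rightarrow> nat \<Rightarrow> ((nat \<Rightarrow> real) \<Rightarrow> nat \<Rightarrow> real) \<Rightarrow> (nat \<Rightarrow> real) set \<Rightarrow> bool" where
  "smooth_vec d e f D \<longleftrightarrow>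
     f ` D \<subseteq> topspace (Euclidean_space e) \<and> (\<forall>i<e. smooth_real d (\<lambda>x. f x i) D)"


section \<open>Smooth manifolds\<close>

text \<open>A manifold is given by its atlas; the carrier is the union of the chart domains and the
  topology is the one making the charts homeomorphisms onto open sets.  A chart \<open>(d, U, \<phi>)\<close>
  has domain \<open>U\<close> and model space \<open>Euclidean_space d\<close>; \<open>\<phi>\<close> is irrelevant outside \<open>U\<close>.\<close>

type_synonym 'm atlas = "(nat \<times> 'm set \<times> ('m \<Rightarrow> nat \<Rightarrow> real)) set"

definition mcarrier :: "'m atlas \<Rightarrow> 'm set" where
  "mcarrier A = (\<Union>(d, U, \<phi>)\<in>A. U)"

definition mtop :: "'m atlas \<Rightarrow> 'm topology" where
  "mtop A = topology (\<lambda>W. W \<subseteq> mcarrier A \<and>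
     (\<forall>(d, U, \<phi>)\<in>A. openin (Euclidean_space d) (\<phi> ` (W \<inter> U))))"

definition smooth_atlas :: "'m atlas \<Rightarrow> bool" where
  "smooth_atlas A \<longleftrightarrow>
     (\<forall>(d, U, \<phi>)\<in>A. inj_on \<phi> U \<and> openin (Euclidean_space d) (\<phi> ` U)) \<and>
     (\<forall>(d, U, \<phi>)\<in>A. \<forall>(e, V, \<psi>)\<in>A.
        openin (Euclidean_space d) (\<phi> ` (U \<inter> V)) \<and>
        smooth_vec d e (\<psi> \<circ> inv_into U \<phi>) (\<phi> ` (U \<inter> V)))"

definition smooth_manifold :: "'m atlas \<Rightarrow> bool" where
  "smooth_manifold A \<longleftrightarrow>
     smooth_atlas A \<and> Hausdorff_space (mtop A) \<and> second_countable (mtop A)"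

definition smooth_map :: "'m atlas \<Rightarrow> 'k atlas \<Rightarrow> ('m \<Rightarrow> 'k) \<Rightarrow> bool" where
  "smooth_map A B f \<longleftrightarrow>
     continuous_map (mtop A) (mtop B) f \<and>
     (\<forall>(d, U, \<phi>)\<in>A. \<forall>(e, V, \<psi>)\<in>B.
        smooth_vec d e (\<psi> \<circ> f \<circ> inv_into U \<phi>) (\<phi> ` {x\<in>U. f x \<in> V}))"

definition smooth_fun :: "'m atlas \<Rightarrow> ('m \<Rightarrow> real) \<Rightarrow> bool" where
  "smooth_fun A f \<longleftrightarrow> (\<forall>(d, U, \<phi>)\<in>A. smooth_real d (f \<circ> inv_into U \<phi>) (\<phi> ` U))"

definition diffeo :: "'m atlas \<Rightarrow> 'k atlas \<Rightarrow> ('m \<Rightarrow> 'k) \<Rightarrow> bool" where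
  "diffeo A B f \<longleftrightarrow> bij_betw f (mcarrier A) (mcarrier B) \<and>
     smooth_map A B f \<and> smooth_map B A (inv_into (mcarrier A) f)"

definition euclid_atlas :: "nat \<Rightarrow> (nat \<Rightarrow> real) atlas" where
  "euclid_atlas d = {(d, topspace (Euclidean_space d), id)}"

definition prod_atlas :: "'m atlas \<Rightarrow> 'k atlas \<Rightarrow> ('m \<times> 'k) atlas" where
  "prod_atlas A B = {(d + e, U \<times> V, \<lambda>(x, y) i. if i < d then \<phi> x i else \<psi> y (i - d)) |
     d U \<phi> e V \<psi>. (d, U, \<phi>) \<in> A \<and> (e, V, \<psi>) \<in> B}"

definition restrict_atlas :: "'m atlas \<Rightarrow> 'm set \<Rightarrow> 'm atlas" where
  "restrict_atlas A W = {(d, U \<inter> W, \<phi>) | d U \<phi>. (d, U, \<phi>) \<in> A}"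

text \<open>The structure transported along a bijection or, more generally, along a covering
  projection \<open>f\<close>: the inverse branches of \<open>f\<close> composed with charts are the new charts.\<close>

definition push_atlas :: "('m \<Rightarrow> 'k) \<Rightarrow> 'm atlas \<Rightarrow> 'k atlas" where
  "push_atlas f A = {(d, f ` (U \<inter> W), \<phi> \<circ> inv_into (U \<inter> W) f) |
     d U \<phi> W. (d, U, \<phi>) \<in> A \<and> openin (mtop A) W \<and> inj_on f (U \<inter> W)}"

text \<open>The submanifold structure of \<open>S\<close>, embedded in Euclidean \<open>N\<close>-space by the injection \<open>c\<close>:
  charts are defined on relatively open sets, locally extend to smooth maps on the ambient
  space, and have an inverse that is smooth as a map to the ambient space.\<close>

definition embedded_atlas :: "nat \<Rightarrow> ('m \<Rightarrow> nat \<Rightarrow> real) \<Rightarrow> 'm set \<Rightarrow> 'm atlas" where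
  "embedded_atlas N c S = {(d, W, \<phi>).
     W \<subseteq> S \<and> inj_on \<phi> W \<and> openin (Euclidean_space d) (\<phi> ` W) \<and>
     smooth_vec d N (c \<circ> inv_into W \<phi>) (\<phi> ` W) \<and>
     (\<forall>p\<in>W. \<exists>E F. openin (Euclidean_space N) E \<and> c p \<in> E \<and> smooth_vec N d F E \<and>
        (\<forall>q\<in>S. c q \<in> E \<longrightarrow> q \<in> W \<and> F (c q) = \<phi> q))}"


section \<open>The groups SO(n), Spin(n), U(1) and Spin\<open>\<^sup>c\<close>(n)\<close>

definition SO :: "nat \<Rightarrow> real mat monoid" where
  "SO n = \<lparr>carrier = {A \<in> carrier_mat n n. A * transpose_mat A = 1\<^sub>m n \<and> Determinant.det A = 1},
           mult = (*), one = 1\<^sub>m n\<rparr>"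

definition SO_atlas :: "nat \<Rightarrow> real mat atlas" where
  "SO_atlas n = embedded_atlas (n * n)
     (\<lambda>A k. if k < n * n then A $$ (k div n, k mod n) else 0) (carrier (SO n))"

text \<open>The real Clifford algebra on generators \<open>e 0, \<dots>, e (n - 1)\<close> with \<open>e i * e i = -1\<close>
  and \<open>e i * e j = - e j * e i\<close>.  The basis monomial \<open>e i\<^sub>1 * \<dots> * e i\<^sub>r\<close> with \<open>i\<^sub>1 < \<dots> < i\<^sub>r\<close> has
  as index the number below \<open>2 ^ n\<close> whose binary digits \<open>1\<close> are at \<open>i\<^sub>1, \<dots>, i\<^sub>r\<close>.  Then the
  product of the monomials \<open>j\<close> and \<open>k\<close> is \<open>\<plusminus>\<close> the monomial \<open>xor j k\<close>; the sign counts
  transpositions (\<open>b < a\<close>) and squares (\<open>b = a\<close>).\<close>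

definition cl_sign :: "nat \<Rightarrow> nat \<Rightarrow> real" where
  "cl_sign j k = (- 1) ^ card {(a, b). bit j a \<and> bit k b \<and> b \<le> a}"

definition cl_mult :: "nat \<Rightarrow> (nat \<Rightarrow> real) \<Rightarrow> (nat \<Rightarrow> real) \<Rightarrow> nat \<Rightarrow> real" where
  "cl_mult n x y = (\<lambda>m. \<Sum>(j, k) \<in> {(j, k). j < 2 ^ n \<and> k < 2 ^ n \<and> xor j k = m}.
     cl_sign j k * x j * y k)"

definition cl_one :: "nat \<Rightarrow> real" where
  "cl_one = (\<lambda>k. if k = 0 then 1 else 0)"

definition cl_degree :: "nat \<Rightarrow> nat" where
  "cl_degree k = card {i. bit k i}"

text \<open>The anti-automorphism that fixes vectors.\<close>

definition cl_transpose :: "(nat \<Rightarrow> real) \<Rightarrow> nat \<Rightarrow> real" where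
  "cl_transpose x = (\<lambda>k. (- 1) ^ (cl_degree k * (cl_degree k - 1) div 2) * x k)"

definition cl_even :: "(nat \<Rightarrow> real) \<Rightarrow> bool" where
  "cl_even x \<longleftrightarrow> (\<forall>k. odd (cl_degree k) \<longrightarrow> x k = 0)"

definition cl_vectors :: "nat \<Rightarrow> (nat \<Rightarrow> real) set" where
  "cl_vectors n = {x. \<forall>k. x k \<noteq> 0 \<longrightarrow> (\<exists>i<n. k = 2 ^ i)}"

definition cl_gen :: "nat \<Rightarrow> nat \<Rightarrow> real" where
  "cl_gen i = (\<lambda>k. if k = 2 ^ i then 1 else 0)"

text \<open>The even elements of spinor norm \<open>1\<close> of the Clifford group.  For \<open>n \<ge> 1\<close> these
  are the products of an even number of unit vectors; for \<open>n = 0\<close> they are \<open>\<plusminus>1\<close>.\<close>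

definition Spin :: "nat \<Rightarrow> (nat \<Rightarrow> real) monoid" where
  "Spin n = \<lparr>carrier = {g \<in> topspace (Euclidean_space (2 ^ n)). cl_even g \<and>
               cl_mult n g (cl_transpose g) = cl_one \<and>
               (\<forall>v\<in>cl_vectors n. cl_mult n (cl_mult n g v) (cl_transpose g) \<in> cl_vectors n)},
             mult = cl_mult n, one = cl_one\<rparr>"

definition Spin_atlas :: "nat \<Rightarrow> (nat \<Rightarrow> real) atlas" where
  "Spin_atlas n = embedded_atlas (2 ^ n) id (carrier (Spin n))"

text \<open>\<open>Ad g v = g v g\<^sup>-\<^sup>1\<close> on vectors, as a matrix with respect to the generators.\<close>

definition Ad :: "nat \<Rightarrow> (nat \<Rightarrow> real) \<Rightarrow> real mat" where
  "Ad n g = Matrix.mat n n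
     (\<lambda>(i, j). cl_mult n (cl_mult n g (cl_gen j)) (inv\<^bsub>Spin n\<^esub> g) (2 ^ i))"

definition U1 :: "complex monoid" where
  "U1 = \<lparr>carrier = {z. cmod z = 1}, mult = (*), one = 1\<rparr>"

definition U1_atlas :: "complex atlas" where
  "U1_atlas = embedded_atlas 2
     (\<lambda>z i. if i = 0 then Re z else if i = 1 then Im z else 0) (carrier U1)"

type_synonym spinc = "((nat \<Rightarrow> real) \<times> complex) set"

definition spinc_kernel :: spinc where
  "spinc_kernel = {(cl_one, 1), (\<lambda>k. - cl_one k, - 1)}"

definition Spinc :: "nat \<Rightarrow> spinc monoid" where
  "Spinc n = (Spin n \<times>\<times> U1) Mod spinc_kernel"

definition Spinc_atlas :: "nat \<Rightarrow> spinc atlas" where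
  "Spinc_atlas n = push_atlas (\<lambda>p. spinc_kernel #>\<^bsub>Spin n \<times>\<times> U1\<^esub> p)
     (prod_atlas (Spin_atlas n) U1_atlas)"

definition Adc :: "nat \<Rightarrow> spinc \<Rightarrow> real mat" where
  "Adc n s = the_elem ((Ad n \<circ> fst) ` s)"

definition kappa :: "('g \<Rightarrow> int) \<Rightarrow> 'g \<Rightarrow> spinc \<Rightarrow> spinc" where
  "kappa \<epsilon> \<gamma> s = (\<lambda>(g, z). (g, if \<epsilon> \<gamma> = - 1 then cnj z else z)) ` s"

definition iota :: "('g \<Rightarrow> int) \<Rightarrow> 'g \<Rightarrow> int \<Rightarrow> int" where
  "iota \<epsilon> \<gamma> t = \<epsilon> \<gamma> * t"


section \<open>Orientifolds\<close>

definition Z2 :: "int monoid" where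
  "Z2 = \<lparr>carrier = {1, - 1}, mult = (*), one = 1\<rparr>"

text \<open>Finite orientifold groups; being finite they are discrete, so no smoothness in the
  group variable has to be imposed on \<open>\<epsilon>\<close> or on actions.\<close>

definition finite_orientifold_group :: "('g, 'b) monoid_scheme \<Rightarrow> ('g \<Rightarrow> int) \<Rightarrow> bool" where
  "finite_orientifold_group \<Gamma> \<epsilon> \<longleftrightarrow> Group.group \<Gamma> \<and> finite (carrier \<Gamma>) \<and>
     \<epsilon> \<in> hom \<Gamma> Z2 \<and> (\<exists>\<gamma>\<in>carrier \<Gamma>. \<epsilon> \<gamma> \<noteq> 1)"

definition smooth_action ::
    "('g, 'b) monoid_scheme \<Rightarrow> 'm atlas \<Rightarrow> ('g \<Rightarrow> 'm \<Rightarrow> 'm) \<Rightarrow> bool" where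
  "smooth_action \<Gamma> M \<rho> \<longleftrightarrow>
     (\<forall>\<gamma>\<in>carrier \<Gamma>. smooth_map M M (\<rho> \<gamma>)) \<and>
     (\<forall>x\<in>mcarrier M. \<rho> \<one>\<^bsub>\<Gamma>\<^esub> x = x) \<and>
     (\<forall>\<gamma>\<in>carrier \<Gamma>. \<forall>\<delta>\<in>carrier \<Gamma>. \<forall>x\<in>mcarrier M. \<rho> (\<gamma> \<otimes>\<^bsub>\<Gamma>\<^esub> \<delta>) x = \<rho> \<gamma> (\<rho> \<delta> x))"

definition orientifold ::
    "('g, 'b) monoid_scheme \<Rightarrow> ('g \<Rightarrow> int) \<Rightarrow> 'x atlas \<Rightarrow> ('g \<Rightarrow> 'x \<Rightarrow> 'x) \<Rightarrow> bool" where
  "orientifold \<Gamma> \<epsilon> M \<rho> \<longleftrightarrow> finite_orientifold_group \<Gamma> \<epsilon> \<and>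
     smooth_manifold M \<and> compact_space (mtop M) \<and> smooth_action \<Gamma> M \<rho>"


section \<open>Semi-equivariant principal bundles\<close>

record ('p, 'x, 's, 'g) pbundle =
  ptot :: "'p atlas"
  pproj :: "'p \<Rightarrow> 'x"
  ract :: "'p \<Rightarrow> 's \<Rightarrow> 'p"
  lact :: "'g \<Rightarrow> 'p \<Rightarrow> 'p"

definition principal_bundle ::
    "'x atlas \<Rightarrow> ('s, 'c) monoid_scheme \<Rightarrow> 's atlas \<Rightarrow> ('p, 'x, 's, 'g) pbundle \<Rightarrow> bool" where
  "principal_bundle M G AG P \<longleftrightarrow>
     smooth_manifold (ptot P) \<and>
     smooth_map (ptot P) M (pproj P) \<and>
     smooth_map (prod_atlas (ptot P) AG) (ptot P) (\<lambda>(p, g). ract P p g) \<and>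
     (\<forall>p\<in>mcarrier (ptot P). ract P p \<one>\<^bsub>G\<^esub> = p \<and>
        (\<forall>g\<in>carrier G. pproj P (ract P p g) = pproj P p \<and>
           (\<forall>h\<in>carrier G. ract P p (g \<otimes>\<^bsub>G\<^esub> h) = ract P (ract P p g) h))) \<and>
     (\<forall>x\<in>mcarrier M. \<exists>U \<tau>. openin (mtop M) U \<and> x \<in> U \<and>
        diffeo (prod_atlas (restrict_atlas M U) AG)
          (restrict_atlas (ptot P) {p \<in> mcarrier (ptot P). pproj P p \<in> U}) \<tau> \<and>
        (\<forall>y\<in>U. \<forall>g\<in>carrier G. pproj P (\<tau> (y, g)) = y \<and>
           (\<forall>h\<in>carrier G. \<tau> (y, g \<otimes>\<^bsub>G\<^esub> h) = ract P (\<tau> (y, g)) h)))"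

definition semi_equivariant_bundle ::
    "('g, 'b) monoid_scheme \<Rightarrow> 'x atlas \<Rightarrow> ('g \<Rightarrow> 'x \<Rightarrow> 'x) \<Rightarrow>
     ('s, 'c) monoid_scheme \<Rightarrow> 's atlas \<Rightarrow> ('g \<Rightarrow> 's \<Rightarrow> 's) \<Rightarrow>
     ('p, 'x, 's, 'g) pbundle \<Rightarrow> bool" where
  "semi_equivariant_bundle \<Gamma> M \<rho> G AG \<theta> P \<longleftrightarrow>
     principal_bundle M G AG P \<and> smooth_action \<Gamma> (ptot P) (lact P) \<and>
     (\<forall>\<gamma>\<in>carrier \<Gamma>. \<forall>p\<in>mcarrier (ptot P).
        pproj P (lact P \<gamma> p) = \<rho> \<gamma> (pproj P p) \<and>
        (\<forall>g\<in>carrier G. lact P \<gamma> (ract P p g) = ract P (lact P \<gamma> p) (\<theta> \<gamma> g)))"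


section \<open>Oriented Riemannian equivariant vector bundles\<close>

text \<open>\<open>vorient V x\<close> is the set of positively oriented ordered bases of the fibre at \<open>x\<close>;
  ordered bases and frames are extensional functions on \<open>{..<n}\<close>.\<close>

record ('v, 'x, 'g) vbundle =
  vtot :: "'v atlas"
  vproj :: "'v \<Rightarrow> 'x"
  vzero :: "'x \<Rightarrow> 'v"
  vadd :: "'v \<Rightarrow> 'v \<Rightarrow> 'v"
  vscale :: "real \<Rightarrow> 'v \<Rightarrow> 'v"
  vinner :: "'v \<Rightarrow> 'v \<Rightarrow> real"
  vorient :: "'x \<Rightarrow> (nat \<Rightarrow> 'v) set"
  vact :: "'g \<Rightarrow> 'v \<Rightarrow> 'v"

definition vfibre :: "('v, 'x, 'g) vbundle \<Rightarrow> 'x \<Rightarrow> 'v set" where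
  "vfibre V x = {v \<in> mcarrier (vtot V). vproj V v = x}"

text \<open>The fibres are vector spaces of dimension \<open>n\<close> because the local trivialisations
  identify their operations with those of \<open>n\<close>-space; likewise the
  trivialisations identify \<open>vorient\<close> with the standard orientation of \<open>n\<close>-space.\<close>

definition oriented_vector_bundle ::
    "'x atlas \<Rightarrow> nat \<Rightarrow> ('v, 'x, 'g) vbundle \<Rightarrow> bool" where
  "oriented_vector_bundle M n V \<longleftrightarrow>
     smooth_manifold (vtot V) \<and>
     smooth_map (vtot V) M (vproj V) \<and>
     (\<forall>x\<in>mcarrier M. \<exists>U \<tau>. openin (mtop M) U \<and> x \<in> U \<and>
        diffeo (prod_atlas (restrict_atlas M U) (euclid_atlas n))
          (restrict_atlas (vtot V) {v \<in> mcarrier (vtot V). vproj V v \<in> U}) \<tau> \<and>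
        (\<forall>y\<in>U. \<tau> (y, \<lambda>i. 0) = vzero V y \<and>
           (\<forall>a\<in>topspace (Euclidean_space n). vproj V (\<tau> (y, a)) = y \<and>
              (\<forall>b\<in>topspace (Euclidean_space n).
                 \<tau> (y, \<lambda>i. a i + b i) = vadd V (\<tau> (y, a)) (\<tau> (y, b))) \<and>
              (\<forall>r. \<tau> (y, \<lambda>i. r * a i) = vscale V r (\<tau> (y, a)))) \<and>
           vorient V y =
             {(\<lambda>j\<in>{..<n}. \<tau> (y, \<lambda>i. if i < n then B $$ (i, j) else 0)) | B.
                B \<in> carrier_mat n n \<and> Determinant.det B > 0}))"

definition smooth_section ::
    "'x atlas \<Rightarrow> ('v, 'x, 'g) vbundle \<Rightarrow> 'x set \<Rightarrow> ('x \<Rightarrow> 'v) \<Rightarrow> bool" where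
  "smooth_section M V U s \<longleftrightarrow>
     smooth_map (restrict_atlas M U) (vtot V) s \<and> (\<forall>x\<in>U. s x \<in> vfibre V x)"

definition fibre_metric :: "'x atlas \<Rightarrow> ('v, 'x, 'g) vbundle \<Rightarrow> bool" where
  "fibre_metric M V \<longleftrightarrow>
     (\<forall>x\<in>mcarrier M. \<forall>u\<in>vfibre V x. \<forall>v\<in>vfibre V x.
        vinner V u v = vinner V v u \<and>
        (\<forall>w\<in>vfibre V x. vinner V (vadd V u v) w = vinner V u w + vinner V v w) \<and>
        (\<forall>r. vinner V (vscale V r u) v = r * vinner V u v) \<and>
        (u \<noteq> vzero V x \<longrightarrow> vinner V u u > 0)) \<and>
     (\<forall>U s t. openin (mtop M) U \<and> smooth_section M V U s \<and> smooth_section M V U t \<longrightarrow>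
        smooth_fun (restrict_atlas M U) (\<lambda>x. vinner V (s x) (t x)))"

text \<open>\<open>\<Gamma>\<close> acts on \<open>V\<close> over its action on \<open>M\<close> by fibrewise linear, isometric and
  orientation-preserving maps.\<close>

definition equivariant_oriented_bundle ::
    "('g, 'b) monoid_scheme \<Rightarrow> 'x atlas \<Rightarrow> ('g \<Rightarrow> 'x \<Rightarrow> 'x) \<Rightarrow> nat \<Rightarrow>
     ('v, 'x, 'g) vbundle \<Rightarrow> bool" where
  "equivariant_oriented_bundle \<Gamma> M \<rho> n V \<longleftrightarrow>
     oriented_vector_bundle M n V \<and> fibre_metric M V \<and>
     smooth_action \<Gamma> (vtot V) (vact V) \<and>
     (\<forall>\<gamma>\<in>carrier \<Gamma>. \<forall>x\<in>mcarrier M.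
        (\<forall>u\<in>vfibre V x.
           vproj V (vact V \<gamma> u) = \<rho> \<gamma> x \<and>
           (\<forall>r. vact V \<gamma> (vscale V r u) = vscale V r (vact V \<gamma> u)) \<and>
           (\<forall>v\<in>vfibre V x.
              vact V \<gamma> (vadd V u v) = vadd V (vact V \<gamma> u) (vact V \<gamma> v) \<and>
              vinner V (vact V \<gamma> u) (vact V \<gamma> v) = vinner V u v)) \<and>
        (\<forall>e\<in>vorient V x. (\<lambda>i\<in>{..<n}. vact V \<gamma> (e i)) \<in> vorient V (\<rho> \<gamma> x)))"


section \<open>The oriented orthonormal frame bundle\<close>

text \<open>Frames carry their base point, which matters only in rank \<open>0\<close>.\<close>

definition frames :: "'x atlas \<Rightarrow> nat \<Rightarrow> ('v, 'x, 'g) vbundle \<Rightarrow> ('x \<times> (nat \<Rightarrow> 'v)) set" where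
  "frames M n V = {(x, e). x \<in> mcarrier M \<and> e \<in> vorient V x \<and>
     (\<forall>i<n. \<forall>j<n. vinner V (e i) (e j) = (if i = j then 1 else 0))}"

definition lincomb ::
    "nat \<Rightarrow> ('v, 'x, 'g) vbundle \<Rightarrow> 'x \<Rightarrow> (nat \<Rightarrow> real) \<Rightarrow> (nat \<Rightarrow> 'v) \<Rightarrow> 'v" where
  "lincomb n V x c e = foldr (\<lambda>i w. vadd V (vscale V (c i) (e i)) w) [0..<n] (vzero V x)"

definition frame_ract ::
    "nat \<Rightarrow> ('v, 'x, 'g) vbundle \<Rightarrow> 'x \<times> (nat \<Rightarrow> 'v) \<Rightarrow> real mat \<Rightarrow> 'x \<times> (nat \<Rightarrow> 'v)" where
  "frame_ract n V = (\<lambda>(x, e) A. (x, \<lambda>j\<in>{..<n}. lincomb n V x (\<lambda>i. A $$ (i, j)) e))"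

definition local_frame ::
    "'x atlas \<Rightarrow> nat \<Rightarrow> ('v, 'x, 'g) vbundle \<Rightarrow> 'x set \<Rightarrow> (nat \<Rightarrow> 'x \<Rightarrow> 'v) \<Rightarrow> bool" where
  "local_frame M n V U s \<longleftrightarrow> openin (mtop M) U \<and> (\<forall>i<n. smooth_section M V U (s i)) \<and>
     (\<forall>x\<in>U. (x, \<lambda>i\<in>{..<n}. s i x) \<in> frames M n V)"

text \<open>The smooth structure is the one for which every smooth local oriented orthonormal frame
  over \<open>U\<close> yields a trivialisation by \<open>U \<times> SO(n)\<close>.\<close>

definition frame_atlas ::
    "'x atlas \<Rightarrow> nat \<Rightarrow> ('v, 'x, 'g) vbundle \<Rightarrow> ('x \<times> (nat \<Rightarrow> 'v)) atlas" where
  "frame_atlas M n V = (\<Union>(U, s)\<in>{(U, s). local_frame M n V U s}.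
     push_atlas (\<lambda>(x, A). frame_ract n V (x, \<lambda>i\<in>{..<n}. s i x) A)
       (prod_atlas (restrict_atlas M U) (SO_atlas n)))"

definition Fr ::
    "'x atlas \<Rightarrow> ('g \<Rightarrow> 'x \<Rightarrow> 'x) \<Rightarrow> nat \<Rightarrow> ('v, 'x, 'g) vbundle \<Rightarrow>
     ('x \<times> (nat \<Rightarrow> 'v), 'x, real mat, 'g) pbundle" where
  "Fr M \<rho> n V = \<lparr>ptot = frame_atlas M n V, pproj = fst, ract = frame_ract n V,
     lact = (\<lambda>\<gamma> (x, e). (\<rho> \<gamma> x, \<lambda>i\<in>{..<n}. vact V \<gamma> (e i)))\<rparr>"


section \<open>Spin\<open>\<^sup>\<kappa>\<close>-structures\<close>

type_synonym ('p, 'v, 'x, 'g) spin_kappa =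
  "('p, 'x, spinc, 'g) pbundle \<times> ('p \<Rightarrow> 'x \<times> (nat \<Rightarrow> 'v))"

definition spin_kappa_structure ::
    "('g, 'b) monoid_scheme \<Rightarrow> ('g \<Rightarrow> int) \<Rightarrow> 'x atlas \<Rightarrow> ('g \<Rightarrow> 'x \<Rightarrow> 'x) \<Rightarrow> nat \<Rightarrow>
     ('v, 'x, 'g) vbundle \<Rightarrow> ('p, 'v, 'x, 'g) spin_kappa \<Rightarrow> bool" where
  "spin_kappa_structure \<Gamma> \<epsilon> M \<rho> n V = (\<lambda>(P, \<phi>).
     semi_equivariant_bundle \<Gamma> M \<rho> (Spinc n) (Spinc_atlas n) (kappa \<epsilon>) P \<and>
     smooth_map (ptot P) (ptot (Fr M \<rho> n V)) \<phi> \<and>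
     (\<forall>p\<in>mcarrier (ptot P). pproj (Fr M \<rho> n V) (\<phi> p) = pproj P p \<and>
        (\<forall>\<gamma>\<in>carrier \<Gamma>. \<phi> (lact P \<gamma> p) = lact (Fr M \<rho> n V) \<gamma> (\<phi> p)) \<and>
        (\<forall>g\<in>carrier (Spinc n). \<phi> (ract P p g) = ract (Fr M \<rho> n V) (\<phi> p) (Adc n g))))"

definition spin_kappa_iso ::
    "('g, 'b) monoid_scheme \<Rightarrow> nat \<Rightarrow>
     ('p, 'v, 'x, 'g) spin_kappa \<Rightarrow> ('q, 'v, 'x, 'g) spin_kappa \<Rightarrow> bool" where
  "spin_kappa_iso \<Gamma> n = (\<lambda>(P, \<phi>) (Q, \<psi>). \<exists>f. diffeo (ptot P) (ptot Q) f \<and>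
     (\<forall>p\<in>mcarrier (ptot P). pproj Q (f p) = pproj P p \<and> \<psi> (f p) = \<phi> p \<and>
        (\<forall>\<gamma>\<in>carrier \<Gamma>. f (lact P \<gamma> p) = lact Q \<gamma> (f p)) \<and>
        (\<forall>g\<in>carrier (Spinc n). f (ract P p g) = ract Q (f p) g)))"

text \<open>The total spaces are subsets of the type \<open>'p\<close>.  All structures on \<open>V\<close> have
  total spaces of the same cardinality as \<open>M \<times> Spin\<^sup>c(n)\<close>, so as soon as one of them lives on \<open>'p\<close>,
  every structure on any other type is isomorphic to one living on \<open>'p\<close>, and the set
  below comprises all isomorphism classes.\<close>

definition spin_kappa_structures ::
    "('g, 'b) monoid_scheme \<Rightarrow> ('g \<Rightarrow> int) \<Rightarrow> 'x atlas \<Rightarrow> ('g \<Rightarrow> 'x \<Rightarrow> 'x) \<Rightarrow> nat \<Rightarrow>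
     ('v, 'x, 'g) vbundle \<Rightarrow> ('p, 'v, 'x, 'g) spin_kappa set" where
  "spin_kappa_structures \<Gamma> \<epsilon> M \<rho> n V = {s. spin_kappa_structure \<Gamma> \<epsilon> M \<rho> n V s}"

definition spin_kappa_classes ::
    "('g, 'b) monoid_scheme \<Rightarrow> ('g \<Rightarrow> int) \<Rightarrow> 'x atlas \<Rightarrow> ('g \<Rightarrow> 'x \<Rightarrow> 'x) \<Rightarrow> nat \<Rightarrow>
     ('v, 'x, 'g) vbundle \<Rightarrow> ('p, 'v, 'x, 'g) spin_kappa set set" where
  "spin_kappa_classes \<Gamma> \<epsilon> M \<rho> n V = spin_kappa_structures \<Gamma> \<epsilon> M \<rho> n V //
     {(s, t). s \<in> spin_kappa_structures \<Gamma> \<epsilon> M \<rho> n V \<and>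
              t \<in> spin_kappa_structures \<Gamma> \<epsilon> M \<rho> n V \<and> spin_kappa_iso \<Gamma> n s t}"


section \<open>Equivariant Cech cohomology with discrete coefficients\<close>

text \<open>Covers are sets of open sets, indexed by themselves; these are cofinal among all indexed
  covers.  A cochain takes as arguments the lists \<open>[a\<^sub>0, \<dots>, a\<^sub>p]\<close> and \<open>[\<gamma>\<^sub>1, \<dots>, \<gamma>\<^sub>p]\<close> (so in the
  order opposite to the traditional \<open>c\<^bsub>a\<^sub>p \<dots> a\<^sub>0\<^esub> (\<gamma>\<^sub>p, \<dots>, \<gamma>\<^sub>1, x)\<close>) and a point \<open>x\<close>,
  and is \<open>0\<close> by convention where it is not defined.\<close>

definition open_covers :: "'x atlas \<Rightarrow> 'x set set set" where
  "open_covers M = {\<U>. (\<forall>U\<in>\<U>. openin (mtop M) U) \<and> \<Union>\<U> = mcarrier M}"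

text \<open>\<open>x \<in> a\<^sub>0\<close>, \<open>\<gamma>\<^sub>1 x \<in> a\<^sub>1\<close>, \dots, \<open>\<gamma>\<^sub>p \<cdots> \<gamma>\<^sub>1 x \<in> a\<^sub>p\<close>.\<close>

fun trail :: "('g \<Rightarrow> 'x \<Rightarrow> 'x) \<Rightarrow> 'x set list \<Rightarrow> 'g list \<Rightarrow> 'x \<Rightarrow> bool" where
  "trail \<rho> [a] [] x \<longleftrightarrow> x \<in> a"
| "trail \<rho> (a # as) (\<gamma> # \<gamma>s) x \<longleftrightarrow> x \<in> a \<and> trail \<rho> as \<gamma>s (\<rho> \<gamma> x)"
| "trail \<rho> _ _ x \<longleftrightarrow> False"

definition cech_index ::
    "('g, 'b) monoid_scheme \<Rightarrow> 'x set set \<Rightarrow> nat \<Rightarrow> ('x set list \<times> 'g list) set" where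
  "cech_index \<Gamma> \<U> p = {(as, \<gamma>s). set as \<subseteq> \<U> \<and> length as = p + 1 \<and>
     set \<gamma>s \<subseteq> carrier \<Gamma> \<and> length \<gamma>s = p}"

definition cech_domain ::
    "('g, 'b) monoid_scheme \<Rightarrow> ('g \<Rightarrow> 'x \<Rightarrow> 'x) \<Rightarrow> 'x set set \<Rightarrow> nat \<Rightarrow>
     ('x set list \<times> 'g list \<times> 'x) set" where
  "cech_domain \<Gamma> \<rho> \<U> p = {(as, \<gamma>s, x). (as, \<gamma>s) \<in> cech_index \<Gamma> \<U> p \<and> trail \<rho> as \<gamma>s x}"

type_synonym ('x, 'g, 'a) cochain = "'x set list \<Rightarrow> 'g list \<Rightarrow> 'x \<Rightarrow> 'a"

definition locally_constant_on :: "'x topology \<Rightarrow> 'x set \<Rightarrow> ('x \<Rightarrow> 'a) \<Rightarrow> bool" where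
  "locally_constant_on T D f \<longleftrightarrow>
     (\<forall>x\<in>D. \<exists>W. openin T W \<and> x \<in> W \<and> (\<forall>y\<in>W \<inter> D. f y = f x))"

definition cochains ::
    "('g, 'b) monoid_scheme \<Rightarrow> 'x atlas \<Rightarrow> ('g \<Rightarrow> 'x \<Rightarrow> 'x) \<Rightarrow> 'x set set \<Rightarrow> nat \<Rightarrow>
     ('x, 'g, 'a :: ab_group_add) cochain set" where
  "cochains \<Gamma> M \<rho> \<U> p = {c.
     (\<forall>as \<gamma>s x. (as, \<gamma>s, x) \<notin> cech_domain \<Gamma> \<rho> \<U> p \<longrightarrow> c as \<gamma>s x = 0) \<and>
     (\<forall>(as, \<gamma>s)\<in>cech_index \<Gamma> \<U> p. locally_constant_on (mtop M) {x. trail \<rho> as \<gamma>s x} (c as \<gamma>s))}"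

text \<open>\<open>drop_vertex i\<close> omits \<open>a\<^sub>i\<close>, and \<open>merge_edges \<Gamma> i\<close> replaces the adjacent entries
  \<open>\<gamma>\<^sub>i, \<gamma>\<^bsub>i+1\<^esub>\<close> by the product \<open>\<gamma>\<^bsub>i+1\<^esub> \<gamma>\<^sub>i\<close>; note that \<open>\<gamma>\<^sub>i\<close> sits at position \<open>i - 1\<close>.\<close>

definition drop_vertex :: "nat \<Rightarrow> 'i list \<Rightarrow> 'i list" where
  "drop_vertex i as = take i as @ drop (i + 1) as"

definition merge_edges :: "('g, 'b) monoid_scheme \<Rightarrow> nat \<Rightarrow> 'g list \<Rightarrow> 'g list" where
  "merge_edges \<Gamma> i \<gamma>s = take (i - 1) \<gamma>s @ [\<gamma>s ! i \<otimes>\<^bsub>\<Gamma>\<^esub> \<gamma>s ! (i - 1)] @ drop (i + 1) \<gamma>s"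

definition alternate :: "nat \<Rightarrow> 'a :: ab_group_add \<Rightarrow> 'a" where
  "alternate i t = (if even i then t else - t)"

definition coboundary ::
    "('g, 'b) monoid_scheme \<Rightarrow> ('g \<Rightarrow> 'x \<Rightarrow> 'x) \<Rightarrow> ('g \<Rightarrow> 'a \<Rightarrow> 'a) \<Rightarrow> 'x set set \<Rightarrow> nat \<Rightarrow>
     ('x, 'g, 'a :: ab_group_add) cochain \<Rightarrow> ('x, 'g, 'a) cochain" where
  "coboundary \<Gamma> \<rho> \<theta> \<U> p c = (\<lambda>as \<gamma>s x.
     if (as, \<gamma>s, x) \<in> cech_domain \<Gamma> \<rho> \<U> (p + 1) then
       c (tl as) (tl \<gamma>s) (\<rho> (hd \<gamma>s) x) +
       (\<Sum>i=1..p. alternate i (c (drop_vertex i as) (merge_edges \<Gamma> i \<gamma>s) x)) +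
       alternate (p + 1) (\<theta> (last \<gamma>s) (c (butlast as) (butlast \<gamma>s) x))
     else 0)"

definition cocycles ::
    "('g, 'b) monoid_scheme \<Rightarrow> 'x atlas \<Rightarrow> ('g \<Rightarrow> 'x \<Rightarrow> 'x) \<Rightarrow> ('g \<Rightarrow> 'a \<Rightarrow> 'a) \<Rightarrow> 'x set set \<Rightarrow>
     nat \<Rightarrow> ('x, 'g, 'a :: ab_group_add) cochain set" where
  "cocycles \<Gamma> M \<rho> \<theta> \<U> p =
     {c \<in> cochains \<Gamma> M \<rho> \<U> p. coboundary \<Gamma> \<rho> \<theta> \<U> p c = (\<lambda>as \<gamma>s x. 0)}"

definition coboundaries ::
    "('g, 'b) monoid_scheme \<Rightarrow> 'x atlas \<Rightarrow> ('g \<Rightarrow> 'x \<Rightarrow> 'x) \<Rightarrow> ('g \<Rightarrow> 'a \<Rightarrow> 'a) \<Rightarrow> 'x set set \<Rightarrow>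
     nat \<Rightarrow> ('x, 'g, 'a :: ab_group_add) cochain set" where
  "coboundaries \<Gamma> M \<rho> \<theta> \<U> p =
     (case p of 0 \<Rightarrow> {\<lambda>as \<gamma>s x. 0} | Suc q \<Rightarrow> coboundary \<Gamma> \<rho> \<theta> \<U> q ` cochains \<Gamma> M \<rho> \<U> q)"

definition refinement :: "'x set set \<Rightarrow> 'x set set \<Rightarrow> ('x set \<Rightarrow> 'x set) \<Rightarrow> bool" where
  "refinement \<W> \<U> r \<longleftrightarrow> (\<forall>W\<in>\<W>. r W \<in> \<U> \<and> W \<subseteq> r W)"

definition pullback_cochain ::
    "('g, 'b) monoid_scheme \<Rightarrow> ('g \<Rightarrow> 'x \<Rightarrow> 'x) \<Rightarrow> 'x set set \<Rightarrow> nat \<Rightarrow> ('x set \<Rightarrow> 'x set) \<Rightarrow>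
     ('x, 'g, 'a :: ab_group_add) cochain \<Rightarrow> ('x, 'g, 'a) cochain" where
  "pullback_cochain \<Gamma> \<rho> \<W> p r c = (\<lambda>as \<gamma>s x.
     if (as, \<gamma>s, x) \<in> cech_domain \<Gamma> \<rho> \<W> p then c (map r as) \<gamma>s x else 0)"

text \<open>An element of the direct limit is represented by a cover and a cocycle for it; two
  representatives are identified if they become cohomologous on a common refinement.\<close>

definition cech_rel ::
    "('g, 'b) monoid_scheme \<Rightarrow> 'x atlas \<Rightarrow> ('g \<Rightarrow> 'x \<Rightarrow> 'x) \<Rightarrow> ('g \<Rightarrow> 'a \<Rightarrow> 'a) \<Rightarrow> nat \<Rightarrow>
     (('x set set \<times> ('x, 'g, 'a :: ab_group_add) cochain) \<times>
      ('x set set \<times> ('x, 'g, 'a) cochain)) set" where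
  "cech_rel \<Gamma> M \<rho> \<theta> p = {((\<U>, c), (\<V>, d)).
     \<U> \<in> open_covers M \<and> c \<in> cocycles \<Gamma> M \<rho> \<theta> \<U> p \<and>
     \<V> \<in> open_covers M \<and> d \<in> cocycles \<Gamma> M \<rho> \<theta> \<V> p \<and>
     (\<exists>\<W>\<in>open_covers M. \<exists>r s. refinement \<W> \<U> r \<and> refinement \<W> \<V> s \<and>
        (\<lambda>as \<gamma>s x. pullback_cochain \<Gamma> \<rho> \<W> p r c as \<gamma>s x
                   - pullback_cochain \<Gamma> \<rho> \<W> p s d as \<gamma>s x)
          \<in> coboundaries \<Gamma> M \<rho> \<theta> \<W> p)}"

definition equivariant_cohomology ::
    "('g, 'b) monoid_scheme \<Rightarrow> 'x atlas \<Rightarrow> ('g \<Rightarrow> 'x \<Rightarrow> 'x) \<Rightarrow> ('g \<Rightarrow> 'a \<Rightarrow> 'a) \<Rightarrow> nat \<Rightarrow>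
     ('x set set \<times> ('x, 'g, 'a :: ab_group_add) cochain) set set" where
  "equivariant_cohomology \<Gamma> M \<rho> \<theta> p =
     (SIGMA \<U>:open_covers M. cocycles \<Gamma> M \<rho> \<theta> \<U> p) // cech_rel \<Gamma> M \<rho> \<theta> p"

end

theory Submission
 imports Defs
begin

text \<open>Fix one \<open>Spin\<^sup>\<kappa>\<close>-structure \<open>S\<close>. Any other structure \<open>T\<close> is locally isomorphic to \<open>S\<close> over
  the frame bundle, and for local isomorphisms \<open>h\<^sub>a\<close> the maps \<open>\<gamma> h\<^sub>a\<close> and \<open>h\<^sub>b \<gamma>\<close> differ by a \<open>U(1)\<close>-valued
  function, which on a fine cover is \<open>exp (2 \<pi> i r\<^sub>a\<^sub>b(\<gamma>, x))\<close>. Since conjugation on \<open>U(1)\<close> is the sign \<open>\<epsilon>\<close> on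
  exponents, the coboundary of \<open>r\<close> is an integral cocycle: the class of \<open>T\<close>. Averaging over \<open>\<Gamma>\<close> and a
  partition of unity kills the cohomology with coefficients in smooth real functions. In degree \<open>1\<close> this shows
  that the class determines \<open>T\<close> up to isomorphism; in degree \<open>2\<close> it solves \<open>\<partial>r = m\<close> for every integral
  cocycle \<open>m\<close>, and \<open>S\<close> reglued along \<open>exp (2 \<pi> i r)\<close> has class \<open>m\<close>. Local isomorphisms exist because
  \<open>Spin(n) \<rightarrow> SO(n)\<close> is surjective with kernel \<open>\<plusminus>1\<close> and has smooth local sections; the coordinates on
  \<open>Spin(n)\<close> needed for this are built by induction on \<open>n\<close> from rotors,
  the products of the last basis vector with the unit vector halfway between it and a given one.\<close>

text \<open>A family \<open>r\<close> indexed by pairs of cover members and group elements carries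
  two kinds of data: its part at the neutral element consists of transition functions of the bundle,
  the rest describes the action. Covers are arbitrary, not invariant, so averaging must insert a
  group element together with a vertex. Logarithms are the delicate point: a gauge function needs
  one on a whole cover member, while its domain depends on a second member of the same cover. A
  finite cover with closed shrinkings breaks this circle. Regluing must not leave the type
  \<open>'p\<close>. A twisted structure therefore keeps the set, projection, right action and frame
  map of \<open>S\<close>; with the help of a possibly discontinuous choice of one cover member per
  point, only the atlas and the action are changed. Smoothness is tested on germs of real functions,
  so that one glueing construction serves quotients, frame bundles and reglued bundles. The atlas of
  a submanifold holds all admissible charts, yet a point belongs to it only once some chart is
  exhibited; this is why coordinates on the spin group and the circle are written down.\<close>

type_synonym vec = "nat => real"
type_synonym ('p, 'v, 'x, 'g) sk = "('p, 'v, 'x, 'g) spin_kappa"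

abbreviation "opE d \<equiv> openin (Euclidean_space d)"
abbreviation "opn A \<equiv> openin (mtop A)"
abbreviation "mc \<equiv> mcarrier"
abbreviation "ngh A x P \<equiv> eventually P (nhdsin (mtop A) x)"

section \<open>Calculus of iterated partial derivatives on open subsets of Euclidean space\<close>

definition eucl :: "nat => vec set" where
 "eucl d = {x. \<forall>i\<ge>d. x i = 0}"

lemma topspace_eucl [simp]: "topspace (Euclidean_space d) = eucl d"
 by (simp add: topspace_Euclidean_space eucl_def)

lemma euc: "x:eucl d \<longleftrightarrow> (\<forall>i\<ge>d. x i = 0)"
 by (simp add: eucl_def)

lemma Eu_top_of_set: "Euclidean_space d = top_of_set (eucl d)"
 by (simp add: Euclidean_space_def euclidean_product_topology eucl_def)

lemma eucl_upd: "x:eucl d ==> i < d ==> x(i := t):eucl d"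
 by (auto simp: euc)

lemma opn_eucl_subset: "opE d D ==> D \<subseteq> eucl d"
 using openin_subset by fastforce

text \<open>Points of \<open>eucl d\<close> agree in all coordinates from \<open>d\<close> on, so
  only \<open>d\<close> factors of a basic open set of the product topology constrain anything, and
  the minimum of \<open>d\<close> radii works for all of them.\<close>

lemma eucl_box:
 assumes "opE d D" "x:D"
 shows "\<exists>e>0. ALL y:eucl d. (\<forall>i<d. \<bar>y i - x i\<bar> < e) --> y:D"
proof -
 obtain T where T: "openin (powertop_real UNIV) T" and D: "D = T \<inter> {x. \<forall>i\<ge>d. x i = 0}"
  using assms(1) by (auto simp: Euclidean_space_def openin_subtopology)
 have xT: "x:T" and xE: "\<forall>i\<ge>d. x i = 0" using assms(2) D by auto
 obtain U where U: "!!i. open (U i)" and xU: "!!i. x i:U i" and UT: "Pi\<^sub>E UNIV U \<subseteq> T"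
  using T xT unfolding openin_product_topology_alt by (force simp: PiE_iff)
 have "\<exists>e>0. \<forall>t. \<bar>t - x i\<bar> < e --> t:U i" for i
  using U[of i] xU[of i] by (auto simp: open_real)
 then obtain e where e: "!!i. e i > 0" "!!i t. \<bar>t - x i\<bar> < e i ==> t:U i" by metis
 \<comment> \<open>The inserted \<open>1\<close> keeps the minimum defined in dimension
   \<open>0\<close>.\<close>
 define e0 where "e0 = Min (insert 1 (e ` {..<d}))"
 have e0: "e0 > 0" "!!i. i < d ==> e0 \<le> e i"
  using e(1) by (auto simp: e0_def)
 have "y:D" if y: "y:eucl d" "\<forall>i<d. \<bar>y i - x i\<bar> < e0" for y
 proof -
  have "y i:U i" for i
  proof (cases "i < d")
   case True thus ?thesis using e(2)[of "y i" i] y(2) e0(2)[of i] by force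
  next
   case False hence "y i = x i" using y(1) xE by (simp add: euc)
   thus ?thesis using xU by simp
  qed
  hence "y:T" using UT by auto
  thus ?thesis using D y(1) by (simp add: euc)
 qed
 thus ?thesis using e0(1) by blast
qed

lemma opn_eucl_boxI:
 assumes "D \<subseteq> eucl d"
  and "!!x. x:D ==> \<exists>e>0. ALL y:eucl d. (\<forall>i<d. \<bar>y i - x i\<bar> < e) --> y:D"
 shows "opE d D"
proof (subst openin_subopen, intro ballI)
 fix x assume x: "x:D"
 then obtain e where e: "e > 0" "ALL y:eucl d. (\<forall>i<d. \<bar>y i - x i\<bar> < e) --> y:D" using assms(2) by blast
 let ?B = "{y. \<forall>i<d. \<bar>y i - x i\<bar> < e}"
 have "?B = (INT i:{..<d}. {y. \<bar>y i - x i\<bar> < e})" by auto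
 moreover have "open {y::nat=>real. \<bar>y i - x i\<bar> < e}" for i
  by (intro open_Collect_less continuous_intros) (simp add: continuous_on_product_coordinates)
 ultimately have "open ?B" by (auto intro!: open_INT)
 hence "opE d (eucl d \<inter> ?B)"
  unfolding Eu_top_of_set by (simp add: openin_open_Int)
 thus "\<exists>T. opE d T & x:T & T \<subseteq> D"
  using e x assms(1) by (intro exI[of _ "eucl d \<inter> ?B"]) auto
qed

lemma cont_map_euc:
 "continuous_map (subtopology (Euclidean_space d) D) euclideanreal f \<longleftrightarrow> continuous_on (eucl d \<inter> D) f"
 unfolding Eu_top_of_set subtopology_subtopology by (simp add: continuous_map_iff_continuous)

lemma cont_on_euc:
 assumes "opE d D"
 shows "continuous_on D (f :: _ => real) \<longleftrightarrow>
  (ALL x:D. \<forall>e>0. \<exists>r>0. ALL y:D. (\<forall>i<d. \<bar>y i - x i\<bar> < r) --> \<bar>f y - f x\<bar> < e)" (is "_ \<longleftrightarrow> ?R")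
proof
 assume c: "continuous_on D f"
 show ?R
 proof (intro ballI allI impI)
  fix x and e :: real assume x: "x:D" "e > 0"
  have "openin (top_of_set D) (D \<inter> f -` ball (f x) e)"
   using c by (simp add: continuous_on_open_gen continuous_openin_preimage_gen)
  hence "opE d (D \<inter> f -` ball (f x) e)"
   using assms unfolding Eu_top_of_set by (meson openin_trans)
  from eucl_box[OF this, of x] x
  obtain r where "r > 0" "ALL y:eucl d. (\<forall>i<d. \<bar>y i - x i\<bar> < r) --> y:D \<inter> f -` ball (f x) e" by auto
  thus "\<exists>r>0. ALL y:D. (\<forall>i<d. \<bar>y i - x i\<bar> < r) --> \<bar>f y - f x\<bar> < e"
   using opn_eucl_subset[OF assms] by (intro exI[of _ r]) (force simp: dist_real_def)
 qed
next
 assume R: ?R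
 show "continuous_on D f"
 proof (rule continuous_on_open_invariant[THEN iffD2], intro allI impI)
  fix B :: "real set" assume B: "open B"
  let ?P = "f -` B \<inter> D"
  have "opE d ?P"
  proof (rule opn_eucl_boxI)
   show "?P \<subseteq> eucl d" using opn_eucl_subset[OF assms] by auto
   fix x assume x: "x:?P"
   then obtain e where e: "e > 0" "!!t. \<bar>t - f x\<bar> < e ==> t:B"
    using B by (auto simp: open_real)
   obtain r where r: "r > 0" "ALL y:D. (\<forall>i<d. \<bar>y i - x i\<bar> < r) --> \<bar>f y - f x\<bar> < e"
    using R x e(1) by blast
   obtain r' where r': "r' > 0" "ALL y:eucl d. (\<forall>i<d. \<bar>y i - x i\<bar> < r') --> y:D"
    using eucl_box[OF assms, of x] x by blast
   show "\<exists>e>0. ALL y:eucl d. (\<forall>i<d. \<bar>y i - x i\<bar> < e) --> y:?P"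
    using r r' e by (intro exI[of _ "min r r'"]) auto
  qed
  then obtain A where "open A" "?P = eucl d \<inter> A"
   unfolding Eu_top_of_set by (auto simp: openin_open)
  thus "\<exists>A. open A & A \<inter> D = f -` B \<inter> D"
   using opn_eucl_subset[OF assms] by (intro exI[of _ A]) auto
 qed
qed

lemma Ck_0_iff:
 assumes "opE d D"
 shows "Ck 0 d f D \<longleftrightarrow> continuous_on D f"
 using opn_eucl_subset[OF assms] by (simp add: cont_map_euc Int_absorb1)

lemma eventually_upd_in:
 assumes "opE d D" "x:D" "i < d"
 shows "\<forall>\<^sub>F t in nhds (x i). x(i := t):D"
proof -
 obtain e where e: "e > 0" "ALL y:eucl d. (\<forall>i<d. \<bar>y i - x i\<bar> < e) --> y:D"
  using eucl_box[OF assms(1,2)] by blast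
 have xe: "x:eucl d" using opn_eucl_subset[OF assms(1)] assms(2) by auto
 show ?thesis unfolding eventually_nhds_metric
  using e eucl_upd[OF xe assms(3)] by (intro exI[of _ e]) (auto simp: dist_real_def)
qed

definition pd :: "nat => (vec => real) => vec => real" where
 "pd i f x = deriv (%t. f (x(i := t))) (x i)"

lemma Ck_SucE:
 assumes "Ck (Suc k) d f D" "opE d D"
 shows "continuous_on D f"
  and "i < d ==> x:D ==> ((%t. f (x(i := t))) has_real_derivative pd i f x) (at (x i))"
  and "i < d ==> Ck k d (pd i f) D"
 using assms opn_eucl_subset[OF assms(2)]
 by (auto simp: cont_map_euc Int_absorb1 pd_def[abs_def] field_differentiable_derivI)

text \<open>Partial derivatives look beyond a point; as \<open>D\<close> is open, a small change of
  one coordinate stays in \<open>D\<close>, so the values on \<open>D\<close> determine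
  them.\<close>

lemma Ck_cong:
 assumes "opE d D" "!!x. x:D ==> f x = g x" "Ck k d f D"
 shows "Ck k d g D"
 using assms(2,3)
proof (induction k arbitrary: f g)
 case 0
 thus ?case using Ck_0_iff[OF assms(1)] continuous_on_cong[of D D f g] by simp
next
 case (Suc k)
 have ev: "\<forall>\<^sub>F t in nhds (x i). f (x(i := t)) = g (x(i := t))" if "i < d" "x:D" for i x
  using eventually_upd_in[OF assms(1) that(2,1)] by eventually_elim (use Suc.prems(1) in auto)
 have c: "continuous_on D g"
  using Ck_SucE(1)[OF Suc.prems(2) assms(1)] continuous_on_cong[of D D f g] Suc.prems(1) by simp
 have "pd i f x = pd i g x" if "i < d" "x:D" for i x
  unfolding pd_def by (rule deriv_cong_ev[OF ev[OF that] refl])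
 hence k: "Ck k d (pd i g) D" if "i < d" for i
  using Suc.IH[of "pd i f" "pd i g"] Ck_SucE(3)[OF Suc.prems(2) assms(1) that] that by blast
 have d: "(%t. g (x(i := t))) field_differentiable at (x i)" if "i < d" "x:D" for i x
  unfolding field_differentiable_def
  using DERIV_cong_ev[OF refl ev[OF that] refl, THEN iffD1, OF Ck_SucE(2)[OF Suc.prems(2) assms(1) that]] by blast
 show ?case using c k d opn_eucl_subset[OF assms(1)]
  by (auto simp: cont_map_euc Int_absorb1 pd_def[abs_def])
qed

lemma Ck_SucI:
 assumes "opE d D" "continuous_on D f"
  and "!!i x. i < d ==> x:D ==> ((%t. f (x(i := t))) has_real_derivative f' i x) (at (x i))"
  and "!!i. i < d ==> Ck k d (f' i) D"
 shows "Ck (Suc k) d f D"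
proof -
 have "Ck k d (%x. deriv (%t. f (x(i := t))) (x i)) D" if "i < d" for i
  using assms(1) _ assms(4)[OF that] by (rule Ck_cong) (metis DERIV_imp_deriv assms(3) that)
 thus ?thesis using assms(2,3) opn_eucl_subset[OF assms(1)]
  by (auto simp: cont_map_euc Int_absorb1 field_differentiable_def)
qed

lemma Ck_mono: "Ck k d f D ==> D' \<subseteq> D ==> Ck k d f D'"
proof (induction k arbitrary: f)
 case 0
 thus ?case by (auto simp: cont_map_euc elim: continuous_on_subset)
next
 case (Suc k)
 thus ?case by (auto simp: cont_map_euc elim: continuous_on_subset)
qed

declare Ck.simps [simp del]

lemma Ck_cont: "Ck k d f D ==> opE d D ==> continuous_on D f"
 by (cases k) (auto simp: Ck_0_iff Ck_SucE)

lemma Ck_Suc: "Ck (Suc k) d f D ==> opE d D ==> Ck k d f D"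
proof (induction k arbitrary: f)
 case 0
 thus ?case using Ck_0_iff Ck_SucE(1) by blast
next
 case (Suc k)
 show ?case
  by (rule Ck_SucI[OF Suc.prems(2) Ck_SucE(1)[OF Suc.prems] Ck_SucE(2)[OF Suc.prems]])
   (use Suc.IH[OF Ck_SucE(3)[OF Suc.prems] Suc.prems(2)] in auto)
qed

text \<open>Locality is what later allows functions on open sets to be replaced by the germs
  \<open>sma\<close>.\<close>

lemma Ck_local:
 assumes "opE d D"
  and "!!x. x:D ==> \<exists>D'. opE d D' & x:D' & Ck k d f D'"
 shows "Ck k d f D"
 using assms(2)
proof (induction k arbitrary: f)
 case 0
 have "continuous_on D f"
  unfolding cont_on_euc[OF assms(1)]
 proof (intro ballI allI impI)
  fix x and e :: real assume x: "x:D" "e > 0"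
  obtain D' where D': "opE d D'" "x:D'" "continuous_on D' f"
   using 0[OF x(1)] Ck_0_iff by blast
  obtain r where r: "r > 0" "ALL y:D'. (\<forall>i<d. \<bar>y i - x i\<bar> < r) --> \<bar>f y - f x\<bar> < e"
   using D' x(2) unfolding cont_on_euc[OF D'(1)] by blast
  obtain r' where r': "r' > 0" "ALL y:eucl d. (\<forall>i<d. \<bar>y i - x i\<bar> < r') --> y:D'"
   using eucl_box[OF D'(1,2)] by blast
  show "\<exists>r>0. ALL y:D. (\<forall>i<d. \<bar>y i - x i\<bar> < r) --> \<bar>f y - f x\<bar> < e"
   using r r' opn_eucl_subset[OF assms(1)] by (intro exI[of _ "min r r'"]) auto
 qed
 thus ?case by (simp add: Ck_0_iff[OF assms(1)])
next
 case (Suc k)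
 have l: "\<exists>D'. opE d D' & x:D' & Ck k d f D'" if "x:D" for x
  using Suc.prems[OF that] Ck_Suc by blast
 show ?case
 proof (rule Ck_SucI[OF assms(1)])
  show "continuous_on D f" using Ck_cont[OF Suc.IH[OF l] assms(1)] by blast
  show "((%t. f (x(i := t))) has_real_derivative pd i f x) (at (x i))" if "i < d" "x:D" for i x
   using Suc.prems[OF that(2)] Ck_SucE(2) that by blast
  show "Ck k d (pd i f) D" if "i < d" for i
  proof (rule Suc.IH)
   fix x assume "x:D"
   then obtain D' where "opE d D'" "x:D'" "Ck (Suc k) d f D'" using Suc.prems by blast
   thus "\<exists>D'. opE d D' & x:D' & Ck k d (pd i f) D'"
    using Ck_SucE(3) that by blast
  qed
 qed
qed

lemma Ck_const: "opE d D ==> Ck k d (%x. c) D"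
proof (induction k arbitrary: c)
 case 0 thus ?case by (simp add: Ck_0_iff)
next
 case (Suc k)
 thus ?case by (intro Ck_SucI[where f' = "%i x. 0"]) (auto)
qed

lemma Ck_coord: "opE d D ==> Ck k d (%x. x j) D"
proof (cases k)
 case 0
 assume "opE d D"
 thus ?thesis unfolding 0
  by (simp add: Ck_0_iff) (rule continuous_on_subset[OF continuous_on_product_coordinates], simp)
next
 case (Suc k)
 assume D: "opE d D"
 show ?thesis unfolding Suc
 proof (rule Ck_SucI[where f' = "%i x. if i = j then 1 else 0", OF D])
  show "continuous_on D (%x. x j)"
   by (rule continuous_on_subset[OF continuous_on_product_coordinates]) simp
  show "((%t. (x(i := t)) j) has_real_derivative (if i = j then 1 else 0)) (at (x i))" for i x
   by auto
 qed (rule Ck_const[OF D])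
qed

lemma Ck_add: "opE d D ==> Ck k d f D ==> Ck k d g D ==> Ck k d (%x. f x + g x) D"
proof (induction k arbitrary: f g)
 case 0 thus ?case by (simp add: Ck_0_iff continuous_on_add)
next
 case (Suc k)
 note D = Suc.prems(1) and f = Ck_SucE[OF Suc.prems(2,1)] and g = Ck_SucE[OF Suc.prems(3,1)]
 show ?case
 proof (rule Ck_SucI[where f' = "%i x. pd i f x + pd i g x", OF D])
  show "continuous_on D (%x. f x + g x)" using f(1) g(1) by (rule continuous_on_add)
  show "((%t. f (x(i := t)) + g (x(i := t))) has_real_derivative pd i f x + pd i g x) (at (x i))"
   if "i < d" "x:D" for i x using f(2)[OF that] g(2)[OF that] by (rule DERIV_add)
  show "Ck k d (%x. pd i f x + pd i g x) D" if "i < d" for i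
   using Suc.IH[OF D f(3)[OF that] g(3)[OF that]] .
 qed
qed

lemma Ck_mult: "opE d D ==> Ck k d f D ==> Ck k d g D ==> Ck k d (%x. f x * g x) D"
proof (induction k arbitrary: f g)
 case 0 thus ?case by (simp add: Ck_0_iff continuous_on_mult)
next
 case (Suc k)
 note D = Suc.prems(1) and f = Ck_SucE[OF Suc.prems(2,1)] and g = Ck_SucE[OF Suc.prems(3,1)]
 show ?case
 proof (rule Ck_SucI[where f' = "%i x. pd i f x * g x + pd i g x * f x", OF D])
  show "continuous_on D (%x. f x * g x)" using f(1) g(1) by (rule continuous_on_mult)
  show "((%t. f (x(i := t)) * g (x(i := t))) has_real_derivative pd i f x * g x + pd i g x * f x) (at (x i))"
   if "i < d" "x:D" for i x using DERIV_mult[OF f(2)[OF that] g(2)[OF that]] by (simp only: fun_upd_triv)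
  show "Ck k d (%x. pd i f x * g x + pd i g x * f x) D" if "i < d" for i
   using Suc.IH[OF D f(3)[OF that] Ck_Suc[OF Suc.prems(3,1)]] Suc.IH[OF D g(3)[OF that] Ck_Suc[OF Suc.prems(2,1)]]
   by (rule Ck_add[OF D])
 qed
qed

lemma Ck_sum: "opE d D ==> (!!i. i:I ==> Ck k d (f i) D) ==> Ck k d (%x. SUM i:I. f i x) D"
 by (induction I rule: infinite_finite_induct) (auto intro: Ck_const Ck_add)

text \<open>The difference quotient along a curve is telescoped coordinatewise; the mean value theorem
  turns each summand into a partial derivative at a nearby point.\<close>

lemma chain_rule_curve:
 assumes E: "opE e E"
  and g: "!!j y. j < e ==> y:E ==> ((%t. g (y(j := t))) has_real_derivative g' j y) (at (y j))"
  and g': "!!j. j < e ==> continuous_on E (g' j)"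
  and c0: "c t0:E" and cE: "\<forall>\<^sub>F t in at t0. c t:eucl e"
  and c: "!!j. j < e ==> ((%t. c t j) has_real_derivative c' j) (at t0)"
 shows "((%t. g (c t)) has_real_derivative (\<Sum>j<e. g' j (c t0) * c' j)) (at t0)"
proof -
 define x where "x = c t0"
 have xe: "x:eucl e" using opn_eucl_subset[OF E] c0 by (auto simp: x_def)
 define h where "h j y = (%i. if i < j then y i else x i)" for j and y :: "nat => real"
 \<comment> \<open>The difference quotient in direction \<open>j\<close>. The value
   \<open>g' j x\<close> at a vanishing increment makes it continuous there and keeps the
   telescoping sum valid.\<close>
 define Q where "Q j t = (if c t j = x j then g' j x else (g (h (Suc j) (c t)) - g (h j (c t))) / (c t j - x j))" for j t
 have h0: "h 0 y = x" for y by (simp add: h_def)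
 have he: "h e y = y" if "y:eucl e" for y using that xe by (auto simp: h_def euc)
 have hS: "h (Suc j) y = (h j y)(j := y j)" for j y by (auto simp: h_def less_Suc_eq)
 have hj: "h j y j = x j" for j y by (simp add: h_def)
 have hE: "h (Suc j) y = h j y" if "y j = x j" for j y using hS hj that by (metis fun_upd_triv)
 have tel: "g (c t) - g x = (\<Sum>j<e. Q j t * (c t j - x j))" if "c t:eucl e" for t
 proof -
  have "(\<Sum>j<e. Q j t * (c t j - x j)) = (\<Sum>j<e. g (h (Suc j) (c t)) - g (h j (c t)))"
   by (rule sum.cong) (auto simp: Q_def hE)
  also have "... = g (h e (c t)) - g (h 0 (c t))" by (rule sum_lessThan_telescope)
  finally show ?thesis using that by (simp add: h0 he)
 qed
 have box: "\<forall>\<^sub>F t in at t0. \<forall>i<e. \<bar>c t i - x i\<bar> < r" if "r > 0" for r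
 proof -
  have "\<forall>\<^sub>F t in at t0. \<bar>c t i - x i\<bar> < r" if "i < e" for i
  proof -
   have "((%t. c t i) \<longlongrightarrow> x i) (at t0)"
    using DERIV_isCont[OF c[OF that]] by (simp add: isCont_def x_def)
   from tendstoD[OF this \<open>r > 0\<close>] show ?thesis by (simp add: dist_real_def)
  qed
  hence "\<forall>\<^sub>F t in at t0. ALL i:{..<e}. \<bar>c t i - x i\<bar> < r"
   by (intro eventually_ball_finite) auto
  thus ?thesis by (simp add: Ball_def)
 qed
 have Qlim: "(Q j \<longlongrightarrow> g' j x) (at t0)" if j: "j < e" for j
 proof (rule tendstoI)
  fix et :: real assume et: "et > 0"
  obtain r1 where r1: "r1 > 0" "ALL y:eucl e. (\<forall>i<e. \<bar>y i - x i\<bar> < r1) --> y:E"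
   using eucl_box[OF E c0] unfolding x_def by blast
  obtain r2 where r2: "r2 > 0" "ALL y:E. (\<forall>i<e. \<bar>y i - x i\<bar> < r2) --> \<bar>g' j y - g' j x\<bar> < et"
   using g'[OF j] et c0 unfolding cont_on_euc[OF E] x_def by blast
  define r where "r = min r1 r2"
  have "r > 0" using r1 r2 by (simp add: r_def)
  from box[OF this] cE show "\<forall>\<^sub>F t in at t0. dist (Q j t) (g' j x) < et"
  proof eventually_elim
   case (elim t)
   show ?case
   proof (cases "c t j = x j")
    case True thus ?thesis using et by (simp add: Q_def)
   next
    case False
    define w where "w = (%s. (h j (c t))(j := s))"
    have in_box: "w s:E & \<bar>g' j (w s) - g' j x\<bar> < et" if "\<bar>s - x j\<bar> \<le> \<bar>c t j - x j\<bar>" for s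
    proof -
     have "w s:eucl e" using elim(2) xe j by (auto simp: w_def h_def euc)
     moreover have b: "\<bar>w s i - x i\<bar> < r" if "i < e" for i
      using elim(1) j \<open>\<bar>s - x j\<bar> \<le> _\<close> that \<open>r > 0\<close> by (force simp: w_def h_def)
     ultimately show ?thesis using r1 r2 by (auto simp: r_def)
    qed
    have wd: "((%s. g (w s)) has_real_derivative g' j (w s)) (at s)" if "\<bar>s - x j\<bar> \<le> \<bar>c t j - x j\<bar>" for s
     using g[OF j, of "w s"] in_box[OF that] by (simp add: w_def)
    have "\<exists>s. \<bar>s - x j\<bar> \<le> \<bar>c t j - x j\<bar> & g (w (c t j)) - g (w (x j)) = (c t j - x j) * g' j (w s)"
    proof (cases "x j < c t j")
     case True
     obtain s where "x j < s" "s < c t j" "g (w (c t j)) - g (w (x j)) = (c t j - x j) * g' j (w s)"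
      using MVT2[OF True, of "%s. g (w s)" "%s. g' j (w s)"] wd by force
     thus ?thesis by (intro exI[of _ s]) auto
    next
     case F: False
     with False have lt: "c t j < x j" by simp
     obtain s where "c t j < s" "s < x j" "g (w (x j)) - g (w (c t j)) = (x j - c t j) * g' j (w s)"
      using MVT2[OF lt, of "%s. g (w s)" "%s. g' j (w s)"] wd by force
     thus ?thesis by (intro exI[of _ s]) (auto simp: algebra_simps)
    qed
    then obtain s where s: "\<bar>s - x j\<bar> \<le> \<bar>c t j - x j\<bar>"
     "g (w (c t j)) - g (w (x j)) = (c t j - x j) * g' j (w s)" by blast
    have "w (c t j) = h (Suc j) (c t)" "w (x j) = h j (c t)" by (auto simp: w_def hS h_def)
    hence "Q j t = g' j (w s)" using s(2) False by (simp add: Q_def)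
    thus ?thesis using in_box[OF s(1)] by (simp add: dist_real_def)
   qed
  qed
 qed
 have "((%t. \<Sum>j<e. Q j t * ((c t j - x j) / (t - t0))) \<longlongrightarrow> (\<Sum>j<e. g' j x * c' j)) (at t0)"
 proof (intro tendsto_sum tendsto_mult)
  show "(Q j \<longlongrightarrow> g' j x) (at t0)" if "j:{..<e}" for j using Qlim that by simp
  show "((%t. (c t j - x j) / (t - t0)) \<longlongrightarrow> c' j) (at t0)" if "j:{..<e}" for j
   using c[of j] that by (simp add: x_def has_field_derivative_iff)
 qed
 moreover have "\<forall>\<^sub>F t in at t0. (\<Sum>j<e. Q j t * ((c t j - x j) / (t - t0))) = (g (c t) - g (c t0)) / (t - t0)"
  using cE by eventually_elim (simp add: tel x_def[symmetric] sum_divide_distrib)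
 ultimately have "((%t. (g (c t) - g (c t0)) / (t - t0)) \<longlongrightarrow> (\<Sum>j<e. g' j x * c' j)) (at t0)"
  by (rule Lim_transform_eventually)
 thus ?thesis by (simp add: has_field_derivative_iff x_def)
qed

lemma Ck_cmp:
 assumes D: "opE d D" and E: "opE e E"
  and F: "!!x. x:D ==> F x:E"
 shows "Ck k e g E ==> (!!j. j < e ==> Ck k d (%x. F x j) D) ==> Ck k d (%x. g (F x)) D"
proof (induction k arbitrary: g)
 case 0
 have "continuous_on D (%x. F x j)" for j
 proof (cases "j < e")
  case True thus ?thesis using 0 D by (simp add: Ck_0_iff)
 next
  case False
  hence "!!x. x:D ==> F x j = 0" using F opn_eucl_subset[OF E] by (force simp: euc)
  thus ?thesis using continuous_on_cong[of D D "%x. F x j" "%x. 0"] by simp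
 qed
 hence "continuous_on D F" by (intro continuous_on_coordinatewise_then_product)
 hence "continuous_on D (%x. g (F x))" using 0(1) F E
  by (intro continuous_on_compose2[of E g D F]) (auto simp: Ck_0_iff)
 thus ?case using D by (simp add: Ck_0_iff)
next
 case (Suc k)
 note g = Ck_SucE[OF Suc.prems(1) E]
 have Fd: "!!j i x. j < e ==> i < d ==> x:D ==>
   ((%t. F (x(i := t)) j) has_real_derivative pd i (%x. F x j) x) (at (x i))"
  "!!j i. j < e ==> i < d ==> Ck k d (pd i (%x. F x j)) D"
  "!!j. j < e ==> Ck k d (%x. F x j) D"
  using Ck_SucE(2,3)[OF Suc.prems(2) D] Ck_Suc[OF Suc.prems(2) D] by blast+
 show ?case
 proof (rule Ck_SucI[where f' = "%i x. \<Sum>j<e. pd j g (F x) * pd i (%x. F x j) x", OF D])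
  show "continuous_on D (%x. g (F x))"
   using Suc.IH[OF Ck_Suc[OF Suc.prems(1) E] Fd(3)] Ck_cont D by blast
  show "((%t. g (F (x(i := t)))) has_real_derivative (\<Sum>j<e. pd j g (F x) * pd i (%x. F x j) x)) (at (x i))"
   if i: "i < d" and x: "x:D" for i x
  proof -
   have "((%t. g (F (x(i := t)))) has_real_derivative
     (\<Sum>j<e. pd j g (F (x(i := x i))) * pd i (%x. F x j) x)) (at (x i))"
   proof (rule chain_rule_curve[OF E g(2)])
    show "continuous_on E (pd j g)" if "j < e" for j using Ck_cont[OF g(3)[OF that] E] .
    show "F (x(i := x i)):E" using F x by simp
    have "\<forall>\<^sub>F t in at (x i). x(i := t):D"
     using eventually_upd_in[OF D x i] eventually_at_filter eventually_mono by (simp add: eventually_nhds_conv_at)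
    thus "\<forall>\<^sub>F t in at (x i). F (x(i := t)):eucl e"
     by eventually_elim (use F opn_eucl_subset[OF E] in auto)
    show "((%t. F (x(i := t)) j) has_real_derivative pd i (%x. F x j) x) (at (x i))" if "j < e" for j
     using Fd(1)[OF that i x] .
   qed auto
   thus ?thesis by simp
  qed
  show "Ck k d (%x. \<Sum>j<e. pd j g (F x) * pd i (%x. F x j) x) D" if i: "i < d" for i
  proof (rule Ck_sum[OF D])
   fix j assume "j:{..<e}"
   hence j: "j < e" by simp
   show "Ck k d (%x. pd j g (F x) * pd i (%x. F x j) x) D"
    by (rule Ck_mult[OF D Suc.IH[OF g(3)[OF j] Fd(3)] Fd(2)[OF j i]])
  qed
 qed
qed

lemma Ck_cmp_real:
 assumes D: "opE d D"
  and h: "!!x. x:D ==> (h has_real_derivative h' (f x)) (at (f x))"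
  and f: "Ck (Suc k) d f D" and h': "Ck k d (%x. h' (f x)) D"
 shows "Ck (Suc k) d (%x. h (f x)) D"
proof (rule Ck_SucI[where f' = "%i x. h' (f x) * pd i f x", OF D])
 note fE = Ck_SucE[OF f D]
 have "continuous_on (f ` D) h"
  using h by (intro continuous_at_imp_continuous_on) (auto dest: DERIV_isCont)
 thus "continuous_on D (%x. h (f x))"
  using continuous_on_compose2[OF _ fE(1)] by blast
 show "((%t. h (f (x(i := t)))) has_real_derivative h' (f x) * pd i f x) (at (x i))"
  if "i < d" "x:D" for i x
  by (rule DERIV_chain2[where g = "%t. f (x(i := t))"]) (use fE(2)[OF that] h[OF that(2)] in simp_all)
 show "Ck k d (%x. h' (f x) * pd i f x) D" if "i < d" for i
  by (rule Ck_mult[OF D h' fE(3)[OF that]])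
qed

lemma Ck_inverse:
 assumes D: "opE d D" and nz: "!!x. x:D ==> f x \<noteq> 0" and f: "Ck k d f D"
 shows "Ck k d (%x. inverse (f x)) D"
 using f
proof (induction k)
 case 0 thus ?case using D nz by (auto simp: Ck_0_iff intro: continuous_on_inverse)
next
 case (Suc k)
 note I = Suc.IH[OF Ck_Suc[OF Suc.prems D]]
 have "Ck k d (%x. - 1 * (inverse (f x) * inverse (f x))) D"
  by (intro Ck_mult[OF D] Ck_const[OF D] I)
 thus ?case
  by (intro Ck_cmp_real[where h' = "%y. - 1 * (inverse y * inverse y)", OF D _ Suc.prems])
   (use nz in "auto intro!: derivative_eq_intros simp: power2_eq_square")
qed

section \<open>Germs of smooth functions on Euclidean space\<close>

definition sma :: "nat => (vec => real) => vec => bool" where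
 "sma d f x \<longleftrightarrow> (\<exists>D. opE d D & x:D & smooth_real d f D)"

abbreviation enear :: "nat => vec => vec filter" where
 "enear d x \<equiv> nhdsin (Euclidean_space d) x"

lemma sma_eucl: "sma d f x ==> x:eucl d"
 using opn_eucl_subset by (auto simp: sma_def)

lemma enear_def:
 "x:eucl d ==> eventually P (enear d x) \<longleftrightarrow> (\<exists>D. opE d D & x:D & (ALL y:D. P y))"
 by (simp add: eventually_nhdsin)

lemma smr_iff:
 assumes "opE d D"
 shows "smooth_real d f D \<longleftrightarrow> (ALL x:D. sma d f x)"
unfolding sma_def smooth_real_def by (metis assms Ck_local)

lemma smr_mono: "smooth_real d f D ==> D' \<subseteq> D ==> smooth_real d f D'"
 unfolding smooth_real_def using Ck_mono by blast

lemma smr_cont: "smooth_real d f D ==> opE d D ==> continuous_on D f"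
 unfolding smooth_real_def using Ck_cont by blast

lemma sma_cong:
 assumes "\<forall>\<^sub>F y in enear d x. f y = g y" "sma d f x"
 shows "sma d g x"
proof -
 obtain D where D: "opE d D" "x:D" "smooth_real d f D"
  using assms(2) by (auto simp: sma_def)
 obtain D' where D': "opE d D'" "x:D'" "ALL y:D'. f y = g y"
  using assms(1) sma_eucl[OF assms(2)] by (auto simp: enear_def)
 have o: "opE d (D \<inter> D')" using D D' by blast
 have "Ck k d g (D \<inter> D')" for k
  using o _ Ck_mono[of k d f D "D \<inter> D'"] D(3) D'(3) by (intro Ck_cong[of d _ f g]) (auto simp: smooth_real_def)
 thus ?thesis using o D D' by (auto simp: sma_def smooth_real_def)
qed

lemma sma_eventually:
 assumes "sma d f x" shows "\<forall>\<^sub>F y in enear d x. sma d f y"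
 using assms sma_eucl[OF assms] by (auto simp: enear_def sma_def)

lemma sma_open_cond:
 assumes f: "sma d f x" and S: "open S" "f x:S"
 shows "\<exists>D. opE d D & x:D & smooth_real d f D & (ALL y:D. f y:S)"
proof -
 obtain D where D: "opE d D" "x:D" "smooth_real d f D"
  using f by (auto simp: sma_def)
 have "openin (top_of_set D) (D \<inter> f -` S)"
  using smr_cont[OF D(3,1)] S(1) by (rule continuous_openin_preimage_gen)
 hence "opE d (D \<inter> f -` S)"
  using D(1) unfolding Eu_top_of_set by (meson openin_trans)
 thus ?thesis using D S(2) by (intro exI[of _ "D \<inter> f -` S"]) (auto intro: smr_mono)
qed

lemma sma_eventually_in:
 "sma d f x ==> open S ==> f x:S ==> \<forall>\<^sub>F y in enear d x. f y:S"
 using sma_open_cond[of d f x S] sma_eucl[of d f x] by (auto simp: enear_def)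

lemma sma_const: "x:eucl d ==> sma d (%x. c) x"
 unfolding sma_def smooth_real_def
 using openin_topspace[of "Euclidean_space d"] Ck_const by auto

lemma sma_coord: "x:eucl d ==> sma d (%x. x j) x"
 unfolding sma_def smooth_real_def
 using openin_topspace[of "Euclidean_space d"] Ck_coord by auto

lemma sma_common:
 assumes "sma d f x" "sma d g x"
 obtains D where "opE d D" "x:D" "smooth_real d f D" "smooth_real d g D"
proof -
 obtain D D' where "opE d D" "x:D" "smooth_real d f D"
  "opE d D'" "x:D'" "smooth_real d g D'"
  using assms by (auto simp: sma_def)
 thus thesis using that[of "D \<inter> D'"] by (auto intro: smr_mono)
qed

lemma sma_add:
 assumes "sma d f x" "sma d g x"
 shows "sma d (%x. f x + g x) x"
proof -
 obtain D where D: "opE d D" "x:D" "smooth_real d f D" "smooth_real d g D"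
  by (rule sma_common[OF assms])
 hence "smooth_real d (%x. f x + g x) D" using Ck_add[OF D(1)] by (simp add: smooth_real_def)
 thus ?thesis unfolding sma_def using D by blast
qed

lemma sma_mult:
 assumes "sma d f x" "sma d g x"
 shows "sma d (%x. f x * g x) x"
proof -
 obtain D where D: "opE d D" "x:D" "smooth_real d f D" "smooth_real d g D"
  by (rule sma_common[OF assms])
 hence "smooth_real d (%x. f x * g x) D" using Ck_mult[OF D(1)] by (simp add: smooth_real_def)
 thus ?thesis unfolding sma_def using D by blast
qed

lemma sma_inverse:
 assumes "sma d f x" "f x \<noteq> 0"
 shows "sma d (%x. inverse (f x)) x"
proof -
 obtain D where D: "opE d D" "x:D" "smooth_real d f D" "ALL y:D. f y:- {0}"
  using sma_open_cond[OF assms(1), of "- {0}"] assms(2) by auto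
 hence "smooth_real d (%x. inverse (f x)) D" using Ck_inverse[of d D f] by (auto simp: smooth_real_def)
 thus ?thesis unfolding sma_def using D by blast
qed

lemma sma_cmp:
 assumes g: "sma e g (F x)" and x: "x:eucl d"
  and F: "\<forall>\<^sub>F y in enear d x. F y:eucl e" "!!j. j < e ==> sma d (%x. F x j) x"
 shows "sma d (%x. g (F x)) x"
proof -
 obtain E where E: "opE e E" "F x:E" "smooth_real e g E"
  using g by (auto simp: sma_def)
 obtain r where r: "r > 0" "ALL y:eucl e. (\<forall>i<e. \<bar>y i - F x i\<bar> < r) --> y:E"
  using eucl_box[OF E(1,2)] by blast
 have "\<exists>D. opE d D & x:D & smooth_real d (%x. F x j) D & (ALL y:D. \<bar>F y j - F x j\<bar> < r)"
  if "j < e" for j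
  using sma_open_cond[OF F(2)[OF that], of "ball (F x j) r"] r(1)
  by (simp add: dist_real_def abs_minus_commute)
 then obtain D where D: "!!j. j < e ==> opE d (D j)" "!!j. j < e ==> x:D j"
  "!!j. j < e ==> smooth_real d (%x. F x j) (D j)"
  "!!j y. j < e ==> y:D j ==> \<bar>F y j - F x j\<bar> < r" by metis
 obtain D' where D': "opE d D'" "x:D'" "ALL y:D'. F y:eucl e"
  using F(1) x by (auto simp: enear_def)
 define D0 where "D0 = D' \<inter> (INT j:{..<e}. D j)"
 have o: "opE d D0"
 proof (cases "e = 0")
  case True thus ?thesis using D' by (simp add: D0_def)
 next
  case False
  hence "opE d (INT j:{..<e}. D j)" using D(1) by (intro openin_Inter) auto
  thus ?thesis unfolding D0_def using D'(1) by blast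
 qed
 have "Ck k d (%x. g (F x)) D0" for k
 proof (rule Ck_cmp[OF o E(1), where g = g and F = F])
  show "F y:E" if "y:D0" for y using that D(4) D'(3) r(2) by (auto simp: D0_def)
  show "Ck k e g E" using E(3) by (simp add: smooth_real_def)
  show "Ck k d (%x. F x j) D0" if "j < e" for j
   using smr_mono[OF D(3)[OF that], of D0] that by (auto simp: smooth_real_def D0_def)
 qed
 thus ?thesis using o D(2) D'(2) by (auto simp: sma_def smooth_real_def D0_def)
qed

text \<open>A set \<open>H\<close> of functions closed under differentiation lets a single induction
  on the order treat all its members at once, in place of formulas for higher derivatives.\<close>

lemma sma_cmp_real:
 assumes f: "sma d f x" and S: "open S" "f x:S" and h: "h:H"
  and H: "!!h. h:H ==> EX h':H. ALL t:S. (h has_real_derivative h' t) (at t)"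
 shows "sma d (%x. h (f x)) x"
proof -
 obtain D where D: "opE d D" "x:D" "smooth_real d f D" "ALL y:D. f y:S"
  using sma_open_cond[OF f S] by blast
 have "Ck k d (%x. h (f x)) D" if "h:H" for k h
  using that
 proof (induction k arbitrary: h)
  case 0
  have "continuous_on (f ` D) h"
   using H[OF 0] D(4) by (intro continuous_at_imp_continuous_on) (auto dest: DERIV_isCont)
  thus ?case using continuous_on_compose2[OF _ smr_cont[OF D(3,1)], of "f ` D" h] D(1)
   by (simp add: Ck_0_iff)
 next
  case (Suc k)
  obtain h' where "h':H" "ALL t:S. (h has_real_derivative h' t) (at t)" using H[OF Suc.prems] by blast
  thus ?case using D Suc.IH[of h']
   by (intro Ck_cmp_real[where h = h and h' = h' and f = f, OF D(1)]) (auto simp: smooth_real_def)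
 qed
 thus ?thesis using D h by (auto simp: sma_def smooth_real_def)
qed

lemma sma_sin_cos:
 assumes "sma d f x"
 shows "sma d (%x. sin (f x)) x" "sma d (%x. cos (f x)) x"
proof -
 let ?H = "range (%(a, b) t. a * sin t + b * cos t) :: (real => real) set"
 have H: "EX h':?H. ALL t:UNIV. (h has_real_derivative h' t) (at t)" if "h:?H" for h
 proof -
  obtain a b where "h = (%t. a * sin t + b * cos t)" using \<open>h:?H\<close> by auto
  thus ?thesis
   by (intro bexI[of _ "%t. (- b) * sin t + a * cos t"])
    (auto intro!: derivative_eq_intros image_eqI[of _ _ "(- b, a)"])
 qed
 show "sma d (%x. sin (f x)) x"
  by (rule sma_cmp_real[OF assms open_UNIV UNIV_I _ H]) (auto intro!: image_eqI[of _ _ "(1, 0)"])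
 show "sma d (%x. cos (f x)) x"
  by (rule sma_cmp_real[OF assms open_UNIV UNIV_I _ H]) (auto intro!: image_eqI[of _ _ "(0, 1)"])
qed

lemma sma_powr:
 assumes f: "sma d f x" and pos: "f x > 0"
 shows "sma d (%x. f x powr a) x"
proof -
 let ?H = "range (%(a, b) t. a * t powr b) :: (real => real) set"
 have H: "EX h':?H. ALL t:{0<..}. (h has_real_derivative h' t) (at t)" if "h:?H" for h
 proof -
  obtain a b where "h = (%t. a * t powr b)" using \<open>h:?H\<close> by auto
  thus ?thesis
   by (intro bexI[of _ "%t. (a * b) * t powr (b - 1)"])
    (auto intro!: derivative_eq_intros image_eqI[of _ _ "(a * b, b - 1)"] simp: field_simps)
 qed
 show ?thesis
  by (rule sma_cmp_real[OF f open_greaterThan _ _ H]) (use pos in \<open>auto intro!: image_eqI[of _ _ "(1, a)"]\<close>)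
qed

lemma sma_sqrt:
 assumes "sma d f x" "f x > 0" shows "sma d (%x. sqrt (f x)) x"
proof -
 have "\<forall>\<^sub>F y in enear d x. f y:{0<..}" using sma_eventually_in[OF assms(1) open_greaterThan] assms(2) by simp
 hence "\<forall>\<^sub>F y in enear d x. f y powr (1/2) = sqrt (f y)"
  by eventually_elim (simp add: powr_half_sqrt)
 thus ?thesis using sma_powr[OF assms] by (rule sma_cong)
qed

text \<open>The derivatives of \<open>arctan\<close> are of the form \<open>p(t) (1 + t\<^sup>2)\<^sup>-\<^sup>k\<close> with \<open>p\<close> a polynomial.\<close>

lemma sma_arctan:
 assumes "sma d f x" shows "sma d (%x. arctan (f x)) x"
proof -
 let ?H = "insert arctan (range (%(p, k) t. poly p t * inverse (1 + t\<^sup>2) ^ k)) :: (real => real) set"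
 have p: "1 + t\<^sup>2 \<noteq> 0" for t :: real by (metis add.commute power_one sum_power2_eq_zero_iff zero_neq_one)
 have H: "EX h':?H. ALL t:UNIV. (h has_real_derivative h' t) (at t)" if "h:?H" for h
  using that
 proof (elim insertE)
  assume "h = arctan"
  thus ?thesis
   by (intro bexI[of _ "%t. poly 1 t * inverse (1 + t\<^sup>2) ^ 1"])
    (auto intro!: derivative_eq_intros image_eqI[of _ _ "(1, 1)"])
 next
  assume "h:range (%(p, k) t. poly p t * inverse (1 + t\<^sup>2) ^ k)"
  then obtain p k where h: "h = (%t. poly p t * inverse (1 + t\<^sup>2) ^ k)" by auto
  let ?q = "pderiv p * [:1, 0, 1:] - Polynomial.smult (real k) (p * [:0, 2:])"
  have "(h has_real_derivative poly ?q t * inverse (1 + t\<^sup>2) ^ (Suc k)) (at t)" for t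
  proof -
   define r where "r t = inverse (1 + t\<^sup>2)" for t :: real
   have r1: "r t ^ k = (1 + t\<^sup>2) * r t ^ Suc k" using p[of t] by (simp add: r_def)
   have "(r has_real_derivative - (2 * t) * (r t)\<^sup>2) (at t)"
    unfolding r_def using p[of t] by (auto intro!: derivative_eq_intros simp: power2_eq_square)
   from DERIV_power[OF this, of k]
   have "((%t. r t ^ k) has_real_derivative - (2 * real k * t) * r t ^ Suc k) (at t)"
    by (cases k) (simp_all add: power2_eq_square algebra_simps)
   from DERIV_mult[OF poly_DERIV this, of p]
   have "((%t. poly p t * r t ^ k) has_real_derivative
     poly (pderiv p) t * ((1 + t\<^sup>2) * r t ^ Suc k) + - (2 * real k * t) * r t ^ Suc k * poly p t) (at t)"
    unfolding r1 .
   moreover have "poly (pderiv p) t * ((1 + t\<^sup>2) * r t ^ Suc k) + - (2 * real k * t) * r t ^ Suc k * poly p t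
     = poly ?q t * r t ^ Suc k"
    by (simp add: algebra_simps power2_eq_square)
   ultimately show ?thesis by (simp only: h r_def)
  qed
  thus ?thesis
   by (intro bexI[of _ "%t. poly ?q t * inverse (1 + t\<^sup>2) ^ (Suc k)"])
    (auto intro!: image_eqI[of _ _ "(?q, Suc k)"])
 qed
 show ?thesis
  by (rule sma_cmp_real[OF assms open_UNIV UNIV_I insertI1 H])
qed

text \<open>The polynomial makes the family closed under differentiation, as
  \<open>sma_cmp_real\<close> demands. The member \<open>flat 1\<close> is the classical flat
  function behind bump functions.\<close>

definition flat :: "real poly => real => real" where
 "flat p t = (if t > 0 then poly p (inverse t) * exp (- inverse t) else 0)"

lemma flat_lim: "((%t. poly p (inverse t) * exp (- inverse t)) \<longlongrightarrow> (0::real)) (at_right 0)"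
proof -
 have "((%s. poly p s * exp (- s)) \<longlongrightarrow> (0::real)) at_top"
 proof -
  have "((%s. \<Sum>i\<le>Polynomial.degree p. poly.coeff p i * (s ^ i / exp s)) \<longlongrightarrow>
    (\<Sum>i\<le>Polynomial.degree p. poly.coeff p i * (0::real))) at_top"
   by (intro tendsto_intros tendsto_power_div_exp_0)
  thus ?thesis unfolding poly_altdef
   by (simp add: sum_distrib_right exp_minus field_simps sum_divide_distrib)
 qed
 from filterlim_compose[OF this filterlim_inverse_at_top_right] show ?thesis .
qed

text \<open>Differentiating \<open>p(1/t) exp(-1/t)\<close> produces the factor \<open>1/t^2\<close>
  and turns \<open>p\<close> into \<open>p - pderiv p\<close>. At \<open>0\<close> the difference
  quotient lies in the same family, with \<open>p\<close> multiplied by the variable, so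
  \<open>flat_lim\<close> gives the limit.\<close>

lemma flat_deriv: "(flat p has_real_derivative flat ([:0,0,1:] * (p - pderiv p)) t) (at t)"
proof -
 consider "t > 0" | "t < 0" | "t = 0" by linarith
 thus ?thesis
 proof cases
  case 1
  have "\<forall>\<^sub>F s in nhds t. s:{0<..}" using 1 by (intro eventually_nhds_in_open) auto
  hence ev: "\<forall>\<^sub>F s in nhds t. flat p s = poly p (inverse s) * exp (- inverse s)"
   by eventually_elim (simp add: flat_def)
  have "((%s. poly p (inverse s) * exp (- inverse s)) has_real_derivative flat ([:0,0,1:] * (p - pderiv p)) t) (at t)"
   using 1 by (auto intro!: derivative_eq_intros DERIV_chain2[OF poly_DERIV]
     simp: flat_def field_simps power2_eq_square)
  thus ?thesis using DERIV_cong_ev[OF refl ev refl] by blast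
 next
  case 2
  have "\<forall>\<^sub>F s in nhds t. s:{..<0}" using 2 by (intro eventually_nhds_in_open) auto
  hence ev: "\<forall>\<^sub>F s in nhds t. flat p s = 0"
   by eventually_elim (simp add: flat_def)
  have "((%s. 0) has_real_derivative flat ([:0,0,1:] * (p - pderiv p)) t) (at t)"
   using 2 by (simp add: flat_def)
  thus ?thesis using DERIV_cong_ev[OF refl ev refl] by blast
 next
  case 3
  have "((%s. flat p s / s) \<longlongrightarrow> 0) (at_right 0)"
  proof (rule Lim_transform_eventually[OF flat_lim[of "[:0,1:] * p"]])
   show "\<forall>\<^sub>F s in at_right 0. poly ([:0,1:] * p) (inverse s) * exp (- inverse s) = flat p s / s"
    by (auto simp: eventually_at_filter flat_def field_simps)
  qed
  moreover have "((%s. flat p s / s) \<longlongrightarrow> 0) (at_left 0)"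
   by (rule tendsto_eventually) (auto simp: eventually_at_filter flat_def)
  ultimately have "((%s. flat p s / s) \<longlongrightarrow> 0) (at 0)" by (simp add: filterlim_split_at)
  thus ?thesis using 3 by (simp add: has_field_derivative_iff flat_def)
 qed
qed

lemma sma_flat: "sma d f x ==> sma d (%x. flat p (f x)) x"
 by (rule sma_cmp_real[where S = UNIV and H = "range flat"]) (auto intro: flat_deriv)

lemma opn_smv_preimage:
 assumes D: "opE d D" and F: "smooth_vec d e F D" and E: "opE e E"
 shows "opE d {y:D. F y:E}"
proof -
 have "continuous_on D (%x. F x j)" for j
 proof (cases "j < e")
  case True thus ?thesis using F D smr_cont by (auto simp: smooth_vec_def)
 next
  case False
  hence "!!x. x:D ==> F x j = 0" using F by (force simp: euc smooth_vec_def)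
  thus ?thesis using continuous_on_cong[of D D "%x. F x j" "%x. 0"] by simp
 qed
 hence c: "continuous_on D F" by (intro continuous_on_coordinatewise_then_product)
 obtain T where T: "open T" "E = eucl e \<inter> T"
  using E unfolding Eu_top_of_set by (auto simp: openin_open)
 have "{y:D. F y:E} = D \<inter> F -` T" using F T by (auto simp: smooth_vec_def)
 moreover have "openin (top_of_set D) (D \<inter> F -` T)" by (rule continuous_openin_preimage_gen[OF c T(1)])
 ultimately show ?thesis using D unfolding Eu_top_of_set by (metis openin_trans)
qed

lemma smv_eucl: "smooth_vec d e F D ==> x:D ==> F x:eucl e"
 by (auto simp: smooth_vec_def)

lemma smv_at:
 "smooth_vec d e F D ==> opE d D ==> x:D ==> i < e ==> sma d (%y. F y i) x"
 using smr_iff by (auto simp: smooth_vec_def)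

lemma smvI:
 "opE d D ==> (!!x. x:D ==> F x:eucl e) ==>
  (!!x i. x:D ==> i < e ==> sma d (%y. F y i) x) ==> smooth_vec d e F D"
 using smr_iff by (auto simp: smooth_vec_def)

section \<open>Charts and the topology of an atlas\<close>

lemma saD:
 assumes "smooth_atlas A" "(d, U, ph):A"
 shows "inj_on ph U" "opE d (ph ` U)"
 using assms by (auto simp: smooth_atlas_def)

lemma sa_trs:
 assumes "smooth_atlas A" "(d, U, ph):A" "(e, V, ps):A"
 shows "opE d (ph ` (U \<inter> V))" "smooth_vec d e (%y. ps (inv_into U ph y)) (ph ` (U \<inter> V))"
 using assms by (force simp: smooth_atlas_def comp_def)+

lemma chart_eucl: "smooth_atlas A ==> (d, U, ph):A ==> x:U ==> ph x:eucl d"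
 using saD(2) opn_eucl_subset by blast

lemma chart_inv: "smooth_atlas A ==> (d, U, ph):A ==> x:U ==> inv_into U ph (ph x) = x"
 using saD(1) inv_into_f_f by metis

lemma mc_iff: "x:mc A \<longleftrightarrow> (\<exists>d U ph. (d, U, ph):A & x:U)"
 by (auto simp: mcarrier_def)

text \<open>\<open>mtop\<close> is obtained through \<open>topology\<close>, which returns the given
  predicate only if it is closed under unions and binary intersections. For intersections the
  injectivity of the charts is decisive.\<close>

lemma openin_mtop:
 assumes A: "smooth_atlas A"
 shows "opn A W \<longleftrightarrow> W \<subseteq> mc A & (ALL (d, U, ph):A. opE d (ph ` (W \<inter> U)))"
proof -
 let ?P = "%W. W \<subseteq> mc A & (ALL (d, U, ph):A. opE d (ph ` (W \<inter> U)))"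
 have "istopology ?P"
  unfolding istopology_def
 proof (intro conjI allI impI)
  fix S T assume S: "?P S" and T: "?P T"
  have "opE d (ph ` (S \<inter> T \<inter> U))" if c: "(d, U, ph):A" for d U ph
  proof -
   have "ph ` (S \<inter> T \<inter> U) = ph ` (S \<inter> U) \<inter> ph ` (T \<inter> U)"
    using saD(1)[OF A c] by (auto simp: inj_on_def)
   thus ?thesis using S T c by (auto intro!: openin_Int)
  qed
  thus "S \<inter> T \<subseteq> mc A" "ALL (d, U, ph):A. opE d (ph ` (S \<inter> T \<inter> U))"
   using S by auto
 next
  fix K assume K: "ALL W:K. ?P W"
  have "opE d (ph ` (\<Union>K \<inter> U))" if c: "(d, U, ph):A" for d U ph
  proof -
   have "ph ` (\<Union>K \<inter> U) = \<Union>((%W. ph ` (W \<inter> U)) ` K)" by auto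
   thus ?thesis using K c by (auto intro!: openin_Union)
  qed
  thus "\<Union>K \<subseteq> mc A" "ALL (d, U, ph):A. opE d (ph ` (\<Union>K \<inter> U))"
   using K by auto
 qed
 thus ?thesis by (simp add: mtop_def topology_inverse')
qed

lemma chart_subset: "(d, U, ph):A ==> U \<subseteq> mc A"
 unfolding mcarrier_def by blast

lemma topspace_mtop [simp]:
 assumes "smooth_atlas A" shows "topspace (mtop A) = mc A"
proof -
 have "ph ` (mc A \<inter> U) = ph ` U" if "(d, U, ph):A" for d U ph
  using chart_subset[OF that] by (simp add: Int_absorb1)
 hence "opn A (mc A)"
  using saD(2)[OF assms] by (auto simp: openin_mtop[OF assms])
 thus ?thesis using openin_mtop[OF assms] openin_subset[of "mtop A" "mc A"]
  by (metis openin_topspace subset_antisym)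
qed

lemma opn_subset: "smooth_atlas A ==> opn A W ==> W \<subseteq> mc A"
 using openin_mtop by blast

lemma chart_image_open:
 "smooth_atlas A ==> (d, U, ph):A ==> opn A W ==> opE d (ph ` (W \<inter> U))"
 by (auto simp: openin_mtop)

lemma chart_preimage_open:
 assumes A: "smooth_atlas A" and c: "(d, U, ph):A" and E: "opE d E"
 shows "opn A {x:U. ph x:E}"
proof -
 have "opE e (ps ` ({x:U. ph x:E} \<inter> V))" if c': "(e, V, ps):A" for e V ps
 proof -
  have "ps ` ({x:U. ph x:E} \<inter> V) = {y:ps ` (V \<inter> U). ph (inv_into V ps y):E}"
   using chart_inv[OF A c'] by force
  thus ?thesis
   using opn_smv_preimage[OF sa_trs[OF A c' c] E] by simp
 qed
 thus ?thesis using chart_subset[OF c] by (auto simp: openin_mtop[OF A])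
qed

lemma chart_open:
 assumes A: "smooth_atlas A" and c: "(d, U, ph):A"
 shows "opn A U"
proof -
 have "{x:U. ph x:topspace (Euclidean_space d)} = U" using chart_eucl[OF A c] by auto
 thus ?thesis using chart_preimage_open[OF A c openin_topspace] by simp
qed

section \<open>Neighbourhoods, germs and smooth maps on a manifold\<close>

abbreviation near :: "'m atlas => 'm => 'm filter" where
 "near A x \<equiv> nhdsin (mtop A) x"

lemma nr:
 "smooth_atlas A ==> x:mc A ==>
  eventually P (near A x) \<longleftrightarrow> (\<exists>W. opn A W & x:W & (ALL y:W. P y))"
 by (simp add: eventually_nhdsin)

lemma nr_open:
 "opn A W ==> x:W ==> ngh A x (%y. y:W)"
 by (auto simp: eventually_nhdsin)

lemma nr_self: "eventually P (near A x) ==> smooth_atlas A ==> x:mc A ==> P x"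
 by (auto simp: nr)

lemma nr_near:
 assumes "eventually P (near A x)" shows "ngh A x (%y. eventually P (near A y))"
 using assms by (auto simp: eventually_nhdsin)

lemma opn_near:
 assumes A: "smooth_atlas A" and "W \<subseteq> mc A" "!!x. x:W ==> ngh A x (%y. y:W)"
 shows "opn A W"
proof (subst openin_subopen, intro ballI)
 fix x assume x: "x:W"
 hence xA: "x:mc A" using assms(2) by auto
 show "\<exists>T. opn A T & x:T & T \<subseteq> W"
  using assms(3)[OF x] unfolding nr[OF A xA] by blast
qed

lemma near_chart_iff:
 assumes A: "smooth_atlas A" and c: "(d, U, ph):A" and x: "x:U"
 shows "eventually P (near A x) \<longleftrightarrow> (\<forall>\<^sub>F y in enear d (ph x). y:ph ` U & P (inv_into U ph y))"
proof -
 have xA: "x:mc A" using chart_subset[OF c] x by auto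
 have px: "ph x:eucl d" by (rule chart_eucl[OF A c x])
 show ?thesis
 proof
  assume "eventually P (near A x)"
  then obtain W where W: "opn A W" "x:W" "ALL y:W. P y" by (auto simp: nr[OF A xA])
  thus "\<forall>\<^sub>F y in enear d (ph x). y:ph ` U & P (inv_into U ph y)"
   using chart_image_open[OF A c W(1)] x chart_inv[OF A c]
   unfolding enear_def[OF px] by (intro exI[of _ "ph ` (W \<inter> U)"]) auto
 next
  assume "\<forall>\<^sub>F y in enear d (ph x). y:ph ` U & P (inv_into U ph y)"
  then obtain D where D: "opE d D" "ph x:D" "ALL y:D. y:ph ` U & P (inv_into U ph y)"
   by (auto simp: enear_def[OF px])
  thus "eventually P (near A x)"
   unfolding nr[OF A xA] using chart_preimage_open[OF A c D(1)] x chart_inv[OF A c]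
   by (intro exI[of _ "{x:U. ph x:D}"]) force
 qed
qed

text \<open>Germs of smooth real functions at a point of a manifold.  Outside a neighbourhood of the point
  the functions are arbitrary, which makes locally constant truncations available.\<close>

definition sm :: "'m atlas => ('m => real) => 'm => bool" where
 "sm A f x \<longleftrightarrow> x:mc A &
  (\<forall>d U ph. (d, U, ph):A --> x:U --> sma d (%y. f (inv_into U ph y)) (ph x))"

lemma sm_chart:
 assumes A: "smooth_atlas A" and c: "(d, U, ph):A" and x: "x:U"
 shows "sm A f x \<longleftrightarrow> sma d (%y. f (inv_into U ph y)) (ph x)"
proof
 assume "sm A f x" thus "sma d (%y. f (inv_into U ph y)) (ph x)" using c x by (auto simp: sm_def)
next
 assume s: "sma d (%y. f (inv_into U ph y)) (ph x)"
 have "sma e (%y. f (inv_into V ps y)) (ps x)" if c': "(e, V, ps):A" and x': "x:V" for e V ps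
 proof -
  note t = sa_trs[OF A c' c]
  have px: "ps x:ps ` (V \<inter> U)" using x x' by auto
  have pe: "ps x:eucl e" by (rule chart_eucl[OF A c' x'])
  have ev: "\<forall>\<^sub>F y in enear e (ps x). y:ps ` (V \<inter> U)"
   unfolding enear_def[OF pe] using t(1) px by blast
  have "sma e (%y. f (inv_into U ph (ph (inv_into V ps y)))) (ps x)"
  proof (rule sma_cmp[where g = "%y. f (inv_into U ph y)" and F = "%y. ph (inv_into V ps y)" and e = d])
   show "sma d (%y. f (inv_into U ph y)) (ph (inv_into V ps (ps x)))"
    using s chart_inv[OF A c' x'] by simp
   show "ps x:eucl e" by (rule pe)
   show "\<forall>\<^sub>F y in enear e (ps x). ph (inv_into V ps y):eucl d"
    using ev by eventually_elim (rule smv_eucl[OF t(2)])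
   show "sma e (%y. ph (inv_into V ps y) j) (ps x)" if "j < d" for j
    using smv_at[OF t(2,1) px that] .
  qed
  moreover have "\<forall>\<^sub>F y in enear e (ps x). f (inv_into U ph (ph (inv_into V ps y))) = f (inv_into V ps y)"
   using ev by eventually_elim (use chart_inv[OF A c'] chart_inv[OF A c] in auto)
  ultimately show ?thesis by (rule sma_cong[rotated])
 qed
 thus "sm A f x" using chart_subset[OF c] x by (auto simp: sm_def)
qed

lemma smI:
 "x:mc A ==> (!!d U ph. (d, U, ph):A ==> x:U ==>
  sma d (%y. f (inv_into U ph y)) (ph x)) ==> sm A f x"
 by (simp add: sm_def)

lemma smD: "sm A f x ==> (d, U, ph):A ==> x:U ==> sma d (%y. f (inv_into U ph y)) (ph x)"
 by (simp add: sm_def)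

lemma sm_car: "sm A f x ==> x:mc A"
 by (simp add: sm_def)

lemma sm_const: "smooth_atlas A ==> x:mc A ==> sm A (%x. c) x"
 by (auto simp: sm_def intro: sma_const chart_eucl)

lemma sm_add: "sm A f x ==> sm A g x ==> sm A (%x. f x + g x) x"
 by (rule smI, erule sm_car, rule sma_add, (erule (2) smD)+)

lemma sm_mult: "sm A f x ==> sm A g x ==> sm A (%x. f x * g x) x"
 by (rule smI, erule sm_car, rule sma_mult, (erule (2) smD)+)

lemma sm_cmult: "smooth_atlas A ==> sm A f x ==> sm A (%x. c * f x) x"
 by (rule sm_mult, rule sm_const, assumption, erule sm_car)

lemma sm_minus: "smooth_atlas A ==> sm A f x ==> sm A (%x. - f x) x"
 using sm_cmult[of A f x "- 1"] by simp

lemma sm_diff: "smooth_atlas A ==> sm A f x ==> sm A g x ==> sm A (%x. f x - g x) x"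
 using sm_add[of A f x "%x. - g x"] sm_minus[of A g x] by simp

lemma sm_sum:
 "smooth_atlas A ==> x:mc A ==> (!!i. i:I ==> sm A (f i) x) ==> sm A (%x. SUM i:I. f i x) x"
 by (induction I rule: infinite_finite_induct) (auto intro: sm_const sm_add)

lemma sm_inverse:
 assumes A: "smooth_atlas A" and f: "sm A f x" "f x \<noteq> 0"
 shows "sm A (%x. inverse (f x)) x"
 unfolding sm_def
using conjI allI impI f sma_inverse chart_inv A unfolding sm_def by fastforce

lemma sm_divide: "smooth_atlas A ==> sm A f x ==> sm A g x ==> g x \<noteq> 0 ==> sm A (%x. f x / g x) x"
 using sm_mult[of A f x "%x. inverse (g x)"] sm_inverse[of A g x] by (simp add: field_class.field_divide_inverse)

lemma sm_sqrt:
 assumes A: "smooth_atlas A" and f: "sm A f x" "f x > 0"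
 shows "sm A (%x. sqrt (f x)) x"
 unfolding sm_def
using conjI allI impI f sma_sqrt chart_inv A unfolding sm_def by fastforce

lemma sm_sin: "sm A f x ==> sm A (%x. sin (f x)) x"
 by (rule smI, erule sm_car, rule sma_sin_cos, erule (2) smD)

lemma sm_cos: "sm A f x ==> sm A (%x. cos (f x)) x"
 by (rule smI, erule sm_car, rule sma_sin_cos, erule (2) smD)

lemma sm_arctan: "sm A f x ==> sm A (%x. arctan (f x)) x"
 by (rule smI, erule sm_car, rule sma_arctan, erule (2) smD)

lemma sm_flat: "sm A f x ==> sm A (%x. flat p (f x)) x"
 by (rule smI, erule sm_car, rule sma_flat, erule (2) smD)

lemma sm_chartE:
 assumes "x:mc A"
 obtains d U ph where "(d, U, ph):A" "x:U"
 using assms by (auto simp: mc_iff)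

lemma sm_cong:
 assumes A: "smooth_atlas A" and ev: "ngh A x (%y. f y = g y)" and f: "sm A f x"
 shows "sm A g x"
proof -
 obtain d U ph where c: "(d, U, ph):A" "x:U" by (rule sm_chartE[OF sm_car[OF f]])
 have "\<forall>\<^sub>F y in enear d (ph x). f (inv_into U ph y) = g (inv_into U ph y)"
  using ev unfolding near_chart_iff[OF A c] by eventually_elim simp
 hence "sma d (%y. g (inv_into U ph y)) (ph x)"
  by (rule sma_cong) (use f sm_chart[OF A c] in blast)
 thus ?thesis using sm_chart[OF A c] by blast
qed

lemma sm_near:
 assumes A: "smooth_atlas A" and f: "sm A f x" and S: "open S" "f x:S"
 shows "ngh A x (%y. f y:S)"
proof -
 obtain d U ph where c: "(d, U, ph):A" "x:U" by (rule sm_chartE[OF sm_car[OF f]])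
 have "\<forall>\<^sub>F y in enear d (ph x). f (inv_into U ph y):S"
  using sma_eventually_in[OF _ S(1)] f S(2) sm_chart[OF A c] chart_inv[OF A c] by auto
 moreover have "\<forall>\<^sub>F y in enear d (ph x). y:ph ` U"
  unfolding enear_def[OF chart_eucl[OF A c]] using saD(2)[OF A c(1)] c(2) by blast
 ultimately show ?thesis unfolding near_chart_iff[OF A c] by eventually_elim simp
qed

lemma sm_eventually:
 assumes A: "smooth_atlas A" and f: "sm A f x"
 shows "ngh A x (%y. sm A f y)"
proof -
 obtain d U ph where c: "(d, U, ph):A" "x:U" by (rule sm_chartE[OF sm_car[OF f]])
 have "\<forall>\<^sub>F y in enear d (ph x). sma d (%y. f (inv_into U ph y)) y"
  using f sm_chart[OF A c] sma_eventually by blast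
 moreover have "\<forall>\<^sub>F y in enear d (ph x). y:ph ` U"
  unfolding enear_def[OF chart_eucl[OF A c]] using saD(2)[OF A c(1)] c(2) by blast
 ultimately show ?thesis unfolding near_chart_iff[OF A c]
  by eventually_elim (use sm_chart[OF A c(1)] chart_inv[OF A c(1)] in auto)
qed

lemma sm_coord:
 assumes A: "smooth_atlas A" and c: "(d, U, ph):A" "x:U"
 shows "sm A (%y. ph y i) x"
proof -
 have e: "ph x:eucl d" by (rule chart_eucl[OF A c])
 have "\<forall>\<^sub>F y in enear d (ph x). y:ph ` U"
  unfolding enear_def[OF e] using saD(2)[OF A c(1)] c(2) by blast
 hence "\<forall>\<^sub>F y in enear d (ph x). y i = ph (inv_into U ph y) i"
  by eventually_elim (simp add: f_inv_into_f)
 thus ?thesis unfolding sm_chart[OF A c] by (rule sma_cong) (rule sma_coord[OF e])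
qed

lemma sm_cmp_eucl:
 assumes A: "smooth_atlas A" and g: "sma N g (F x)" and x: "x:mc A"
  and F: "ngh A x (%y. F y:eucl N)" "!!j. j < N ==> sm A (%y. F y j) x"
 shows "sm A (%y. g (F y)) x"
proof -
 obtain d U ph where c: "(d, U, ph):A" "x:U" by (rule sm_chartE[OF x])
 have "sma d (%y. g (F (inv_into U ph y))) (ph x)"
 proof (rule sma_cmp[where g = g and F = "%y. F (inv_into U ph y)"])
  show "sma N g (F (inv_into U ph (ph x)))" using g chart_inv[OF A c] by simp
  show "\<forall>\<^sub>F y in enear d (ph x). F (inv_into U ph y):eucl N"
   using F(1) unfolding near_chart_iff[OF A c] by eventually_elim simp
 qed (use chart_eucl[OF A c] F(2) sm_chart[OF A c] in auto)
 thus ?thesis using sm_chart[OF A c] by blast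
qed

text \<open>A map is smooth if it pulls back smooth germs to smooth germs.  Since germs include
  indicator functions of neighbourhoods, this comprises continuity.\<close>

definition smap :: "'m atlas => 'k atlas => ('m => 'k) => 'm => bool" where
 "smap A B f x \<longleftrightarrow> x:mc A & f x:mc B & (\<forall>h. sm B h (f x) --> sm A (%y. h (f y)) x)"

lemma smap_car: "smap A B f x ==> x:mc A" "smap A B f x ==> f x:mc B"
 by (auto simp: smap_def)

lemma smap_sm: "smap A B f x ==> sm B h (f x) ==> sm A (%y. h (f y)) x"
 by (auto simp: smap_def)

lemma smap_id: "x:mc A ==> smap A A (%x. x) x"
 by (auto simp: smap_def)

lemma smap_comp: "smap A B f x ==> smap B C g (f x) ==> smap A C (%y. g (f y)) x"
 by (auto simp: smap_def)

lemma smap_cong: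
 assumes A: "smooth_atlas A" and ev: "ngh A x (%y. f y = g y)" and f: "smap A B f x"
 shows "smap A B g x"
proof -
 have fx: "f x = g x" using nr_self[OF ev A] f by (simp add: smap_def)
 have "sm A (%y. h (g y)) x" if h: "sm B h (g x)" for h
 proof (rule sm_cong[OF A])
  show "sm A (%y. h (f y)) x" using f h fx by (simp add: smap_def)
  show "ngh A x (%y. h (f y) = h (g y))" using ev by eventually_elim simp
 qed
 thus ?thesis using f fx by (simp add: smap_def)
qed

text \<open>The indicator of a property holding near \<open>f x\<close> is a smooth germ. Its
  pullback is smooth and equals \<open>1\<close> at \<open>x\<close>, hence stays positive near
  \<open>x\<close>.\<close>

lemma smap_near:
 assumes A: "smooth_atlas A" and B: "smooth_atlas B" and f: "smap A B f x" and P: "eventually P (near B (f x))"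
 shows "ngh A x (%y. P (f y))"
proof -
 let ?h = "%z. if P z then 1 else 0 :: real"
 have "ngh B (f x) (%z. 1 = ?h z)" using P by eventually_elim simp
 hence "sm B ?h (f x)" by (rule sm_cong[OF B]) (rule sm_const[OF B smap_car(2)[OF f]])
 from smap_sm[OF f this] have "sm A (%y. ?h (f y)) x" .
 moreover have "P (f x)" using nr_self[OF P B smap_car(2)[OF f]] .
 ultimately have "ngh A x (%y. ?h (f y):{0<..})" by (intro sm_near[OF A]) auto
 thus ?thesis by eventually_elim (auto split: if_splits)
qed

text \<open>One chart at the image is enough: near \<open>x\<close>, a germ at \<open>f x\<close>
  pulled back by \<open>f\<close> is its chart expression composed with the coordinates of
  \<open>f\<close>.\<close>

lemma smapI:
 assumes A: "smooth_atlas A" and B: "smooth_atlas B" and c: "(e, V, ps):B" and x: "x:mc A"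
  and ev: "ngh A x (%y. f y:V)" and co: "!!i. i < e ==> sm A (%y. ps (f y) i) x"
 shows "smap A B f x"
proof -
 have fx: "f x:V" using nr_self[OF ev A x] .
 have "sm A (%y. h (f y)) x" if h: "sm B h (f x)" for h
 proof (rule sm_cong[OF A])
  show "sm A (%y. h (inv_into V ps (ps (f y)))) x"
  proof (rule sm_cmp_eucl[where g = "%y. h (inv_into V ps y)" and F = "%y. ps (f y)", OF A _ x])
   show "sma e (%y. h (inv_into V ps y)) (ps (f x))" using h sm_chart[OF B c fx] by blast
   show "ngh A x (%y. ps (f y):eucl e)"
    using ev by eventually_elim (rule chart_eucl[OF B c])
  qed (rule co)
  show "ngh A x (%y. h (inv_into V ps (ps (f y))) = h (f y))"
   using ev by eventually_elim (simp add: chart_inv[OF B c])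
 qed
 thus ?thesis using x fx chart_subset[OF c] by (auto simp: smap_def)
qed

lemma smap_coord:
 assumes "smooth_atlas B" "smap A B f x" "(e, V, ps):B" "f x:V"
 shows "sm A (%y. ps (f y) i) x"
 using smap_sm[OF assms(2) sm_coord[OF assms(1,3,4)]] .

lemma smap_eventually:
 assumes A: "smooth_atlas A" and B: "smooth_atlas B" and f: "smap A B f x"
 shows "ngh A x (%y. smap A B f y)"
proof -
 obtain e V ps where c: "(e, V, ps):B" "f x:V" by (rule sm_chartE[OF smap_car(2)[OF f]])
 have 1: "ngh A x (%y. f y:V)"
  by (rule smap_near[OF A B f nr_open[OF chart_open[OF B c(1)] c(2)]])
 have "ngh A x (%y. ALL i:{..<e}. sm A (%y. ps (f y) i) y)"
  by (intro eventually_ball_finite) (auto intro!: sm_eventually[OF A] smap_coord[OF B f c])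
 moreover have "ngh A x (%y. y:mc A)"
  using nr_open[of A "mc A"] openin_topspace[of "mtop A"] smap_car(1)[OF f] A by simp
 ultimately show ?thesis using nr_near[OF 1]
  by eventually_elim (rule smapI[OF A B c(1)], auto)
qed

lemma cont_map_near:
 assumes A: "smooth_atlas A" and B: "smooth_atlas B"
 shows "continuous_map (mtop A) (mtop B) f \<longleftrightarrow>
  (ALL x:mcarrier A. f x:mc B & (\<forall>P. eventually P (near B (f x)) --> (ngh A x (%y. P (f y)))))"
  (is "_ \<longleftrightarrow> ?R")
proof
 assume c: "continuous_map (mtop A) (mtop B) f"
 show ?R
 proof (intro ballI conjI allI impI)
  fix x assume x: "x:mc A"
  show fx: "f x:mc B" using c x A B by (auto simp: continuous_map_def Pi_iff)
  fix P assume "eventually P (near B (f x))"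
  then obtain W where W: "opn B W" "f x:W" "ALL z:W. P z" by (auto simp: nr[OF B fx])
  have "opn A {y:mc A. f y:W}"
   using c W(1) A by (simp add: continuous_map_def)
  thus "ngh A x (%y. P (f y))"
   unfolding nr[OF A x] using W x by blast
 qed
next
 assume R: ?R
 show "continuous_map (mtop A) (mtop B) f"
  unfolding continuous_map_def
 proof (intro conjI allI impI)
  show "f:topspace (mtop A) \<rightarrow> topspace (mtop B)" using R A B by auto
  fix W assume W: "opn B W"
  show "opn A {x:topspace (mtop A). f x:W}"
  proof (rule opn_near[OF A])
   fix x assume x: "x:{x:topspace (mtop A). f x:W}"
   hence "ngh A x (%y. f y:W)" using R nr_open[OF W] A by auto
   moreover have "ngh A x (%y. y:topspace (mtop A))"
    using x by (intro nr_open) auto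
   ultimately show "ngh A x (%y. y:{x:topspace (mtop A). f x:W})"
    by eventually_elim simp
  qed (use A in auto)
 qed
qed

text \<open>The bridge between the chartwise definition and germs; smoothness of all later maps is
  established pointwise as \<open>smap\<close> and translated here.\<close>

lemma smm_iff:
 assumes A: "smooth_atlas A" and B: "smooth_atlas B"
 shows "smooth_map A B f \<longleftrightarrow> (ALL x:mcarrier A. smap A B f x)"
proof
 assume s: "smooth_map A B f"
 show "ALL x:mcarrier A. smap A B f x"
 proof
  fix x assume x: "x:mc A"
  have c: "continuous_map (mtop A) (mtop B) f" using s by (simp add: smooth_map_def)
  note cn = c[unfolded cont_map_near[OF A B], rule_format, OF x]
  obtain d U ph where cU: "(d, U, ph):A" "x:U" by (rule sm_chartE[OF x])
  obtain e V ps where cV: "(e, V, ps):B" "f x:V" using sm_chartE cn by metis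
  have ev: "ngh A x (%y. f y:V)" using cn nr_open[OF chart_open[OF B cV(1)] cV(2)] by blast
  have "opn A {y:mc A. f y:V}"
   using c chart_open[OF B cV(1)] A by (simp add: continuous_map_def)
  from chart_image_open[OF A cU(1) this]
  have o: "opE d (ph ` {x:U. f x:V})"
   using chart_subset[OF cU(1)] by (auto elim!: back_subst[of "openin _"] intro!: arg_cong[of _ _ "image ph"])
  have sv: "smooth_vec d e (%y. ps (f (inv_into U ph y))) (ph ` {x:U. f x:V})"
   using s cU(1) cV(1) by (force simp: smooth_map_def comp_def)
  show "smap A B f x"
  proof (rule smapI[OF A B cV(1) x ev])
   fix i assume "i < e"
   show "sm A (%y. ps (f y) i) x" unfolding sm_chart[OF A cU]
    by (rule smv_at[OF sv o _ \<open>i < e\<close>]) (use cU cV in auto)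
  qed
 qed
next
 assume s: "ALL x:mcarrier A. smap A B f x"
 have c: "continuous_map (mtop A) (mtop B) f"
  unfolding cont_map_near[OF A B]
 by (metis ballI conjI allI impI s smap_car smap_near A B)
 have "smooth_vec d e (%y. ps (f (inv_into U ph y))) (ph ` {x:U. f x:V})"
  if cU: "(d, U, ph):A" and cV: "(e, V, ps):B" for d U ph e V ps
 proof (rule smvI)
  have "opn A {y:mc A. f y:V}"
   using c chart_open[OF B cV(1)] A by (simp add: continuous_map_def)
  from chart_image_open[OF A cU(1) this]
  show "opE d (ph ` {x:U. f x:V})"
   using chart_subset[OF cU(1)] by (auto elim!: back_subst[of "openin _"] intro!: arg_cong[of _ _ "image ph"])
  fix y assume "y:ph ` {x:U. f x:V}"
  then obtain x where x: "x:U" "f x:V" "y = ph x" by auto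
  show "ps (f (inv_into U ph y)):eucl e" using x chart_inv[OF A cU] chart_eucl[OF B cV] by simp
  show "sma d (%y. ps (f (inv_into U ph y)) i) y" for i
  proof -
   have sx: "smap A B f x" using s x(1) chart_subset[OF cU] by auto
   show ?thesis using smap_coord[OF B sx cV x(2)] sm_chart[OF A cU x(1), of "%y. ps (f y) i"] x(3) by simp
  qed
 qed
 thus "smooth_map A B f" using c by (auto simp: smooth_map_def comp_def)
qed

lemma smooth_fun_iff:
 assumes A: "smooth_atlas A"
 shows "smooth_fun A f \<longleftrightarrow> (ALL x:mcarrier A. sm A f x)"
proof -
 have "smooth_real d (f \<circ> inv_into U ph) (ph ` U) \<longleftrightarrow> (ALL x:U. sm A f x)" if c: "(d, U, ph):A" for d U ph
  using smr_iff[OF saD(2)[OF A c]] sm_chart[OF A c] by (simp add: comp_def)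
 thus ?thesis by (force simp: smooth_fun_def mcarrier_def)
qed

subsection \<open>Open submanifolds\<close>

lemma rst_atlas_iff: "(d, U, ph):restrict_atlas A W \<longleftrightarrow> (\<exists>U'. (d, U', ph):A & U = U' \<inter> W)"
 by (auto simp: restrict_atlas_def)

lemma mc_rst: "mc (restrict_atlas A W) = mc A \<inter> W"
 unfolding set_eq_iff Int_iff mc_iff rst_atlas_iff by blast

lemma inv_into_chart_Int:
 "smooth_atlas A ==> (d, U, ph):A ==> Xs \<subseteq> U ==> y:ph ` Xs ==> inv_into Xs ph y = inv_into U ph y"
 using saD(1) by (metis (no_types, lifting) image_iff inj_on_subset inv_into_f_f subsetD)

lemma smv_mono: "smooth_vec d e F D ==> D' \<subseteq> D ==> smooth_vec d e F D'"
 unfolding smooth_vec_def using smr_mono by blast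

lemma smv_cong:
 assumes D: "opE d D" and eq: "!!x. x:D ==> F x = G x" and F: "smooth_vec d e F D"
 shows "smooth_vec d e G D"
proof (rule smvI[OF D])
 fix x assume x: "x:D"
 show "G x:eucl e" using smv_eucl[OF F x] eq[OF x] by simp
 fix i assume i: "i < e"
 have "\<forall>\<^sub>F y in enear d x. F y i = G y i"
  using D x eq by (auto simp: eventually_nhdsin)
 thus "sma d (%y. G y i) x"
  using smv_at[OF F D x i] by (rule sma_cong)
qed

lemma sa_rst:
 assumes A: "smooth_atlas A" and W: "opn A W"
 shows "smooth_atlas (restrict_atlas A W)"
 unfolding smooth_atlas_def
proof (intro conjI; clarify)
 fix d U' ph assume "(d, U', ph):restrict_atlas A W"
 then obtain U where c: "(d, U, ph):A" and U': "U' = U \<inter> W" by (auto simp: rst_atlas_iff)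
 show "inj_on ph U' & opE d (ph ` U')"
  using saD(1)[OF A c] chart_image_open[OF A c W] U' by (auto simp: Int_commute inj_on_def)
 fix e V' ps assume "(e, V', ps):restrict_atlas A W"
 then obtain V where c': "(e, V, ps):A" and V': "V' = V \<inter> W" by (auto simp: rst_atlas_iff)
 have "opn A (W \<inter> V)" using W chart_open[OF A c'] by blast
 from chart_image_open[OF A c this] have o: "opE d (ph ` (U' \<inter> V'))"
  by (simp add: U' V' Int_ac)
 have "smooth_vec d e (ps \<circ> inv_into U' ph) (ph ` (U' \<inter> V'))"
  using o _ smv_mono[OF sa_trs(2)[OF A c c']]
 proof (rule smv_cong)
  show "ph ` (U' \<inter> V') \<subseteq> ph ` (U \<inter> V)" using U' V' by auto
  show "ps (inv_into U ph y) = (ps \<circ> inv_into U' ph) y" if "y:ph ` (U' \<inter> V')" for y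
   using inv_into_chart_Int[OF A c, of U' y] that U' by auto
 qed
 with o show "opE d (ph ` (U' \<inter> V')) & smooth_vec d e (ps \<circ> inv_into U' ph) (ph ` (U' \<inter> V'))"
  by blast
qed

lemma opn_rst:
 assumes A: "smooth_atlas A" and W: "opn A W"
 shows "opn (restrict_atlas A W) Z \<longleftrightarrow> opn A Z & Z \<subseteq> W"
proof
 assume Z: "opn (restrict_atlas A W) Z"
 have sub: "Z \<subseteq> mc A" "Z \<subseteq> W"
  using opn_subset[OF sa_rst[OF A W] Z] by (auto simp: mc_rst)
 have "opE d (ph ` (Z \<inter> U))" if c: "(d, U, ph):A" for d U ph
 proof -
  have "(d, U \<inter> W, ph):restrict_atlas A W" using c by (auto simp: rst_atlas_iff)
  from chart_image_open[OF sa_rst[OF A W] this Z]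
  moreover have "Z \<inter> (U \<inter> W) = Z \<inter> U" using sub by auto
  ultimately show ?thesis by simp
 qed
 thus "opn A Z & Z \<subseteq> W" using sub by (auto simp: openin_mtop[OF A])
next
 assume Z: "opn A Z & Z \<subseteq> W"
 have "opE d (ph ` (Z \<inter> U))" if r: "(d, U, ph):restrict_atlas A W" for d U ph
 proof -
  obtain U' where c: "(d, U', ph):A" and U: "U = U' \<inter> W" using r unfolding rst_atlas_iff by blast
  have "Z \<inter> U = Z \<inter> U'" using U Z by auto
  thus ?thesis using chart_image_open[OF A c] Z by simp
 qed
 thus "opn (restrict_atlas A W) Z"
  using Z opn_subset[OF A] by (auto simp: openin_mtop[OF sa_rst[OF A W]] mc_rst)
qed

lemma near_rst:
 assumes A: "smooth_atlas A" and W: "opn A W" and x: "x:W"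
 shows "eventually P (near (restrict_atlas A W) x) \<longleftrightarrow> eventually P (near A x)"
proof -
 have xA: "x:mc A" using opn_subset[OF A W] x by auto
 have xR: "x:mc (restrict_atlas A W)" using xA x by (simp add: mc_rst)
 show ?thesis
  unfolding nr[OF A xA] nr[OF sa_rst[OF A W] xR] opn_rst[OF A W]
 proof
  assume "\<exists>S. opn A S & x:S & (ALL y:S. P y)"
  then obtain S where "opn A S" "x:S" "ALL y:S. P y" by blast
  thus "\<exists>S. (opn A S & S \<subseteq> W) & x:S & (ALL y:S. P y)"
   using W x by (intro exI[of _ "S \<inter> W"]) auto
 qed blast
qed

lemma sm_rst:
 assumes A: "smooth_atlas A" and W: "opn A W"
 shows "sm (restrict_atlas A W) f x \<longleftrightarrow> sm A f x & x:W"
proof (cases "x:mc A \<inter> W")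
 case True
 then obtain d U ph where c: "(d, U, ph):A" "x:U" by (auto simp: mc_iff)
 have c': "(d, U \<inter> W, ph):restrict_atlas A W" "x:U \<inter> W" using c True by (auto simp: rst_atlas_iff)
 have "\<forall>\<^sub>F y in enear d (ph x). y:ph ` (U \<inter> W)"
  using chart_image_open[OF A c(1) W] c'(2) by (auto simp: eventually_nhdsin Int_commute)
 hence ev: "\<forall>\<^sub>F y in enear d (ph x). f (inv_into (U \<inter> W) ph y) = f (inv_into U ph y)"
  by eventually_elim (simp add: inv_into_chart_Int[OF A c(1)])
 hence ev': "\<forall>\<^sub>F y in enear d (ph x). f (inv_into U ph y) = f (inv_into (U \<inter> W) ph y)"
  by eventually_elim simp
 show ?thesis unfolding sm_chart[OF A c] sm_chart[OF sa_rst[OF A W] c']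
  using sma_cong[OF ev] sma_cong[OF ev'] True by blast
next
 case False
 thus ?thesis using sm_car by (metis IntI mc_rst IntD2 IntD1)
qed

lemma smap_rst_left:
 assumes A: "smooth_atlas A" and W: "opn A W"
 shows "smap (restrict_atlas A W) B f x \<longleftrightarrow> smap A B f x & x:W"
 by (auto simp: smap_def sm_rst[OF A W] mc_rst)

lemma smap_rst_right:
 assumes A: "smooth_atlas A" and W: "opn A W"
 shows "smap B (restrict_atlas A W) f x \<longleftrightarrow> smap B A f x & f x:W"
 by (auto simp: smap_def sm_rst[OF A W] mc_rst)

subsection \<open>Products\<close>

text \<open>Concatenation of a vector of length \<open>d\<close> with another one, as in the charts
  of \<open>prod_atlas\<close>; \<open>feu\<close> and \<open>seu\<close> recover the two
  parts.\<close>

definition peu :: "nat => vec => vec => nat => real" where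
 "peu d x y = (%i. if i < d then x i else y (i - d))"

definition feu :: "nat => vec => nat => real" where
 "feu d z = (%i. if i < d then z i else 0)"

definition seu :: "nat => vec => nat => real" where
 "seu d z = (%i. z (i + d))"

lemma peu_simps:
 "x:eucl d ==> feu d (peu d x y) = x" "seu d (peu d x y) = y"
 "peu d (feu d z) (seu d z) = z"
 by (auto simp: feu_def seu_def peu_def euc)

lemma peu_mem:
 "y:eucl e ==> peu d x y:eucl (d + e)"
 "feu d z:eucl d" "z:eucl (d + e) ==> seu d z:eucl e"
 by (auto simp: feu_def seu_def peu_def euc)

lemma sma_feu: "z:eucl d' ==> sma d' (%z. feu d z i) z"
 by (cases "i < d") (simp_all add: feu_def sma_coord sma_const)

lemma sma_seu: "z:eucl d' ==> sma d' (%z. seu d z i) z"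
 by (simp add: seu_def sma_coord)

lemma sma_pair_fst:
 assumes "sma d f (feu d z)" "z:eucl d'"
 shows "sma d' (%z. f (feu d z)) z"
 by (rule sma_cmp[where g = f and F = "feu d" and e = d])
  (use assms in "auto simp: peu_mem intro: sma_feu")

lemma sma_pair_snd:
 assumes "sma e f (seu d z)" "z:eucl (d + e)"
 shows "sma (d + e) (%z. f (seu d z)) z"
proof (rule sma_cmp[where g = f and F = "seu d" and e = e, OF assms])
 have "\<forall>\<^sub>F y in enear (d + e) z. y:topspace (Euclidean_space (d + e))"
  using assms(2) openin_topspace[of "Euclidean_space (d + e)"] by (auto simp: eventually_nhdsin)
 thus "\<forall>\<^sub>F y in enear (d + e) z. seu d y:eucl e"
  by eventually_elim (auto intro: peu_mem)
qed (rule sma_seu[OF assms(2)])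

lemma opn_peu:
 assumes D: "opE d D" and E: "opE e E"
 shows "opE (d + e) {z:eucl (d + e). feu d z:D & seu d z:E}"
proof (rule opn_eucl_boxI)
 fix z assume z: "z:{z:eucl (d + e). feu d z:D & seu d z:E}"
 obtain r where r: "r > 0" "ALL y:eucl d. (\<forall>i<d. \<bar>y i - feu d z i\<bar> < r) --> y:D"
  using eucl_box[OF D, of "feu d z"] z by blast
 obtain s where s: "s > 0" "ALL y:eucl e. (\<forall>i<e. \<bar>y i - seu d z i\<bar> < s) --> y:E"
  using eucl_box[OF E, of "seu d z"] z by blast
 show "\<exists>t>0. ALL y:eucl (d + e). (\<forall>i<d + e. \<bar>y i - z i\<bar> < t) -->
   y:{z:eucl (d + e). feu d z:D & seu d z:E}"
 proof (intro exI[of _ "min r s"] conjI ballI impI)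
  fix y assume y: "y:eucl (d + e)" "\<forall>i<d + e. \<bar>y i - z i\<bar> < min r s"
  have "feu d y:D" using r(2) peu_mem(2)[of d y] y(2) by (auto simp: feu_def)
  moreover have "seu d y:E" using s(2) peu_mem(3)[OF y(1)] y(2) by (auto simp: seu_def)
  ultimately show "y:{z:eucl (d + e). feu d z:D & seu d z:E}" using y by simp
 qed (use r s in auto)
qed auto

lemma prod_atlas_iff:
 "(k, Z, ze):prod_atlas A B \<longleftrightarrow> (\<exists>d U ph e V ps. (d, U, ph):A & (e, V, ps):B &
  k = d + e & Z = U \<times> V & ze = (%p. peu d (ph (fst p)) (ps (snd p))))"
 unfolding prod_atlas_def peu_def mem_Collect_eq prod.inject case_prod_unfold by blast

lemma mc_prod: "mc (prod_atlas A B) = mc A \<times> mc B"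
proof -
 have 1: "(x, y):mc (prod_atlas A B)" if x: "x:mc A" and y: "y:mc B" for x y
 proof -
  obtain d U ph where "(d, U, ph):A" "x:U" by (rule sm_chartE[OF x])
  moreover obtain e V ps where "(e, V, ps):B" "y:V" by (rule sm_chartE[OF y])
  ultimately show ?thesis unfolding mc_iff prod_atlas_iff by blast
 qed
 have 2: "fst p:mc A & snd p:mc B" if p: "p:mc (prod_atlas A B)" for p
 proof -
  obtain k Z ze where c: "(k, Z, ze):prod_atlas A B" "p:Z" by (rule sm_chartE[OF p])
  then obtain d U ph e V ps where "(d, U, ph):A" "(e, V, ps):B" "Z = U \<times> V" unfolding prod_atlas_iff by blast
  thus ?thesis using c(2) chart_subset by (metis mem_Times_iff subsetD)
 qed
 show ?thesis
 proof (intro equalityI subsetI)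
  fix p assume "p:mc (prod_atlas A B)"
  thus "p:mc A \<times> mc B" using 2 by (simp add: mem_Times_iff)
 next
  fix p assume "p:mc A \<times> mc B"
  thus "p:mc (prod_atlas A B)" using 1[of "fst p" "snd p"] by (simp add: mem_Times_iff)
 qed
qed

lemma pair_chart_image:
 assumes "!!x. x:Xs ==> ph x:eucl d" "!!y. y:Y ==> ps y:eucl e"
 shows "(%p. peu d (ph (fst p)) (ps (snd p))) ` (Xs \<times> Y) =
  {z:eucl (d + e). feu d z:ph ` Xs & seu d z:ps ` Y}"
proof (intro equalityI subsetI)
 fix z assume "z:(%p. peu d (ph (fst p)) (ps (snd p))) ` (Xs \<times> Y)"
 thus "z:{z:eucl (d + e). feu d z:ph ` Xs & seu d z:ps ` Y}"
  using assms by (auto simp: peu_simps intro!: peu_mem)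
next
 fix z assume "z:{z:eucl (d + e). feu d z:ph ` Xs & seu d z:ps ` Y}"
 then obtain x y where "x:Xs" "feu d z = ph x" "y:Y" "seu d z = ps y" by auto
 moreover from this have "z = peu d (ph x) (ps y)" using peu_simps(3)[of d z] by simp
 ultimately show "z:(%p. peu d (ph (fst p)) (ps (snd p))) ` (Xs \<times> Y)"
  by (intro image_eqI[of _ _ "(x, y)"]) auto
qed

lemma sa_prod:
 assumes A: "smooth_atlas A" and B: "smooth_atlas B"
 shows "smooth_atlas (prod_atlas A B)"
 unfolding smooth_atlas_def
proof (intro conjI; clarify)
 fix k Z ze assume "(k, Z, ze):prod_atlas A B"
 then obtain d U ph e V ps where c: "(d, U, ph):A" "(e, V, ps):B"
  and k: "k = d + e" and Z: "Z = U \<times> V" and ze: "ze = (%p. peu d (ph (fst p)) (ps (snd p)))"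
  unfolding prod_atlas_iff by blast
 have inj: "inj_on ze Z"
 proof (rule inj_onI)
  fix p q assume p: "p:Z" and q: "q:Z" and eq: "ze p = ze q"
  have "ph (fst p):eucl d" "ph (fst q):eucl d" using p q chart_eucl[OF A c(1)] by (auto simp: Z)
  hence "ph (fst p) = ph (fst q)"
   using arg_cong[OF eq, of "feu d"] by (simp add: ze peu_simps(1))
  moreover have "ps (snd p) = ps (snd q)"
   using arg_cong[OF eq, of "seu d"] by (simp add: ze peu_simps(2))
  ultimately show "p = q" using p q inj_onD[OF saD(1)[OF A c(1)]] inj_onD[OF saD(1)[OF B c(2)]]
   unfolding Z by (auto simp: prod_eq_iff)
 qed
 have im: "ze ` (Xs \<times> Y) = {z:eucl (d + e). feu d z:ph ` Xs & seu d z:ps ` Y}"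
  if "Xs \<subseteq> U" "Y \<subseteq> V" for Xs Y
  unfolding ze by (rule pair_chart_image) (use that chart_eucl[OF A c(1)] chart_eucl[OF B c(2)] in auto)
 show "inj_on ze Z & opE k (ze ` Z)"
  using inj opn_peu[OF saD(2)[OF A c(1)] saD(2)[OF B c(2)]] im[of U V] k Z by simp
 fix k' Z' ze' assume "(k', Z', ze'):prod_atlas A B"
 then obtain d' U' ph' e' V' ps' where c': "(d', U', ph'):A" "(e', V', ps'):B"
  and k': "k' = d' + e'" and Z': "Z' = U' \<times> V'" and ze': "ze' = (%p. peu d' (ph' (fst p)) (ps' (snd p)))"
  unfolding prod_atlas_iff by blast
 note tA = sa_trs[OF A c(1) c'(1)] and tB = sa_trs[OF B c(2) c'(2)]
 have im2: "ze ` (Z \<inter> Z') = {z:eucl (d + e). feu d z:ph ` (U \<inter> U') & seu d z:ps ` (V \<inter> V')}"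
  using im[of "U \<inter> U'" "V \<inter> V'"] by (simp add: Z Z' Times_Int_Times)
 have o: "opE k (ze ` (Z \<inter> Z'))"
  using opn_peu[OF tA(1) tB(1)] im2 k by simp
 have inv: "inv_into Z ze z = (inv_into U ph (feu d z), inv_into V ps (seu d z))" if z: "z:ze ` Z" for z
 proof -
  obtain x y where xy: "x:U" "y:V" "z = ze (x, y)" using z Z by auto
  thus ?thesis using inv_into_f_f[OF inj, of "(x, y)"] chart_inv[OF A c(1)] chart_inv[OF B c(2)]
    chart_eucl[OF A c(1)] by (simp add: Z ze peu_simps)
 qed
 have "smooth_vec k k' (%z. peu d' (ph' (inv_into U ph (feu d z))) (ps' (inv_into V ps (seu d z)))) (ze ` (Z \<inter> Z'))"
 proof (rule smvI[OF o])
  fix z assume z: "z:ze ` (Z \<inter> Z')"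
  hence z': "z:eucl (d + e)" "feu d z:ph ` (U \<inter> U')" "seu d z:ps ` (V \<inter> V')" using im2 by auto
  show "peu d' (ph' (inv_into U ph (feu d z))) (ps' (inv_into V ps (seu d z))):eucl k'"
   unfolding k' by (rule peu_mem(1)[OF smv_eucl[OF tB(2) z'(3)]])
  fix i assume i: "i < k'"
  show "sma k (%z. peu d' (ph' (inv_into U ph (feu d z))) (ps' (inv_into V ps (seu d z))) i) z"
  proof (cases "i < d'")
   case True
   have "sma k (%z. ph' (inv_into U ph (feu d z)) i) z"
    by (rule sma_pair_fst[where f = "%y. ph' (inv_into U ph y) i", OF smv_at[OF tA(2,1) z'(2) True]])
     (use z' k in simp)
   thus ?thesis using True by (simp add: peu_def)
  next
   case False
   hence i': "i - d' < e'" using i k' by simp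
   have "sma k (%z. ps' (inv_into V ps (seu d z)) (i - d')) z"
    unfolding k by (rule sma_pair_snd[where f = "%y. ps' (inv_into V ps y) (i - d')", OF smv_at[OF tB(2,1) z'(3) i'] z'(1)])
   thus ?thesis using False by (simp add: peu_def)
  qed
 qed
 hence "smooth_vec k k' (ze' \<circ> inv_into Z ze) (ze ` (Z \<inter> Z'))"
  by (rule smv_cong[OF o, rotated]) (use inv in "auto simp: ze'")
 with o show "opE k (ze ` (Z \<inter> Z')) & smooth_vec k k' (ze' \<circ> inv_into Z ze) (ze ` (Z \<inter> Z'))"
  by blast
qed

lemma smap_fst_snd:
 assumes A: "smooth_atlas A" and B: "smooth_atlas B" and p: "p:mc (prod_atlas A B)"
 shows "smap (prod_atlas A B) A fst p" "smap (prod_atlas A B) B snd p"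
proof -
 note P = sa_prod[OF A B]
 obtain k Z ze where c: "(k, Z, ze):prod_atlas A B" "p:Z" by (rule sm_chartE[OF p])
 then obtain d U ph e V ps where cA: "(d, U, ph):A" and cB: "(e, V, ps):B"
  and k: "k = d + e" and Z: "Z = U \<times> V" and ze: "ze = (%p. peu d (ph (fst p)) (ps (snd p)))"
  unfolding prod_atlas_iff by blast
 have ev: "ngh (prod_atlas A B) p (%q. q:Z)" by (rule nr_open[OF chart_open[OF P c(1)] c(2)])
 show "smap (prod_atlas A B) A fst p"
 proof (rule smapI[OF P A cA p])
  show "ngh (prod_atlas A B) p (%q. fst q:U)" using ev by eventually_elim (auto simp: Z)
  show "sm (prod_atlas A B) (%q. ph (fst q) i) p" if "i < d" for i
   using sm_coord[OF P c, of i] that by (simp add: ze peu_def)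
 qed
 show "smap (prod_atlas A B) B snd p"
 proof (rule smapI[OF P B cB p])
  show "ngh (prod_atlas A B) p (%q. snd q:V)" using ev by eventually_elim (auto simp: Z)
  show "sm (prod_atlas A B) (%q. ps (snd q) i) p" for i
   using sm_coord[OF P c, of "i + d"] by (simp add: ze peu_def)
 qed
qed

lemma smap_Pair:
 assumes A: "smooth_atlas A" and B: "smooth_atlas B" and C: "smooth_atlas C"
  and f: "smap C A f x" and g: "smap C B g x"
 shows "smap C (prod_atlas A B) (%y. (f y, g y)) x"
proof -
 obtain d U ph where cA: "(d, U, ph):A" "f x:U" by (rule sm_chartE[OF smap_car(2)[OF f]])
 obtain e V ps where cB: "(e, V, ps):B" "g x:V" by (rule sm_chartE[OF smap_car(2)[OF g]])
 have c: "(d + e, U \<times> V, %p. peu d (ph (fst p)) (ps (snd p))):prod_atlas A B"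
  unfolding prod_atlas_iff using cA cB by blast
 show ?thesis
 proof (rule smapI[OF C sa_prod[OF A B] c smap_car(1)[OF f]])
  show "ngh C x (%y. (f y, g y):U \<times> V)"
   using smap_near[OF C A f nr_open[OF chart_open[OF A cA(1)] cA(2)]]
    smap_near[OF C B g nr_open[OF chart_open[OF B cB(1)] cB(2)]]
   by eventually_elim simp
  show "sm C (%y. peu d (ph (fst (f y, g y))) (ps (snd (f y, g y))) i) x" for i
   by (cases "i < d") (simp_all add: peu_def smap_coord[OF A f cA] smap_coord[OF B g cB])
 qed
qed

subsection \<open>Embedded submanifolds\<close>

context
 fixes N :: nat and c :: "'m => nat => real" and S :: "'m set"
 assumes inj: "inj_on c S" and cN: "!!p. p:S ==> c p:eucl N"
begin

lemma emb_atlasD: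
 assumes "(d, W, ph):embedded_atlas N c S"
 shows "W \<subseteq> S" "inj_on ph W" "opE d (ph ` W)"
  "smooth_vec d N (%y. c (inv_into W ph y)) (ph ` W)"
  "p:W ==> \<exists>E F. opE N E & c p:E & smooth_vec N d F E &
    (ALL q:S. c q:E --> q:W & F (c q) = ph q)"
 using assms by (auto simp: embedded_atlas_def comp_def)

text \<open>Near a point the second chart is the restriction of a smooth ambient map
  \<open>F\<close>, so the transition map is \<open>F\<close> composed with the smooth inverse of
  the first chart.\<close>

lemma sa_emb: "smooth_atlas (embedded_atlas N c S)"
 unfolding smooth_atlas_def
proof (intro conjI; clarify)
 fix d W ph assume cW: "(d, W, ph):embedded_atlas N c S"
 note W = emb_atlasD[OF cW]
 show "inj_on ph W & opE d (ph ` W)" using W by blast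
 fix e V ps assume cV: "(e, V, ps):embedded_atlas N c S"
 note V = emb_atlasD[OF cV]
 have inv: "inv_into W ph (ph p) = p" if "p:W" for p using inv_into_f_f[OF W(2) that] .
 have loc: "\<exists>D F. opE d D & ph p:D & D \<subseteq> ph ` (W \<inter> V) &
   (\<forall>i<e. sma d (%y. F (c (inv_into W ph y)) i) (ph p)) & (ALL y:D. F (c (inv_into W ph y)) = ps (inv_into W ph y))"
  if p: "p:W \<inter> V" for p
 proof -
  obtain E F where E: "opE N E" "c p:E" and F: "smooth_vec N e F E"
   "!!q. q:S ==> c q:E ==> q:V & F (c q) = ps q"
   using V(5)[of p] p by auto
  define D where "D = {y:ph ` W. c (inv_into W ph y):E}"
  have o: "opE d D" unfolding D_def by (rule opn_smv_preimage[OF W(3,4) E(1)])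
  have pD: "ph p:D" using p E inv by (auto simp: D_def)
  have DV: "inv_into W ph y:V & F (c (inv_into W ph y)) = ps (inv_into W ph y)" if "y:D" for y
   using that F(2)[of "inv_into W ph y"] W(1) inv_into_into[of y ph W] by (auto simp: D_def)
  have "D \<subseteq> ph ` (W \<inter> V)" using DV inv by (force simp: D_def)
  moreover have "sma d (%y. F (c (inv_into W ph y)) i) (ph p)" if i: "i < e" for i
  proof (rule sma_cmp[where g = "%z. F z i" and F = "%y. c (inv_into W ph y)" and e = N])
   show "sma N (%z. F z i) (c (inv_into W ph (ph p)))"
    using smv_at[OF F(1) E(1,2) i] inv p by simp
   have e: "\<forall>\<^sub>F y in enear d (ph p). y:D" using o pD by (auto simp: eventually_nhdsin)
   show "ph p:eucl d" using o pD opn_eucl_subset by auto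
   show "\<forall>\<^sub>F y in enear d (ph p). c (inv_into W ph y):eucl N"
    using e by eventually_elim (use E(1) opn_eucl_subset in "auto simp: D_def")
   show "sma d (%y. c (inv_into W ph y) j) (ph p)" if "j < N" for j
    by (rule smv_at[OF W(4,3) _ that]) (use p in auto)
  qed
  ultimately show ?thesis using o pD DV by blast
 qed
 have o: "opE d (ph ` (W \<inter> V))"
 proof (subst openin_subopen, intro ballI)
  fix y assume "y:ph ` (W \<inter> V)"
  then obtain p where p: "p:W \<inter> V" "y = ph p" by auto
  show "\<exists>T. opE d T & y:T & T \<subseteq> ph ` (W \<inter> V)"
   using loc[OF p(1)] unfolding p(2) by blast
 qed
 have "smooth_vec d e (%y. ps (inv_into W ph y)) (ph ` (W \<inter> V))"
 proof (rule smvI[OF o])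
  fix y assume "y:ph ` (W \<inter> V)"
  then obtain p where p: "p:W \<inter> V" "y = ph p" by auto
  show "ps (inv_into W ph y):eucl e" using p inv opn_eucl_subset[OF V(3)] by auto
  fix i assume i: "i < e"
  obtain D F where D: "opE d D" "ph p:D"
   "\<forall>i<e. sma d (%y. F (c (inv_into W ph y)) i) (ph p)" "ALL y:D. F (c (inv_into W ph y)) = ps (inv_into W ph y)"
   using loc[OF p(1)] by blast
  have "\<forall>\<^sub>F y in enear d (ph p). F (c (inv_into W ph y)) i = ps (inv_into W ph y) i"
   using D by (auto simp: eventually_nhdsin)
  thus "sma d (%y. ps (inv_into W ph y) i) y"
   unfolding p(2) by (rule sma_cong) (use D(3) i in blast)
 qed
 with o show "opE d (ph ` (W \<inter> V)) & smooth_vec d e (ps \<circ> inv_into W ph) (ph ` (W \<inter> V))"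
  by (simp add: comp_def)
qed

lemma mc_emb_subset: "mc (embedded_atlas N c S) \<subseteq> S"
 using emb_atlasD(1) by (fastforce simp: mc_iff)

lemma near_emb_subset:
 assumes "p:mc (embedded_atlas N c S)" shows "ngh (embedded_atlas N c S) p (%q. q:S)"
proof -
 have "opn (embedded_atlas N c S) (mc (embedded_atlas N c S))"
  using openin_topspace[of "mtop (embedded_atlas N c S)"] sa_emb by simp
 from nr_open[OF this assms] show ?thesis
  by eventually_elim (use mc_emb_subset in auto)
qed

lemma sm_emb:
 assumes p: "p:mc (embedded_atlas N c S)"
 shows "sm (embedded_atlas N c S) (%q. c q k) p"
proof (cases "k < N")
 case True
 obtain d W ph where cW: "(d, W, ph):embedded_atlas N c S" "p:W" by (rule sm_chartE[OF p])
 show ?thesis unfolding sm_chart[OF sa_emb cW]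
  using smv_at[OF emb_atlasD(4,3)[OF cW(1)] _ True] cW(2) by auto
next
 case False
 have "ngh (embedded_atlas N c S) p (%q. 0 = c q k)"
  using near_emb_subset[OF p] by eventually_elim (use cN False in "auto simp: euc")
 thus ?thesis by (rule sm_cong[OF sa_emb]) (rule sm_const[OF sa_emb p])
qed

text \<open>A chart at \<open>f x\<close> extends to a smooth ambient map, so smooth ambient
  coordinates of \<open>f\<close> have smooth chart coordinates. That such a chart exists is the
  hypothesis on \<open>f x\<close>.\<close>

lemma smap_emb:
 assumes C: "smooth_atlas C" and x: "x:mc C" and fx: "f x:mc (embedded_atlas N c S)"
  and ev: "ngh C x (%y. f y:S)" and co: "!!k. k < N ==> sm C (%y. c (f y) k) x"
 shows "smap C (embedded_atlas N c S) f x"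
proof -
 obtain d W ph where cW: "(d, W, ph):embedded_atlas N c S" "f x:W" by (rule sm_chartE[OF fx])
 obtain E F where E: "opE N E" "c (f x):E" and F: "smooth_vec N d F E"
  "!!q. q:S ==> c q:E ==> q:W & F (c q) = ph q"
  using emb_atlasD(5)[OF cW] by auto
 obtain r where r: "r > 0" "ALL y:eucl N. (\<forall>i<N. \<bar>y i - c (f x) i\<bar> < r) --> y:E"
  using eucl_box[OF E] by blast
 have "ngh C x (%y. ALL i:{..<N}. c (f y) i:ball (c (f x) i) r)"
  by (intro eventually_ball_finite ballI sm_near[OF C co open_ball]) (use r(1) in auto)
 with ev have E': "ngh C x (%y. f y:S & c (f y):E)"
  by eventually_elim (use r(2) cN in "auto simp: dist_real_def abs_minus_commute")
 show ?thesis
 proof (rule smapI[OF C sa_emb cW(1) x])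
  show "ngh C x (%y. f y:W)" using E' by eventually_elim (use F(2) in blast)
  fix i assume i: "i < d"
  show "sm C (%y. ph (f y) i) x"
  proof (rule sm_cong[OF C])
   show "sm C (%y. F (c (f y)) i) x"
   proof (rule sm_cmp_eucl[where g = "%z. F z i" and F = "%y. c (f y)", OF C _ x])
    show "sma N (%z. F z i) (c (f x))" using smv_at[OF F(1) E i] .
    show "ngh C x (%y. c (f y):eucl N)" using ev by eventually_elim (rule cN)
   qed (rule co)
   show "ngh C x (%y. F (c (f y)) i = ph (f y) i)" using E' by eventually_elim (use F(2) in auto)
  qed
 qed
qed

end

subsection \<open>Glueing manifolds along local diffeomorphisms\<close>

lemma push_atlas_iff:
 "(d, Z, ze):push_atlas f A \<longleftrightarrow> (\<exists>U ph W. (d, U, ph):A & opn A W & inj_on f (U \<inter> W) &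
  Z = f ` (U \<inter> W) & ze = ph \<circ> inv_into (U \<inter> W) f)"
 unfolding push_atlas_def by auto

text \<open>Common frame for \<open>Spin^c\<close>, the frame bundle and the reglued total spaces.
  The maps \<open>f i\<close> need not be injective, as the double quotient \<open>Spin^c\<close>
  shows; \<open>tr\<close> only asks that two points with the same image be related by a local
  smooth map over the target.\<close>

locale glueing =
 fixes I :: "'i set" and A :: "'i => 'm atlas" and f :: "'i => 'm => 'k"
 assumes sa: "i:I ==> smooth_atlas (A i)"
  and tr: "i:I ==> j:I ==> p:mc (A i) ==> q:mc (A j) ==> f i p = f j q ==>
   \<exists>g. smap (A i) (A j) g p & g p = q & (ngh (A i) p (%p'. f j (g p') = f i p'))"
begin

definition glued :: "'k atlas" where
 "glued = (UN i:I. push_atlas (f i) (A i))"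

text \<open>Exactly these points lie in domains from which \<open>push_atlas\<close> makes
  charts.\<close>

definition linj :: "'i => 'm => bool" where
 "linj i p \<longleftrightarrow> (\<exists>W. opn (A i) W & p:W & inj_on (f i) W)"

lemma glued_chart:
 "(d, Z, ze):glued \<longleftrightarrow> (EX i:I. \<exists>U ph Xs. (d, U, ph):A i & opn (A i) Xs & Xs \<subseteq> U & inj_on (f i) Xs &
  Z = f i ` Xs & ze = ph \<circ> inv_into Xs (f i))" (is "?L \<longleftrightarrow> ?R")
proof
 assume ?L
 then obtain i U ph W where "i:I" "(d, U, ph):A i" "opn (A i) W" "inj_on (f i) (U \<inter> W)"
  "Z = f i ` (U \<inter> W)" "ze = ph \<circ> inv_into (U \<inter> W) (f i)"
  by (auto simp: glued_def push_atlas_iff)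
 thus ?R using chart_open[OF sa] by (intro bexI[of _ i] exI[of _ U] exI[of _ ph] exI[of _ "U \<inter> W"]) auto
next
 assume ?R
 then obtain i U ph Xs where iX: "i:I" "(d, U, ph):A i" "opn (A i) Xs" "Xs \<subseteq> U" "inj_on (f i) Xs"
  "Z = f i ` Xs" "ze = ph \<circ> inv_into Xs (f i)" by blast
 moreover have "U \<inter> Xs = Xs" using iX by auto
 ultimately have "(d, Z, ze):push_atlas (f i) (A i)"
  unfolding push_atlas_iff by (intro exI[of _ U] exI[of _ ph] exI[of _ Xs]) simp
 thus ?L using iX(1) by (auto simp: glued_def)
qed

context
 fixes i d U ph Xs
 assumes i: "i:I" and c: "(d, U, ph):A i" and Xs: "opn (A i) Xs" "Xs \<subseteq> U" and inj: "inj_on (f i) Xs"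
begin

lemma pushed_chart: "p:Xs ==> (ph \<circ> inv_into Xs (f i)) (f i p) = ph p"
 by (simp add: inv_into_f_f[OF inj])

lemma pushed_image: "Y \<subseteq> Xs ==> (ph \<circ> inv_into Xs (f i)) ` (f i ` Y) = ph ` Y"
 using pushed_chart by (force simp: image_image)

lemma pushed_inj: "inj_on (ph \<circ> inv_into Xs (f i)) (f i ` Xs)"
 using saD(1)[OF sa[OF i] c] Xs(2) pushed_chart by (auto simp: inj_on_def subset_iff)

lemma pushed_inv:
 assumes "y:ph ` Xs" shows "inv_into (f i ` Xs) (ph \<circ> inv_into Xs (f i)) y = f i (inv_into U ph y)"
using assms inv_into_f_f pushed_inj Xs pushed_chart chart_inv sa i c by fastforce

lemma pushed_open: "Y \<subseteq> Xs ==> opn (A i) Y ==> opE d (ph ` Y)"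
 using chart_image_open[OF sa[OF i] c, of Y] Xs(2) by (simp add: Int_absorb2)

end

text \<open>Where two pushed charts meet, \<open>tr\<close> supplies a smooth \<open>g\<close> with
  \<open>f j (g p') = f i p'\<close>; the transition map is then \<open>g\<close> read in charts of
  \<open>A i\<close> and \<open>A j\<close>.\<close>

lemma sa_glued: "smooth_atlas glued"
 unfolding smooth_atlas_def
proof (intro conjI; clarify)
 fix d Z ze assume "(d, Z, ze):glued"
 then obtain i U ph Xs where i: "i:I" and c: "(d, U, ph):A i"
  and Xs: "opn (A i) Xs" "Xs \<subseteq> U" and inj: "inj_on (f i) Xs"
  and Z: "Z = f i ` Xs" and ze: "ze = ph \<circ> inv_into Xs (f i)"
  unfolding glued_chart by blast
 note A = sa[OF i]
 show "inj_on ze Z & opE d (ze ` Z)"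
  using pushed_inj[OF i c Xs inj] pushed_open[OF i c Xs inj _ Xs(1)] pushed_image[OF i c Xs inj, of Xs] Xs(1)
  by (simp add: Z ze del: comp_apply)
 fix e Y et assume "(e, Y, et):glued"
 then obtain j V ps Xs' where j: "j:I" and c': "(e, V, ps):A j"
  and Xs': "opn (A j) Xs'" "Xs' \<subseteq> V" and inj': "inj_on (f j) Xs'"
  and Y: "Y = f j ` Xs'" and et: "et = ps \<circ> inv_into Xs' (f j)"
  unfolding glued_chart by blast
 define X0 where "X0 = {p:Xs. f i p:f j ` Xs'}"
 have loc: "\<exists>g. smap (A i) (A j) g p & (ngh (A i) p (%p'. g p':Xs' & f j (g p') = f i p')) & g p:V"
  if p: "p:X0" for p
 proof -
  obtain q where q: "q:Xs'" "f i p = f j q" using p by (auto simp: X0_def)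
  have pA: "p:mc (A i)" "q:mc (A j)"
   using p q Xs(2) Xs'(2) chart_subset[OF c] chart_subset[OF c'] by (auto simp: X0_def)
  obtain g where g: "smap (A i) (A j) g p" "g p = q" "ngh (A i) p (%p'. f j (g p') = f i p')"
   using tr[OF i j pA q(2)] by blast
  have "ngh (A i) p (%p'. g p':Xs')"
   by (rule smap_near[OF A sa[OF j] g(1)]) (use g(2) q nr_open[OF Xs'(1)] in auto)
  with g(3) have "ngh (A i) p (%p'. g p':Xs' & f j (g p') = f i p')" by eventually_elim simp
  thus ?thesis using g q Xs'(2) by blast
 qed
 have "opn (A i) X0"
 proof (rule opn_near[OF A])
  show "X0 \<subseteq> mc (A i)" using Xs(2) chart_subset[OF c] by (auto simp: X0_def)
  fix p assume p: "p:X0"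
  hence "ngh (A i) p (%p'. p':Xs)" using Xs(1) by (intro nr_open) (auto simp: X0_def)
  moreover obtain g where "ngh (A i) p (%p'. g p':Xs' & f j (g p') = f i p')" using loc[OF p] by blast
  ultimately show "ngh (A i) p (%p'. p':X0)"
   by eventually_elim (auto simp: X0_def image_iff intro: sym)
 qed
 hence o: "opE d (ph ` X0)" by (rule pushed_open[OF i c Xs inj, rotated]) (auto simp: X0_def)
 have "Z \<inter> Y = f i ` X0" by (auto simp: Z Y X0_def)
 hence im: "ze ` (Z \<inter> Y) = ph ` X0" using pushed_image[OF i c Xs inj, of X0] by (auto simp: ze X0_def simp del: comp_apply)
 have "smooth_vec d e (%y. et (f i (inv_into U ph y))) (ph ` X0)"
 proof (rule smvI[OF o])
  fix y assume "y:ph ` X0"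
  then obtain p where p: "p:X0" "y = ph p" by auto
  have pU: "p:U" using p Xs(2) by (auto simp: X0_def)
  obtain q where q: "q:Xs'" "f i p = f j q" using p by (auto simp: X0_def)
  show "et (f i (inv_into U ph y)):eucl e"
   using q p chart_inv[OF A c pU] inv_into_f_f[OF inj' q(1)] chart_eucl[OF sa[OF j] c'] Xs'(2) by (auto simp: et)
  obtain g where g: "smap (A i) (A j) g p" "ngh (A i) p (%p'. g p':Xs' & f j (g p') = f i p')" "g p:V"
   using loc[OF p(1)] by blast
  show "sma d (%y. et (f i (inv_into U ph y)) k) y" for k
  proof -
   have "sm (A i) (%p. et (f i p) k) p"
   proof (rule sm_cong[OF A])
    show "sm (A i) (%p. ps (g p) k) p" by (rule smap_coord[OF sa[OF j] g(1) c' g(3)])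
    show "ngh (A i) p (%p'. ps (g p') k = et (f i p') k)"
     using g(2) by eventually_elim (metis et comp_apply inj' inv_into_f_f)
   qed
   thus ?thesis using sm_chart[OF A c pU, of "%p. et (f i p) k"] p(2) by simp
  qed
 qed
 hence "smooth_vec d e (et \<circ> inv_into Z ze) (ph ` X0)"
 proof (rule smv_cong[OF o, rotated])
  fix y assume "y:ph ` X0"
  hence "y:ph ` Xs" by (auto simp: X0_def)
  thus "et (f i (inv_into U ph y)) = (et \<circ> inv_into Z ze) y"
   using pushed_inv[OF i c Xs inj] by (simp add: Z ze)
 qed
 with o im show "opE d (ze ` (Z \<inter> Y)) & smooth_vec d e (et \<circ> inv_into Z ze) (ze ` (Z \<inter> Y))"
  by simp
qed

lemma linj_chartE:
 assumes "i:I" "linj i p"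
 obtains d U ph Xs where "(d, U, ph):A i" "opn (A i) Xs" "Xs \<subseteq> U" "inj_on (f i) Xs" "p:Xs"
proof -
 obtain W where W: "opn (A i) W" "p:W" "inj_on (f i) W" using assms(2) by (auto simp: linj_def)
 have "p:mc (A i)" using opn_subset[OF sa[OF assms(1)] W(1)] W(2) by auto
 then obtain d U ph where c: "(d, U, ph):A i" "p:U" by (rule sm_chartE)
 show thesis
  by (rule that[OF c(1), of "W \<inter> U"]) (use W c chart_open[OF sa[OF assms(1)] c(1)] in "auto simp: inj_on_def")
qed

lemma mc_glued: "mc glued = (UN i:I. f i ` {p:mc (A i). linj i p})"
proof (intro equalityI subsetI)
 fix x assume "x:mc glued"
 then obtain i d U ph Xs where "i:I" "(d, U, ph):A i" "opn (A i) Xs" "Xs \<subseteq> U" "inj_on (f i) Xs" "x:f i ` Xs"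
  unfolding mc_iff glued_chart by blast
 thus "x:(UN i:I. f i ` {p:mc (A i). linj i p})"
  using chart_subset by (fastforce simp: linj_def)
next
 fix x assume "x:(UN i:I. f i ` {p:mc (A i). linj i p})"
 then obtain i p where ip: "i:I" "linj i p" "x = f i p" by auto
 obtain d U ph Xs where "(d, U, ph):A i" "opn (A i) Xs" "Xs \<subseteq> U" "inj_on (f i) Xs" "p:Xs"
  by (rule linj_chartE[OF ip(1,2)])
 thus "x:mc glued" unfolding mc_iff glued_chart ip(3) using ip(1) by blast
qed

text \<open>A chart at \<open>f i p\<close> is a chart at \<open>p\<close> transported by
  \<open>f i\<close>, so both sides have the same chart expression: \<open>f i\<close> is a local
  diffeomorphism at \<open>p\<close>.\<close>

lemma sm_glued:
 assumes i: "i:I" and p: "linj i p"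
 shows "sm glued h (f i p) \<longleftrightarrow> sm (A i) (%q. h (f i q)) p"
proof -
 obtain d U ph Xs where c: "(d, U, ph):A i" and Xs: "opn (A i) Xs" "Xs \<subseteq> U" and inj: "inj_on (f i) Xs"
  and pX: "p:Xs" by (rule linj_chartE[OF i p])
 have pU: "p:U" using Xs(2) pX by auto
 have g: "(d, f i ` Xs, ph \<circ> inv_into Xs (f i)):glued" unfolding glued_chart using i c Xs inj by blast
 have fp: "f i p:f i ` Xs" using pX by auto
 let ?y = "ph p"
 have "\<forall>\<^sub>F y in enear d ?y. y:ph ` Xs"
  using pushed_open[OF i c Xs inj subset_refl Xs(1)] pX by (auto simp: eventually_nhdsin)
 hence ev: "\<forall>\<^sub>F y in enear d ?y. h (inv_into (f i ` Xs) (ph \<circ> inv_into Xs (f i)) y) = h (f i (inv_into U ph y))"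
  by eventually_elim (simp add: pushed_inv[OF i c Xs inj] del: comp_apply)
 hence ev': "\<forall>\<^sub>F y in enear d ?y. h (f i (inv_into U ph y)) = h (inv_into (f i ` Xs) (ph \<circ> inv_into Xs (f i)) y)"
  by eventually_elim simp
 show ?thesis unfolding sm_chart[OF sa_glued g fp] sm_chart[OF sa[OF i] c pU]
   pushed_chart[OF i c Xs inj pX]
  using sma_cong[OF ev] sma_cong[OF ev'] by blast
qed

lemma linj_car: "i:I ==> linj i p ==> p:mc (A i)"
 using opn_subset[OF sa] by (auto simp: linj_def)

lemma glued_carI: "i:I ==> linj i p ==> f i p:mc glued"
 using linj_car by (auto simp: mc_glued)

lemma smap_from_glued:
 "i:I ==> linj i p ==> smap glued C k (f i p) \<longleftrightarrow> smap (A i) C (%q. k (f i q)) p"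
 using linj_car glued_carI sm_glued[of i p] by (auto simp: smap_def)

lemma smap_into_glued:
 "i:I ==> linj i p ==> smap (A i) glued (f i) p"
 using linj_car glued_carI sm_glued[of i p] by (auto simp: smap_def)

end

subsection \<open>The Clifford algebra\<close>

text \<open>Signs with a cardinality in the exponent become products of \<open>sg\<close> over pairs
  of positions; identities for \<open>xor\<close> can then be checked factor by factor.\<close>

definition sg :: "bool => real" where
 "sg P = (if P then - 1 else 1)"

lemma xor_bound: "j < 2 ^ n ==> k < 2 ^ n ==> xor j k < (2 ^ n :: nat)"
 by (metis take_bit_nat_eq_self_iff take_bit_xor)

lemma cl_sign_gen_right: "cl_sign k (2 ^ j) = (- 1) ^ card {a. bit k a & j \<le> a}"
proof -
 have "{(a, b). bit k a & bit (2 ^ j :: nat) b & b \<le> a} = (%a. (a, j)) ` {a. bit k a & j \<le> a}"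
  by (auto simp: bit_exp_iff)
 thus ?thesis by (simp add: cl_sign_def card_image inj_on_def)
qed

lemma cl_sign_gen_left: "cl_sign (2 ^ j) k = (- 1) ^ card {b. bit k b & b \<le> j}"
proof -
 have "{(a, b). bit (2 ^ j :: nat) a & bit k b & b \<le> a} = Pair j ` {b. bit k b & b \<le> j}"
  by (auto simp: bit_exp_iff)
 thus ?thesis by (simp add: cl_sign_def card_image inj_on_def)
qed

lemma xor_cancel: "xor j (xor j m) = (m :: nat)"
 by (metis xor.assoc xor.left_neutral xor_self_eq)

lemma bit_bound: "j < 2 ^ n ==> bit (j :: nat) a ==> a < n"
 by (metis bit_take_bit_iff take_bit_nat_eq_self_iff)

lemma power_card_sg:
 assumes "finite T" "S \<subseteq> T"
 shows "(- 1 :: real) ^ card S = (PROD p:T. sg (p:S))"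
proof -
 have "(PROD p:T. sg (p:S)) = (PROD p:S. - 1) * (PROD p:T - S. 1)"
  using assms by (subst prod.subset_diff[OF assms(2,1)]) (auto simp: sg_def mult.commute intro!: arg_cong2[of _ _ _ _ "(*)"] prod.cong)
 thus ?thesis by simp
qed

lemma cl_sign_prod:
 assumes "j < 2 ^ n" "k < 2 ^ n"
 shows "cl_sign j k = (PROD (a, b):{..<n} \<times> {..<n}. sg (bit j a & bit k b & b \<le> a))"
proof -
 have "cl_sign j k = (PROD p:{..<n} \<times> {..<n}. sg (p:{(a, b). bit j a & bit k b & b \<le> a}))"
  unfolding cl_sign_def by (rule power_card_sg) (use bit_bound assms in auto)
 thus ?thesis by (simp add: case_prod_unfold)
qed

text \<open>A bit of \<open>xor\<close> is a sum modulo \<open>2\<close>, so every factor is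
  multiplicative. Together with \<open>cl_sign_xor_right\<close> this makes \<open>cl_sign\<close> a
  bicharacter, which is the source of associativity.\<close>

lemma cl_sign_xor_left:
 assumes "j < 2 ^ n" "j' < 2 ^ n" "k < 2 ^ n"
 shows "cl_sign (xor j j') k = cl_sign j k * cl_sign j' k"
 unfolding cl_sign_prod[OF assms(1,3)] cl_sign_prod[OF assms(2,3)] cl_sign_prod[OF xor_bound[OF assms(1,2)] assms(3)]
  prod.distrib[symmetric]
 by (rule prod.cong) (auto simp: sg_def bit_xor_iff)

lemma cl_sign_xor_right:
 assumes "j < 2 ^ n" "k < 2 ^ n" "k' < 2 ^ n"
 shows "cl_sign j (xor k k') = cl_sign j k * cl_sign j k'"
 unfolding cl_sign_prod[OF assms(1,2)] cl_sign_prod[OF assms(1,3)] cl_sign_prod[OF assms(1) xor_bound[OF assms(2,3)]]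
  prod.distrib[symmetric]
 by (rule prod.cong) (auto simp: sg_def bit_xor_iff)

lemma cl_sign_0 [simp]: "cl_sign 0 k = 1" "cl_sign j 0 = 1"
 by (simp_all add: cl_sign_def)

definition tsign :: "nat => real" where
 "tsign k = (- 1) ^ (cl_degree k * (cl_degree k - 1) div 2)"

text \<open>The number of transpositions reversing a monomial, counted by pairs, so that
  \<open>tsign\<close> too becomes a product over pairs of positions.\<close>

lemma card_pairs_less:
 "finite (D :: nat set) ==> card {(a, b). a:D & b:D & b < a} = card D * (card D - 1) div 2"
proof (induction D rule: finite_linorder_max_induct)
 case empty thus ?case by simp
next
 case (insert m D)
 let ?P = "{(a, b). a:D & b:D & b < a}"
 have 1: "{(a, b). a:insert m D & b:insert m D & b < a} = ?P \<union> {m} \<times> D"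
 proof -
  have "b < m" if "b:D" for b using insert.hyps(2) that by blast
  thus ?thesis using less_asym less_irrefl by blast
 qed
 have "?P \<subseteq> D \<times> D" by blast
 hence "finite ?P" by (rule finite_subset) (use insert.hyps(1) in blast)
 have 2: "card (?P \<union> {m} \<times> D) = card ?P + card D"
 proof -
  have "m \<notin> D" using insert.hyps(2) by blast
  hence "?P \<inter> {m} \<times> D = {}" by blast
  moreover have "finite ({m} \<times> D)" using insert.hyps(1) by blast
  ultimately show ?thesis
   using card_Un_disjoint[OF \<open>finite ?P\<close>, of "{m} \<times> D"] by (simp only: card_cartesian_product_singleton)
 qed
 have 3: "card (insert m D) = Suc (card D)" using insert by (subst card_insert_disjoint) auto
 have "Suc (card D) * card D = card D * (card D - 1) + 2 * card D" by (cases "card D") (auto simp: algebra_simps)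
 hence 4: "card D * (card D - 1) div 2 + card D = Suc (card D) * card D div 2" by simp
 show ?case unfolding 1 2 3 insert.IH using 4 by simp
qed

lemma tsign_prod:
 assumes "k < 2 ^ n"
 shows "tsign k = (PROD (a, b):{..<n} \<times> {..<n}. sg (bit k a & bit k b & b < a))"
proof -
 have "{i. bit k i} \<subseteq> {..<n}" using bit_bound[OF assms] by auto
 hence "finite {i. bit k i}" using finite_subset by blast
 from card_pairs_less[OF this]
 have "tsign k = (- 1) ^ card {(a, b). a:{i. bit k i} & b:{i. bit k i} & b < a}"
  by (simp add: tsign_def cl_degree_def)
 also have "... = (PROD p:{..<n} \<times> {..<n}. sg (p:{(a, b). a:{i. bit k i} & b:{i. bit k i} & b < a}))"
  by (rule power_card_sg) (use bit_bound assms in auto)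
 finally show ?thesis by (simp add: case_prod_unfold)
qed

text \<open>For \<open>b < a\<close> the exponents satisfy \<open>(j_a + k_a)(j_b + k_b) + j_a k_b =
  j_a j_b + k_a k_b + k_a j_b\<close> modulo \<open>2\<close>. On monomials this says that
  \<open>cl_transpose\<close> reverses products.\<close>

lemma tsign_xor:
 assumes "j < 2 ^ n" "k < 2 ^ n"
 shows "tsign (xor j k) * cl_sign j k = tsign j * tsign k * cl_sign k j"
 unfolding tsign_prod[OF assms(1)] tsign_prod[OF assms(2)] tsign_prod[OF xor_bound[OF assms]]
  cl_sign_prod[OF assms] cl_sign_prod[OF assms(2,1)] prod.distrib[symmetric]
 by (rule prod.cong) (auto simp: sg_def bit_xor_iff)

lemma degree_sign_prod:
 assumes "k < 2 ^ n"
 shows "(- 1 :: real) ^ cl_degree k = (\<Prod>a<n. sg (bit k a))"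
proof -
 have "(- 1 :: real) ^ cl_degree k = (\<Prod>a<n. sg (a:{i. bit k i}))"
  unfolding cl_degree_def by (rule power_card_sg) (use bit_bound[OF assms] in auto)
 thus ?thesis by simp
qed

lemma degree_sign_xor:
 assumes "j < 2 ^ n" "k < 2 ^ n"
 shows "(- 1 :: real) ^ cl_degree (xor j k) = (- 1) ^ cl_degree j * (- 1) ^ cl_degree k"
 unfolding degree_sign_prod[OF assms(1)] degree_sign_prod[OF assms(2)] degree_sign_prod[OF xor_bound[OF assms]]
  prod.distrib[symmetric]
 by (rule prod.cong) (auto simp: sg_def bit_xor_iff)

lemma cl_sign_sq: "cl_sign j k * cl_sign j k = 1" "tsign k * tsign k = 1"
 by (simp_all add: cl_sign_def tsign_def flip: power_mult_distrib)

text \<open>A monomial times its reversal collapses to a scalar in which each generator contributes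
  its square \<open>-1\<close>.\<close>

lemma cl_sign_tsign: "k < 2 ^ n ==> cl_sign k k * tsign k = (- 1) ^ cl_degree k"
proof -
 assume k: "k < 2 ^ n"
 have "cl_sign k k * tsign k = (PROD (a, b):{..<n} \<times> {..<n}. sg (a = b & bit k a))"
  unfolding cl_sign_prod[OF k k] tsign_prod[OF k] prod.distrib[symmetric]
  by (rule prod.cong) (auto simp: sg_def)
 also have "... = (\<Prod>a<n. \<Prod>b<n. sg (a = b & bit k a))" by (simp add: prod.cartesian_product)
 also have "... = (\<Prod>a<n. sg (bit k a))"
 proof (rule prod.cong)
  fix a assume a: "a:{..<n}"
  have "(\<Prod>b<n. sg (a = b & bit k a)) = (\<Prod>b<n. if b = a then sg (bit k a) else 1)"
   by (rule prod.cong) (auto simp: sg_def)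
  thus "(\<Prod>b<n. sg (a = b & bit k a)) = sg (bit k a)" using a by simp
 qed simp
 finally show ?thesis using degree_sign_prod[OF k] by simp
qed

text \<open>Linear combinations as one function, so that bilinearity is available by rewriting. A
  scalar multiple is written with second coefficient \<open>0\<close>, as in
  \<open>lin (- 1) cl_one 0 cl_one\<close> for \<open>-1\<close>.\<close>

definition lin :: "real => vec => real => vec => nat => real" where
 "lin a x b y = (%k. a * x k + b * y k)"

lemma lin_mem: "x:eucl N ==> y:eucl N ==> lin a x b y:eucl N"
 by (auto simp: lin_def euc)

definition cmono :: "nat => nat => real" where
 "cmono j = (%k. if k = j then 1 else 0)"

lemma cl_gen_cmono: "cl_gen i = cmono (2 ^ i)" and cl_one_cmono: "cl_one = cmono 0"
 by (auto simp: cl_gen_def cl_one_def cmono_def)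

lemma clt_alt: "cl_transpose x = (%k. tsign k * x k)"
 by (simp add: cl_transpose_def tsign_def)

lemma clt_invol [simp]: "cl_transpose (cl_transpose x) = x"
 by (simp add: clt_alt cl_sign_sq flip: mult.assoc)

lemma clt_mem: "x:eucl N ==> cl_transpose x:eucl N"
 by (auto simp: clt_alt euc)

lemma cl_degree_simps [simp]: "cl_degree 0 = 0" "cl_degree (2 ^ i) = 1"
by (auto simp: cl_degree_def bit_exp_iff)

lemma clt_one [simp]: "cl_transpose cl_one = cl_one"
 by (auto simp: clt_alt cl_one_def tsign_def)

lemma clt_lin: "cl_transpose (lin a x b y) = lin a (cl_transpose x) b (cl_transpose y)"
 by (auto simp: clt_alt lin_def algebra_simps)

lemma clt_vec: "v:cl_vectors n ==> cl_transpose v = v"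
 by (rule ext) (force simp: cl_vectors_def clt_alt tsign_def)

lemma cl_even_transpose: "cl_even x ==> cl_even (cl_transpose x)"
 by (auto simp: cl_even_def clt_alt)

lemma cl_even_one: "cl_even cl_one"
 by (auto simp: cl_even_def cl_one_def)

lemma cl_even_lin: "cl_even x ==> cl_even y ==> cl_even (lin a x b y)"
 by (auto simp: cl_even_def lin_def)

lemma cl_even_sign: "cl_even x ==> (- 1) ^ cl_degree k * x k = x k"
 by (cases "even (cl_degree k)") (auto simp: cl_even_def)

lemma clgv: "i < n ==> cl_gen i:cl_vectors n"
 by (auto simp: cl_vectors_def cl_gen_def)

lemma clv_lin: "v:cl_vectors n ==> w:cl_vectors n ==> lin a v b w:cl_vectors n"
proof -
 assume v: "v:cl_vectors n" and w: "w:cl_vectors n"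
 have "\<exists>i<n. k = 2 ^ i" if "lin a v b w k \<noteq> 0" for k
 proof -
  have "v k \<noteq> 0 \<or> w k \<noteq> 0" using that by (auto simp: lin_def)
  thus ?thesis using v w by (auto simp: cl_vectors_def)
 qed
 thus ?thesis by (auto simp: cl_vectors_def)
qed

lemma clv_mem: "v:cl_vectors n ==> v:eucl (2 ^ n)"
by (auto simp: ccontr cl_vectors_def power_strict_increasing euc)

lemma cl_gen_apply [simp]: "cl_gen j (2 ^ i) = (if i = j then 1 else 0)"
 by (auto simp: cl_gen_def)

lemma sum_gen_vec: "(%k. \<Sum>i<n. c i * cl_gen i k):cl_vectors n"
proof -
 have "\<exists>i<n. k = 2 ^ i" if "(\<Sum>i<n. c i * cl_gen i k) \<noteq> 0" for k
 proof (rule ccontr)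
  assume "\<not> ?thesis"
  hence "(\<Sum>i<n. c i * cl_gen i k) = (\<Sum>i<n. 0)" by (intro sum.cong) (auto simp: cl_gen_def)
  thus False using that by simp
 qed
 thus ?thesis by (auto simp: cl_vectors_def)
qed

lemma sum_gen_apply: "i < n ==> (\<Sum>j<n. c j * cl_gen j (2 ^ i)) = c i"
proof -
 assume "i < n"
 have "(\<Sum>j<n. c j * cl_gen j (2 ^ i)) = (\<Sum>j<n. if j = i then c i else 0)" by (rule sum.cong) auto
 thus ?thesis using \<open>i < n\<close> by simp
qed

lemma vec_eqI:
 assumes "v:cl_vectors n" "w:cl_vectors n" "!!i. i < n ==> v (2 ^ i) = w (2 ^ i)"
 shows "v = w"
proof
 fix k show "v k = w k"
 proof (cases "\<exists>i<n. k = 2 ^ i")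
  case True thus ?thesis using assms(3) by auto
 next
  case False hence "v k = 0" "w k = 0" using assms(1,2) unfolding cl_vectors_def by blast+
  thus ?thesis by simp
 qed
qed

lemma vec_expand: "v:cl_vectors n ==> v = (%k. \<Sum>i<n. v (2 ^ i) * cl_gen i k)"
 by (rule vec_eqI[OF _ sum_gen_vec]) (simp_all add: sum_gen_apply del: cl_gen_apply)

definition ip :: "nat => vec => vec => real" where
 "ip n v w = (\<Sum>i<n. v (2 ^ i) * w (2 ^ i))"

lemma ip_sym: "ip n v w = ip n w v"
 by (simp add: ip_def mult.commute)

lemma ip_lin_left: "ip n (lin a v b w) x = a * ip n v x + b * ip n w x"
 by (simp add: ip_def lin_def sum.distrib algebra_simps sum_distrib_left)

lemma ip_lin_right: "ip n x (lin a v b w) = a * ip n x v + b * ip n x w"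
 by (simp add: ip_sym[of n x] ip_lin_left)

lemma ip_gen: "i < n ==> ip n v (cl_gen i) = v (2 ^ i)" "i < n ==> ip n (cl_gen i) v = v (2 ^ i)"
proof -
 show *: "ip n v (cl_gen i) = v (2 ^ i)" if "i < n"
 proof -
  have "ip n v (cl_gen i) = (\<Sum>j<n. if j = i then v (2 ^ i) else 0)"
   unfolding ip_def by (rule sum.cong) auto
  thus ?thesis using that by simp
 qed
 thus "i < n ==> ip n (cl_gen i) v = v (2 ^ i)" by (simp add: ip_sym)
qed

lemma clm_alt:
 "cl_mult n x y m = (if m < 2 ^ n then \<Sum>j<2 ^ n. cl_sign j (xor j m) * x j * y (xor j m) else 0)"
proof (cases "m < 2 ^ n")
 case True
 have "cl_mult n x y m = (SUM (j, k):{(j, k). j < 2 ^ n & k < 2 ^ n & xor j k = m}. cl_sign j k * x j * y k)"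
  by (simp add: cl_mult_def)
 also have "... = (\<Sum>j<2 ^ n. cl_sign j (xor j m) * x j * y (xor j m))"
  by (rule sum.reindex_bij_witness[where i = "%j. (j, xor j m)" and j = fst])
   (use True in "auto simp: xor_cancel xor_bound")
 finally show ?thesis using True by simp
next
 case False
 have "{(j, k). j < 2 ^ n & k < 2 ^ n & xor j k = m} = {}" using False xor_bound by auto
 thus ?thesis using False by (simp only: cl_mult_def sum.empty if_False)
qed

lemma mult_shuffle: "a * b = c * d ==> c * x * (d * y * z) = a * (b * x * y) * (z :: real)"
by simp

locale clf =
 fixes n :: nat
begin

abbreviation mul :: "vec => vec => nat => real" (infixl \<open>\<star>\<close> 70) where
 "x \<star> y \<equiv> cl_mult n x y"

abbreviation "E \<equiv> eucl (2 ^ n)"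
abbreviation "tr \<equiv> cl_transpose"
abbreviation "Vec \<equiv> cl_vectors n"

lemma mul_mem: "x \<star> y:E"
 by (simp add: euc clm_alt)

lemma mul_lin_left: "lin a x b y \<star> z = lin a (x \<star> z) b (y \<star> z)"
 by (rule ext) (simp add: lin_def clm_alt sum.distrib[symmetric] sum_distrib_left algebra_simps)

lemma mul_lin_right: "z \<star> lin a x b y = lin a (z \<star> x) b (z \<star> y)"
 by (rule ext) (simp add: lin_def clm_alt sum.distrib[symmetric] sum_distrib_left algebra_simps)

lemma mul_sum_left: "(%k. SUM i:I. c i * x i k) \<star> z = (%k. SUM i:I. c i * (x i \<star> z) k)"
proof
 fix m
 have "(\<Sum>j<2 ^ n. cl_sign j (xor j m) * (SUM i:I. c i * x i j) * z (xor j m)) =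
   (SUM i:I. c i * (\<Sum>j<2 ^ n. cl_sign j (xor j m) * x i j * z (xor j m)))"
  unfolding sum_distrib_left sum_distrib_right by (subst sum.swap) (simp add: algebra_simps)
 thus "((%k. SUM i:I. c i * x i k) \<star> z) m = (SUM i:I. c i * (x i \<star> z) m)"
  by (simp add: clm_alt)
qed

lemma mul_sum_right: "z \<star> (%k. SUM i:I. c i * x i k) = (%k. SUM i:I. c i * (z \<star> x i) k)"
proof
 fix m
 have "(\<Sum>j<2 ^ n. cl_sign j (xor j m) * z j * (SUM i:I. c i * x i (xor j m))) =
   (SUM i:I. c i * (\<Sum>j<2 ^ n. cl_sign j (xor j m) * z j * x i (xor j m)))"
  unfolding sum_distrib_left sum_distrib_right by (subst sum.swap) (simp add: algebra_simps)
 thus "(z \<star> (%k. SUM i:I. c i * x i k)) m = (SUM i:I. c i * (z \<star> x i) m)"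
  by (simp add: clm_alt)
qed

lemma cmono_mul_apply:
 assumes "j < 2 ^ n" "m < 2 ^ n"
 shows "(cmono j \<star> x) m = cl_sign j (xor j m) * x (xor j m)"
proof -
 have "(cmono j \<star> x) m = (\<Sum>i<2 ^ n. cl_sign i (xor i m) * cmono j i * x (xor i m))"
  using assms(2) by (simp only: clm_alt if_True)
 also have "... = (\<Sum>i<2 ^ n. if i = j then cl_sign j (xor j m) * x (xor j m) else 0)"
  by (rule sum.cong) (auto simp: cmono_def)
 finally show ?thesis using assms(1) by simp
qed

lemma mul_cmono_apply:
 assumes "j < 2 ^ n" "m < 2 ^ n"
 shows "(x \<star> cmono j) m = cl_sign (xor j m) j * x (xor j m)"
proof -
 have "(xor i m = j) \<longleftrightarrow> i = xor j m" for i by (metis xor.commute xor_cancel)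
 hence "(\<Sum>i<2 ^ n. cl_sign i (xor i m) * x i * cmono j (xor i m)) =
   (\<Sum>i<2 ^ n. if i = xor j m then cl_sign (xor j m) j * x (xor j m) else 0)"
  by (intro sum.cong) (auto simp: cmono_def, metis xor.assoc xor_cancel xor.commute)
 moreover have "(x \<star> cmono j) m = (\<Sum>i<2 ^ n. cl_sign i (xor i m) * x i * cmono j (xor i m))"
  using assms(2) by (simp only: clm_alt if_True)
 ultimately show ?thesis using xor_bound[OF assms] by simp
qed

lemma one_mem: "cl_one:E"
 by (auto simp: euc cl_one_def)

lemma mul1l: "x:E ==> cl_one \<star> x = x"
proof
 fix m assume x: "x:E"
 show "(cl_one \<star> x) m = x m"
 proof (cases "m < 2 ^ n")
  case True thus ?thesis using cmono_mul_apply[of 0 m x] by (simp add: cl_one_cmono)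
 next
  case False thus ?thesis using x by (simp add: clm_alt euc)
 qed
qed

lemma mul1r: "x:E ==> x \<star> cl_one = x"
proof
 fix m assume x: "x:E"
 show "(x \<star> cl_one) m = x m"
 proof (cases "m < 2 ^ n")
  case True thus ?thesis using mul_cmono_apply[of 0 m x] by (simp add: cl_one_cmono)
 next
  case False thus ?thesis using x by (simp add: clm_alt euc)
 qed
qed

lemma cmono_mul_cmono:
 assumes "j < 2 ^ n" "k < 2 ^ n"
 shows "cmono j \<star> cmono k = (%m. cl_sign j k * cmono (xor j k) m)"
proof
 fix m
 show "(cmono j \<star> cmono k) m = cl_sign j k * cmono (xor j k) m"
 proof (cases "m < 2 ^ n")
  case True
  have "xor j m = k \<longleftrightarrow> m = xor j k" by (metis xor_cancel)
  thus ?thesis using cmono_mul_apply[OF assms(1) True] by (auto simp: cmono_def)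
 next
  case False
  thus ?thesis using xor_bound[OF assms] by (auto simp: clm_alt cmono_def)
 qed
qed

lemma mul_assoc: "(x \<star> y) \<star> z = x \<star> (y \<star> z)"
proof
 fix m
 show "((x \<star> y) \<star> z) m = (x \<star> (y \<star> z)) m"
 proof (cases "m < 2 ^ n")
  case m: True
  have "((x \<star> y) \<star> z) m = (\<Sum>i<2 ^ n. \<Sum>j<2 ^ n. cl_sign i (xor i m) * (cl_sign j (xor j i) * x j * y (xor j i)) * z (xor i m))"
   using m by (simp add: clm_alt sum_distrib_left sum_distrib_right)
  also have "... = (\<Sum>j<2 ^ n. \<Sum>i<2 ^ n. cl_sign i (xor i m) * (cl_sign j (xor j i) * x j * y (xor j i)) * z (xor i m))"
   by (rule sum.swap)
  also have "... = (\<Sum>j<2 ^ n. \<Sum>k<2 ^ n. cl_sign j (xor j m) * x j * (cl_sign k (xor k (xor j m)) * y k * z (xor k (xor j m))))"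
  proof (rule sum.cong[OF refl])
   fix j :: nat assume "j:{..<2 ^ n}"
   hence j: "j < 2 ^ n" by simp
   show "(\<Sum>i<2 ^ n. cl_sign i (xor i m) * (cl_sign j (xor j i) * x j * y (xor j i)) * z (xor i m)) =
    (\<Sum>k<2 ^ n. cl_sign j (xor j m) * x j * (cl_sign k (xor k (xor j m)) * y k * z (xor k (xor j m))))"
   \<comment> \<open>Substituting \<open>i = xor j k\<close> turns the terms of
     \<open>(x y) z\<close> into those of \<open>x (y z)\<close>; the signs agree because
     \<open>cl_sign\<close> is a bicharacter.\<close>
   proof (rule sum.reindex_bij_witness[where i = "xor j" and j = "xor j"])
    fix i assume "i:{..<(2::nat) ^ n}"
    hence i: "i < 2 ^ n" by simp
    define k where "k = xor j i"
    have k: "k < 2 ^ n" unfolding k_def by (rule xor_bound[OF j i])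
    define l where "l = xor i m"
    have l: "l < 2 ^ n" unfolding l_def by (rule xor_bound[OF i m])
    have ik: "i = xor j k" by (simp add: k_def xor_cancel)
    have kl: "xor k (xor j m) = l" by (simp add: l_def ik xor.assoc xor.left_commute)
    have jm: "xor j m = xor k l" by (metis kl xor_cancel)
    have eq: "cl_sign i l * cl_sign j k = cl_sign j (xor k l) * cl_sign k l"
     unfolding ik cl_sign_xor_left[OF j k l] cl_sign_xor_right[OF j k l] by simp
    show "cl_sign j (xor j m) * x j * (cl_sign (xor j i) (xor (xor j i) (xor j m)) * y (xor j i) * z (xor (xor j i) (xor j m))) =
     cl_sign i (xor i m) * (cl_sign j (xor j i) * x j * y (xor j i)) * z (xor i m)"
     unfolding k_def[symmetric] kl jm l_def[symmetric] xor_cancel by (rule mult_shuffle[OF eq])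
   qed (use j in "auto simp: xor_cancel xor_bound")
  qed
  also have "... = (x \<star> (y \<star> z)) m"
   using m by (simp add: clm_alt xor_bound sum_distrib_left)
  finally show ?thesis .
 next
  case False thus ?thesis by (simp add: clm_alt)
 qed
qed

lemma tr_mul: "tr (x \<star> y) = tr y \<star> tr x"
proof
 fix m
 show "tr (x \<star> y) m = (tr y \<star> tr x) m"
 proof (cases "m < 2 ^ n")
  case m: True
  have "tr (x \<star> y) m = (\<Sum>j<2 ^ n. tsign m * (cl_sign j (xor j m) * x j * y (xor j m)))"
   using m by (simp add: clt_alt clm_alt sum_distrib_left)
  also have "... = (\<Sum>k<2 ^ n. cl_sign k (xor k m) * (tsign k * y k) * (tsign (xor k m) * x (xor k m)))"
  proof (rule sum.reindex_bij_witness[where i = "%k. xor k m" and j = "%k. xor k m"])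
   fix j assume "j:{..<(2::nat) ^ n}"
   hence j: "j < 2 ^ n" by simp
   define k where "k = xor j m"
   have k: "k < 2 ^ n" unfolding k_def by (rule xor_bound[OF j m])
   have jk: "m = xor j k" by (simp add: k_def xor_cancel)
   have km: "xor k m = j" unfolding jk by (metis xor.commute xor_cancel)
   have "tsign m * cl_sign j k = tsign j * tsign k * cl_sign k j" unfolding jk by (rule tsign_xor[OF j k])
   thus "cl_sign (xor j m) (xor (xor j m) m) * (tsign (xor j m) * y (xor j m)) * (tsign (xor (xor j m) m) * x (xor (xor j m) m)) =
     tsign m * (cl_sign j (xor j m) * x j * y (xor j m))"
    unfolding k_def[symmetric] km by (simp add: mult_ac)
  qed (use m in "auto simp: xor.assoc xor_bound")
  also have "... = (tr y \<star> tr x) m" using m by (simp add: clt_alt clm_alt)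
  finally show ?thesis .
 next
  case False thus ?thesis by (simp add: clt_alt clm_alt)
 qed
qed

lemma even_mul:
 assumes "cl_even x" "cl_even y" shows "cl_even (x \<star> y)"
 unfolding cl_even_def
proof (intro allI impI)
 fix m assume odd: "odd (cl_degree m)"
 show "(x \<star> y) m = 0"
 proof (cases "m < 2 ^ n")
  case m: True
  have "cl_sign j (xor j m) * x j * y (xor j m) = 0" if j: "j < 2 ^ n" for j
  proof -
   have "(- 1 :: real) ^ cl_degree (xor j m) = (- 1) ^ cl_degree j * (- 1)"
    using degree_sign_xor[OF j m] odd by simp
   hence "even (cl_degree j) \<longleftrightarrow> odd (cl_degree (xor j m))"
    by (cases "even (cl_degree j)"; cases "even (cl_degree (xor j m))") auto
   thus ?thesis using assms by (auto simp: cl_even_def)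
  qed
  hence "(\<Sum>j<2 ^ n. cl_sign j (xor j m) * x j * y (xor j m)) = 0" by (intro sum.neutral) simp
  thus ?thesis by (simp only: clm_alt if_cancel)
 qed (simp add: clm_alt)
qed

lemma scal_mul: "(x \<star> y) 0 = (\<Sum>j<2 ^ n. cl_sign j j * x j * y j)"
 by (simp add: clm_alt)

text \<open>By \<open>cl_sign_tsign\<close> each monomial of even degree contributes the square of
  its coefficient. This positivity drives \<open>left_inverse\<close> and
  \<open>adm_kernel\<close>.\<close>

lemma scal_even:
 assumes "cl_even x"
 shows "(x \<star> tr x) 0 = (\<Sum>j<2 ^ n. (x j)\<^sup>2)" "(tr x \<star> x) 0 = (\<Sum>j<2 ^ n. (x j)\<^sup>2)"
proof -
 have *: "cl_sign j j * (tsign j * (x j * x j)) = (x j)\<^sup>2" if "j < 2 ^ n" for j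
 proof -
  have "cl_sign j j * (tsign j * (x j * x j)) = (cl_sign j j * tsign j * x j) * x j" by simp
  also have "... = (x j)\<^sup>2" by (simp only: cl_sign_tsign[OF that] cl_even_sign[OF assms] power2_eq_square)
  finally show ?thesis .
 qed
 show "(x \<star> tr x) 0 = (\<Sum>j<2 ^ n. (x j)\<^sup>2)" "(tr x \<star> x) 0 = (\<Sum>j<2 ^ n. (x j)\<^sup>2)"
  unfolding scal_mul clt_alt by (rule sum.cong; use * in "simp add: mult_ac")+
qed

text \<open>For \<open>w = g\<^sup>t g - 1\<close> one has \<open>w w\<^sup>t = - w\<close>, whose scalar part vanishes; as the scalar part of
 \<open>w w\<^sup>t\<close> is the square of the Euclidean norm, \<open>w = 0\<close>.\<close>

lemma left_inverse:
 assumes g: "g:E" "cl_even g" and gg: "g \<star> tr g = cl_one"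
 shows "tr g \<star> g = cl_one"
proof -
 define w where "w = lin 1 (tr g \<star> g) (- 1) cl_one"
 have tw: "tr w = w" by (simp add: w_def clt_lin tr_mul)
 have ev: "cl_even w" unfolding w_def by (intro cl_even_lin even_mul cl_even_transpose g cl_even_one)
 have ggg: "(tr g \<star> g) \<star> (tr g \<star> g) = tr g \<star> g"
 by (metis mul_assoc gg mul1l g)
 have "w \<star> w = lin (- 1) w 0 w"
  unfolding w_def mul_lin_left mul_lin_right ggg mul1l[OF mul_mem] mul1r[OF mul_mem] mul1l[OF one_mem]
  by (auto simp: lin_def)
 hence "(w \<star> tr w) 0 = - w 0" unfolding tw by (simp add: lin_def)
 moreover have "w 0 = 0"
 proof -
  have "(tr g \<star> g) 0 = (g \<star> tr g) 0" using scal_even[OF g(2)] by simp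
  thus ?thesis using gg by (simp add: w_def lin_def)
 qed
 ultimately have "(\<Sum>j<2 ^ n. (w j)\<^sup>2) = 0" using scal_even(1)[OF ev] by simp
 hence "w j = 0" if "j < 2 ^ n" for j using that by (subst (asm) sum_nonneg_eq_0_iff) auto
 moreover have "w:E" unfolding w_def by (intro lin_mem mul_mem one_mem)
 ultimately have "w k = 0" for k by (cases "k < 2 ^ n") (auto simp: euc)
 thus ?thesis by (auto simp: w_def lin_def)
qed

lemma cl_sign_gen: "cl_sign (2 ^ i) (2 ^ j) = (if j \<le> i then - 1 else 1)"
proof -
 have "{(a, b). bit (2 ^ i :: nat) a & bit (2 ^ j :: nat) b & b \<le> a} = (if j \<le> i then {(i, j)} else {})"
  by (auto simp: bit_exp_iff)
 thus ?thesis by (simp add: cl_sign_def)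
qed

lemma gen_anticommute:
 assumes "i < n" "j < n"
 shows "(cl_gen i \<star> cl_gen j) m + (cl_gen j \<star> cl_gen i) m = - 2 * (if i = j then 1 else 0) * cl_one m"
by (simp add: assms cases cl_gen_cmono cmono_mul_cmono cl_sign_gen cl_one_cmono xor.commute)

lemma mul_expand:
 assumes "v:Vec"
 shows "(v \<star> z) m = (\<Sum>i<n. v (2 ^ i) * (cl_gen i \<star> z) m)" "(z \<star> v) m = (\<Sum>i<n. v (2 ^ i) * (z \<star> cl_gen i) m)"
proof -
 have "v \<star> z = (%k. \<Sum>i<n. v (2 ^ i) * cl_gen i k) \<star> z" "z \<star> v = z \<star> (%k. \<Sum>i<n. v (2 ^ i) * cl_gen i k)"
  using vec_expand[OF assms] by metis+
 thus "(v \<star> z) m = (\<Sum>i<n. v (2 ^ i) * (cl_gen i \<star> z) m)" "(z \<star> v) m = (\<Sum>i<n. v (2 ^ i) * (z \<star> cl_gen i) m)"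
  unfolding mul_sum_left mul_sum_right by simp_all
qed

lemma vec_anticommute:
 assumes "v:Vec" "w:Vec"
 shows "(v \<star> w) m + (w \<star> v) m = - 2 * ip n v w * cl_one m"
proof -
 have vw: "(v \<star> w) m = (\<Sum>i<n. \<Sum>j<n. v (2 ^ i) * w (2 ^ j) * (cl_gen i \<star> cl_gen j) m)"
  by (simp only: mul_expand(1)[OF assms(1)] mul_expand(2)[OF assms(2), of "cl_gen _"] sum_distrib_left mult.assoc)
 have wv: "(w \<star> v) m = (\<Sum>i<n. \<Sum>j<n. v (2 ^ i) * w (2 ^ j) * (cl_gen j \<star> cl_gen i) m)"
  by (subst sum.swap) (simp only: mul_expand(1)[OF assms(2)] mul_expand(2)[OF assms(1), of "cl_gen _"] sum_distrib_left mult.left_commute mult.assoc)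
 have "(v \<star> w) m + (w \<star> v) m =
   (\<Sum>i<n. \<Sum>j<n. v (2 ^ i) * w (2 ^ j) * ((cl_gen i \<star> cl_gen j) m + (cl_gen j \<star> cl_gen i) m))"
  by (simp add: vw wv sum.distrib[symmetric] distrib_left)
 also have "... = (\<Sum>i<n. \<Sum>j<n. if j = i then v (2 ^ i) * w (2 ^ i) * (- 2 * cl_one m) else 0)"
  by (intro sum.cong refl) (auto simp: gen_anticommute)
 also have "... = - 2 * ip n v w * cl_one m"
  by (simp add: ip_def sum_distrib_left sum_distrib_right mult_ac)
 finally show ?thesis .
qed

lemma vec_swap: "v:Vec ==> w:Vec ==> w \<star> v = lin (- 2 * ip n v w) cl_one (- 1) (v \<star> w)"
proof
 fix m assume "v:Vec" "w:Vec"
 thus "(w \<star> v) m = lin (- 2 * ip n v w) cl_one (- 1) (v \<star> w) m"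
  using vec_anticommute[of v w m] unfolding lin_def by linarith
qed

lemma vec_sq: "v:Vec ==> v \<star> v = lin (- ip n v v) cl_one 0 cl_one"
proof
 fix m assume "v:Vec"
 thus "(v \<star> v) m = lin (- ip n v v) cl_one 0 cl_one m"
  using vec_anticommute[of v v m] unfolding lin_def by linarith
qed

text \<open>For a unit vector \<open>w\<close> the right side is the reflection of \<open>x\<close>
  in the hyperplane orthogonal to \<open>w\<close>; since \<open>w\<close> squares to
  \<open>-1\<close>, no further sign appears.\<close>

lemma vec_sandwich:
 assumes w: "w:Vec" and x: "x:Vec"
 shows "w \<star> x \<star> w = lin (ip n w w) x (- 2 * ip n w x) w"
proof -
 have "w \<star> x \<star> w = w \<star> lin (- 2 * ip n w x) cl_one (- 1) (w \<star> x)"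
  by (simp add: mul_assoc vec_swap[OF w x])
 also have "... = lin (- 2 * ip n w x) w (- 1) ((w \<star> w) \<star> x)"
  using mul1r[OF clv_mem[OF w]] by (simp add: mul_lin_right mul_assoc)
 also have "... = lin (ip n w w) x (- 2 * ip n w x) w"
  using mul1l[OF clv_mem[OF x]] by (simp add: vec_sq[OF w] mul_lin_left) (auto simp: lin_def)
 finally show ?thesis .
qed

lemma vec_mul_even:
 assumes "v:Vec" "w:Vec" shows "cl_even (v \<star> w)"
proof -
 have e: "cl_even (cl_gen i \<star> cl_gen j)" if ij: "i < n" "j < n" for i j
 proof -
  have b: "(2::nat) ^ i < 2 ^ n" "(2::nat) ^ j < 2 ^ n" using ij by auto
  have "(- 1 :: real) ^ cl_degree (xor (2 ^ i) (2 ^ j)) = 1" using degree_sign_xor[OF b] by simp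
  hence "even (cl_degree (xor (2 ^ i) (2 ^ j)))" by (metis neg_one_odd_power one_neq_neg_one)
  thus ?thesis unfolding cl_gen_cmono cmono_mul_cmono[OF b] by (auto simp: cl_even_def cmono_def)
 qed
 have "(v \<star> w) m = (\<Sum>i<n. \<Sum>j<n. v (2 ^ i) * w (2 ^ j) * (cl_gen i \<star> cl_gen j) m)" for m
  by (simp only: mul_expand(1)[OF assms(1)] mul_expand(2)[OF assms(2), of "cl_gen _"] sum_distrib_left mult.assoc)
 thus ?thesis using e by (auto simp: cl_even_def)
qed

subsection \<open>The spin group\<close>

text \<open>On the spin group \<open>tr g\<close> is the inverse of \<open>g\<close>. Written with
  \<open>tr\<close>, the formula is polynomial in \<open>g\<close> and makes sense on the whole
  algebra, which the ambient extension of charts requires.\<close>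

definition act :: "vec => vec => nat => real" where
 "act g v = g \<star> v \<star> tr g"

abbreviation "Spn \<equiv> carrier (Spin n)"

lemma Spin_iff: "g:Spn \<longleftrightarrow> g:E & cl_even g & g \<star> tr g = cl_one & (ALL v:Vec. act g v:Vec)"
 by (simp add: Spin_def act_def)

lemma Spin_mem: "g:Spn ==> g:E" and Spin_even: "g:Spn ==> cl_even g"
 and Spin_right: "g:Spn ==> g \<star> tr g = cl_one" and Spin_vec: "g:Spn ==> v:Vec ==> act g v:Vec"
 and Spin_left: "g:Spn ==> tr g \<star> g = cl_one"
 using left_inverse by (auto simp: Spin_iff)

lemma act_lin: "act g (lin a v b w) = lin a (act g v) b (act g w)"
 by (simp add: act_def mul_lin_left mul_lin_right)

lemma act_sum: "act g (%k. SUM i:I. c i * v i k) = (%k. SUM i:I. c i * act g (v i) k)"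
 by (simp add: act_def mul_sum_left mul_sum_right)

lemma act_mul: "act (g \<star> h) v = act g (act h v)"
 by (simp add: act_def tr_mul mul_assoc)

lemma act_one: "v:E ==> act cl_one v = v"
 by (simp add: act_def mul1l mul1r)

lemma act_expand: "v:Vec ==> act g v k = (\<Sum>j<n. v (2 ^ j) * act g (cl_gen j) k)"
 using arg_cong[OF vec_expand, of v n "%v. act g v k"] by (simp add: act_sum del: cl_gen_apply)

text \<open>The product of the images is the product of \<open>v\<close> and \<open>w\<close>
  conjugated by \<open>g\<close>. Conjugation fixes scalars, hence the anticommutator, and this
  encodes the inner product.\<close>

lemma ip_act:
 assumes g: "g:Spn" and v: "v:Vec" and w: "w:Vec"
 shows "ip n (act g v) (act g w) = ip n v w"
proof -
 have p: "act g v \<star> act g w = g \<star> (v \<star> w) \<star> tr g" if "v:Vec" "w:Vec" for v w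
 unfolding act_def by (metis mul_assoc Spin_left g mul1r mul_mem)
 have "act g w \<star> act g v = g \<star> lin (- 2 * ip n v w) cl_one (- 1) (v \<star> w) \<star> tr g"
  by (simp add: p[OF w v] vec_swap[OF v w])
 also have "... = lin (- 2 * ip n v w) cl_one (- 1) (act g v \<star> act g w)"
  by (simp add: mul_lin_left mul_lin_right mul1r[OF Spin_mem[OF g]] Spin_right[OF g] p[OF v w])
 finally have "(act g v \<star> act g w) 0 + (act g w \<star> act g v) 0 = - 2 * ip n v w * cl_one 0"
  by (simp add: lin_def)
 thus ?thesis using vec_anticommute[OF Spin_vec[OF g v] Spin_vec[OF g w], of 0] by (simp add: cl_one_def)
qed

definition adm :: "vec => real mat" where
 "adm g = Matrix.mat n n (%(i, j). act g (cl_gen j) (2 ^ i))"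

lemma adm_car [simp]: "adm g:carrier_mat n n"
 by (simp add: adm_def)

lemma adm_index: "i < n ==> j < n ==> adm g $$ (i, j) = act g (cl_gen j) (2 ^ i)"
 by (simp add: adm_def)

lemma adm_orth_left:
 assumes "g:Spn" shows "transpose_mat (adm g) * adm g = 1\<^sub>m n"
proof (rule eq_matI)
 fix i j assume "i < dim_row (1\<^sub>m n :: real mat)" "j < dim_col (1\<^sub>m n :: real mat)"
 hence ij: "i < n" "j < n" by auto
 have "(transpose_mat (adm g) * adm g) $$ (i, j) = (\<Sum>k<n. adm g $$ (k, i) * adm g $$ (k, j))"
  using ij by (simp add: adm_def scalar_prod_def atLeast0LessThan)
 also have "... = ip n (act g (cl_gen i)) (act g (cl_gen j))"
  unfolding ip_def by (rule sum.cong) (use ij in "auto simp: adm_index")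
 also have "... = ip n (cl_gen i) (cl_gen j)" by (rule ip_act[OF assms clgv[OF ij(1)] clgv[OF ij(2)]])
 also have "... = 1\<^sub>m n $$ (i, j)" using ij by (simp add: ip_gen)
 finally show "(transpose_mat (adm g) * adm g) $$ (i, j) = 1\<^sub>m n $$ (i, j)" .
qed (auto simp: adm_def)

lemma adm_orth:
 assumes "g:Spn" shows "adm g * transpose_mat (adm g) = 1\<^sub>m n"
 by (rule mat_mult_left_right_inverse[OF _ _ adm_orth_left[OF assms]]) auto

lemma Spin_mul: assumes "g:Spn" "h:Spn" shows "g \<star> h:Spn"
proof -
 have "g \<star> h \<star> tr (g \<star> h) = g \<star> (h \<star> tr h) \<star> tr g" by (simp add: tr_mul mul_assoc)
 also have "... = cl_one" using assms by (simp add: Spin_right mul1r Spin_mem)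
 finally show ?thesis using assms by (auto simp: Spin_iff act_mul mul_mem intro: even_mul)
qed

lemma Spin_one: "cl_one:Spn"
 by (auto simp: Spin_iff one_mem cl_even_one mul1l act_one clv_mem)

text \<open>The point is that \<open>act (tr g)\<close> preserves vectors. As \<open>act g\<close>
  is orthogonal on vectors it is onto: the vector \<open>v\<close> with coefficients given by the
  transposed matrix applied to \<open>w\<close> satisfies \<open>act g v = w\<close>, and
  \<open>act (tr g)\<close> undoes \<open>act g\<close>.\<close>

lemma Spin_tr:
 assumes g: "g:Spn" shows "tr g:Spn"
proof -
 have "act (tr g) w:Vec" if w: "w:Vec" for w
 proof -
  define v where "v = (%k. \<Sum>i<n. (\<Sum>l<n. adm g $$ (l, i) * w (2 ^ l)) * cl_gen i k)"
  have v: "v:Vec" unfolding v_def by (rule sum_gen_vec)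
  have vi: "v (2 ^ i) = (\<Sum>l<n. adm g $$ (l, i) * w (2 ^ l))" if "i < n" for i
   unfolding v_def by (rule sum_gen_apply[OF that])
  have "act g v = w"
  proof (rule vec_eqI[OF Spin_vec[OF g v] w])
   fix i assume i: "i < n"
   have "act g v (2 ^ i) = (\<Sum>j<n. (\<Sum>l<n. adm g $$ (l, j) * w (2 ^ l)) * adm g $$ (i, j))"
    unfolding act_expand[OF v] by (rule sum.cong) (use i vi in "auto simp: adm_index")
   also have "... = (\<Sum>l<n. (\<Sum>j<n. adm g $$ (i, j) * adm g $$ (l, j)) * w (2 ^ l))"
    unfolding sum_distrib_right by (subst sum.swap) (simp add: mult_ac)
   also have "... = (\<Sum>l<n. if l = i then w (2 ^ i) else 0)"
   proof (rule sum.cong)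
    fix l assume "l:{..<n}"
    hence l: "l < n" by simp
    have "(\<Sum>j<n. adm g $$ (i, j) * adm g $$ (l, j)) = (adm g * transpose_mat (adm g)) $$ (i, l)"
     using i l by (simp add: adm_def scalar_prod_def atLeast0LessThan)
    thus "(\<Sum>j<n. adm g $$ (i, j) * adm g $$ (l, j)) * w (2 ^ l) = (if l = i then w (2 ^ i) else 0)"
     using i l by (auto simp: adm_orth[OF g])
   qed simp
   finally show "act g v (2 ^ i) = w (2 ^ i)" using i by simp
  qed
  hence "act (tr g) w = act (tr g \<star> g) v" by (simp add: act_mul)
  thus ?thesis using v by (simp add: Spin_left[OF g] act_one clv_mem)
 qed
 thus ?thesis using g
  by (auto simp: Spin_iff clt_mem intro: cl_even_transpose left_inverse)
qed

lemma Spin_simps: "\<one>\<^bsub>Spin n\<^esub> = cl_one" "g \<otimes>\<^bsub>Spin n\<^esub> h = g \<star> h"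
 by (simp_all add: Spin_def)

lemma Spin_group: "Group.group (Spin n)"
proof (rule groupI)
 show "EX y:carrier (Spin n). y \<otimes>\<^bsub>Spin n\<^esub> x = \<one>\<^bsub>Spin n\<^esub>" if "x:carrier (Spin n)" for x
  by (rule bexI[of _ "tr x"]) (use Spin_left[OF that] Spin_tr[OF that] in "simp_all only: Spin_simps")
next
 fix x y z assume x: "x:carrier (Spin n)" and y: "y:carrier (Spin n)"
 show "x \<otimes>\<^bsub>Spin n\<^esub> y:carrier (Spin n)" using Spin_mul[OF x y] by (simp only: Spin_simps)
 show "x \<otimes>\<^bsub>Spin n\<^esub> y \<otimes>\<^bsub>Spin n\<^esub> z = x \<otimes>\<^bsub>Spin n\<^esub> (y \<otimes>\<^bsub>Spin n\<^esub> z)" by (simp only: Spin_simps mul_assoc)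
 show "\<one>\<^bsub>Spin n\<^esub> \<otimes>\<^bsub>Spin n\<^esub> x = x" using mul1l[OF Spin_mem[OF x]] by (simp only: Spin_simps)
next
 show "\<one>\<^bsub>Spin n\<^esub>:carrier (Spin n)" using Spin_one by (simp only: Spin_simps)
qed

lemma Spin_inv: "g:Spn ==> inv\<^bsub>Spin n\<^esub> g = tr g"
 by (rule group.inv_equality[OF Spin_group]) (auto simp: Spin_simps Spin_left Spin_tr)

lemma Ad_eq: "g:Spn ==> Ad n g = adm g"
 by (simp add: Ad_def adm_def act_def Spin_inv)

lemma adm_mul:
 assumes "g:Spn" "h:Spn" shows "adm (g \<star> h) = adm g * adm h"
proof (rule eq_matI)
 fix i j assume "i < dim_row (adm g * adm h)" "j < dim_col (adm g * adm h)"
 hence ij: "i < n" "j < n" by (auto simp: adm_def)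
 have v: "act h (cl_gen j):Vec" by (rule Spin_vec[OF assms(2) clgv[OF ij(2)]])
 have "(adm g * adm h) $$ (i, j) = (\<Sum>k<n. adm g $$ (i, k) * adm h $$ (k, j))"
  using ij by (simp add: adm_def scalar_prod_def atLeast0LessThan)
 also have "... = act g (act h (cl_gen j)) (2 ^ i)"
  unfolding act_expand[OF v] by (rule sum.cong) (use ij in "auto simp: adm_index")
 finally show "adm (g \<star> h) $$ (i, j) = (adm g * adm h) $$ (i, j)" using ij by (simp add: adm_index act_mul)
qed (auto simp: adm_def)

lemma adm_one: "adm cl_one = 1\<^sub>m n"
 by (rule eq_matI) (auto simp: adm_index act_one clv_mem[OF clgv] adm_def)

lemma adm_tr: "g:Spn ==> adm (tr g) = transpose_mat (adm g)"
proof -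
 assume g: "g:Spn"
 have 1: "adm (tr g) * adm g = 1\<^sub>m n" using adm_mul[OF Spin_tr[OF g] g] by (simp add: Spin_left[OF g] adm_one)
 have "adm (tr g) = adm (tr g) * (adm g * transpose_mat (adm g))"
  unfolding adm_orth[OF g] using right_mult_one_mat[OF adm_car] by simp
 also have "... = (adm (tr g) * adm g) * transpose_mat (adm g)"
  by (rule assoc_mult_mat[symmetric, of _ n n _ n _ n]) simp_all
 also have "... = transpose_mat (adm g)" unfolding 1 by (rule left_mult_one_mat[of _ n n]) simp
 finally show ?thesis .
qed

text \<open>Such a \<open>g\<close> commutes with every generator. An even nonconstant monomial
  anticommutes with each generator occurring in it, so its coefficient in \<open>g\<close> vanishes;
  the remaining scalar has square \<open>1\<close>.\<close>

lemma adm_kernel: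
 assumes g: "g:Spn" and A: "adm g = 1\<^sub>m n"
 shows "g = cl_one \<or> g = (%k. - cl_one k)"
proof -
 have gk: "g k = 0" if k: "k \<noteq> 0" for k
 proof (cases "k < 2 ^ n & even (cl_degree k)")
  case True
  obtain j where j: "bit k j" using k by (metis bit_eqI bit_0_eq bot_apply bot_bool_def)
  have jn: "j < n" using bit_bound j True by blast
  have b: "(2::nat) ^ j < 2 ^ n" using jn by simp
  have "act g (cl_gen j) = cl_gen j"
   by (rule vec_eqI[OF Spin_vec[OF g clgv[OF jn]] clgv[OF jn]])
    (use adm_index[of _ j g] A jn in auto)
  hence "act g (cl_gen j) \<star> g = cl_gen j \<star> g" by simp
  hence c: "g \<star> cl_gen j = cl_gen j \<star> g"
   using mul1r[OF mul_mem, of g "cl_gen j"] by (simp add: act_def mul_assoc Spin_left[OF g])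
  define m where "m = xor (2 ^ j) k"
  have m: "m < 2 ^ n" unfolding m_def using b True by (simp add: xor_bound)
  have km: "xor (2 ^ j) m = k" by (simp add: m_def xor_cancel)
  have "cl_sign k (2 ^ j) * g k = cl_sign (2 ^ j) k * g k"
   using fun_cong[OF c, of m] unfolding cl_gen_cmono mul_cmono_apply[OF b m] cmono_mul_apply[OF b m] km .
  \<comment> \<open>The exponents count the bits of \<open>k\<close> from \<open>j\<close> upwards
    and the bits up to \<open>j\<close>. Bit \<open>j\<close> is counted twice, so they add up to
    the even degree plus one.\<close>
  moreover have "cl_sign k (2 ^ j) * cl_sign (2 ^ j) k = - 1"
  proof -
   have "{i. bit k i} \<subseteq> {..<n}" using bit_bound True lessThan_iff by blast
   hence f: "finite {i. bit k i}" by (rule finite_subset) simp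
   have "finite {a. bit k a & j \<le> a}" "finite {b. bit k b & b \<le> j}"
    by (rule finite_subset[OF _ f], blast)+
   hence "card ({a. bit k a & j \<le> a} \<union> {b. bit k b & b \<le> j}) + card ({a. bit k a & j \<le> a} \<inter> {b. bit k b & b \<le> j}) =
     card {a. bit k a & j \<le> a} + card {b. bit k b & b \<le> j}"
    by (rule card_Un_Int[symmetric])
   moreover have "{a. bit k a & j \<le> a} \<union> {b. bit k b & b \<le> j} = {i. bit k i}" by auto
   moreover have "{a. bit k a & j \<le> a} \<inter> {b. bit k b & b \<le> j} = {j}" using j by auto
   ultimately have "card {a. bit k a & j \<le> a} + card {b. bit k b & b \<le> j} = Suc (cl_degree k)"
    by (simp add: cl_degree_def)
   thus ?thesis using True by (simp add: cl_sign_gen_left cl_sign_gen_right flip: power_add)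
  qed
  ultimately have "cl_sign (2 ^ j) k * (cl_sign (2 ^ j) k * g k) = - g k"
   by (metis mult.assoc mult.commute mult_minus1)
  thus ?thesis using cl_sign_sq(1)[of "2 ^ j" k] by (simp flip: mult.assoc)
 next
  case False thus ?thesis using Spin_mem[OF g] Spin_even[OF g] by (auto simp: euc cl_even_def)
 qed
 have "(g \<star> tr g) 0 = (\<Sum>j<2 ^ n. (g j)\<^sup>2)" by (rule scal_even(1)[OF Spin_even[OF g]])
 also have "... = (\<Sum>j<(2 :: nat) ^ n. if j = 0 then (g 0)\<^sup>2 else 0)" by (rule sum.cong) (auto simp: gk)
 finally have "(g 0)\<^sup>2 = 1" by (simp add: Spin_right[OF g] cl_one_def)
 hence "g 0 = 1 \<or> g 0 = - 1" by (simp add: power2_eq_1_iff)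
 thus ?thesis using gk by (auto simp: cl_one_def fun_eq_iff)
qed

lemma Spin_vec_mul:
 assumes v: "v:Vec" "ip n v v = 1" and w: "w:Vec" "ip n w w = 1"
 shows "v \<star> w:Spn" "x:Vec ==> act (v \<star> w) x = v \<star> (w \<star> x \<star> w) \<star> v"
proof -
 have t: "tr (v \<star> w) = w \<star> v" using v w by (simp add: tr_mul clt_vec[of _ n])
 show a: "act (v \<star> w) x = v \<star> (w \<star> x \<star> w) \<star> v" for x by (simp add: act_def t mul_assoc)
 have sq: "u \<star> u = (%k. - cl_one k)" if "u:Vec" "ip n u u = 1" for u
  using vec_sq[OF that(1)] that(2) by (auto simp: lin_def)
 have "v \<star> w \<star> tr (v \<star> w) = v \<star> ((w \<star> w) \<star> v)" by (simp add: t mul_assoc)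
 also have "... = v \<star> lin (- 1) v 0 v"
  using mul1l[OF clv_mem[OF v(1)]] vec_sq[OF w(1)] w(2) by (simp add: mul_lin_left)
 also have "... = cl_one" unfolding mul_lin_right sq[OF v] by (auto simp: lin_def)
 finally have o: "v \<star> w \<star> tr (v \<star> w) = cl_one" .
 have "act (v \<star> w) x:Vec" if x: "x:Vec" for x
  unfolding a vec_sandwich[OF w(1) x] using vec_sandwich[OF v(1) clv_lin[OF x w(1)]] clv_lin x v w by simp
 thus "v \<star> w:Spn" using o vec_mul_even[OF v(1) w(1)] by (simp add: Spin_iff mul_mem)
qed

lemma Spin_neg: "g:Spn ==> (%k. - g k):Spn" "adm (%k. - g k) = adm g" "act (%k. - g k) v = act g v"
proof -
 have l: "(%k. - g k) = lin (- 1) g 0 g" for g by (simp add: lin_def)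
 have t: "tr (%k. - g k) = (%k. - tr g k)" by (simp add: clt_alt)
 have p: "(%k. - g k) \<star> h = (%k. - (g \<star> h) k)" "h \<star> (%k. - g k) = (%k. - (h \<star> g) k)" for g h
  unfolding l mul_lin_left mul_lin_right by (auto simp: lin_def)
 show a: "act (%k. - g k) v = act g v" for v by (simp add: act_def t p)
 thus "adm (%k. - g k) = adm g" by (simp add: adm_def)
 show "g:Spn ==> (%k. - g k):Spn"
  by (auto simp: Spin_iff a t p euc cl_even_def)
qed

end

context clf
begin

subsection \<open>Rotors\<close>

text \<open>It acts as the reflection in the \<open>i\<close>-th generator followed by the one in
  \<open>u\<close>. The sign makes \<open>refl2 i (cl_gen i)\<close> the identity, since generators
  square to \<open>-1\<close>.\<close>

definition refl2 :: "nat => vec => nat => real" where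
 "refl2 i u = (%k. - (u \<star> cl_gen i) k)"

text \<open>For a unit vector \<open>v\<close> the sum of \<open>cl_gen i\<close> and
  \<open>v\<close> has squared length \<open>2 + 2 * v (2 ^ i)\<close>, which vanishes only at the
  antipode of \<open>cl_gen i\<close>.\<close>

definition halfway :: "nat => vec => nat => real" where
 "halfway i v = lin (1 / sqrt (2 + 2 * v (2 ^ i))) (cl_gen i) (1 / sqrt (2 + 2 * v (2 ^ i))) v"

definition rotor :: "nat => vec => nat => real" where
 "rotor i v = refl2 i (halfway i v)"

context
 fixes i assumes i: "i < n"
begin

lemma gen_unit: "ip n (cl_gen i) (cl_gen i) = 1"
 using i by (simp add: ip_gen)

lemma gen_sq: "cl_gen i \<star> cl_gen i = lin (- 1) cl_one 0 cl_one"
 using vec_sq[OF clgv[OF i]] by (simp add: gen_unit)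

lemma refl2_Spin:
 assumes u: "u:Vec" "ip n u u = 1"
 shows "refl2 i u:Spn" "act (refl2 i u) (cl_gen i) = lin (2 * u (2 ^ i)) u (- 1) (cl_gen i)"
proof -
 note m = Spin_vec_mul[OF u clgv[OF i] gen_unit]
 show "refl2 i u:Spn" unfolding refl2_def by (rule Spin_neg(1)[OF m(1)])
 have "act (refl2 i u) (cl_gen i) = u \<star> (cl_gen i \<star> cl_gen i \<star> cl_gen i) \<star> u"
  unfolding refl2_def Spin_neg(3) by (rule m(2)[OF clgv[OF i]])
 also have "... = u \<star> lin (- 1) (cl_gen i) 0 (cl_gen i) \<star> u"
  using vec_sandwich[OF clgv[OF i] clgv[OF i]] by (simp add: gen_unit) (simp add: lin_def)
 also have "... = lin (- 1) (u \<star> cl_gen i \<star> u) 0 (u \<star> cl_gen i \<star> u)"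
  by (simp add: mul_lin_left mul_lin_right)
 also have "... = lin (2 * u (2 ^ i)) u (- 1) (cl_gen i)"
  unfolding vec_sandwich[OF u(1) clgv[OF i]] u(2) ip_gen(1)[OF i] by (rule ext) (simp add: lin_def)
 finally show "act (refl2 i u) (cl_gen i) = lin (2 * u (2 ^ i)) u (- 1) (cl_gen i)" .
qed

lemma halfway_unit:
 assumes v: "v:Vec" "ip n v v = 1" "v (2 ^ i) > - 1"
 shows "halfway i v:Vec" "ip n (halfway i v) (halfway i v) = 1"
  "halfway i v (2 ^ i) = sqrt (2 + 2 * v (2 ^ i)) / 2"
proof -
 define c where "c = sqrt (2 + 2 * v (2 ^ i))"
 have c: "c > 0" "c * c = 2 + 2 * v (2 ^ i)" using v(3) by (auto simp: c_def)
 show "halfway i v:Vec" unfolding halfway_def by (rule clv_lin[OF clgv[OF i] v(1)])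
 have "ip n (halfway i v) (halfway i v) = (2 + 2 * v (2 ^ i)) / (c * c)"
  unfolding halfway_def c_def[symmetric] ip_lin_left ip_lin_right
  using v(2) i by (simp add: ip_gen add_divide_distrib)
 thus "ip n (halfway i v) (halfway i v) = 1" using c by (metis divide_self_if mult_eq_0_iff less_numeral_extra(3))
 have "halfway i v (2 ^ i) = (1 + v (2 ^ i)) / c" unfolding halfway_def c_def[symmetric] by (simp add: lin_def add_divide_distrib)
 also have "... = c / 2" using c by (simp add: field_simps)
 finally show "halfway i v (2 ^ i) = sqrt (2 + 2 * v (2 ^ i)) / 2" by (simp add: c_def)
qed

text \<open>With \<open>u\<close> halfway, of the form \<open>(e + v) / c\<close> and with
  \<open>i\<close>-th coordinate \<open>c / 2\<close>, the image \<open>2 u_i u - e\<close> of the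
  base vector \<open>e\<close> equals \<open>v\<close>.\<close>

lemma rotor_Spin:
 assumes v: "v:Vec" "ip n v v = 1" "v (2 ^ i) > - 1"
 shows "rotor i v:Spn" "act (rotor i v) (cl_gen i) = v"
proof -
 note h = halfway_unit[OF v]
 define c where "c = sqrt (2 + 2 * v (2 ^ i))"
 have c: "c > 0" using v(3) by (auto simp: c_def)
 show "rotor i v:Spn" unfolding rotor_def by (rule refl2_Spin(1)[OF h(1,2)])
 show "act (rotor i v) (cl_gen i) = v"
  unfolding rotor_def refl2_Spin(2)[OF h(1,2)] h(3) unfolding halfway_def c_def[symmetric]
  using c by (auto simp: lin_def field_simps)
qed

text \<open>A rotor to \<open>u\<close> squares to the product of the reflections in \<open>u\<close> and in the base vector.\<close>

lemma det_refl2: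
 assumes u: "u:Vec" "ip n u u = 1" "u (2 ^ i) > - 1"
 shows "Determinant.det (adm (refl2 i u)) = 1"
proof -
 define e s w where "e = cl_gen i" and "s = rotor i u" and "w = halfway i u"
 note s = rotor_Spin[OF u, folded s_def e_def]
 have eV: "e:Vec" unfolding e_def by (rule clgv[OF i])
 have wV: "w:Vec" unfolding w_def by (rule halfway_unit(1)[OF u])
 have ee: "e \<star> e = lin (- 1) cl_one 0 cl_one" unfolding e_def by (rule gen_sq)
 have s1: "s = lin (- 1) (w \<star> e) 0 cl_one" by (simp add: s_def rotor_def refl2_def lin_def w_def e_def)
 have ts: "tr s = lin (- 1) (e \<star> w) 0 cl_one"
  unfolding s1 clt_lin tr_mul clt_vec[OF eV] clt_vec[OF wV] clt_one ..
 have "e \<star> tr s \<star> e = lin (- 1) ((e \<star> e) \<star> w \<star> e) 0 (e \<star> e)"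
  unfolding ts mul_lin_left mul_lin_right using mul1r[OF clv_mem[OF eV]] by (simp add: mul_assoc)
 also have "... = w \<star> e"
  unfolding ee mul_lin_left mul1l[OF clv_mem[OF wV]] mul_lin_left by (rule ext) (simp add: lin_def)
 also have "... = lin (- 1) s 0 s" unfolding s1 by (rule ext) (simp add: lin_def)
 finally have ese: "e \<star> tr s \<star> e = lin (- 1) s 0 s" .
 have "refl2 i u = lin (- 1) (act s e \<star> e) 0 cl_one" using s(2) by (simp add: refl2_def lin_def e_def)
 also have "... = lin (- 1) (s \<star> (e \<star> tr s \<star> e)) 0 cl_one" by (simp add: act_def mul_assoc)
 also have "... = s \<star> s" unfolding ese mul_lin_right by (rule ext) (simp add: lin_def)
 finally have "adm (refl2 i u) = adm s * adm s" by (simp add: adm_mul s(1))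
 hence "Determinant.det (adm (refl2 i u)) = Determinant.det (adm s) * Determinant.det (adm s)"
  by (simp add: det_mult[of _ n])
 also have "... = Determinant.det (adm s * transpose_mat (adm s))"
  by (simp add: det_mult[of _ n] det_transpose[of _ n])
 finally show ?thesis by (simp add: adm_orth[OF s(1)])
qed

lemma det_rotor:
 assumes v: "v:Vec" "ip n v v = 1" "v (2 ^ i) > - 1"
 shows "Determinant.det (adm (rotor i v)) = 1"
 unfolding rotor_def
proof (rule det_refl2[OF halfway_unit(1,2)[OF v]])
 have "sqrt (2 + 2 * v (2 ^ i)) \<ge> 0" using v(3) by simp
 thus "halfway i v (2 ^ i) > - 1" unfolding halfway_unit(3)[OF v] by linarith
qed

end

end

subsection \<open>Passing from dimension \<open>n\<close> to \<open>n + 1\<close>\<close>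

lemma clm_Suc:
 assumes "x:eucl (2 ^ n)" "y:eucl (2 ^ n)"
 shows "cl_mult (Suc n) x y = cl_mult n x y"
proof
 fix m
 show "cl_mult (Suc n) x y m = cl_mult n x y m"
 proof (cases "m < 2 ^ n")
  case True
  have "(\<Sum>j<2 ^ Suc n. cl_sign j (xor j m) * x j * y (xor j m)) = (\<Sum>j<2 ^ n. cl_sign j (xor j m) * x j * y (xor j m))"
   by (rule sum.mono_neutral_right) (use assms(1) in "auto simp: euc")
  thus ?thesis using True by (simp add: clm_alt)
 next
  case False
  have "x j * y (xor j m) = 0" for j
  proof (cases "j < 2 ^ n")
   case True
   have "\<not> xor j m < 2 ^ n" using xor_bound[OF True, of "xor j m"] False by (auto simp: xor_cancel)
   thus ?thesis using assms(2) by (auto simp: euc)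
  next
   case False thus ?thesis using assms(1) by (auto simp: euc)
  qed
  hence "(\<Sum>j<2 ^ Suc n. cl_sign j (xor j m) * x j * y (xor j m)) = 0"
   by (intro sum.neutral) (simp add: mult.assoc)
  hence "cl_mult (Suc n) x y m = 0" by (simp only: clm_alt if_cancel)
  thus ?thesis using False by (simp add: clm_alt)
 qed
qed

lemma eucl_mono: "x:eucl N ==> N \<le> N' ==> x:eucl N'"
 by (auto simp: euc)

lemma act_Suc:
 assumes h: "h:eucl (2 ^ n)" and v: "v:eucl (2 ^ n)"
 shows "clf.act (Suc n) h v = clf.act n h v"
 unfolding clf.act_def clm_Suc[OF h v] by (rule clm_Suc[OF clf.mul_mem clt_mem[OF h]])

text \<open>Moving the new generator past a monomial without it costs one sign per factor, and the
  number of factors is even. Hence the smaller spin group fixes the new generator, see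
  \<open>act_Suc_gen\<close>.\<close>

lemma gen_commute_Suc:
 assumes h: "h:eucl (2 ^ n)" "cl_even h"
 shows "cl_mult (Suc n) h (cl_gen n) = cl_mult (Suc n) (cl_gen n) h"
proof
 fix m
 have b: "(2::nat) ^ n < 2 ^ Suc n" by simp
 show "cl_mult (Suc n) h (cl_gen n) m = cl_mult (Suc n) (cl_gen n) h m"
 proof (cases "m < 2 ^ Suc n")
  case True
  define k where "k = xor (2 ^ n) m"
  have "cl_sign k (2 ^ n) * h k = cl_sign (2 ^ n) k * h k"
  proof (cases "k < 2 ^ n & even (cl_degree k)")
   case k: True
   have lt: "a < n" if "bit k a" for a using bit_bound[of k n a] k that by blast
   have e: "{a. bit k a & n \<le> a} = {}" "{b. bit k b & b \<le> n} = {i. bit k i}"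
    using lt leD less_imp_le by blast+
   show ?thesis unfolding cl_sign_gen_left cl_sign_gen_right e cl_degree_def[symmetric] using k by simp
  next
   case False thus ?thesis using h by (auto simp: euc cl_even_def)
  qed
  thus ?thesis
   unfolding cl_gen_cmono clf.mul_cmono_apply[OF b True] clf.cmono_mul_apply[OF b True] k_def .
 next
  case False thus ?thesis by (simp add: clm_alt)
 qed
qed

lemma act_Suc_gen:
 assumes h: "h:carrier (Spin n)"
 shows "clf.act (Suc n) h (cl_gen n) = cl_gen n"
proof -
 have hE: "h:eucl (2 ^ n)" and he: "cl_even h" by (rule clf.Spin_mem[OF h], rule clf.Spin_even[OF h])
 have "clf.act (Suc n) h (cl_gen n) = cl_mult (Suc n) (cl_mult (Suc n) (cl_gen n) h) (cl_transpose h)"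
  by (simp add: clf.act_def gen_commute_Suc[OF hE he])
 also have "... = cl_mult (Suc n) (cl_gen n) (cl_mult n h (cl_transpose h))"
  by (simp add: clf.mul_assoc clm_Suc[OF hE clt_mem[OF hE]])
 also have "... = cl_gen n"
  unfolding clf.Spin_right[OF h] by (rule clf.mul1r[OF clv_mem[OF clgv]]) simp
 finally show ?thesis .
qed

lemma clv_Suc: "v:cl_vectors n ==> v:cl_vectors (Suc n)"
 by (force simp: cl_vectors_def)

text \<open>A vector splits into a part of dimension \<open>n\<close>, on which \<open>h\<close>
  acts as before, and a multiple of the new generator, which \<open>h\<close> fixes.\<close>

lemma Spin_Suc:
 assumes h: "h:carrier (Spin n)"
 shows "h:carrier (Spin (Suc n))"
proof -
 interpret lo: clf n .
 interpret hi: clf "Suc n" .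
 note hE = lo.Spin_mem[OF h]
 have "hi.act h v:cl_vectors (Suc n)" if v: "v:cl_vectors (Suc n)" for v
 proof -
  define v' where "v' = (%k. \<Sum>i<n. v (2 ^ i) * cl_gen i k)"
  have v': "v':cl_vectors n" unfolding v'_def by (rule sum_gen_vec)
  have "v = lin 1 v' (v (2 ^ n)) (cl_gen n)"
   by (subst vec_expand[OF v]) (auto simp: lin_def v'_def)
  hence "hi.act h v = lin 1 (lo.act h v') (v (2 ^ n)) (cl_gen n)"
   by (metis act_Suc act_Suc_gen clv_mem h hE hi.act_lin v')
  moreover have "lo.act h v':cl_vectors (Suc n)" using lo.Spin_vec[OF h v'] by (rule clv_Suc)
  ultimately show ?thesis using clv_lin[OF _ clgv[of n "Suc n"]] by simp
 qed
 moreover have "cl_mult (Suc n) h (cl_transpose h) = cl_one"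
  unfolding clm_Suc[OF hE clt_mem[OF hE]] by (rule lo.Spin_right[OF h])
 ultimately show ?thesis using lo.Spin_even[OF h] eucl_mono[OF hE] by (auto simp: hi.Spin_iff)
qed

text \<open>Entries as a plain function, defined for every element of the algebra. A recursion over
  \<open>n\<close> can then pass to corner blocks without changing types.\<close>

definition amat :: "nat => vec => nat => nat => real" where
 "amat n g i j = clf.act n g (cl_gen j) (2 ^ i)"

lemma adm_amat: "clf.adm n g = Matrix.mat n n (%(i, j). amat n g i j)"
 by (simp add: clf.adm_def amat_def)

lemma ip_amat:
 assumes "g:carrier (Spin n)" "i < n" "j < n"
 shows "(\<Sum>k<n. amat n g k i * amat n g k j) = (if i = j then 1 else 0)"
proof -
 interpret clf n .
 have "(\<Sum>k<n. amat n g k i * amat n g k j) = ip n (act g (cl_gen i)) (act g (cl_gen j))"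
  by (simp add: ip_def amat_def)
 also have "... = ip n (cl_gen i) (cl_gen j)" using assms by (intro ip_act clgv)
 finally show ?thesis using assms by (simp add: ip_gen)
qed

lemma ip_amat_right:
 assumes "g:carrier (Spin n)" "i < n" "j < n"
 shows "(\<Sum>k<n. amat n g i k * amat n g j k) = (if i = j then 1 else 0)"
proof -
 interpret clf n .
 have "(\<Sum>k<n. amat n g i k * amat n g j k) = (adm g * transpose_mat (adm g)) $$ (i, j)"
  using assms by (simp add: adm_amat scalar_prod_def atLeast0LessThan)
 thus ?thesis using assms by (simp add: adm_orth)
qed

lemma amat_mul:
 assumes "g:carrier (Spin n)" "h:carrier (Spin n)" "i < n" "j < n"
 shows "amat n (cl_mult n g h) i j = (\<Sum>k<n. amat n g i k * amat n h k j)"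
proof -
 interpret clf n .
 have "act h (cl_gen j):Vec" using assms by (intro Spin_vec clgv)
 from act_expand[OF this, of g "2 ^ i"] show ?thesis by (simp add: amat_def act_mul mult.commute)
qed

lemma amat_Suc:
 assumes h: "h:carrier (Spin n)"
 shows "i < n ==> j < n ==> amat (Suc n) h i j = amat n h i j"
  "j < n ==> amat (Suc n) h n j = 0" "i \<le> n ==> amat (Suc n) h i n = (if i = n then 1 else 0)"
proof -
 interpret lo: clf n .
 note hE = lo.Spin_mem[OF h]
 show "i < n ==> j < n ==> amat (Suc n) h i j = amat n h i j"
  using act_Suc[OF hE clv_mem[OF clgv]] by (simp add: amat_def)
 show "amat (Suc n) h n j = 0" if "j < n"
 proof -
  have "lo.act h (cl_gen j) (2 ^ n) = 0"
   using clv_mem[OF lo.Spin_vec[OF h clgv[OF that]]] by (simp add: euc)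
  thus ?thesis using act_Suc[OF hE clv_mem[OF clgv[OF that]]] by (simp add: amat_def)
 qed
 show "i \<le> n ==> amat (Suc n) h i n = (if i = n then 1 else 0)"
  by (simp add: amat_def act_Suc_gen[OF h])
qed

subsection \<open>Coordinates on the spin group\<close>

text \<open>The rotor taking the last basis vector of dimension \<open>n + 1\<close> to
  \<open>v\<close>. It is a section, away from the antipode, of the fibration of
  \<open>Spin(n+1)\<close> over the \<open>n\<close>-sphere with fibre \<open>Spin(n)\<close>, and
  it drives the recursive coordinates below.\<close>

definition rt :: "nat => vec => nat => real" where
 "rt n v = clf.rotor (Suc n) n v"

definition last_col :: "nat => (nat => nat => real) => nat => real" where
 "last_col n A = (%k. \<Sum>i<Suc n. A i n * cl_gen i k)"

text \<open>The matrix \<open>R^t A\<close>, with \<open>R\<close> the rotation by the rotor to the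
  last column of \<open>A\<close>. For orthogonal \<open>A\<close> its last column is the last basis
  vector, which leaves an orthogonal block of size \<open>n\<close>.\<close>

definition reduce :: "nat => (nat => nat => real) => nat => nat => real" where
 "reduce n A i j = (\<Sum>k<Suc n. amat (Suc n) (rt n (last_col n A)) k i * A k j)"

text \<open>The open upper hemisphere as a graph over the unit ball.\<close>

definition sph :: "nat => vec => nat => real" where
 "sph n y = (%k. \<Sum>i<Suc n. (if i < n then y i else sqrt (1 - (\<Sum>i<n. (y i)\<^sup>2))) * cl_gen i k)"

fun sdim :: "nat => nat" where
 "sdim 0 = 0"
| "sdim (Suc n) = sdim n + n"

text \<open>Parametrisation of part of \<open>Spin(n)\<close>: a rotor given by a point of the
  hemisphere, times an element of the smaller spin group.\<close>

fun spar :: "nat => vec => nat => real" where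
 "spar 0 y = cl_one"
| "spar (Suc n) y = cl_mult (Suc n) (rt n (sph n (seu (sdim n) y)))
  (spar n (feu (sdim n) y))"

text \<open>The inverse coordinates, computed from the rotation matrix alone: the last column
  without its last entry, preceded by the coordinates of the reduced matrix. They cannot tell
  \<open>g\<close> from \<open>-g\<close>.\<close>

fun sco :: "nat => (nat => nat => real) => nat => real" where
 "sco 0 A = (%_. 0)"
| "sco (Suc n) A = peu (sdim n) (sco n (reduce n A)) (%i. if i < n then A i n else 0)"

fun pdom :: "nat => vec set" where
 "pdom 0 = eucl 0"
| "pdom (Suc n) = {y:eucl (sdim n + n). feu (sdim n) y:pdom n &
  seu (sdim n) y:{z:eucl n. (\<Sum>i<n. (z i)\<^sup>2) < 1}}"

text \<open>The domain of \<open>sco\<close>: at each stage the last column points into the upper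
  hemisphere.\<close>

fun cok :: "nat => (nat => nat => real) => bool" where
 "cok 0 A \<longleftrightarrow> True"
| "cok (Suc n) A \<longleftrightarrow> A n n > 0 & cok n (reduce n A)"

lemma reduce_cong:
 assumes "!!i j. i < Suc n ==> j < Suc n ==> A i j = B i j"
 shows "j < Suc n ==> reduce n A i j = reduce n B i j"
using assms sum.cong by (simp add: last_col_def reduce_def)

text \<open>Only the upper left block of size \<open>n\<close> matters. This is needed because
  reduced matrices agree with \<open>amat\<close> only on that block.\<close>

lemma coord_cong:
 "(!!i j. i < n ==> j < n ==> A i j = B i j) ==> sco n A = sco n B & cok n A = cok n B"
proof (induction n arbitrary: A B)
 case 0 thus ?case by simp
next
 case (Suc n)
 have "sco n (reduce n A) = sco n (reduce n B) & cok n (reduce n A) = cok n (reduce n B)"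
  by (rule Suc.IH) (use reduce_cong[OF Suc.prems] in simp)
 moreover have "(%i. if i < n then A i n else 0) = (%i. if i < n then B i n else 0)" using Suc.prems by auto
 ultimately show ?case using Suc.prems[of n n] by simp
qed

lemma last_col_apply: "i < Suc n ==> last_col n A (2 ^ i) = A i n"
 unfolding last_col_def by (rule sum_gen_apply)

lemma sph_apply:
 "i < Suc n ==> sph n y (2 ^ i) = (if i < n then y i else sqrt (1 - (\<Sum>i<n. (y i)\<^sup>2)))"
 unfolding sph_def by (rule sum_gen_apply)

lemma sph_unit:
 assumes "(\<Sum>i<n. (y i)\<^sup>2) < 1"
 shows "sph n y:cl_vectors (Suc n)" "ip (Suc n) (sph n y) (sph n y) = 1" "sph n y (2 ^ n) > 0"
proof -
 show "sph n y:cl_vectors (Suc n)" unfolding sph_def by (rule sum_gen_vec)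
 show "ip (Suc n) (sph n y) (sph n y) = 1"
  using assms by (simp add: ip_def sph_apply power2_eq_square)
 show "sph n y (2 ^ n) > 0" using assms by (simp add: sph_apply)
qed

lemma rt_Spin:
 assumes "v:cl_vectors (Suc n)" "ip (Suc n) v v = 1" "v (2 ^ n) > 0"
 shows "rt n v:carrier (Spin (Suc n))" "clf.act (Suc n) (rt n v) (cl_gen n) = v"
 using assms clf.rotor_Spin[of n "Suc n" v] by (auto simp: rt_def)

text \<open>In the product of \<open>r\<close> and \<open>h\<close> the factor \<open>h\<close>
  fixes the last basis vector, so the last column is \<open>v\<close> and determines
  \<open>r\<close>; reducing cancels \<open>r\<close> and leaves the matrix of
  \<open>h\<close>.\<close>

lemma spar_Spin:
 "y:pdom n ==> spar n y:carrier (Spin n) & cok n (amat n (spar n y)) &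
  sco n (amat n (spar n y)) = y"
proof (induction n arbitrary: y)
 case 0
 interpret clf 0 .
 show ?case using 0 Spin_one by (auto simp: euc)
next
 case (Suc n)
 interpret hi: clf "Suc n" .
 define y1 y2 where "y1 = feu (sdim n) y" and "y2 = seu (sdim n) y"
 have y: "y1:pdom n" "(\<Sum>i<n. (y2 i)\<^sup>2) < 1" "y2:eucl n" using Suc.prems by (auto simp: y1_def y2_def)
 define v h where "v = sph n y2" and "h = spar n y1"
 note v = sph_unit[OF y(2), folded v_def]
 define r where "r = rt n v"
 note r = rt_Spin[OF v, folded r_def]
 have h: "h:carrier (Spin n)" "cok n (amat n h)" "sco n (amat n h) = y1"
  using Suc.IH[OF y(1)] by (auto simp: h_def)
 note hS = Spin_Suc[OF h(1)]
 define g where "g = cl_mult (Suc n) r h"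
 have g: "spar (Suc n) y = g" by (simp add: g_def r_def v_def h_def y1_def y2_def)
 have gS: "g:carrier (Spin (Suc n))" unfolding g_def by (rule hi.Spin_mul[OF r(1) hS])
 have col: "amat (Suc n) g i n = v (2 ^ i)" for i
  by (simp add: amat_def g_def hi.act_mul act_Suc_gen[OF h(1)] r(2))
 have lc: "last_col n (amat (Suc n) g) = v"
  using vec_expand[OF v(1)] unfolding last_col_def col by simp
 have red: "reduce n (amat (Suc n) g) i j = amat n h i j" if ij: "i < n" "j < n" for i j
 proof -
  have hV: "hi.act h (cl_gen j):hi.Vec" using ij by (intro hi.Spin_vec hS clgv) simp
  have "reduce n (amat (Suc n) g) i j = ip (Suc n) (hi.act r (cl_gen i)) (hi.act r (hi.act h (cl_gen j)))"
   unfolding reduce_def lc r_def[symmetric] by (simp add: ip_def amat_def g_def hi.act_mul)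
  also have "... = ip (Suc n) (cl_gen i) (hi.act h (cl_gen j))"
   using ij hV by (intro hi.ip_act r(1) clgv) auto
  also have "... = amat (Suc n) h i j" using ij by (simp add: ip_gen amat_def)
  finally show ?thesis using amat_Suc(1)[OF h(1) ij] by simp
 qed
 have c: "sco n (reduce n (amat (Suc n) g)) = y1" "cok n (reduce n (amat (Suc n) g))"
  using coord_cong[of n "reduce n (amat (Suc n) g)" "amat n h"] red h by auto
 have "(%i. if i < n then amat (Suc n) g i n else 0) = y2"
  using y(3) by (auto simp: col v_def sph_apply euc)
 hence "sco (Suc n) (amat (Suc n) g) = y"
  using c(1) by (simp add: y1_def y2_def peu_simps)
 moreover have "cok (Suc n) (amat (Suc n) g)" using c(2) v(3) by (simp add: col)
 ultimately show ?case using gS unfolding g by blast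
qed

lemma sco_eucl: "sco n A:eucl (sdim n)"
proof (induction n arbitrary: A)
 case 0 thus ?case by (simp add: euc)
next
 case (Suc n)
 have "(%i. if i < n then A i n else 0):eucl n" by (simp add: euc)
 thus ?case by (simp add: peu_mem(1))
qed

lemma sum_delta_mult: "(i::nat) < n ==> (\<Sum>k<n. (if k = i then 1 else 0) * (f k :: real)) = f i"
 "(i::nat) < n ==> (\<Sum>k<n. (if i = k then 1 else 0) * (f k :: real)) = f i"
proof -
 assume "i < n"
 have "(\<Sum>k<n. (if k = i then 1 else 0) * f k) = (\<Sum>k<n. if k = i then f k else 0)" by (rule sum.cong) auto
 thus "(\<Sum>k<n. (if k = i then 1 else 0) * f k) = f i" using \<open>i < n\<close> by simp
 moreover have "(\<Sum>k<n. (if i = k then 1 else 0) * f k) = (\<Sum>k<n. (if k = i then 1 else 0) * f k)" by (rule sum.cong) auto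
 ultimately show "(\<Sum>k<n. (if i = k then 1 else 0) * f k) = f i" by simp
qed

text \<open>If the rotation by \<open>r\<close> and the orthogonal matrix \<open>A\<close> share the
  last column, then \<open>B = R^t A\<close> is a block of size \<open>n\<close> together with a
  \<open>1\<close>. Both the coordinates and the surjectivity of the double cover rest on this
  induction step.\<close>

lemma reduce_orth:
 fixes A :: "nat => nat => real"
 assumes orth': "\<forall>i<Suc n. \<forall>j<Suc n. (\<Sum>k<Suc n. A k i * A k j) = (if i = j then 1 else 0)"
  and r': "r:carrier (Spin (Suc n))" "\<forall>k<Suc n. amat (Suc n) r k n = A k n"
  and B: "!!i j. B i j = (\<Sum>k<Suc n. amat (Suc n) r k i * A k j)"
 shows "i < Suc n ==> B i n = (if i = n then 1 else 0)"
  and "j < Suc n ==> B n j = (if j = n then 1 else 0)"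
  and "i < n ==> j < n ==> (\<Sum>k<n. B k i * B k j) = (if i = j then 1 else 0)"
  and "i < Suc n ==> j < Suc n ==> (\<Sum>k<Suc n. amat (Suc n) r i k * B k j) = A i j"
proof -
 note orth = orth'[rule_format] and r = r'(1) r'(2)[rule_format]
 let ?R = "amat (Suc n) r"
 show 1: "B i n = (if i = n then 1 else 0)" if "i < Suc n" for i
 proof -
  have "B i n = (\<Sum>k<Suc n. ?R k i * ?R k n)" using that by (simp add: B r(2) del: sum.lessThan_Suc)
  thus ?thesis using ip_amat[OF r(1) that, of n] by simp
 qed
 show 2: "B n j = (if j = n then 1 else 0)" if "j < Suc n" for j
 proof -
  have "B n j = (\<Sum>k<Suc n. A k n * A k j)" using that by (simp add: B r(2) del: sum.lessThan_Suc)
  thus ?thesis using orth[of n j] that by auto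
 qed
 show 3: "(\<Sum>k<Suc n. ?R i k * B k j) = A i j" if "i < Suc n" "j < Suc n" for i j
 proof -
  have "(\<Sum>k<Suc n. ?R i k * B k j) = (\<Sum>k<Suc n. \<Sum>l<Suc n. ?R i k * (?R l k * A l j))"
   using that by (simp add: B sum_distrib_left del: sum.lessThan_Suc)
  also have "... = (\<Sum>l<Suc n. (\<Sum>k<Suc n. ?R i k * ?R l k) * A l j)"
   by (subst sum.swap) (simp add: sum_distrib_right mult.assoc del: sum.lessThan_Suc)
  also have "... = (\<Sum>l<Suc n. (if i = l then 1 else 0) * A l j)"
   by (rule sum.cong) (use ip_amat_right[OF r(1) that(1)] in auto)
  finally show ?thesis using that by (simp only: sum_delta_mult)
 qed
 show "(\<Sum>k<n. B k i * B k j) = (if i = j then 1 else 0)" if "i < n" "j < n"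
 proof -
  have ij: "i < Suc n" "j < Suc n" using that by auto
  have "(\<Sum>k<n. B k i * B k j) = (\<Sum>k<Suc n. B k i * B k j)" using 2[of i] that by simp
  also have "... = (\<Sum>k<Suc n. \<Sum>l<Suc n. ?R l k * A l i * B k j)"
   using ij by (simp add: B[of _ i] sum_distrib_right del: sum.lessThan_Suc)
  also have "... = (\<Sum>l<Suc n. A l i * (\<Sum>k<Suc n. ?R l k * B k j))"
   by (subst sum.swap) (simp add: sum_distrib_left mult_ac del: sum.lessThan_Suc)
  also have "... = (\<Sum>l<Suc n. A l i * A l j)"
   by (rule sum.cong) (use 3 ij in auto)
  finally show ?thesis using orth[OF ij] by simp
 qed
qed

text \<open>On orthogonal matrices in its domain, \<open>spar\<close> after \<open>sco\<close> is a
  section of the double cover. In the induction, \<open>A = R B\<close> and the block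
  \<open>B\<close> is covered by an element of the smaller group.\<close>

lemma sco_orth:
 fixes A :: "nat => nat => real"
 assumes "!!i j. i < n ==> j < n ==> (\<Sum>k<n. A k i * A k j) = (if i = j then 1 else 0)" "cok n A"
 shows "sco n A:pdom n & (\<forall>i<n. \<forall>j<n. amat n (spar n (sco n A)) i j = A i j)"
 using assms
proof (induction n arbitrary: A)
 case 0 thus ?case by (simp add: euc)
next
 case (Suc n)
 interpret hi: clf "Suc n" .
 note orth = Suc.prems(1)
 define v where "v = last_col n A"
 have vi: "v (2 ^ i) = A i n" if "i < Suc n" for i unfolding v_def by (rule last_col_apply[OF that])
 have v: "v:cl_vectors (Suc n)" "ip (Suc n) v v = 1" "v (2 ^ n) > 0"
 proof -
  show "v:cl_vectors (Suc n)" unfolding v_def last_col_def by (rule sum_gen_vec)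
  have "ip (Suc n) v v = (\<Sum>k<Suc n. A k n * A k n)" unfolding ip_def by (rule sum.cong) (auto simp: vi)
  thus "ip (Suc n) v v = 1" using orth[of n n] by simp
  show "v (2 ^ n) > 0" using Suc.prems(2) vi[of n] by simp
 qed
 define r where "r = rt n v"
 note r = rt_Spin[OF v, folded r_def]
 have rcol: "amat (Suc n) r k n = A k n" if "k < Suc n" for k using r(2) vi[OF that] by (simp add: amat_def)
 define B where "B = reduce n A"
 have Bdef: "B i j = (\<Sum>k<Suc n. amat (Suc n) r k i * A k j)" for i j
  by (simp add: B_def reduce_def v_def r_def)
 have "\<forall>i<Suc n. \<forall>j<Suc n. (\<Sum>k<Suc n. A k i * A k j) = (if i = j then 1 else 0)"
  "\<forall>k<Suc n. amat (Suc n) r k n = A k n" using orth rcol by blast+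
 note Bp = reduce_orth[OF this(1) r(1) this(2) Bdef]
 have IH: "sco n B:pdom n" "!!i j. i < n ==> j < n ==> amat n (spar n (sco n B)) i j = B i j"
  using Suc.IH[of B, OF Bp(3)] Suc.prems(2) by (auto simp: B_def)
 define h where "h = spar n (sco n B)"
 have h: "h:carrier (Spin n)" using spar_Spin[OF IH(1)] by (simp add: h_def)
 define y2 where "y2 = (%i. if i < n then A i n else 0)"
 have y2: "y2:eucl n" by (simp add: y2_def euc)
 have sum1: "(\<Sum>i<n. (y2 i)\<^sup>2) + (A n n)\<^sup>2 = 1"
  using orth[of n n] by (simp add: y2_def power2_eq_square)
 have An: "A n n > 0" using Suc.prems(2) by simp
 have lt: "(\<Sum>i<n. (y2 i)\<^sup>2) < 1" using sum1 zero_less_power[OF An, of 2] by linarith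
 have sq: "sqrt (1 - (\<Sum>i<n. (y2 i)\<^sup>2)) = A n n"
 proof -
  have "1 - (\<Sum>i<n. (y2 i)\<^sup>2) = (A n n)\<^sup>2" using sum1 by linarith
  thus ?thesis using An by simp
 qed
 have "sph n y2 = v"
 proof (rule vec_eqI[OF sph_unit(1)[OF lt] v(1)])
  fix i assume i: "i < Suc n"
  show "sph n y2 (2 ^ i) = v (2 ^ i)"
  proof (cases "i < n")
   case True thus ?thesis by (simp add: sph_apply vi y2_def)
  next
   case False
   hence "i = n" using i by simp
   thus ?thesis unfolding sph_apply[OF i] sq by (simp add: vi)
  qed
 qed
 moreover have c: "sco (Suc n) A = peu (sdim n) (sco n B) y2" by (simp add: B_def y2_def)
 ultimately have p: "spar (Suc n) (sco (Suc n) A) = cl_mult (Suc n) r h"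
  by (simp add: c peu_simps sco_eucl r_def h_def del: sco.simps)
 have "sco (Suc n) A:pdom (Suc n)"
  unfolding c using IH(1) y2 lt by (simp add: peu_simps sco_eucl peu_mem)
 moreover have "amat (Suc n) (cl_mult (Suc n) r h) i j = A i j" if ij: "i < Suc n" "j < Suc n" for i j
 proof -
  have hB: "amat (Suc n) h k j = B k j" if k: "k < Suc n" for k
  proof (cases "j = n")
   case True thus ?thesis using amat_Suc(3)[OF h, of k] k Bp(1)[OF k] by simp
  next
   case False
   hence j: "j < n" using ij by simp
   show ?thesis
   proof (cases "k = n")
    case True thus ?thesis using amat_Suc(2)[OF h j] Bp(2)[of j] j by simp
   next
    case False
    hence k: "k < n" using k by simp
    thus ?thesis using amat_Suc(1)[OF h k j] IH(2)[OF k j] by (simp add: h_def)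
   qed
  qed
  have "amat (Suc n) (cl_mult (Suc n) r h) i j = (\<Sum>k<Suc n. amat (Suc n) r i k * amat (Suc n) h k j)"
   by (rule amat_mul[OF r(1) Spin_Suc[OF h] ij])
  also have "... = (\<Sum>k<Suc n. amat (Suc n) r i k * B k j)" by (rule sum.cong) (auto simp: hB)
  finally show ?thesis using Bp(4)[OF ij] by simp
 qed
 ultimately show ?case unfolding p by blast
qed

text \<open>A rotation \<open>r\<close> takes the last basis vector to the last column of
  \<open>A\<close>; the remaining block has determinant \<open>1\<close>, because \<open>r\<close>
  has, and is covered by induction. Away from the antipode \<open>r\<close> is the rotor.\<close>

lemma adm_surj:
 "A:carrier_mat n n ==> A * transpose_mat A = 1\<^sub>m n ==> Determinant.det A = 1 ==>
  EX g:carrier (Spin n). clf.adm n g = A"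
proof (induction n arbitrary: A)
 case 0
 interpret clf 0 .
 show ?case by (rule bexI[OF _ Spin_one], rule eq_matI) (use 0 in "auto simp: adm_def")
next
 case (Suc n)
 interpret hi: clf "Suc n" .
 note A = Suc.prems(1)
 have A': "transpose_mat A * A = 1\<^sub>m (Suc n)"
  by (rule mat_mult_left_right_inverse[OF A _ Suc.prems(2)]) (use A in auto)
 define a where "a i j = A $$ (i, j)" for i j
 have orth: "(\<Sum>k<Suc n. a k i * a k j) = (if i = j then 1 else 0)" if "i < Suc n" "j < Suc n" for i j
 proof -
  have "(transpose_mat A * A) $$ (i, j) = (\<Sum>k<Suc n. a k i * a k j)"
   using A that by (simp add: scalar_prod_def atLeast0LessThan a_def del: sum.lessThan_Suc)
  thus ?thesis using A' that by simp
 qed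
 define v where "v = last_col n a"
 have vi: "v (2 ^ i) = a i n" if "i < Suc n" for i unfolding v_def by (rule last_col_apply[OF that])
 have v: "v:cl_vectors (Suc n)" "ip (Suc n) v v = 1"
 proof -
  show "v:cl_vectors (Suc n)" unfolding v_def last_col_def by (rule sum_gen_vec)
  have "ip (Suc n) v v = (\<Sum>k<Suc n. a k n * a k n)" unfolding ip_def by (rule sum.cong) (auto simp: vi)
  thus "ip (Suc n) v v = 1" using orth[of n n] by simp
 qed
 have vn: "(\<Sum>i<n. (v (2 ^ i))\<^sup>2) + (v (2 ^ n))\<^sup>2 = 1" using v(2) by (simp add: ip_def power2_eq_square)
 have "EX r:carrier (Spin (Suc n)). hi.act r (cl_gen n) = v & Determinant.det (hi.adm r) = 1"
 proof (cases "v (2 ^ n) > - 1")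
  case True
  thus ?thesis using hi.rotor_Spin[of n v] hi.det_rotor[of n v] v by (intro bexI[of _ "hi.rotor n v"]) auto
 next
  case False
  hence le: "v (2 ^ n) \<le> - 1" by simp
  have nn: "(\<Sum>i<n. (v (2 ^ i))\<^sup>2) \<ge> 0" by (rule sum_nonneg) simp
  have "(v (2 ^ n))\<^sup>2 \<le> 1" using vn nn by linarith
  hence m1: "v (2 ^ n) = - 1" using le abs_square_le_1[of "v (2 ^ n)"] by linarith
  hence "(\<Sum>i<n. (v (2 ^ i))\<^sup>2) = 0" using vn by simp
  hence "ALL i:{..<n}. (v (2 ^ i))\<^sup>2 = 0" by (subst (asm) sum_nonneg_eq_0_iff) auto
  hence v0: "v (2 ^ i) = 0" if "i < n" for i using that by simp
  \<comment> \<open>In dimension one the last column is the whole matrix, and its entry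
    \<open>-1\<close> contradicts determinant \<open>1\<close>.\<close>
  have "n \<noteq> 0"
  proof
   assume "n = 0"
   hence "Determinant.det A = A $$ (0, 0)" using A by (simp add: det_single)
   thus False using vi[of 0] m1 \<open>n = 0\<close> Suc.prems(3) by (simp add: a_def)
  qed
  \<comment> \<open>At the antipode no halfway vector exists. Reflecting in \<open>cl_gen n\<close>
    and then in a vector orthogonal to it is a half turn that reverses
    \<open>cl_gen n\<close>.\<close>
  define u where "u = cl_gen 0"
  have u: "u:hi.Vec" "ip (Suc n) u u = 1" "u (2 ^ n) = 0"
   unfolding u_def using \<open>n \<noteq> 0\<close> ip_gen(1)[of 0 "Suc n" "cl_gen 0"] clgv[of 0 "Suc n"] by (auto simp: cl_gen_def)
  have "hi.act (hi.refl2 n u) (cl_gen n) = v"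
  proof (rule vec_eqI[OF _ v(1)])
   show "hi.act (hi.refl2 n u) (cl_gen n):hi.Vec"
    using hi.refl2_Spin(1)[of n u] u by (intro hi.Spin_vec clgv) auto
   show "hi.act (hi.refl2 n u) (cl_gen n) (2 ^ i) = v (2 ^ i)" if "i < Suc n" for i
    using hi.refl2_Spin(2)[of n u] u that v0[of i] m1 by (auto simp: lin_def less_Suc_eq)
  qed
  thus ?thesis using hi.refl2_Spin(1)[of n u] hi.det_refl2[of n u] u
   by (intro bexI[of _ "hi.refl2 n u"]) auto
 qed
 then obtain r where r: "r:carrier (Spin (Suc n))" "hi.act r (cl_gen n) = v" "Determinant.det (hi.adm r) = 1" by blast
 have rcol: "amat (Suc n) r k n = a k n" if "k < Suc n" for k using r(2) vi[OF that] by (simp add: amat_def)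
 define b where "b i j = (\<Sum>k<Suc n. amat (Suc n) r k i * a k j)" for i j
 have "\<forall>i<Suc n. \<forall>j<Suc n. (\<Sum>k<Suc n. a k i * a k j) = (if i = j then 1 else 0)"
  "\<forall>k<Suc n. amat (Suc n) r k n = a k n" using orth rcol by blast+
 note bp = reduce_orth[OF this(1) r(1) this(2) b_def]
 define B where "B = Matrix.mat n n (%(i, j). b i j)"
 define B1 where "B1 = Matrix.mat (Suc n) (Suc n) (%(i, j). b i j)"
 have B: "B:carrier_mat n n" by (simp add: B_def)
 have "B1 = transpose_mat (hi.adm r) * A"
  by (rule eq_matI) (use A in "auto simp: B1_def b_def adm_amat scalar_prod_def atLeast0LessThan a_def simp del: sum.lessThan_Suc")
 hence "Determinant.det B1 = 1"
  using A Suc.prems(3) r(3) by (simp add: det_mult[of _ "Suc n"] det_transpose[of _ "Suc n"])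
 moreover have "B1 = four_block_mat B (0\<^sub>m n 1) (0\<^sub>m 1 n) (1\<^sub>m 1)"
  by (rule eq_matI) (use bp(1,2) in "auto simp: B1_def B_def less_Suc_eq")
 ultimately have detB: "Determinant.det B = 1"
  using det_four_block_mat_lower_left_zero[OF B, of "0\<^sub>m n 1" 1 "0\<^sub>m 1 n" "1\<^sub>m 1"] by simp
 have "transpose_mat B * B = 1\<^sub>m n"
  by (rule eq_matI) (use bp(3) in "auto simp: B_def scalar_prod_def atLeast0LessThan")
 hence BB: "B * transpose_mat B = 1\<^sub>m n" by (rule mat_mult_left_right_inverse[rotated 2]) (use B in auto)
 obtain h where h: "h:carrier (Spin n)" "clf.adm n h = B" using Suc.IH[OF B BB detB] by blast
 have hb: "amat n h i j = b i j" if "i < n" "j < n" for i j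
  using arg_cong[OF h(2), of "%M. M $$ (i, j)"] that by (simp add: adm_amat B_def)
 have "hi.adm (cl_mult (Suc n) r h) = A"
 proof (rule eq_matI)
  fix i j assume "i < dim_row A" "j < dim_col A"
  hence ij: "i < Suc n" "j < Suc n" using A by auto
  have hB: "amat (Suc n) h k j = b k j" if k: "k < Suc n" for k
   using amat_Suc[OF h(1)] bp(1)[OF k] bp(2)[OF ij(2)] hb k ij(2) by (auto simp: less_Suc_eq)
  have "amat (Suc n) (cl_mult (Suc n) r h) i j = (\<Sum>k<Suc n. amat (Suc n) r i k * amat (Suc n) h k j)"
   by (rule amat_mul[OF r(1) Spin_Suc[OF h(1)] ij])
  also have "... = (\<Sum>k<Suc n. amat (Suc n) r i k * b k j)" by (rule sum.cong) (auto simp: hB)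
  also have "... = A $$ (i, j)" using bp(4)[OF ij] by (simp add: a_def)
  finally show "hi.adm (cl_mult (Suc n) r h) $$ (i, j) = A $$ (i, j)" using ij by (simp add: adm_amat)
 qed (use A in "auto simp: hi.adm_def")
 thus ?case using hi.Spin_mul[OF r(1) Spin_Suc[OF h(1)]] by blast
qed

section \<open>Smooth dependence of the spin coordinates on parameters\<close>

definition csm :: "'m atlas => ('m => nat => real) => 'm => bool" where
 "csm C F x \<longleftrightarrow> (\<forall>k. sm C (%y. F y k) x)"

context
 fixes C :: "'m atlas" and x :: 'm
 assumes C: "smooth_atlas C" and x: "x:mc C"
begin

lemma csm_const: "csm C (%y. v) x"
 by (simp add: csm_def sm_const C x)

lemma csm_mult: "csm C F x ==> csm C H x ==> csm C (%y. cl_mult n (F y) (H y)) x"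
 unfolding csm_def
proof
 fix m assume F: "\<forall>k. sm C (%y. F y k) x" and H: "\<forall>k. sm C (%y. H y k) x"
 have "sm C (%y. \<Sum>j<2 ^ n. cl_sign j (xor j m) * F y j * H y (xor j m)) x"
  by (intro sm_sum[OF C x] sm_mult sm_const[OF C x]) (use F H in auto)
 thus "sm C (%y. cl_mult n (F y) (H y) m) x"
  by (cases "m < 2 ^ n") (simp_all add: clm_alt sm_const C x)
qed

lemma csm_tr: "csm C F x ==> csm C (%y. cl_transpose (F y)) x"
 by (simp add: csm_def clt_alt sm_cmult C)

lemma csm_sum: "(!!i. i:I ==> sm C (%y. c y i) x) ==> csm C (%y k. SUM i:I. c y i * v i k) x"
 unfolding csm_def by (intro allI sm_sum[OF C x] sm_mult sm_const[OF C x]) auto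

lemma csm_lin: "sm C a x ==> sm C b x ==> csm C F x ==> csm C H x ==> csm C (%y. lin (a y) (F y) (b y) (H y)) x"
 unfolding csm_def lin_def by (intro allI sm_add sm_mult) auto

lemma csm_rt:
 assumes v: "csm C v x" "v x (2 ^ n) > - 1"
 shows "csm C (%y. rt n (v y)) x"
proof -
 have vk: "sm C (%y. v y k) x" for k using v(1) by (simp add: csm_def)
 have "sm C (%y. sqrt (2 + 2 * v y (2 ^ n))) x"
  by (intro sm_sqrt[OF C] sm_add sm_const[OF C x] sm_cmult[OF C] vk) (use v(2) in simp)
 hence c: "sm C (%y. 1 / sqrt (2 + 2 * v y (2 ^ n))) x"
  by (intro sm_divide[OF C] sm_const[OF C x]) (use v(2) in auto)
 have h: "csm C (%y. clf.halfway n (v y)) x"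
  unfolding clf.halfway_def by (intro csm_lin c csm_const v(1))
 have "csm C (%y. cl_mult (Suc n) (clf.halfway n (v y)) (cl_gen n)) x"
  by (intro csm_mult h csm_const)
 hence "sm C (%y. cl_mult (Suc n) (clf.halfway n (v y)) (cl_gen n) k) x" for k by (simp add: csm_def)
 thus ?thesis
  unfolding rt_def clf.rotor_def clf.refl2_def csm_def by (intro allI sm_minus[OF C])
qed

lemma sm_amat: "csm C g x ==> sm C (%y. amat n (g y) i j) x"
using csm_mult csm_tr csm_const by (simp add: amat_def clf.act_def csm_def)

lemma csm_spar:
 "(!!k. sm C (%z. y z k) x) ==> y x:pdom n ==> csm C (%z. spar n (y z)) x"
proof (induction n arbitrary: y)
 case 0 thus ?case by (simp add: csm_const)
next
 case (Suc n)
 have 1: "sm C (%z. feu (sdim n) (y z) k) x" for k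
  using Suc.prems(1) by (cases "k < sdim n") (simp_all add: feu_def sm_const C x)
 have 2: "sm C (%z. seu (sdim n) (y z) k) x" for k
  using Suc.prems(1) by (simp add: seu_def)
 have lt: "(\<Sum>i<n. (seu (sdim n) (y x) i)\<^sup>2) < 1" using Suc.prems(2) by simp
 have s: "sm C (%z. sqrt (1 - (\<Sum>i<n. (seu (sdim n) (y z) i)\<^sup>2))) x"
  unfolding power2_eq_square
  by (intro sm_sqrt[OF C] sm_diff[OF C] sm_const[OF C x] sm_sum[OF C x] sm_mult 2)
   (use lt in "simp add: power2_eq_square")
 have "csm C (%z. sph n (seu (sdim n) (y z))) x"
  unfolding sph_def
 proof (rule csm_sum)
  fix i
  show "sm C (%z. if i < n then seu (sdim n) (y z) i
    else sqrt (1 - (\<Sum>i<n. (seu (sdim n) (y z) i)\<^sup>2))) x"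
   by (cases "i < n") (simp_all add: 2 s)
 qed
 moreover have "sph n (seu (sdim n) (y x)) (2 ^ n) > - 1"
  using sph_unit(3)[OF lt] by simp
 ultimately have "csm C (%z. rt n (sph n (seu (sdim n) (y z)))) x" by (rule csm_rt)
 moreover have "csm C (%z. spar n (feu (sdim n) (y z))) x"
  by (rule Suc.IH[OF 1]) (use Suc.prems(2) in simp)
 ultimately show ?case unfolding spar.simps by (rule csm_mult)
qed

lemma sm_sco:
 "(!!i j. i < n ==> j < n ==> sm C (%z. A z i j) x) ==> cok n (A x) ==>
  (\<forall>k. sm C (%z. sco n (A z) k) x) & (ngh C x (%z. cok n (A z)))"
proof (induction n arbitrary: A)
 case 0 thus ?case by (simp add: sm_const C x)
next
 case (Suc n)
 have "csm C (%z. last_col n (A z)) x"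
  unfolding last_col_def by (rule csm_sum) (use Suc.prems(1) in simp)
 moreover have "last_col n (A x) (2 ^ n) > - 1" using Suc.prems(2) by (simp add: last_col_apply)
 ultimately have r: "csm C (%z. rt n (last_col n (A z))) x" by (rule csm_rt)
 have "sm C (%z. reduce n (A z) i j) x" if "j < n" for i j
  unfolding reduce_def by (intro sm_sum[OF C x] sm_mult sm_amat r Suc.prems(1)) (use that in auto)
 hence IH: "\<forall>k. sm C (%z. sco n (reduce n (A z)) k) x" "ngh C x (%z. cok n (reduce n (A z)))"
  using Suc.IH[of "%z. reduce n (A z)"] Suc.prems(2) by auto
 have "sm C (%z. A z n n) x" using Suc.prems(1) by simp
 hence "ngh C x (%z. A z n n:{0<..})" by (rule sm_near[OF C]) (use Suc.prems(2) in auto)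
 with IH(2) have "ngh C x (%z. cok (Suc n) (A z))" by eventually_elim simp
 moreover have "sm C (%z. sco (Suc n) (A z) k) x" for k
 proof (cases "k < sdim n")
  case True thus ?thesis using IH(1) by (simp add: peu_def)
 next
  case False thus ?thesis using Suc.prems(1)
   by (cases "k - sdim n < n") (simp_all add: peu_def sm_const C x)
 qed
 ultimately show ?case by blast
qed

end

subsection \<open>The manifolds \<open>Spin(n)\<close> and \<open>U(1)\<close>\<close>

lemma sa_euclid: "smooth_atlas (euclid_atlas d)"
proof -
 have o: "opE d (eucl d)" using openin_topspace[of "Euclidean_space d"] by simp
 have "smooth_vec d d (%y. y) (eucl d)"
  by (rule smvI[OF o]) (auto intro: sma_coord)
 hence "smooth_vec d d (id \<circ> inv_into (eucl d) id) (eucl d)"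
  by (rule smv_cong[OF o, rotated]) (metis comp_apply f_inv_into_f id_apply image_id)
 thus ?thesis using o by (simp add: smooth_atlas_def euclid_atlas_def)
qed

lemma mc_euclid [simp]: "mc (euclid_atlas d) = eucl d"
 by (simp add: mcarrier_def euclid_atlas_def)

lemma sm_euclid: "sm (euclid_atlas d) f x \<longleftrightarrow> sma d f x"
proof (cases "x:eucl d")
 case True
 have c: "(d, eucl d, id):euclid_atlas d" by (simp add: euclid_atlas_def)
 have ev: "\<forall>\<^sub>F y in enear d x. f (inv_into (eucl d) id y) = f y"
  using openin_topspace[of "Euclidean_space d"] True
  by (auto simp: eventually_nhdsin intro!: exI[of _ "eucl d"] arg_cong[of _ _ f])
 hence ev': "\<forall>\<^sub>F y in enear d x. f y = f (inv_into (eucl d) id y)" by eventually_elim simp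
 show ?thesis unfolding sm_chart[OF sa_euclid c True]
  using sma_cong[OF ev] sma_cong[OF ev'] by auto
next
 case False thus ?thesis using sma_eucl sm_car[of "euclid_atlas d" f x] by auto
qed

lemma opn_euclid: "opn (euclid_atlas d) W \<longleftrightarrow> opE d W"
proof -
 have "id ` (W \<inter> eucl d) = W" if "W \<subseteq> eucl d" using that by auto
 thus ?thesis unfolding openin_mtop[OF sa_euclid] mc_euclid using opn_eucl_subset
  by (auto simp: euclid_atlas_def Int_absorb2)
qed

lemma opn_pdom: "opE (sdim n) (pdom n)"
proof (induction n)
 case 0 thus ?case using openin_topspace[of "Euclidean_space 0"] by simp
next
 case (Suc n)
 have "opE n {z:eucl n. (\<Sum>i<n. (z i)\<^sup>2) < 1}"
 proof -
  have "opn (euclid_atlas n) {z:eucl n. (\<Sum>i<n. (z i)\<^sup>2) < 1}"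
  proof (rule opn_near[OF sa_euclid])
   fix z :: "nat => real" assume z: "z:{z:eucl n. (\<Sum>i<n. (z i)\<^sup>2) < 1}"
   hence ze: "z:mc (euclid_atlas n)" by simp
   have "sm (euclid_atlas n) (%z. \<Sum>i<n. (z i)\<^sup>2) z"
    unfolding power2_eq_square
    by (intro sm_sum[OF sa_euclid ze] sm_mult) (use z in "auto simp: sm_euclid intro: sma_coord")
   hence "ngh (euclid_atlas n) z (%z. (\<Sum>i<n. (z i)\<^sup>2):{..<1})"
    by (rule sm_near[OF sa_euclid]) (use z in auto)
   moreover have "ngh (euclid_atlas n) z (%z. z:eucl n)"
    using ze openin_topspace[of "Euclidean_space n"] by (intro nr_open) (simp_all add: opn_euclid)
   ultimately show "ngh (euclid_atlas n) z (%z. z:{z:eucl n. (\<Sum>i<n. (z i)\<^sup>2) < 1})"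
    by eventually_elim simp
  qed simp
  thus ?thesis by (simp add: opn_euclid)
 qed
 from opn_peu[OF Suc.IH this] show ?case by simp
qed

lemma spin_atlas_ctx: "inj_on id (carrier (Spin n))" "p:carrier (Spin n) ==> id p:eucl (2 ^ n)"
 using clf.Spin_mem by auto

lemma sa_Spin: "smooth_atlas (Spin_atlas n)"
 unfolding Spin_atlas_def by (rule sa_emb[OF spin_atlas_ctx])

context clf
begin

text \<open>Translation by \<open>g0\<close> centres the coordinates at \<open>g0\<close>. The
  formula applies to all \<open>x\<close> of the ambient algebra because charts of
  \<open>embedded_atlas\<close> must extend smoothly.\<close>

definition sch :: "vec => vec => nat => real" where
 "sch g0 x = sco n (amat n (tr g0 \<star> x))"

definition spin_lift :: "vec => vec => nat => real" where
 "spin_lift g0 x = g0 \<star> spar n (sch g0 x)"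

text \<open>Matrix coordinates do not distinguish \<open>g\<close> from \<open>-g\<close>; the
  equation with \<open>spin_lift\<close> selects the sheet of the double cover on which the
  parametrisation returns \<open>g\<close> itself.\<close>

definition snb :: "vec => vec set" where
 "snb g0 = {g:Spn. cok n (amat n (tr g0 \<star> g)) & g = spin_lift g0 g}"

text \<open>The parametrised element and \<open>h\<close> have the same matrix, so they differ by
  the kernel of the double cover.\<close>

lemma spar_amat:
 assumes h: "h:Spn" and ok: "cok n (amat n h)"
 shows "sco n (amat n h):pdom n" "spar n (sco n (amat n h)):Spn"
  "h = spar n (sco n (amat n h)) \<or> h = (%k. - spar n (sco n (amat n h)) k)"
proof -
 define p where "p = spar n (sco n (amat n h))"
 note c = sco_orth[OF ip_amat[OF h] ok]
 show "sco n (amat n h):pdom n" using c by blast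
 thus pS: "p:Spn" unfolding p_def using spar_Spin by blast
 have "adm p = adm h"
  unfolding adm_amat p_def by (rule eq_matI) (use c in auto)
 hence "adm (tr p \<star> h) = 1\<^sub>m n"
  by (simp add: adm_mul Spin_tr pS h adm_tr adm_orth_left flip: \<open>adm p = adm h\<close>)
 hence "tr p \<star> h = cl_one \<or> tr p \<star> h = (%k. - cl_one k)"
  by (rule adm_kernel[OF Spin_mul[OF Spin_tr[OF pS] h]])
 moreover have "p \<star> (tr p \<star> h) = h"
  using mul1l[OF Spin_mem[OF h]] by (simp add: Spin_right[OF pS] flip: mul_assoc)
 moreover have "p \<star> (%k. - cl_one k) = (%k. - p k)"
  using mul_lin_right[of p "- 1" cl_one 0 cl_one] mul1r[OF Spin_mem[OF pS]] by (simp add: lin_def)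
 ultimately show "h = p \<or> h = (%k. - p k)" using mul1r[OF Spin_mem[OF pS]] by metis
qed

lemma mul_tr_cancel: "g0:Spn ==> g:E ==> g0 \<star> (tr g0 \<star> g) = g" "g0:Spn ==> g:E ==> tr g0 \<star> (g0 \<star> g) = g"
 by (simp_all add: Spin_right Spin_left mul1l flip: mul_assoc)

lemma spin_lift_param:
 assumes g0: "g0:Spn" and y: "y:pdom n"
 shows "g0 \<star> spar n y:snb g0" "sch g0 (g0 \<star> spar n y) = y"
by (auto simp: spar_Spin y mul_tr_cancel g0 Spin_mem sch_def snb_def spin_lift_def Spin_mul)

lemma sch_param:
 assumes "g0:Spn" "g:snb g0" shows "sch g0 g:pdom n"
 using assms spar_amat(1)[OF Spin_mul[OF Spin_tr[OF assms(1)]]] by (auto simp: snb_def sch_def)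

lemma sch_inv:
 assumes "g0:Spn" "y:pdom n"
 shows "inv_into (snb g0) (sch g0) y = g0 \<star> spar n y"
proof -
 have "inj_on (sch g0) (snb g0)"
  by (rule inj_on_inverseI[of _ "%y. g0 \<star> spar n y"]) (auto simp: snb_def spin_lift_def)
 from inv_into_f_f[OF this spin_lift_param(1)[OF assms]] show ?thesis by (simp add: spin_lift_param[OF assms])
qed

lemma sch_image: "g0:Spn ==> sch g0 ` snb g0 = pdom n"
 using spin_lift_param sch_param by (auto simp: image_iff) metis

text \<open>Near a point \<open>p\<close> the lift is the identity on \<open>Spin(n)\<close>: up to sign it always is, and the sign
  is detected by a nonzero coordinate of \<open>p\<close>.\<close>

lemma sch_extends:
 assumes g0: "g0:Spn" and p: "p:snb g0"
 shows "ngh (euclid_atlas (2 ^ n)) p (%x. (\<forall>k. sm (euclid_atlas (2 ^ n)) (%x. sch g0 x k) x) &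
  (x:Spn --> x:snb g0))"
proof -
 let ?A = "euclid_atlas (2 ^ n)"
 note A = sa_euclid[of "2 ^ n"]
 have pE: "p:mc ?A" using p Spin_mem by (auto simp: snb_def)
 have ok: "cok n (amat n (tr g0 \<star> p))" and pl: "spin_lift g0 p = p" using p by (auto simp: snb_def)
 have id: "csm ?A (%x. x) x" if "x:E" for x using that by (simp add: csm_def sm_euclid sma_coord)
 have cs: "csm ?A (%x. tr g0 \<star> x) x" if "x:E" for x
  by (intro csm_mult[OF A] csm_const[OF A] id) (use that in auto)
 have am: "sm ?A (%x. amat n (tr g0 \<star> x) i j) x" if "x:E" for x i j
  by (rule sm_amat[OF A _ cs[OF that]]) (use that in simp)
 have sc: "(\<forall>k. sm ?A (%x. sch g0 x k) x) & (ngh ?A x (%z. cok n (amat n (tr g0 \<star> z))))"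
  if "x:E" "cok n (amat n (tr g0 \<star> x))" for x
  unfolding sch_def
  by (rule sm_sco[OF A, where A = "%x. amat n (tr g0 \<star> x)"]) (use that am in auto)
 have "csm ?A (%x. spar n (sch g0 x)) p"
  by (rule csm_spar[OF A pE]) (use sc[of p] pE ok sch_param[OF g0 p] in auto)
 hence "csm ?A (spin_lift g0) p" unfolding spin_lift_def by (intro csm_mult[OF A pE] csm_const[OF A pE])
 hence ls: "sm ?A (%x. spin_lift g0 x k) p" for k by (simp add: csm_def)
 have "\<exists>k. p k \<noteq> 0"
 proof (rule ccontr)
  assume "\<not> ?thesis"
  hence "p = (%k. 0)" by auto
  hence "(p \<star> tr p) 0 = 0" by (simp add: clm_alt)
  thus False using p Spin_right[of p] by (simp add: snb_def cl_one_def)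
 qed
 then obtain k where k: "p k \<noteq> 0" by blast
 have 1: "ngh ?A p (%x. p k * spin_lift g0 x k:{0<..})"
  by (rule sm_near[OF A sm_cmult[OF A ls]]) (use k in "auto simp: pl zero_less_mult_iff linorder_neq_iff")
 have "sm ?A (%x. x k) p" using id[of p] pE by (simp add: csm_def)
 hence 2: "ngh ?A p (%x. p k * x k:{0<..})"
  by (intro sm_near[OF A sm_cmult[OF A]]) (use k in "auto simp: zero_less_mult_iff linorder_neq_iff")
 have 3: "ngh ?A p (%x. cok n (amat n (tr g0 \<star> x)))" using sc[of p] pE ok by simp
 have 4: "ngh ?A p (%x. x:E)"
  by (rule nr_open[OF _ pE[simplified]])
   (use openin_topspace[of "Euclidean_space (2 ^ n)"] in "simp add: opn_euclid")
 from 1 2 3 4 show ?thesis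
 proof eventually_elim
  case (elim x)
  have "x:snb g0" if xS: "x:Spn"
  proof -
   have "tr g0 \<star> x:Spn" by (rule Spin_mul[OF Spin_tr[OF g0] xS])
   note q = spar_amat[OF this elim(3), folded sch_def]
   have "x = spin_lift g0 x \<or> x = (%k. - spin_lift g0 x k)"
   proof -
    have "g0 \<star> (%k. - z k) = (%k. - (g0 \<star> z) k)" for z
     using mul_lin_right[of g0 "- 1" z 0 z] by (simp add: lin_def)
    thus ?thesis using q(3) mul_tr_cancel(1)[OF g0 Spin_mem[OF xS]] unfolding spin_lift_def by metis
   qed
   moreover have "x \<noteq> (%k. - spin_lift g0 x k)"
   proof
    assume "x = (%k. - spin_lift g0 x k)"
    hence "x k = - spin_lift g0 x k" by (rule fun_cong)
    hence "p k * x k = - (p k * spin_lift g0 x k)" by simp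
    thus False using elim(1,2) by (auto simp del: mult_minus_right)
   qed
   ultimately show ?thesis using xS elim(3) by (auto simp: snb_def)
  qed
  thus ?case using sc[OF elim(4,3)] by blast
 qed
qed

lemma sch_mem:
 assumes g0: "g0:Spn"
 shows "(sdim n, snb g0, sch g0):Spin_atlas n"
 unfolding Spin_atlas_def embedded_atlas_def mem_Collect_eq prod.case
proof (intro conjI ballI)
 show "snb g0 \<subseteq> Spn" by (auto simp: snb_def)
 show "inj_on (sch g0) (snb g0)"
  by (rule inj_on_inverseI[of _ "%y. g0 \<star> spar n y"]) (auto simp: snb_def spin_lift_def)
 show "opE (sdim n) (sch g0 ` snb g0)"
  unfolding sch_image[OF g0] by (rule opn_pdom)
 have "smooth_vec (sdim n) (2 ^ n) (%y. g0 \<star> spar n y) (pdom n)"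
 proof (rule smvI[OF opn_pdom mul_mem])
  fix y i assume y: "y:pdom n"
  hence ye: "y:mc (euclid_atlas (sdim n))" using opn_eucl_subset[OF opn_pdom] by auto
  have "csm (euclid_atlas (sdim n)) (%y. spar n y) y"
   by (rule csm_spar[where y = "%y. y", OF sa_euclid ye _ y]) (use ye in "simp add: sm_euclid sma_coord")
  hence "csm (euclid_atlas (sdim n)) (%y. g0 \<star> spar n y) y"
   by (intro csm_mult[OF sa_euclid ye] csm_const[OF sa_euclid ye])
  thus "sma (sdim n) (%y. (g0 \<star> spar n y) i) y" by (simp add: csm_def sm_euclid)
 qed
 hence "smooth_vec (sdim n) (2 ^ n) (id \<circ> inv_into (snb g0) (sch g0)) (pdom n)"
  by (rule smv_cong[OF opn_pdom, rotated]) (simp add: sch_inv[OF g0])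
 thus "smooth_vec (sdim n) (2 ^ n) (id \<circ> inv_into (snb g0) (sch g0)) (sch g0 ` snb g0)"
  unfolding sch_image[OF g0] .
 fix p assume p: "p:snb g0"
 have pE: "p:mc (euclid_atlas (2 ^ n))" using p Spin_mem by (auto simp: snb_def)
 obtain W where W: "opn (euclid_atlas (2 ^ n)) W" "p:W"
  "!!x. x:W ==> (\<forall>k. sm (euclid_atlas (2 ^ n)) (%x. sch g0 x k) x) & (x:Spn --> x:snb g0)"
  using sch_extends[OF g0 p] unfolding nr[OF sa_euclid pE] by blast
 have Wo: "opE (2 ^ n) W" using W(1) by (simp add: opn_euclid)
 have "smooth_vec (2 ^ n) (sdim n) (sch g0) W"
 using smvI Wo sco_eucl W sm_euclid by (simp add: sch_def)
 thus "\<exists>E F. opE (2 ^ n) E & id p:E & smooth_vec (2 ^ n) (sdim n) F E &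
   (ALL q:Spn. id q:E --> q:snb g0 & F (id q) = sch g0 q)"
  using Wo W(2,3) by (intro exI[of _ W] exI[of _ "sch g0"]) auto
qed

end

lemma cok_one: "cok n (%i j. if i = j then 1 else 0)"
 and spar_zero: "(%_. 0):pdom n" "spar n (%_. 0) = cl_one"
proof -
 have z: "feu d (%_. 0) = (%_. 0)" "seu d (%_. 0) = (%_. 0)" for d
  by (auto simp: feu_def seu_def)
 have r1: "rt n (cl_gen n) = cl_one" for n
 proof -
  interpret clf "Suc n" .
  show ?thesis using vec_sq[OF clgv[of n "Suc n"]]
   by (simp add: rt_def rotor_def refl2_def halfway_def mul_lin_left ip_gen) (simp add: lin_def)
 qed
 have s0: "sph n (%_. 0) = cl_gen n" for n
  by (rule vec_eqI[OF sph_unit(1) clgv]) (auto simp: sph_apply)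
 show p: "(%_. 0):pdom n" by (induction n) (auto simp: z euc)
 show q: "spar n (%_. 0) = cl_one" for n
 proof (induction n)
  case (Suc n)
  thus ?case by (simp add: z s0 r1 clf.mul1l[OF clf.one_mem])
 qed simp
 show "cok n (%i j. if i = j then 1 else 0)"
 proof -
  interpret clf n .
  have "cok n (amat n cl_one)" using spar_Spin[OF p] unfolding q by blast
  moreover have "amat n cl_one i j = (if i = j then 1 else 0)" if "i < n" "j < n" for i j
   using that act_one[OF clv_mem[OF clgv[OF that(2)]]] by (simp add: amat_def)
  ultimately show ?thesis using coord_cong[of n "amat n cl_one" "%i j. if i = j then 1 else 0"] by auto
 qed
qed

text \<open>\<open>embedded_atlas\<close> collects all admissible charts but guarantees none; the
  chart \<open>sch g\<close> provides one about each \<open>g\<close>.\<close>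

lemma mc_Spin: "mc (Spin_atlas n) = carrier (Spin n)"
proof
 show "mc (Spin_atlas n) \<subseteq> carrier (Spin n)"
  unfolding Spin_atlas_def by (rule mc_emb_subset[OF spin_atlas_ctx])
 interpret clf n .
 show "carrier (Spin n) \<subseteq> mc (Spin_atlas n)"
 proof
  fix g assume g: "g:carrier (Spin n)"
  have "g:snb g"
   using spin_lift_param(1)[OF g spar_zero(1)] by (simp add: spar_zero mul1r Spin_mem g)
  thus "g:mc (Spin_atlas n)" using sch_mem[OF g] chart_subset by blast
 qed
qed

text \<open>Near the unit matrix an orthogonal family stays in the domain of \<open>sco\<close>, and
  \<open>spar\<close> after \<open>sco\<close> lifts it to the spin group. Both maps depend smoothly
  on the entries.\<close>

lemma spin_section:
 fixes A :: "'m => nat => nat => real"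
 assumes C: "smooth_atlas C" and x: "x:mc C"
  and sA: "!!i j. i < n ==> j < n ==> sm C (%z. A z i j) x"
  and orth: "ngh C x (%z. \<forall>i<n. \<forall>j<n. (\<Sum>k<n. A z k i * A z k j) = (if i = j then 1 else 0))"
  and A1: "!!i j. i < n ==> j < n ==> A x i j = (if i = j then 1 else 0)"
 obtains sig where "csm C sig x" "ngh C x (%z. sig z:carrier (Spin n) & (\<forall>i<n. \<forall>j<n. amat n (sig z) i j = A z i j))"
proof -
 have ok: "cok n (A x)"
  using cok_one[of n] coord_cong[of n "A x" "%i j. if i = j then 1 else 0"] A1 by auto
 have c: "(\<forall>k. sm C (%z. sco n (A z) k) x) & (ngh C x (%z. cok n (A z)))"
  by (rule sm_sco[where A = A, OF C x _ ok]) (rule sA)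
 have o: "sco n (A z):pdom n & (\<forall>i<n. \<forall>j<n. amat n (spar n (sco n (A z))) i j = A z i j)"
  if "\<forall>i<n. \<forall>j<n. (\<Sum>k<n. A z k i * A z k j) = (if i = j then 1 else 0)" "cok n (A z)" for z
  by (rule sco_orth) (use that in auto)
 have "csm C (%z. spar n (sco n (A z))) x"
  by (rule csm_spar[OF C x]) (use c o[of x] ok nr_self[OF orth C x] in auto)
 moreover have "ngh C x (%z. spar n (sco n (A z)):carrier (Spin n) &
   (\<forall>i<n. \<forall>j<n. amat n (spar n (sco n (A z))) i j = A z i j))"
  using orth conjunct2[OF c] by eventually_elim (use o spar_Spin in blast)
 ultimately show thesis by (rule that)
qed

lemma sm_Spin: "g:carrier (Spin n) ==> sm (Spin_atlas n) (%h. h k) g"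
proof -
 assume "g:carrier (Spin n)"
 hence "g:mc (embedded_atlas (2 ^ n) id (carrier (Spin n)))"
  using mc_Spin[of n] unfolding Spin_atlas_def by blast
 from sm_emb[OF spin_atlas_ctx this, of k] show ?thesis unfolding Spin_atlas_def by simp
qed

lemma smap_Spin:
 assumes C: "smooth_atlas C" and x: "x:mc C" and g: "ngh C x (%y. g y:carrier (Spin n))" "csm C g x"
 shows "smap C (Spin_atlas n) g x"
 unfolding Spin_atlas_def
proof (rule smap_emb[OF spin_atlas_ctx C x _ g(1)])
 show "g x:mc (embedded_atlas (2 ^ n) id (carrier (Spin n)))"
  using mc_Spin[of n] nr_self[OF g(1) C x] unfolding Spin_atlas_def by blast
 show "sm C (%y. id (g y) k) x" for k using g(2) by (simp add: csm_def)
qed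

definition cplane :: "complex => nat => real" where
 "cplane z = (%i. if i = 0 then Re z else if i = 1 then Im z else 0)"

lemma U1_atlas_eq: "U1_atlas = embedded_atlas 2 cplane (carrier U1)"
 unfolding U1_atlas_def cplane_def ..

lemma U1_car [simp]: "z:carrier U1 \<longleftrightarrow> cmod z = 1"
 by (simp add: U1_def)

lemma U1_ctx: "inj_on cplane (carrier U1)" "p:carrier U1 ==> cplane p:eucl 2"
 by (auto simp: inj_on_def cplane_def fun_eq_iff complex_eq_iff euc dest: spec[of _ 0] spec[of _ 1])

lemma sa_U1: "smooth_atlas U1_atlas"
 unfolding U1_atlas_eq by (rule sa_emb[OF U1_ctx])

lemma mc_U1: "mc U1_atlas = {z. cmod z = 1}"
proof
 show "mc U1_atlas \<subseteq> {z. cmod z = 1}"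
  unfolding U1_atlas_eq using mc_emb_subset[OF U1_ctx] by auto
 show "{z. cmod z = 1} \<subseteq> mc U1_atlas"
 proof
  fix z0 :: complex assume "z0:{z. cmod z = 1}"
  hence z0: "cmod z0 = 1" by simp
  have zz: "z0 * cnj z0 = 1" "cnj z0 * z0 = 1" using z0 by (simp_all add: complex_norm_square[symmetric] mult.commute)
  \<comment> \<open>After rotating \<open>z0\<close> to \<open>1\<close>, the right half of the
    circle has the imaginary part as coordinate, and the real part is recovered by a square
    root.\<close>
  define W where "W = {z. cmod z = 1 & Re (z * cnj z0) > 0}"
  define ph :: "complex => nat => real" where "ph z = (%i. if i = 0 then Im (z * cnj z0) else 0)" for z
  define D where "D = {y:eucl 1. \<bar>y 0\<bar> < 1}"
  define ps :: "vec => complex" where "ps y = z0 * Complex (sqrt (1 - (y 0)\<^sup>2)) (y 0)" for y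
  have psph: "ps (ph z) = z" if "z:W" for z
  proof -
   define w where "w = z * cnj z0"
   have "cmod w = 1" "Re w > 0" using that z0 by (auto simp: W_def w_def norm_mult)
   hence "1 - (Im w)\<^sup>2 = (Re w)\<^sup>2" by (simp add: cmod_def)
   hence "Complex (sqrt (1 - (Im w)\<^sup>2)) (Im w) = w" using \<open>Re w > 0\<close> by (simp add: complex_eq_iff)
   thus ?thesis using zz by (simp add: ps_def ph_def w_def mult.left_commute)
  qed
  have psD: "ps y:W & ph (ps y) = y" if y: "y:D" for y
  proof -
   have lt: "(y 0)\<^sup>2 < 1" using y by (simp add: D_def abs_square_less_1)
   define w where "w = Complex (sqrt (1 - (y 0)\<^sup>2)) (y 0)"
   have "ps y * cnj z0 = w" using zz by (simp add: ps_def w_def mult.commute mult.left_commute flip: mult.assoc)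
   moreover have "cmod w = 1" using lt by (simp add: w_def cmod_def)
   moreover have "cmod (ps y) = cmod w" using z0 by (simp add: ps_def w_def norm_mult)
   ultimately have a: "Re (ps y * cnj z0) = sqrt (1 - (y 0)\<^sup>2)" "Im (ps y * cnj z0) = y 0" "cmod (ps y) = 1"
    by (simp_all only: w_def complex.sel)
   hence "ps y:W" using lt by (simp only: W_def mem_Collect_eq) simp
   moreover have "ph (ps y) = y" unfolding ph_def a using y by (auto simp: D_def euc fun_eq_iff)
   ultimately show ?thesis ..
  qed
  have phD: "ph z:D" if z: "z:W" for z
  proof -
   define w where "w = z * cnj z0"
   have w: "cmod w = 1" "Re w > 0" using z z0 by (auto simp: W_def w_def norm_mult)
   hence "(Im w)\<^sup>2 = 1 - (Re w)\<^sup>2" by (simp add: cmod_def)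
   hence "(Im w)\<^sup>2 < 1" using w(2) zero_less_power[OF w(2), of 2] by linarith
   thus ?thesis by (simp add: D_def ph_def euc w_def abs_square_less_1)
  qed
  have im: "ph ` W = D"
   using phD psD by (auto simp: image_iff) metis
  have inj: "inj_on ph W" by (rule inj_on_inverseI[of _ ps]) (rule psph)
  have e: "Re z0 * Re z0 + Im z0 * Im z0 = 1" using z0 by (simp add: cmod_def power2_eq_square)
  have Do: "opE 1 D"
  proof (rule opn_eucl_boxI)
   fix x assume x: "x:D"
   show "\<exists>e>0. ALL y:eucl 1. (\<forall>i<1. \<bar>y i - x i\<bar> < e) --> y:D"
    by (rule exI[of _ "1 - \<bar>x 0\<bar>"]) (use x in "auto simp: D_def")
  qed (auto simp: D_def)
  let ?A = "euclid_atlas 1" and ?B = "euclid_atlas 2"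
  have sv: "smooth_vec 1 2 (%y. cplane (ps y)) D"
  proof (rule smvI[OF Do])
   show "cplane (ps y):eucl 2" for y by (simp add: cplane_def euc)
   fix y :: "nat => real" and i :: nat assume y: "y:D"
   hence ye: "y:mc ?A" by (simp add: D_def)
   have y0: "sm ?A (%y. y 0) y" using ye by (simp add: sm_euclid sma_coord)
   have "(y 0)\<^sup>2 < 1" using y by (simp add: D_def abs_square_less_1)
   hence s: "sm ?A (%y. sqrt (1 - (y 0)\<^sup>2)) y"
    unfolding power2_eq_square
    by (intro sm_sqrt[OF sa_euclid] sm_diff[OF sa_euclid] sm_const[OF sa_euclid ye] sm_mult y0) auto
   have "sm ?A (%y. Re (ps y)) y" "sm ?A (%y. Im (ps y)) y"
    unfolding ps_def times_complex.sel complex.sel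
    by (intro sm_diff[OF sa_euclid] sm_add sm_cmult[OF sa_euclid] s y0)+
   hence "sm ?A (%y. cplane (ps y) i) y"
    by (cases "i = 0"; cases "i = 1") (simp_all add: cplane_def sm_const[OF sa_euclid ye] del: One_nat_def)
   thus "sma 1 (%y. cplane (ps y) i) y" by (simp add: sm_euclid)
  qed
  have "(1, W, ph):U1_atlas"
   unfolding U1_atlas_eq embedded_atlas_def mem_Collect_eq prod.case
  proof (intro conjI ballI)
   show "W \<subseteq> carrier U1" by (auto simp: W_def)
   show "inj_on ph W" by (rule inj)
   show "opE 1 (ph ` W)" unfolding im by (rule Do)
   have "inv_into W ph y = ps y" if "y:D" for y using psD[OF that] inv_into_f_f[OF inj] by metis
   thus "smooth_vec 1 2 (cplane \<circ> inv_into W ph) (ph ` W)"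
    unfolding im by (intro smv_cong[OF Do _ sv]) simp
   fix p assume p: "p:W"
   define E where "E = {v:eucl 2. v 0 * Re z0 + v 1 * Im z0:{0<..}}"
   define F :: "vec => nat => real" where "F v = (%i. if i = 0 then v 1 * Re z0 - v 0 * Im z0 else 0)" for v
   have co: "sm ?B (%v. v i) v" if "v:eucl 2" for v i using that by (simp add: sm_euclid sma_coord)
   have ms: "sm ?B (%v. v i * c) v" if "v:eucl 2" for v i c
    by (rule sm_mult[OF co[OF that] sm_const[OF sa_euclid]]) (use that in simp)
   have Eo: "opE 2 E"
    unfolding opn_euclid[symmetric]
   proof (rule opn_near[OF sa_euclid])
    fix v assume v: "v:E"
    have "ngh ?B v (%v. v 0 * Re z0 + v 1 * Im z0:{0<..})"
     by (rule sm_near[OF sa_euclid sm_add[OF ms ms]]) (use v in "auto simp: E_def")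
    moreover have "ngh ?B v (%v. v:eucl 2)"
     using v openin_topspace[of "Euclidean_space 2"] by (intro nr_open) (simp_all add: opn_euclid E_def)
    ultimately show "ngh ?B v (%v. v:E)" by eventually_elim (simp add: E_def)
   qed (auto simp: E_def)
   have "smooth_vec 2 1 F E"
   proof (rule smvI[OF Eo])
    show "F v:eucl 1" for v by (simp add: F_def euc)
    fix v :: "nat => real" and i :: nat assume "v:E" "i < 1"
    thus "sma 2 (%v. F v i) v"
     unfolding F_def sm_euclid[symmetric] by (auto intro!: sm_diff[OF sa_euclid] ms simp: E_def)
   qed
   moreover have "cplane p:E" using p by (simp add: E_def W_def cplane_def euc)
   moreover have "q:W & F (cplane q) = ph q" if "q:carrier U1" "cplane q:E" for q
    using that by (auto simp: W_def E_def F_def ph_def cplane_def algebra_simps)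
   ultimately show "\<exists>E F. opE 2 E & cplane p:E & smooth_vec 2 1 F E &
     (ALL q:carrier U1. cplane q:E --> q:W & F (cplane q) = ph q)"
    using Eo by (intro exI[of _ E] exI[of _ F]) blast
  qed
  moreover have "z0:W" unfolding W_def mem_Collect_eq zz using z0 by simp
  ultimately show "z0:mc U1_atlas" using chart_subset by blast
 qed
qed

lemma sm_U1:
 assumes "cmod z = 1" shows "sm U1_atlas Re z" "sm U1_atlas Im z"
proof -
 have "z:mc (embedded_atlas 2 cplane (carrier U1))" using assms mc_U1 by (simp add: U1_atlas_eq)
 from sm_emb[OF U1_ctx this, of 0] sm_emb[OF U1_ctx this, of 1]
 show "sm U1_atlas Re z" "sm U1_atlas Im z" by (simp_all add: U1_atlas_eq cplane_def)
qed

lemma smap_U1: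
 assumes C: "smooth_atlas C" and x: "x:mc C" and z: "ngh C x (%y. cmod (z y) = 1)"
  and s: "sm C (%y. Re (z y)) x" "sm C (%y. Im (z y)) x"
 shows "smap C U1_atlas z x"
 unfolding U1_atlas_eq
proof (rule smap_emb[OF U1_ctx C x])
 show "z x:mc (embedded_atlas 2 cplane (carrier U1))"
  using nr_self[OF z C x] mc_U1 by (simp add: U1_atlas_eq)
 show "sm C (%y. cplane (z y) k) x" for k
  by (cases "k = 0"; cases "k = 1") (simp_all add: cplane_def s sm_const[OF C x])
 show "ngh C x (%y. z y:carrier U1)" using z by (simp only: U1_car)
qed

subsection \<open>The manifold \<open>Spin\<^sup>c(n)\<close>\<close>

lemma U1_simps: "carrier U1 = {z. cmod z = 1}" "y \<otimes>\<^bsub>U1\<^esub> z = y * z" "\<one>\<^bsub>U1\<^esub> = 1"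
 by (auto simp: U1_def)

lemma U1_group: "Group.group U1"
proof (rule groupI)
 show "EX y:carrier U1. y \<otimes>\<^bsub>U1\<^esub> x = \<one>\<^bsub>U1\<^esub>" if "x:carrier U1" for x
  by (rule bexI[of _ "cnj x"]) (use that complex_norm_square[of x] in "auto simp: U1_def mult.commute")
qed (auto simp: U1_def norm_mult)

abbreviation su :: "nat => (vec \<times> complex) monoid" where
 "su n \<equiv> Spin n \<times>\<times> U1"

definition scls :: "nat => vec \<times> complex => spinc" where
 "scls n p = spinc_kernel #>\<^bsub>su n\<^esub> p"

text \<open>The second representative of the class of \<open>p\<close> in
  \<open>Spin^c\<close>.\<close>

definition pneg :: "vec \<times> complex => vec \<times> complex" where
 "pneg p = ((%k. - fst p k), - snd p)"

lemma su_simps: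
 "carrier (su n) = carrier (Spin n) \<times> {z. cmod z = 1}"
 "p \<otimes>\<^bsub>su n\<^esub> q = (cl_mult n (fst p) (fst q), snd p * snd q)" "\<one>\<^bsub>su n\<^esub> = (cl_one, 1)"
 by (auto simp: DirProd_def U1_def clf.Spin_simps case_prod_unfold)

lemma su_group: "Group.group (su n)"
 by (rule DirProd_group[OF clf.Spin_group U1_group])

lemma neg_one_mul:
 assumes "g:eucl (2 ^ n)"
 shows "cl_mult n (%k. - cl_one k) g = (%k. - g k)" "cl_mult n g (%k. - cl_one k) = (%k. - g k)"
 using clf.mul_lin_left[of n "- 1" cl_one 0 cl_one g] clf.mul_lin_right[of n g "- 1" cl_one 0 cl_one]
  clf.mul1l[OF assms] clf.mul1r[OF assms] by (simp_all add: lin_def)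

lemma scls_eq: "p:carrier (su n) ==> scls n p = {p, pneg p}"
by (auto simp: clf.Spin_mem su_simps scls_def r_coset_def spinc_kernel_def pneg_def neg_one_mul clf.mul1l)

lemma pneg_car: "p:carrier (su n) ==> pneg p:carrier (su n)"
 by (auto simp: su_simps pneg_def clf.Spin_neg)

lemma scls_iff:
 assumes "p:carrier (su n)" "q:carrier (su n)"
 shows "scls n p = scls n q \<longleftrightarrow> q = p \<or> q = pneg p"
proof -
 have "pneg (pneg p) = p" by (simp add: pneg_def)
 thus ?thesis unfolding scls_eq[OF assms(1)] scls_eq[OF assms(2)] by (auto simp: doubleton_eq_iff)
qed

lemma spinc_kernel_normal: "spinc_kernel \<lhd> su n"
proof -
 interpret Group.group "su n" by (rule su_group)
 interpret clf n .
 have m: "(%k. - cl_one k):Spn" by (rule Spin_neg(1)[OF Spin_one])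
 have mm: "cl_mult n (%k. - cl_one k) (%k. - cl_one k) = cl_one" using neg_one_mul[OF Spin_mem[OF m]] by simp
 have inv_m: "inv\<^bsub>su n\<^esub> ((%k. - cl_one k), - 1) = ((%k. - cl_one k), - 1)"
  by (rule inv_equality) (use m mm in "auto simp: clf.Spin_simps U1_simps")
 have "subgroup spinc_kernel (su n)"
 using subgroupI m Spin_one su_simps inv_m inv_one mm mul1l Spin_mem mul1r one_mem by (force simp: spinc_kernel_def)
 moreover have "spinc_kernel #>\<^bsub>su n\<^esub> p = p <#\<^bsub>su n\<^esub> spinc_kernel" if "p:carrier (su n)" for p
 proof -
  have g: "fst p:eucl (2 ^ n)" using that Spin_mem by (auto simp: su_simps)
  show ?thesis unfolding r_coset_def l_coset_def spinc_kernel_def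
   by (auto simp: su_simps neg_one_mul[OF g] mul1l[OF g] mul1r[OF g])
 qed
 ultimately show ?thesis by (simp add: normalI)
qed

lemma Spinc_group: "Group.group (Spinc n)"
 unfolding Spinc_def by (rule normal.factorgroup_is_group[OF spinc_kernel_normal])

lemma Spinc_car: "carrier (Spinc n) = scls n ` carrier (su n)"
 by (auto simp: Spinc_def FactGroup_def RCOSETS_def scls_def)

lemma Spinc_cls_mult:
 "p:carrier (su n) ==> q:carrier (su n) ==>
  scls n p \<otimes>\<^bsub>Spinc n\<^esub> scls n q = scls n (p \<otimes>\<^bsub>su n\<^esub> q)"
 using normal.rcos_sum[OF spinc_kernel_normal] by (simp add: Spinc_def FactGroup_def scls_def)

lemma su_one: "(cl_one, 1):carrier (su n)"
 by (simp add: su_simps clf.Spin_one)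

lemma Spinc_one: "\<one>\<^bsub>Spinc n\<^esub> = scls n (cl_one, 1)"
 unfolding scls_eq[OF su_one] by (simp add: Spinc_def FactGroup_def spinc_kernel_def pneg_def)

lemma Adc_cls: "p:carrier (su n) ==> Adc n (scls n p) = clf.adm n (fst p)"
 by (auto simp: Adc_def scls_eq pneg_def su_simps clf.Ad_eq clf.Spin_neg)

lemma kappa_cls:
 "p:carrier (su n) ==>
  kappa ep ga (scls n p) = scls n (fst p, if ep ga = - 1 then cnj (snd p) else snd p)"
by (auto simp: su_simps kappa_def scls_eq pneg_def case_prod_unfold)

lemma mc_su: "mc (prod_atlas (Spin_atlas n) U1_atlas) = carrier (su n)"
 by (simp add: mc_prod mc_Spin mc_U1 U1_simps)

lemma sa_su: "smooth_atlas (prod_atlas (Spin_atlas n) U1_atlas)"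
 by (rule sa_prod[OF sa_Spin sa_U1])

lemma smap_su_fst_snd:
 assumes "p:carrier (su n)"
 shows "smap (prod_atlas (Spin_atlas n) U1_atlas) (Spin_atlas n) fst p"
  "smap (prod_atlas (Spin_atlas n) U1_atlas) U1_atlas snd p"
  "sm (prod_atlas (Spin_atlas n) U1_atlas) (%q. fst q k) p"
  "sm (prod_atlas (Spin_atlas n) U1_atlas) (%q. Re (snd q)) p"
  "sm (prod_atlas (Spin_atlas n) U1_atlas) (%q. Im (snd q)) p"
proof -
 have p: "p:mc (prod_atlas (Spin_atlas n) U1_atlas)" using assms by (simp add: mc_su)
 note s = smap_fst_snd[OF sa_Spin sa_U1 p]
 show "smap (prod_atlas (Spin_atlas n) U1_atlas) (Spin_atlas n) fst p"
  "smap (prod_atlas (Spin_atlas n) U1_atlas) U1_atlas snd p" by (rule s)+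
 show "sm (prod_atlas (Spin_atlas n) U1_atlas) (%q. fst q k) p"
  "sm (prod_atlas (Spin_atlas n) U1_atlas) (%q. Re (snd q)) p"
  "sm (prod_atlas (Spin_atlas n) U1_atlas) (%q. Im (snd q)) p"
  using smap_sm[OF s(1) sm_Spin] smap_sm[OF s(2) sm_U1(1)] smap_sm[OF s(2) sm_U1(2)] assms
  by (auto simp: su_simps)
qed

lemma near_su: "p:carrier (su n) ==>
  ngh (prod_atlas (Spin_atlas n) U1_atlas) p (%q. q:carrier (su n))"
 using openin_topspace[of "mtop (prod_atlas (Spin_atlas n) U1_atlas)"]
 by (intro nr_open) (simp_all add: sa_su mc_su)

lemma smap_pneg:
 assumes p: "p:carrier (su n)"
 shows "smap (prod_atlas (Spin_atlas n) U1_atlas) (prod_atlas (Spin_atlas n) U1_atlas) pneg p"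
proof -
 let ?P = "prod_atlas (Spin_atlas n) U1_atlas"
 note P = sa_su[of n] and s = smap_su_fst_snd[OF p] and ev = near_su[OF p]
 have pP: "p:mc ?P" using p by (simp add: mc_su)
 have "smap ?P (Spin_atlas n) (%q. %k. - fst q k) p"
 proof (rule smap_Spin[OF P pP])
  show "ngh ?P p (%q. (%k. - fst q k):carrier (Spin n))"
   using ev by eventually_elim (auto simp: su_simps clf.Spin_neg)
  show "csm ?P (%q k. - fst q k) p" unfolding csm_def by (intro allI sm_minus[OF P] s(3))
 qed
 moreover have "smap ?P U1_atlas (%q. - snd q) p"
 proof (rule smap_U1[OF P pP])
  show "ngh ?P p (%q. cmod (- snd q) = 1)" using ev by eventually_elim (auto simp: su_simps)
  show "sm ?P (%q. Re (- snd q)) p" "sm ?P (%q. Im (- snd q)) p"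
   using sm_minus[OF P s(4)] sm_minus[OF P s(5)] by simp_all
 qed
 ultimately show ?thesis unfolding pneg_def by (rule smap_Pair[OF sa_Spin sa_U1 P])
qed

text \<open>With a single index, glueing means dividing by the smooth involution
  \<open>pneg\<close>, the only identification made by \<open>scls\<close>.\<close>

interpretation spinc: glueing "UNIV :: unit set" "%_. prod_atlas (Spin_atlas n) U1_atlas" "%_. scls n" for n
proof
 show "smooth_atlas (prod_atlas (Spin_atlas n) U1_atlas)" by (rule sa_su)
 fix p q assume "p:mc (prod_atlas (Spin_atlas n) U1_atlas)" "q:mc (prod_atlas (Spin_atlas n) U1_atlas)"
  and eq: "scls n p = scls n q"
 hence p: "p:carrier (su n)" and q: "q:carrier (su n)" by (auto simp: mc_su)
 let ?P = "prod_atlas (Spin_atlas n) U1_atlas"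
 consider "q = p" | "q = pneg p" using eq scls_iff[OF p q] by blast
 thus "\<exists>g. smap ?P ?P g p & g p = q & (ngh ?P p (%p'. scls n (g p') = scls n p'))"
 proof cases
  case 1 thus ?thesis using p by (intro exI[of _ "%x. x"]) (simp add: smap_id mc_su)
 next
  case 2
  have "ngh ?P p (%p'. scls n (pneg p') = scls n p')"
   using near_su[OF p] by eventually_elim (use scls_iff pneg_car in blast)
  thus ?thesis using smap_pneg[OF p] 2 by blast
 qed
qed

lemma spinc_glued: "spinc.glued n = Spinc_atlas n"
 unfolding spinc.glued_def Spinc_atlas_def scls_def[symmetric] by simp

lemma sa_Spinc: "smooth_atlas (Spinc_atlas n)"
 using spinc.sa_glued[of n] by (simp add: spinc_glued)

text \<open>Representatives whose circle component has positive inner product with that of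
  \<open>p\<close> form an open set; \<open>pneg\<close> reverses the sign of this inner
  product.\<close>

lemma spinc_linj:
 assumes p: "p:carrier (su n)" shows "spinc.linj n i p"
proof -
 let ?P = "prod_atlas (Spin_atlas n) U1_atlas"
 note P = sa_su[of n]
 define W where "W = {q:carrier (su n). Re (snd q) * Re (snd p) + Im (snd q) * Im (snd p):{0<..}}"
 have "opn ?P W"
 proof (rule opn_near[OF P])
  show "W \<subseteq> mc ?P" by (auto simp: W_def mc_su)
  fix q assume q: "q:W"
  hence q': "q:carrier (su n)" by (simp add: W_def)
  hence qP: "q:mc ?P" by (simp add: mc_su)
  note s = smap_su_fst_snd[OF q']
  have "ngh ?P q (%q. Re (snd q) * Re (snd p) + Im (snd q) * Im (snd p):{0<..})"
   by (rule sm_near[OF P sm_add[OF sm_mult[OF s(4)] sm_mult[OF s(5)]]])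
    (use q in "simp_all add: W_def sm_const[OF P qP]")
  with near_su[OF q'] show "ngh ?P q (%q. q:W)" by eventually_elim (simp add: W_def)
 qed
 moreover have "p:W"
 proof -
  have "(Re (snd p))\<^sup>2 + (Im (snd p))\<^sup>2 = 1" using p by (auto simp: su_simps cmod_def)
  thus ?thesis using p by (simp add: W_def power2_eq_square)
 qed
 moreover have "inj_on (scls n) W"
 proof (rule inj_onI)
  fix q q' assume q: "q:W" "q':W" "scls n q = scls n q'"
  hence "q' = q \<or> q' = pneg q" using scls_iff[of q n q'] by (simp add: W_def)
  thus "q = q'" using q by (auto simp: W_def pneg_def)
 qed
 ultimately show ?thesis unfolding spinc.linj_def by blast
qed

lemma mc_Spinc: "mc (Spinc_atlas n) = carrier (Spinc n)"
 using spinc.mc_glued[of n] spinc_linj by (auto simp: spinc_glued mc_su Spinc_car)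

lemma smap_Spinc:
 assumes C: "smooth_atlas C" and g: "smap C (Spin_atlas n) g x" and z: "smap C U1_atlas z x"
 shows "smap C (Spinc_atlas n) (%y. scls n (g y, z y)) x"
proof -
 have "(g x, z x):carrier (su n)"
  using smap_car(2)[OF g] smap_car(2)[OF z] by (simp add: mc_Spin mc_U1 su_simps)
 from spinc.smap_into_glued[OF UNIV_I spinc_linj[OF this]]
 show ?thesis unfolding spinc_glued
  by (rule smap_comp[OF smap_Pair[OF sa_Spin sa_U1 C g z]])
qed

definition cz :: "nat => complex => spinc" where
 "cz n z = scls n (cl_one, z)"

lemma smap_cz:
 assumes C: "smooth_atlas C" and x: "x:mc C" and z: "ngh C x (%y. cmod (z y) = 1)"
  and s: "sm C (%y. Re (z y)) x" "sm C (%y. Im (z y)) x"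
 shows "smap C (Spinc_atlas n) (%y. cz n (z y)) x"
 unfolding cz_def
 by (rule smap_Spinc[OF C smap_Spin[OF C x _ csm_const[OF C x]] smap_U1[OF C x z s]]) (simp add: clf.Spin_one)

text \<open>Converse of \<open>smap_cz\<close>: near a central class the representative with
  positive scalar spin component is unique and depends smoothly on the class, and its circle
  component is \<open>z\<close>.\<close>

lemma sm_of_smap_cz:
 assumes C: "smooth_atlas C" and z: "ngh C x (%y. cmod (z y) = 1)"
  and s: "smap C (Spinc_atlas n) (%y. cz n (z y)) x"
 shows "sm C (%y. Re (z y)) x" "sm C (%y. Im (z y)) x"
proof -
 let ?P = "prod_atlas (Spin_atlas n) U1_atlas"
 note P = sa_su[of n]
 have x: "x:mc C" by (rule smap_car(1)[OF s])
 have zx: "cmod (z x) = 1" by (rule nr_self[OF z C x])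
 define W where "W = {q:carrier (su n). fst q 0:{0<..}}"
 have WP: "W \<subseteq> mc ?P" by (auto simp: W_def mc_su)
 have Wo: "opn ?P W"
 proof (rule opn_near[OF P WP])
  fix q assume q: "q:W"
  hence q': "q:carrier (su n)" by (simp add: W_def)
  have "ngh ?P q (%q. fst q 0:{0<..})"
   by (rule sm_near[OF P smap_su_fst_snd(3)[OF q']]) (use q in "auto simp: W_def")
  with near_su[OF q'] show "ngh ?P q (%q. q:W)" by eventually_elim (simp add: W_def)
 qed
 have inj: "inj_on (scls n) W"
 proof (rule inj_onI)
  fix q q' assume q: "q:W" "q':W" "scls n q = scls n q'"
  hence "q' = q \<or> q' = pneg q" using scls_iff[of q n q'] by (simp add: W_def)
  thus "q = q'" using q by (auto simp: W_def pneg_def)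
 qed
 have oneW: "(cl_one, w):W" if "cmod w = 1" for w
 proof -
  have "cl_one 0 = 1" by (simp add: cl_one_def)
  thus ?thesis using that by (simp add: W_def U1_simps clf.Spin_one)
 qed
 define L where "L s = snd (inv_into W (scls n) s)" for s
 have Lq: "L (scls n q) = snd q" if "q:W" for q by (simp add: L_def inv_into_f_f[OF inj that])
 have pc: "(cl_one, z x):carrier (su n)" using zx by (simp add: su_simps clf.Spin_one)
 have "smap ?P U1_atlas (%q. L (scls n q)) (cl_one, z x)"
 proof (rule smap_cong[OF P _ smap_su_fst_snd(2)[OF pc]])
  show "ngh ?P (cl_one, z x) (%q. snd q = L (scls n q))"
   using nr_open[OF Wo oneW[OF zx]] by eventually_elim (simp add: Lq)
 qed
 from spinc.smap_from_glued[OF UNIV_I spinc_linj[OF pc], THEN iffD2, OF this]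
 have "smap (Spinc_atlas n) U1_atlas L (cz n (z x))" unfolding spinc_glued cz_def .
 from smap_comp[OF s this] have a: "smap C U1_atlas (%y. L (cz n (z y))) x" .
 have b: "ngh C x (%y. L (cz n (z y)) = z y)"
  using z by eventually_elim (simp add: cz_def Lq oneW)
 have u: "smap C U1_atlas z x" by (rule smap_cong[OF C b a])
 show "sm C (%y. Re (z y)) x" "sm C (%y. Im (z y)) x"
  using smap_sm[OF u sm_U1(1)[OF zx]] smap_sm[OF u sm_U1(2)[OF zx]] .
qed

context glueing
begin

lemma near_glued:
 assumes i: "i:I" and p: "linj i p"
 shows "eventually P (near glued (f i p)) \<longleftrightarrow> (ngh (A i) p (%q. P (f i q)))"
proof
 show "ngh (A i) p (%q. P (f i q))" if "eventually P (near glued (f i p))"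
  by (rule smap_near[OF sa[OF i] sa_glued smap_into_glued[OF i p] that])
next
 assume ev: "ngh (A i) p (%q. P (f i q))"
 let ?h = "%z. if P z then 1 else 0 :: real"
 have "ngh (A i) p (%q. 1 = ?h (f i q))" using ev by eventually_elim simp
 hence "sm (A i) (%q. ?h (f i q)) p"
  by (rule sm_cong[OF sa[OF i]]) (rule sm_const[OF sa[OF i] linj_car[OF i p]])
 hence "sm glued ?h (f i p)" using sm_glued[OF i p, of ?h] by blast
 moreover have "P (f i p)" using nr_self[OF ev sa[OF i] linj_car[OF i p]] .
 ultimately have "ngh glued (f i p) (%z. ?h z:{0<..})" by (intro sm_near[OF sa_glued]) auto
 thus "eventually P (near glued (f i p))" by eventually_elim (auto split: if_splits)
qed

lemma smap_glued_inverse: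
 assumes i: "i:I" and inj: "inj_on (f i) (mc (A i))" and p: "p:mc (A i)"
 shows "linj i p" "smap glued (A i) (inv_into (mc (A i)) (f i)) (f i p)"
  "ngh glued (f i p) (%z. z:f i ` mc (A i))"
proof -
 have o: "opn (A i) (mc (A i))" using openin_topspace[of "mtop (A i)"] sa[OF i] by simp
 thus l: "linj i p" using inj p by (auto simp: linj_def)
 have ev: "ngh (A i) p (%q. q:mc (A i))" by (rule nr_open[OF o p])
 have "smap (A i) (A i) (%q. inv_into (mc (A i)) (f i) (f i q)) p"
 proof (rule smap_cong[OF sa[OF i] _ smap_id[OF p]])
  show "ngh (A i) p (%q. q = inv_into (mc (A i)) (f i) (f i q))"
   using ev by eventually_elim (simp add: inv_into_f_f[OF inj])
 qed
 thus "smap glued (A i) (inv_into (mc (A i)) (f i)) (f i p)"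
  using smap_from_glued[OF i l, THEN iffD2] by blast
 show "ngh glued (f i p) (%z. z:f i ` mc (A i))"
  unfolding near_glued[OF i l] using ev by eventually_elim simp
qed

end

subsection \<open>The manifold \<open>SO(n)\<close>\<close>

definition mat_coord :: "nat => real mat => nat => real" where
 "mat_coord n A k = (if k < n * n then A $$ (k div n, k mod n) else 0)"

lemma SO_atlas_eq: "SO_atlas n = embedded_atlas (n * n) (mat_coord n) (carrier (SO n))"
 unfolding SO_atlas_def mat_coord_def ..

lemma SO_iff: "A:carrier (SO n) \<longleftrightarrow> A:carrier_mat n n & A * transpose_mat A = 1\<^sub>m n & Determinant.det A = 1"
 by (simp add: SO_def)

lemma mat_coord_entry: "i < n ==> j < n ==> mat_coord n A (i * n + j) = A $$ (i, j)"
proof -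
 assume ij: "i < n" "j < n"
 have "i * n + j < Suc i * n" using ij by simp
 also have "... \<le> n * n" using ij by (intro mult_right_mono) auto
 finally show ?thesis using ij by (simp add: mat_coord_def)
qed

lemma SO_ctx: "inj_on (mat_coord n) (carrier (SO n))" "A:carrier (SO n) ==> mat_coord n A:eucl (n * n)"
proof -
 show "inj_on (mat_coord n) (carrier (SO n))"
 proof (rule inj_onI)
  fix A B assume A: "A:carrier (SO n)" and B: "B:carrier (SO n)" and eq: "mat_coord n A = mat_coord n B"
  show "A = B"
   by (rule eq_matI) (use A B mat_coord_entry[of _ n _ A] mat_coord_entry[of _ n _ B] eq in "auto simp: SO_iff")
 qed
qed (simp add: mat_coord_def euc)

lemma sa_SO: "smooth_atlas (SO_atlas n)"
 unfolding SO_atlas_eq by (rule sa_emb[OF SO_ctx])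

lemma mc_SO: "mc (SO_atlas n) \<subseteq> carrier (SO n)"
 unfolding SO_atlas_eq by (rule mc_emb_subset[OF SO_ctx])

lemma sm_SO:
 assumes "A:mc (SO_atlas n)" "i < n" "j < n"
 shows "sm (SO_atlas n) (%A. A $$ (i, j)) A"
 using sm_emb[OF SO_ctx[where n = n], where k = "i * n + j" and p = A] assms by (simp add: mat_coord_entry SO_atlas_eq)

lemma smap_SO:
 assumes C: "smooth_atlas C" and x: "x:mc C" and fx: "f x:mc (SO_atlas n)"
  and ev: "ngh C x (%y. f y:carrier (SO n))"
  and co: "!!i j. i < n ==> j < n ==> sm C (%y. f y $$ (i, j)) x"
 shows "smap C (SO_atlas n) f x"
 unfolding SO_atlas_eq
proof (rule smap_emb[OF SO_ctx C x _ ev])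
 show "f x:mc (embedded_atlas (n * n) (mat_coord n) (carrier (SO n)))" using fx by (simp add: SO_atlas_eq)
 fix k assume k: "k < n * n"
 hence "n > 0" by (cases n) auto
 hence "k div n < n" "k mod n < n" using k by (auto simp: less_mult_imp_div_less)
 thus "sm C (%y. mat_coord n (f y) k) x" using co k by (simp add: mat_coord_def)
qed

lemma SO_transpose: "A:carrier (SO n) ==> transpose_mat A * A = 1\<^sub>m n"
 by (rule mat_mult_left_right_inverse[of A n "transpose_mat A"]) (auto simp: SO_iff)

lemma SO_mult: "A:carrier (SO n) ==> B:carrier (SO n) ==> A * B:carrier (SO n)"
proof -
 assume A: "A:carrier (SO n)" and B: "B:carrier (SO n)"
 have c: "A:carrier_mat n n" "B:carrier_mat n n" using A B by (auto simp: SO_iff)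
 have "A * B * transpose_mat (A * B) = A * B * (transpose_mat B * transpose_mat A)" using c by (simp add: transpose_mult[of A n n B n])
 also have "... = A * (B * (transpose_mat B * transpose_mat A))" by (rule assoc_mult_mat) (use c in auto)
 also have "B * (transpose_mat B * transpose_mat A) = B * transpose_mat B * transpose_mat A"
  by (rule assoc_mult_mat[symmetric]) (use c in auto)
 also have "... = transpose_mat A" using B c by (simp add: SO_iff left_mult_one_mat[of _ n n])
 finally show ?thesis using A B c by (simp add: SO_iff det_mult[of _ n])
qed

lemma SO_transpose_mem: "A:carrier (SO n) ==> transpose_mat A:carrier (SO n)"
 using SO_transpose[of A n] by (auto simp: SO_iff det_transpose)

subsection \<open>Frames\<close>

locale orb =
 fixes M :: "'x atlas" and n :: nat and V :: "('v, 'x, 'g) vbundle"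
 assumes smM: "smooth_atlas M"
  and vb: "oriented_vector_bundle M n V" and metric: "fibre_metric M V"
begin

definition cvec :: "real mat => nat => nat => real" where
 "cvec B j = (%i. if i < n then B $$ (i, j) else 0)"

lemma cvec_eucl: "cvec B j:eucl n"
 by (simp add: cvec_def euc)

definition triv :: "'x => (vec => 'v) => bool" where
 "triv x t \<longleftrightarrow> inj_on t (eucl n) & t (%i. 0) = vzero V x & t ` eucl n \<subseteq> vfibre V x &
  (ALL a:eucl n. ALL b:eucl n. t (%i. a i + b i) = vadd V (t a) (t b)) &
  (ALL a:eucl n. \<forall>r. t (%i. r * a i) = vscale V r (t a)) &
  vorient V x = {(\<lambda>j\<in>{..<n}. t (cvec B j)) | B. B:carrier_mat n n & Determinant.det B > 0}"

lemma triv_exists: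
 assumes x: "x:mc M" shows "\<exists>t. triv x t"
proof -
 obtain U ta where U: "opn M U" "x:U"
  and d: "diffeo (prod_atlas (restrict_atlas M U) (euclid_atlas n))
     (restrict_atlas (vtot V) {v:mc (vtot V). vproj V v:U}) ta"
  and l: "ALL y:U. ta (y, %i. 0) = vzero V y &
     (ALL a:eucl n. vproj V (ta (y, a)) = y &
       (ALL b:eucl n. ta (y, %i. a i + b i) = vadd V (ta (y, a)) (ta (y, b))) &
       (\<forall>r. ta (y, %i. r * a i) = vscale V r (ta (y, a)))) &
     vorient V y =
      {(\<lambda>j\<in>{..<n}. ta (y, %i. if i < n then B $$ (i, j) else 0)) | B.
        B:carrier_mat n n & Determinant.det B > 0}"
  using vb[unfolded oriented_vector_bundle_def topspace_eucl, THEN conjunct2, THEN conjunct2, THEN bspec, OF x] by blast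
 have bij: "bij_betw ta ((mc M \<inter> U) \<times> eucl n) (mc (vtot V) \<inter> {v:mc (vtot V). vproj V v:U})"
  using d by (simp add: diffeo_def mc_prod mc_rst)
 have "inj_on (%a. ta (x, a)) (eucl n)"
  using bij x U(2) by (auto simp: bij_betw_def inj_on_def)
 moreover have "(%a. ta (x, a)) ` eucl n \<subseteq> vfibre V x"
  using bij_betwE[OF bij] x U(2) l by (auto simp: vfibre_def)
 ultimately have "triv x (%a. ta (x, a))" using l U(2) unfolding triv_def cvec_def by blast
 thus ?thesis by blast
qed

lemma fibre_metricD:
 assumes "x:mc M" "u:vfibre V x" "v:vfibre V x"
 shows "vinner V u v = vinner V v u" "w:vfibre V x ==> vinner V (vadd V u v) w = vinner V u w + vinner V v w"
  "vinner V (vscale V r u) v = r * vinner V u v"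
 using metric assms unfolding fibre_metric_def by blast+

context
 fixes x t assumes x: "x:mc M" and t: "triv x t"
begin

lemma triv_fibre: "a:eucl n ==> t a:vfibre V x" using t unfolding triv_def by blast
lemma triv_zero: "t (%i. 0) = vzero V x" using t unfolding triv_def by blast
lemma triv_add: "a:eucl n ==> b:eucl n ==> t (%i. a i + b i) = vadd V (t a) (t b)" using t unfolding triv_def by blast
lemma triv_scale: "a:eucl n ==> t (%i. r * a i) = vscale V r (t a)" using t unfolding triv_def by blast
lemma triv_orient: "vorient V x = {(\<lambda>j\<in>{..<n}. t (cvec B j)) | B. B:carrier_mat n n & Determinant.det B > 0}"
 using t unfolding triv_def by blast

lemma lincomb_triv:
 assumes e: "!!j. j < n ==> e j = t (b j)" "!!j. j < n ==> b j:eucl n"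
 shows "lincomb n V x c e = t (%i. \<Sum>j<n. c j * b j i)"
proof -
 have "foldr (%i w. vadd V (vscale V (c i) (e i)) w) js (vzero V x) = t (%i. \<Sum>j\<leftarrow>js. c j * b j i) &
   (%i. \<Sum>j\<leftarrow>js. c j * b j i):eucl n" if "set js \<subseteq> {..<n}" for js
  using that
 proof (induction js)
  case Nil thus ?case by (simp add: triv_zero euc)
 next
  case (Cons j js)
  hence j: "j < n" and js: "set js \<subseteq> {..<n}" by auto
  have cb: "(%i. c j * b j i):eucl n" using e(2)[OF j] by (simp add: euc)
  have "vadd V (vscale V (c j) (e j)) (t (%i. \<Sum>j\<leftarrow>js. c j * b j i)) = t (%i. c j * b j i + (\<Sum>j\<leftarrow>js. c j * b j i))"
   using triv_add[OF cb, of "%i. \<Sum>j\<leftarrow>js. c j * b j i"] Cons.IH[OF js] triv_scale[OF e(2)[OF j]] e(1)[OF j] by simp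
  thus ?case using Cons.IH[OF js] cb by (simp add: euc)
 qed
 from this[of "[0..<n]"] show ?thesis
  by (simp add: lincomb_def interv_sum_list_conv_sum_set_nat atLeast0LessThan)
qed

lemma frame_ract_triv:
 assumes B: "B:carrier_mat n n" and A: "A:carrier_mat n n"
 shows "frame_ract n V (x, \<lambda>j\<in>{..<n}. t (cvec B j)) A = (x, \<lambda>j\<in>{..<n}. t (cvec (B * A) j))"
proof -
 have "lincomb n V x (%i. A $$ (i, j)) (\<lambda>j\<in>{..<n}. t (cvec B j)) = t (cvec (B * A) j)" if j: "j < n" for j
 proof -
  have "lincomb n V x (%i. A $$ (i, j)) (\<lambda>j\<in>{..<n}. t (cvec B j)) = t (%i. \<Sum>k<n. A $$ (k, j) * cvec B k i)"
   by (rule lincomb_triv) (auto simp: cvec_eucl)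
  also have "(%i. \<Sum>k<n. A $$ (k, j) * cvec B k i) = cvec (B * A) j"
   using A B j by (auto simp: cvec_def fun_eq_iff scalar_prod_def atLeast0LessThan mult.commute intro!: sum.cong)
  finally show ?thesis .
 qed
 thus ?thesis by (auto simp: frame_ract_def fun_eq_iff)
qed

lemma vinner_lincomb:
 assumes e: "!!j. j < n ==> e j:t ` eucl n" and w: "w:vfibre V x"
 shows "vinner V (lincomb n V x c e) w = (\<Sum>j<n. c j * vinner V (e j) w)"
proof -
 obtain b where b: "!!j. j < n ==> e j = t (b j)" "!!j. j < n ==> b j:eucl n" using e by (simp add: image_iff) metis
 have z: "vinner V (vzero V x) w = 0"
  using fibre_metricD(3)[OF x triv_fibre w, of "%i. 0" 0] triv_scale[of "%i. 0" 0] by (simp add: triv_zero euc)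
 have "foldr (%i w. vadd V (vscale V (c i) (e i)) w) js (vzero V x):vfibre V x &
   vinner V (foldr (%i w. vadd V (vscale V (c i) (e i)) w) js (vzero V x)) w = (\<Sum>j\<leftarrow>js. c j * vinner V (e j) w) &
   foldr (%i w. vadd V (vscale V (c i) (e i)) w) js (vzero V x):t ` eucl n" if "set js \<subseteq> {..<n}" for js
  using that
 proof (induction js)
  case Nil
  have z': "(%i. 0):eucl n" by (simp add: euc)
  show ?case using z triv_fibre[OF z'] imageI[OF z', of t] by (simp add: triv_zero)
 next
  case (Cons j js)
  let ?f = "foldr (%i w. vadd V (vscale V (c i) (e i)) w) js (vzero V x)"
  have j: "j < n" and IH: "?f:vfibre V x" "vinner V ?f w = (\<Sum>j\<leftarrow>js. c j * vinner V (e j) w)" "?f:t ` eucl n"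
   using Cons by auto
  obtain a where a: "a:eucl n" "?f = t a" using IH(3) by auto
  have cb: "(%i. c j * b j i):eucl n" using b(2)[OF j] by (simp add: euc)
  have s: "vscale V (c j) (e j) = t (%i. c j * b j i)" using triv_scale[OF b(2)[OF j]] b(1)[OF j] by simp
  have "vadd V (vscale V (c j) (e j)) ?f = t (%i. c j * b j i + a i)" using triv_add[OF cb a(1)] a(2) s by simp
  moreover have ab: "(%i. c j * b j i + a i):eucl n" using cb a by (simp add: euc)
  moreover have "vinner V (vscale V (c j) (e j)) w = c j * vinner V (e j) w"
   unfolding b(1)[OF j] by (rule fibre_metricD(3)[OF x triv_fibre[OF b(2)[OF j]] w])
  hence "vinner V (vadd V (vscale V (c j) (e j)) ?f) w = c j * vinner V (e j) w + vinner V ?f w"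
   using fibre_metricD(2)[OF x triv_fibre[OF cb] IH(1) w] unfolding s[symmetric] by simp
  ultimately show ?case using IH(2) triv_fibre[OF ab] by simp
 qed
 from this[of "[0..<n]"] show ?thesis
  by (simp add: lincomb_def interv_sum_list_conv_sum_set_nat atLeast0LessThan)
qed

end

lemma frameE:
 assumes "(x, e):frames M n V" "triv x t"
 obtains B where "B:carrier_mat n n" "Determinant.det B > 0" "e = (\<lambda>j\<in>{..<n}. t (cvec B j))"
 using assms triv_orient[of x t] by (auto simp: frames_def)

text \<open>An orthonormal frame returns the entries of \<open>A\<close> as inner products. This
  yields freeness of the right action, and it makes transition matrices between local frames smooth
  because the metric is.\<close>

lemma frame_ract_vinner:
 assumes p: "(x, e):frames M n V" and A: "A:carrier_mat n n" and ij: "i < n" "j < n"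
 shows "vinner V (e i) (snd (frame_ract n V (x, e) A) j) = A $$ (i, j)"
proof -
 have x: "x:mc M" and on: "!!i j. i < n ==> j < n ==> vinner V (e i) (e j) = (if i = j then 1 else 0)"
  using p by (auto simp: frames_def)
 obtain t where t: "triv x t" using triv_exists[OF x] by blast
 obtain B where B: "B:carrier_mat n n" "e = (\<lambda>j\<in>{..<n}. t (cvec B j))" by (rule frameE[OF p t])
 have ei: "e k:t ` eucl n" "e k:vfibre V x" if "k < n" for k
  using that B(2) cvec_eucl triv_fibre[OF x t] by auto
 have r: "snd (frame_ract n V (x, e) A) j:vfibre V x"
  unfolding B(2) frame_ract_triv[OF x t B(1) A] using ij triv_fibre[OF x t cvec_eucl] by simp
 have "vinner V (e i) (snd (frame_ract n V (x, e) A) j) = vinner V (snd (frame_ract n V (x, e) A) j) (e i)"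
  by (rule fibre_metricD(1)[OF x ei(2)[OF ij(1)] r])
 also have "... = vinner V (lincomb n V x (%i. A $$ (i, j)) e) (e i)" using ij by (simp add: frame_ract_def)
 also have "... = (\<Sum>k<n. A $$ (k, j) * vinner V (e k) (e i))"
  by (rule vinner_lincomb[OF x t]) (use ei ij in auto)
 also have "... = (\<Sum>k<n. (if k = i then 1 else 0) * A $$ (k, j))" by (rule sum.cong) (auto simp: on ij)
 finally show ?thesis using ij by (simp add: sum_delta_mult)
qed

lemma frame_ract_inj:
 assumes p: "p:frames M n V" and A: "A:carrier_mat n n" "B:carrier_mat n n"
  and eq: "frame_ract n V p A = frame_ract n V p B"
 shows "A = B"
proof (rule eq_matI)
 obtain x e where xe: "p = (x, e)" by (cases p)
 fix i j assume "i < dim_row B" "j < dim_col B"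
 hence ij: "i < n" "j < n" using A by auto
 show "A $$ (i, j) = B $$ (i, j)"
  using frame_ract_vinner[of x e A i j] frame_ract_vinner[of x e B i j] p A eq ij by (simp add: xe)
qed (use A in auto)

lemma frame_ract_assoc:
 assumes p: "p:frames M n V" and A: "A:carrier_mat n n" "B:carrier_mat n n"
 shows "frame_ract n V (frame_ract n V p A) B = frame_ract n V p (A * B)"
proof -
 obtain x e where xe: "p = (x, e)" by (cases p)
 have x: "x:mc M" using p by (auto simp: frames_def xe)
 obtain t where t: "triv x t" using triv_exists[OF x] by blast
 obtain C where C: "C:carrier_mat n n" "e = (\<lambda>j\<in>{..<n}. t (cvec C j))"
  using frameE[OF _ t] p unfolding xe by blast
 have "C * A:carrier_mat n n" "A * B:carrier_mat n n" using C A by auto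
 thus ?thesis unfolding xe C(2)
  by (simp add: frame_ract_triv[OF x t] C(1) A assoc_mult_mat[OF C(1) A])
qed

lemma frame_ract_one:
 assumes p: "p:frames M n V" shows "frame_ract n V p (1\<^sub>m n) = p"
proof -
 obtain x e where xe: "p = (x, e)" by (cases p)
 have x: "x:mc M" using p by (auto simp: frames_def xe)
 obtain t where t: "triv x t" using triv_exists[OF x] by blast
 obtain C where C: "C:carrier_mat n n" "e = (\<lambda>j\<in>{..<n}. t (cvec C j))"
  using frameE[OF _ t] p unfolding xe by blast
 show ?thesis unfolding xe C(2) using C(1) by (simp add: frame_ract_triv[OF x t C(1)])
qed

lemma frame_ract_gram:
 assumes p: "(x, e):frames M n V" and A: "A:carrier_mat n n" and ij: "i < n" "j < n"
 shows "vinner V (snd (frame_ract n V (x, e) A) i) (snd (frame_ract n V (x, e) A) j) = (transpose_mat A * A) $$ (i, j)"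
proof -
 have x: "x:mc M" using p by (auto simp: frames_def)
 obtain t where t: "triv x t" using triv_exists[OF x] by blast
 obtain B where B: "B:carrier_mat n n" "e = (\<lambda>j\<in>{..<n}. t (cvec B j))" by (rule frameE[OF p t])
 have ei: "e k:t ` eucl n" if "k < n" for k using that B(2) cvec_eucl by auto
 have r: "snd (frame_ract n V (x, e) A) j:vfibre V x"
  unfolding B(2) frame_ract_triv[OF x t B(1) A] using ij triv_fibre[OF x t cvec_eucl] by simp
 have "snd (frame_ract n V (x, e) A) i = lincomb n V x (%k. A $$ (k, i)) e" using ij by (simp add: frame_ract_def)
 hence "vinner V (snd (frame_ract n V (x, e) A) i) (snd (frame_ract n V (x, e) A) j) =
   (\<Sum>k<n. A $$ (k, i) * vinner V (e k) (snd (frame_ract n V (x, e) A) j))"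
  using vinner_lincomb[OF x t ei r] by simp
 also have "... = (\<Sum>k<n. A $$ (k, i) * A $$ (k, j))"
  by (rule sum.cong) (use frame_ract_vinner[OF p A] ij in auto)
 finally show ?thesis using A ij by (simp add: scalar_prod_def atLeast0LessThan)
qed

lemma frame_ract_mem:
 assumes p: "p:frames M n V" and A: "A:carrier (SO n)"
 shows "frame_ract n V p A:frames M n V"
proof -
 obtain x e where xe: "p = (x, e)" by (cases p)
 have p': "(x, e):frames M n V" using p by (simp add: xe)
 have x: "x:mc M" using p' by (auto simp: frames_def)
 have Ac: "A:carrier_mat n n" "Determinant.det A = 1" using A by (auto simp: SO_iff)
 obtain t where t: "triv x t" using triv_exists[OF x] by blast
 obtain B where B: "B:carrier_mat n n" "Determinant.det B > 0" "e = (\<lambda>j\<in>{..<n}. t (cvec B j))" by (rule frameE[OF p' t])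
 have f: "frame_ract n V p A = (x, \<lambda>j\<in>{..<n}. t (cvec (B * A) j))"
  unfolding xe B(3) by (rule frame_ract_triv[OF x t B(1) Ac(1)])
 have "B * A:carrier_mat n n" "Determinant.det (B * A) > 0" using B Ac by (auto simp: det_mult[of _ n])
 hence "snd (frame_ract n V p A):vorient V x" unfolding f triv_orient[OF x t] by auto
 moreover have "vinner V (snd (frame_ract n V p A) i) (snd (frame_ract n V p A) j) = (if i = j then 1 else 0)"
  if "i < n" "j < n" for i j
  using frame_ract_gram[OF p' Ac(1) that] SO_transpose[OF A] that by (simp add: xe)
 ultimately show ?thesis using x by (simp add: f frames_def)
qed

text \<open>In a trivialisation the frames are matrices \<open>B\<close> and \<open>C\<close>, and
  \<open>A = B^-1 C\<close>. Orthonormality of both frames makes \<open>A\<close> orthogonal; the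
  positive determinants of \<open>B\<close> and \<open>C\<close> leave only determinant
  \<open>1\<close>.\<close>

lemma frames_trs:
 assumes p: "(x, e):frames M n V" and q: "(x, f):frames M n V"
 obtains A where "A:carrier (SO n)" "(x, f) = frame_ract n V (x, e) A"
  "\<forall>i<n. \<forall>j<n. A $$ (i, j) = vinner V (e i) (f j)"
proof -
 have x: "x:mc M" using p by (auto simp: frames_def)
 obtain t where t: "triv x t" using triv_exists[OF x] by blast
 obtain B where B: "B:carrier_mat n n" "Determinant.det B > 0" "e = (\<lambda>j\<in>{..<n}. t (cvec B j))" by (rule frameE[OF p t])
 obtain C where C: "C:carrier_mat n n" "Determinant.det C > 0" "f = (\<lambda>j\<in>{..<n}. t (cvec C j))" by (rule frameE[OF q t])
 obtain B' where B': "B':carrier_mat n n" "B * B' = 1\<^sub>m n" "B' * B = 1\<^sub>m n"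
  using det_non_zero_imp_unit[OF B(1)] B(2) unfolding Units_def ring_mat_def by auto
 define A where "A = B' * C"
 have Ac: "A:carrier_mat n n" using B' C by (simp add: A_def)
 have "B * A = C" unfolding A_def using assoc_mult_mat[OF B(1) B'(1) C(1)] B'(2) C(1) by simp
 hence f: "(x, f) = frame_ract n V (x, e) A" unfolding B(3) C(3) by (simp add: frame_ract_triv[OF x t B(1) Ac])
 have "transpose_mat A * A = 1\<^sub>m n"
 proof (rule eq_matI)
  fix i j assume "i < dim_row (1\<^sub>m n :: real mat)" "j < dim_col (1\<^sub>m n :: real mat)"
  hence ij: "i < n" "j < n" by auto
  have "(transpose_mat A * A) $$ (i, j) = vinner V (f i) (f j)"
   using frame_ract_gram[OF p Ac ij] by (simp flip: f)
  thus "(transpose_mat A * A) $$ (i, j) = 1\<^sub>m n $$ (i, j)" using q ij by (simp add: frames_def)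
 qed (use Ac in auto)
 hence AA: "A * transpose_mat A = 1\<^sub>m n" by (rule mat_mult_left_right_inverse[rotated 2]) (use Ac in auto)
 have "Determinant.det A * Determinant.det A = Determinant.det (A * transpose_mat A)"
  using Ac by (simp add: det_mult[of _ n] det_transpose)
 hence "Determinant.det A = 1 \<or> Determinant.det A = - 1"
  unfolding AA by (simp flip: power2_eq_square add: power2_eq_1_iff)
 moreover have "Determinant.det B * Determinant.det A > 0"
  using \<open>B * A = C\<close> C(2) det_mult[OF B(1) Ac] by simp
 ultimately have "Determinant.det A = 1" using B(2) by (auto simp: zero_less_mult_iff)
 hence "A:carrier (SO n)" using Ac AA by (simp add: SO_iff)
 thus thesis
  by (rule that[OF _ f]) (use frame_ract_vinner[OF p Ac] in "simp flip: f")
qed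

subsection \<open>The frame bundle\<close>

definition lframes :: "('x set \<times> (nat => 'x => 'v)) set" where
 "lframes = {(U, s). local_frame M n V U s}"

abbreviation fat :: "'x set \<times> (nat => 'x => 'v) => 'x => 'x \<times> (nat => 'v)" where
 "fat l x \<equiv> (x, \<lambda>i\<in>{..<n}. snd l i x)"

abbreviation latlas :: "'x set \<times> (nat => 'x => 'v) => ('x \<times> real mat) atlas" where
 "latlas l \<equiv> prod_atlas (restrict_atlas M (fst l)) (SO_atlas n)"

abbreviation lmap :: "'x set \<times> (nat => 'x => 'v) => 'x \<times> real mat => 'x \<times> (nat => 'v)" where
 "lmap l \<equiv> (%(x, A). frame_ract n V (fat l x) A)"

lemma lframe_open: "l:lframes ==> opn M (fst l)"
 and lframe_mem: "l:lframes ==> x:fst l ==> fat l x:frames M n V"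
 by (auto simp: lframes_def local_frame_def)

lemma fst_frame_ract [simp]: "fst (frame_ract n V p A) = fst p"
 by (cases p) (simp add: frame_ract_def)

lemma lframe_inner:
 assumes l: "l:lframes" and l': "l':lframes" and x: "x:fst l \<inter> fst l'" and ij: "i < n" "j < n"
 shows "sm M (%y. vinner V (snd l i y) (snd l' j y)) x"
proof -
 let ?U = "fst l \<inter> fst l'"
 note o = lframe_open[OF l] lframe_open[OF l']
 have oU: "opn M ?U" using o by blast
 have vV: "smooth_atlas (vtot V)" using vb by (auto simp: oriented_vector_bundle_def smooth_manifold_def)
 have "smooth_section M V ?U s" if s: "smooth_section M V U s" and U: "opn M U" "?U \<subseteq> U" for s U
  using s U(2) unfolding smooth_section_def smm_iff[OF sa_rst[OF smM U(1)] vV]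
   smm_iff[OF sa_rst[OF smM oU] vV]
  by (auto simp: smap_rst_left[OF smM U(1)] smap_rst_left[OF smM oU] mc_rst)
 hence "smooth_section M V ?U (snd l i)" "smooth_section M V ?U (snd l' j)"
  using l l' ij o by (auto simp: lframes_def local_frame_def)
 hence "smooth_fun (restrict_atlas M ?U) (%y. vinner V (snd l i y) (snd l' j y))"
  using metric oU unfolding fibre_metric_def by blast
 moreover have "x:mc (restrict_atlas M ?U)"
  using x opn_subset[OF smM oU] by (auto simp: mc_rst)
 ultimately show ?thesis
  using smooth_fun_iff[OF sa_rst[OF smM oU]] sm_rst[OF smM oU] by blast
qed

lemma sa_latlas: "l:lframes ==> smooth_atlas (latlas l)"
 by (intro sa_prod sa_rst smM lframe_open sa_SO)

lemma mc_latlas: "l:lframes ==> mc (latlas l) = fst l \<times> mc (SO_atlas n)"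
 using opn_subset[OF smM lframe_open, of l] by (auto simp: mc_prod mc_rst)

lemma lmap_inj:
 assumes l: "l:lframes" shows "inj_on (lmap l) (mc (latlas l))"
proof (rule inj_onI)
 fix p q assume p: "p:mc (latlas l)" and q: "q:mc (latlas l)" and eq: "lmap l p = lmap l q"
 obtain x A y B where pq: "p = (x, A)" "q = (y, B)" by (cases p, cases q)
 have "x = y" using arg_cong[OF eq, of fst] by (simp add: pq)
 moreover have "A:carrier_mat n n" "B:carrier_mat n n" "x:fst l"
  using p q mc_SO[of n] by (auto simp: pq mc_latlas[OF l] SO_iff)
 ultimately show "p = q" using frame_ract_inj[OF lframe_mem[OF l]] eq by (auto simp: pq)
qed

text \<open>Two local frames differ by the matrix of their mutual inner products, which is smooth by
  \<open>lframe_inner\<close>; the change of trivialisation is left multiplication by it.\<close>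

lemma lframes_trs_smooth:
 assumes l: "l:lframes" and l': "l':lframes" and p: "p:mc (latlas l)" and q: "q:mc (latlas l')"
  and eq: "lmap l p = lmap l' q"
 shows "\<exists>g. smap (latlas l) (latlas l') g p & g p = q & (ngh (latlas l) p (%p'. lmap l' (g p') = lmap l p'))"
proof -
 obtain x A A' where pq: "p = (x, A)" "q = (x, A')" using arg_cong[OF eq, of fst] by (cases p, cases q) simp
 have x: "x:fst l" "x:fst l'" and A: "A:mc (SO_atlas n)" "A':mc (SO_atlas n)"
  using p q by (auto simp: pq mc_latlas l l')
 note L = sa_latlas[OF l] and AS = subsetD[OF mc_SO A(1)] subsetD[OF mc_SO A(2)]
 define B where "B y = Matrix.mat n n (%(i, j). vinner V (snd l' i y) (snd l j y))" for y
 have BS: "B y:carrier (SO n) & fat l y = frame_ract n V (fat l' y) (B y)" if y: "y:fst l" "y:fst l'" for y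
 proof -
  obtain C where C: "C:carrier (SO n)" "fat l y = frame_ract n V (fat l' y) C"
   "\<forall>i<n. \<forall>j<n. C $$ (i, j) = vinner V ((\<lambda>i\<in>{..<n}. snd l' i y) i) ((\<lambda>i\<in>{..<n}. snd l i y) j)"
   by (rule frames_trs[OF lframe_mem[OF l' y(2)] lframe_mem[OF l y(1)]])
  have "C = B y" by (rule eq_matI) (use C(1,3) in "auto simp: B_def SO_iff")
  thus ?thesis using C by simp
 qed
 define g where "g = (%(y, D). (y, B y * D))"
 have gl: "lmap l' (g (y, D)) = lmap l (y, D)" if "y:fst l" "y:fst l'" "D:carrier (SO n)" for y D
 proof -
  have "B y:carrier_mat n n" "D:carrier_mat n n" using BS[OF that(1,2)] that(3) by (auto simp: SO_iff)
  thus ?thesis using BS[OF that(1,2)] frame_ract_assoc[OF lframe_mem[OF l' that(2)]] by (simp add: g_def)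
 qed
 have gp: "g p = q"
 proof -
  have "B x * A:carrier (SO n)" using BS[OF x] AS by (blast intro: SO_mult)
  moreover have "frame_ract n V (fat l' x) (B x * A) = frame_ract n V (fat l' x) A'"
   using gl[OF x AS(1)] eq by (simp add: g_def pq)
  ultimately have "B x * A = A'" using frame_ract_inj[OF lframe_mem[OF l' x(2)]] AS(2) by (auto simp: SO_iff)
  thus ?thesis by (simp add: g_def pq)
 qed
 note fs = smap_fst_snd[OF sa_rst[OF smM lframe_open[OF l]] sa_SO p]
 have fM: "smap (latlas l) M fst p" 
  by (rule smap_rst_right[OF smM lframe_open[OF l], THEN iffD1, OF fs(1), THEN conjunct1])
 have fl': "smap (latlas l) (restrict_atlas M (fst l')) fst p"
  by (rule smap_rst_right[OF smM lframe_open[OF l'], THEN iffD2]) (use fM x in "simp add: pq")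
 have ev1: "ngh (latlas l) p (%r. fst r:fst l')"
  by (rule smap_near[OF L smM fM nr_open[OF lframe_open[OF l']]]) (use x in "simp add: pq")
 have "opn (latlas l) (mc (latlas l))" using openin_topspace[of "mtop (latlas l)"] L by simp
 from nr_open[OF this p] have ev2: "ngh (latlas l) p (%r. r:mc (latlas l))" .
 from ev1 ev2 have ev: "ngh (latlas l) p (%r. fst r:fst l & fst r:fst l' & snd r:carrier (SO n))"
  by eventually_elim (use mc_SO[of n] in "auto simp: mc_latlas[OF l]")
 have "smap (latlas l) (SO_atlas n) (%r. B (fst r) * snd r) p"
 proof (rule smap_SO[OF L p])
  show "B (fst p) * snd p:mc (SO_atlas n)" using gp A by (simp add: g_def pq)
  show "ngh (latlas l) p (%r. B (fst r) * snd r:carrier (SO n))"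
   using ev by eventually_elim (use BS in \<open>blast intro: SO_mult\<close>)
  fix i j assume ij: "i < n" "j < n"
  have "sm (latlas l) (%r. \<Sum>k<n. vinner V (snd l' i (fst r)) (snd l k (fst r)) * snd r $$ (k, j)) p"
  proof (intro sm_sum[OF L p] sm_mult)
   fix k assume "k:{..<n}"
   hence k: "k < n" by simp
   show "sm (latlas l) (%r. vinner V (snd l' i (fst r)) (snd l k (fst r))) p"
    by (rule smap_sm[OF fM, where h = "%y. vinner V (snd l' i y) (snd l k y)"])
     (use lframe_inner[OF l' l _ ij(1) k] x in "simp add: pq")
   show "sm (latlas l) (%r. snd r $$ (k, j)) p"
    by (rule smap_sm[OF fs(2), where h = "%A. A $$ (k, j)"]) (use sm_SO[OF A(1) k ij(2)] in "simp add: pq")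
  qed
  moreover have "\<forall>\<^sub>F r in near (latlas l) p.
    (\<Sum>k<n. vinner V (snd l' i (fst r)) (snd l k (fst r)) * snd r $$ (k, j)) = (B (fst r) * snd r) $$ (i, j)"
   using ev by eventually_elim (use ij in "auto simp: B_def scalar_prod_def atLeast0LessThan SO_iff")
  ultimately show "sm (latlas l) (%r. (B (fst r) * snd r) $$ (i, j)) p" by (rule sm_cong[OF L, rotated])
 qed
 from smap_Pair[OF sa_rst[OF smM lframe_open[OF l']] sa_SO L fl' this]
 have "smap (latlas l) (latlas l') g p" by (simp add: g_def case_prod_unfold)
 moreover have "ngh (latlas l) p (%r. lmap l' (g r) = lmap l r)"
  using ev
 proof eventually_elim
  case (elim r)
  thus ?case using gl[of "fst r" "snd r"] by simp
 qed
 ultimately show ?thesis using gp by blast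
qed

sublocale frm: glueing lframes latlas lmap
 by unfold_locales (auto intro: sa_latlas lframes_trs_smooth)

lemma frm_glued: "frm.glued = frame_atlas M n V"
 unfolding frm.glued_def frame_atlas_def lframes_def[symmetric] by (rule SUP_cong) auto

lemma sa_frame: "smooth_atlas (frame_atlas M n V)"
 using frm.sa_glued by (simp add: frm_glued)

lemma frame_atlas_obtain:
 assumes "z:mc (frame_atlas M n V)"
 obtains l p where "l:lframes" "p:mc (latlas l)" "z = lmap l p"
 using assms frm.mc_glued unfolding frm_glued by blast

lemma mc_frame: "mc (frame_atlas M n V) \<subseteq> frames M n V"
proof
 fix z assume "z:mc (frame_atlas M n V)"
 then obtain l p where l: "l:lframes" and p: "p:mc (latlas l)" and z: "z = lmap l p" by (rule frame_atlas_obtain)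
 thus "z:frames M n V"
  using frame_ract_mem[OF lframe_mem[OF l]] mc_SO[of n] by (auto simp: mc_latlas[OF l] case_prod_unfold)
qed

text \<open>Reads a smooth family of frames as a smooth family of matrices relative to a local frame
  \<open>l\<close>, which allows two such families to be compared.\<close>

lemma smap_frame_coord:
 assumes C: "smooth_atlas C" and s: "smap C (frame_atlas M n V) sig x"
  and l: "l:lframes" and p: "p:mc (latlas l)" and eq: "sig x = lmap l p"
 obtains A where "A x = snd p" "!!i j. i < n ==> j < n ==> sm C (%y. A y $$ (i, j)) x"
  "ngh C x (%y. A y:carrier (SO n) & fst (sig y):fst l & sig y = frame_ract n V (fat l (fst (sig y))) (A y))"
proof -
 note inj = lmap_inj[OF l]
 note g = frm.smap_glued_inverse[OF l inj p, unfolded frm_glued]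
 define k where "k = inv_into (mc (latlas l)) (lmap l)"
 have kp: "k (sig x) = p" unfolding k_def eq by (rule inv_into_f_f[OF inj p])
 have ks: "smap C (latlas l) (%y. k (sig y)) x"
  by (rule smap_comp[OF s]) (use g(2) eq in "simp add: k_def")
 have ev: "ngh C x (%y. sig y:lmap l ` mc (latlas l))"
  by (rule smap_near[OF C sa_frame s]) (unfold eq, rule g(3))
 note fs = smap_fst_snd[OF sa_rst[OF smM lframe_open[OF l]] sa_SO, of "k (sig x)"]
 have kc: "k (sig x):mc (latlas l)" using p kp by simp
 have ss: "smap C (SO_atlas n) (%y. snd (k (sig y))) x" by (rule smap_comp[OF ks fs(2)[OF kc]])
 have S: "snd p:mc (SO_atlas n)" using p by (auto simp: mc_latlas[OF l])
 show thesis
 proof (rule that[of "%y. snd (k (sig y))"])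
  show "snd (k (sig x)) = snd p" using kp by simp
  show "sm C (%y. snd (k (sig y)) $$ (i, j)) x" if "i < n" "j < n" for i j
   by (rule smap_sm[OF ss, where h = "%A. A $$ (i, j)"]) (use sm_SO[OF S that] kp in simp)
  show "ngh C x (%y. snd (k (sig y)):carrier (SO n) & fst (sig y):fst l &
    sig y = frame_ract n V (fat l (fst (sig y))) (snd (k (sig y))))"
   using ev
  proof eventually_elim
   case (elim y)
   then obtain r where r: "r:mc (latlas l)" "sig y = lmap l r" by auto
   have "k (sig y) = r" unfolding k_def r(2) by (rule inv_into_f_f[OF inj r(1)])
   thus ?case using r mc_SO[of n] by (auto simp: mc_latlas[OF l] case_prod_unfold)
  qed
 qed
qed

end

lemma smap_const: "smooth_atlas C ==> x:mc C ==> c:mc B ==> smap C B (%_. c) x"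
 by (simp add: smap_def sm_const)

lemma opn_car: "smooth_atlas A ==> opn A (mc A)"
 using openin_topspace[of "mtop A"] by simp

lemma opn_smap_preimage:
 assumes A: "smooth_atlas A" and B: "smooth_atlas B" and f: "!!x. x:mc A ==> smap A B f x" and U: "opn B U"
 shows "opn A {x:mc A. f x:U}"
proof (rule opn_near[OF A])
 fix x assume x: "x:{x:mc A. f x:U}"
 hence xA: "x:mc A" by simp
 have "ngh A x (%y. f y:U)" by (rule smap_near[OF A B f[OF xA] nr_open[OF U]]) (use x in simp)
 with nr_open[OF opn_car[OF A] xA]
 show "ngh A x (%y. y:{x:mc A. f x:U})" by eventually_elim simp
qed auto

subsection \<open>Central elements of \<open>Spin\<^sup>c(n)\<close>\<close>

abbreviation Gc :: "nat => spinc set" where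
 "Gc n \<equiv> carrier (Spinc n)"

lemma cz_pair: "cmod z = 1 ==> (cl_one, z):carrier (su n)"
 unfolding su_simps using clf.Spin_one by simp

lemma cz_mem: "cmod z = 1 ==> cz n z:Gc n"
 unfolding cz_def Spinc_car using cz_pair by blast

lemma cz_one: "cz n 1 = \<one>\<^bsub>Spinc n\<^esub>"
 by (simp add: cz_def Spinc_one)

lemma cz_mult: "cmod z = 1 ==> cmod w = 1 ==> cz n z \<otimes>\<^bsub>Spinc n\<^esub> cz n w = cz n (z * w)"
 unfolding cz_def Spinc_cls_mult[OF cz_pair cz_pair] su_simps
 by (simp add: clf.mul1l[OF clf.one_mem])

lemma cz_central: "g:Gc n ==> cmod z = 1 ==> g \<otimes>\<^bsub>Spinc n\<^esub> cz n z = cz n z \<otimes>\<^bsub>Spinc n\<^esub> g"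
proof -
 assume g: "g:Gc n" and z: "cmod z = 1"
 then obtain p where p: "p:carrier (su n)" "g = scls n p" by (auto simp: Spinc_car)
 have "fst p:eucl (2 ^ n)" using p(1) clf.Spin_mem unfolding su_simps by auto
 thus ?thesis unfolding p(2) cz_def Spinc_cls_mult[OF p(1) cz_pair[OF z]] Spinc_cls_mult[OF cz_pair[OF z] p(1)]
  unfolding su_simps by (simp add: clf.mul1l clf.mul1r mult.commute)
qed

definition kz :: "('g => int) => 'g => complex => complex" where
 "kz ep ga z = (if ep ga = - 1 then cnj z else z)"

lemma kappa_cz: "cmod z = 1 ==> kappa ep ga (cz n z) = cz n (kz ep ga z)"
 unfolding cz_def kappa_cls[OF cz_pair] kz_def by simp

lemma kz_norm [simp]: "cmod (kz ep ga z) = cmod z"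
 by (simp add: kz_def)

lemma Adc_cz: "cmod z = 1 ==> Adc n (cz n z) = 1\<^sub>m n"
 unfolding cz_def Adc_cls[OF cz_pair] by (simp add: clf.adm_one)

lemma cz_inj: "cmod z = 1 ==> cmod w = 1 ==> cz n z = cz n w ==> z = w"
 unfolding cz_def by (subst (asm) scls_iff[OF cz_pair cz_pair]) (auto simp: pneg_def cl_one_def fun_eq_iff split: if_splits)

text \<open>The spin part of a representative is \<open>1\<close> or \<open>-1\<close> by
  \<open>adm_kernel\<close>, and in the second case the other representative has spin part
  \<open>1\<close>.\<close>

lemma Adc_kernel:
 assumes g: "g:Gc n" and A: "Adc n g = 1\<^sub>m n"
 obtains z where "cmod z = 1" "g = cz n z"
proof -
 obtain p where p: "p:carrier (su n)" "g = scls n p" using g by (auto simp: Spinc_car)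
 have "fst p:carrier (Spin n)" "cmod (snd p) = 1" using p(1) unfolding su_simps by auto
 then consider "fst p = cl_one" | "fst p = (%k. - cl_one k)"
  using clf.adm_kernel[of "fst p" n] A Adc_cls[OF p(1)] p(2) by auto
 thus thesis
 proof cases
  case 1 hence "p = (cl_one, snd p)" by (simp add: prod_eq_iff)
  thus thesis using that[of "snd p"] \<open>cmod (snd p) = 1\<close> p(2) by (simp add: cz_def)
 next
  case 2
  hence "pneg p = (cl_one, - snd p)" by (simp add: pneg_def)
  hence "scls n p = scls n (cl_one, - snd p)" using scls_iff[OF p(1) pneg_car[OF p(1)]] by simp
  thus thesis using that[of "- snd p"] \<open>cmod (snd p) = 1\<close> p(2) by (simp add: cz_def)
 qed
qed

lemma Adc_SO: "g:Gc n ==> Adc n g:carrier_mat n n & Adc n g * transpose_mat (Adc n g) = 1\<^sub>m n"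
by (auto simp: Spinc_car su_simps Adc_cls clf.adm_car clf.adm_orth)

definition scl :: "nat => vec => spinc" where
 "scl n g = scls n (g, 1)"

lemma scl_pair: "g:carrier (Spin n) ==> (g, 1):carrier (su n)"
 unfolding su_simps by simp

lemma scl_mem: "g:carrier (Spin n) ==> scl n g:Gc n"
 unfolding scl_def Spinc_car using scl_pair by blast

lemma sclm: "g:carrier (Spin n) ==> h:carrier (Spin n) ==> scl n g \<otimes>\<^bsub>Spinc n\<^esub> scl n h = scl n (cl_mult n g h)"
 unfolding scl_def Spinc_cls_mult[OF scl_pair scl_pair] su_simps by simp

lemma scl_one: "scl n cl_one = \<one>\<^bsub>Spinc n\<^esub>"
 by (simp add: scl_def Spinc_one)

lemma Adc_scl: "g:carrier (Spin n) ==> Adc n (scl n g) = clf.adm n g"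
 unfolding scl_def Adc_cls[OF scl_pair] by simp

lemma smap_scl:
 assumes C: "smooth_atlas C" and x: "x:mc C" and g: "ngh C x (%y. g y:carrier (Spin n))" "csm C g x"
 shows "smap C (Spinc_atlas n) (%y. scl n (g y)) x"
 unfolding scl_def
 by (rule smap_Spinc[OF C smap_Spin[OF C x g] smap_const[OF C x]]) (simp add: mc_U1)

subsection \<open>Spin\<open>\<^sup>\<kappa>\<close>-structures\<close>

abbreviation atl :: "('p,'v,'x,'g) sk => 'p atlas" where "atl S \<equiv> ptot (fst S)"
abbreviation tot :: "('p,'v,'x,'g) sk => 'p set" where "tot S \<equiv> mc (ptot (fst S))"
abbreviation pr :: "('p,'v,'x,'g) sk => 'p => 'x" where "pr S \<equiv> pproj (fst S)"
abbreviation ra :: "('p,'v,'x,'g) sk => 'p => spinc => 'p" where "ra S \<equiv> ract (fst S)"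
abbreviation la :: "('p,'v,'x,'g) sk => 'g => 'p => 'p" where "la S \<equiv> lact (fst S)"
abbreviation fm :: "('p,'v,'x,'g) sk => 'p => 'x \<times> (nat => 'v)" where "fm S \<equiv> snd S"

locale spc =
 fixes Gm :: "('g, 'b) monoid_scheme" and ep :: "'g => int"
  and M :: "'x atlas" and rh :: "'g => 'x => 'x"
  and V :: "('v, 'x, 'g) vbundle" and n :: nat
 assumes ori: "orientifold Gm ep M rh"
  and eqv: "equivariant_oriented_bundle Gm M rh n V"
begin

abbreviation GG :: "'g set" where "GG \<equiv> carrier Gm"
abbreviation gmult (infixl "\<odot>" 70) where "ga \<odot> de \<equiv> ga \<otimes>\<^bsub>Gm\<^esub> de"
abbreviation iv :: "'g => 'g" where "iv ga \<equiv> inv\<^bsub>Gm\<^esub> ga"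
abbreviation e1 :: 'g where "e1 \<equiv> \<one>\<^bsub>Gm\<^esub>"
abbreviation smult (infixl "\<cdot>" 70) where "g \<cdot> h \<equiv> g \<otimes>\<^bsub>Spinc n\<^esub> h"

sublocale orb M n V
 using ori eqv by unfold_locales (auto simp: orientifold_def smooth_manifold_def equivariant_oriented_bundle_def)

sublocale G: Group.group "Spinc n"
 by (rule Spinc_group)

sublocale Gam: Group.group Gm
 using ori by (simp add: orientifold_def finite_orientifold_group_def)

lemma finite_Gamma: "finite (GG)"
 and eps_hom: "ep:hom Gm Z2"
 using ori by (auto simp: orientifold_def finite_orientifold_group_def)

lemma eps_mult: "ga:GG ==> de:GG ==> ep (ga \<odot> de) = ep ga * ep de"
 and eps_cases: "ga:GG ==> ep ga = 1 \<or> ep ga = - 1"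
 using eps_hom by (auto simp: hom_def Z2_def Pi_iff)

lemma eps_one: "ep e1 = 1"
 using eps_mult[of "e1" "e1"] eps_cases[of "e1"] by auto

lemma rho_smap: "ga:GG ==> x:mc M ==> smap M M (rh ga) x"
 and rho_one: "x:mc M ==> rh e1 x = x"
 and rho_mult: "ga:GG ==> de:GG ==> x:mc M ==> rh (ga \<odot> de) x = rh ga (rh de x)"
 using ori by (auto simp: orientifold_def smooth_action_def smm_iff[OF smM smM])

lemma rho_mem: "ga:GG ==> x:mc M ==> rh ga x:mc M"
 using smap_car(2)[OF rho_smap] .

abbreviation str :: "('p,'v,'x,'g) sk => bool" where
 "str S \<equiv> spin_kappa_structure Gm ep M rh n V S"

context
 fixes S :: "('p,'v,'x,'g) sk"
 assumes S: "str S"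
begin

lemma str_principal: "principal_bundle M (Spinc n) (Spinc_atlas n) (fst S)"
 and str_action: "smooth_action Gm (atl S) (la S)"
 and str_manifold: "smooth_manifold (atl S)"
 using S by (auto simp: spin_kappa_structure_def semi_equivariant_bundle_def principal_bundle_def case_prod_unfold)

lemma atS: "smooth_atlas (atl S)"
 using str_manifold by (simp add: smooth_manifold_def)

lemma pr_smap: "p:tot S ==> smap (atl S) M (pr S) p"
 using str_principal by (simp add: principal_bundle_def smm_iff[OF atS smM])

lemma pr_mem: "p:tot S ==> pr S p:mc M"
 using smap_car(2)[OF pr_smap] .

lemma ra_comp:
 assumes f: "smap C (atl S) f x" and g: "smap C (Spinc_atlas n) g x" and C: "smooth_atlas C"
 shows "smap C (atl S) (%y. ra S (f y) (g y)) x"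
proof -
 have "(f x, g x):mc (prod_atlas (atl S) (Spinc_atlas n))"
  using smap_car(2)[OF f] smap_car(2)[OF g] by (simp add: mc_prod)
 hence "smap (prod_atlas (atl S) (Spinc_atlas n)) (atl S) (%(p, g). ra S p g) (f x, g x)"
  using str_principal
  by (simp add: principal_bundle_def smm_iff[OF sa_prod[OF atS sa_Spinc] atS])
 from smap_comp[OF smap_Pair[OF atS sa_Spinc C f g] this] show ?thesis by simp
qed

lemma ra_mem: "p:tot S ==> g:Gc n ==> ra S p g:tot S"
 using smap_car(2)[OF ra_comp[OF smap_id smap_const[OF atS] atS]] by (simp add: mc_Spinc)

lemma ra_one: "p:tot S ==> ra S p \<one>\<^bsub>Spinc n\<^esub> = p"
 and ra_mult: "p:tot S ==> g:Gc n ==> h:Gc n ==> ra S p (g \<cdot> h) = ra S (ra S p g) h"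
 and pr_ra: "p:tot S ==> g:Gc n ==> pr S (ra S p g) = pr S p"
 using str_principal by (auto simp: principal_bundle_def)

lemma la_smap: "ga:GG ==> p:tot S ==> smap (atl S) (atl S) (la S ga) p"
 and la_one: "p:tot S ==> la S e1 p = p"
 and la_mult: "ga:GG ==> de:GG ==> p:tot S ==> la S (ga \<odot> de) p = la S ga (la S de p)"
 using str_action by (auto simp: smooth_action_def smm_iff[OF atS atS])

lemma la_mem: "ga:GG ==> p:tot S ==> la S ga p:tot S"
 using smap_car(2)[OF la_smap] .

lemma pr_la: "ga:GG ==> p:tot S ==> pr S (la S ga p) = rh ga (pr S p)"
 and la_ra: "ga:GG ==> p:tot S ==> g:Gc n ==> la S ga (ra S p g) = ra S (la S ga p) (kappa ep ga g)"
 using S by (auto simp: spin_kappa_structure_def semi_equivariant_bundle_def case_prod_unfold)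

lemma fm_smap: "p:tot S ==> smap (atl S) (frame_atlas M n V) (fm S) p"
 using S by (auto simp: spin_kappa_structure_def case_prod_unfold Fr_def smm_iff[OF atS sa_frame])

lemma fm_frame: "p:tot S ==> fm S p:frames M n V"
 using smap_car(2)[OF fm_smap] mc_frame by blast

lemma fst_fm: "p:tot S ==> fst (fm S p) = pr S p"
 and fm_la: "p:tot S ==> ga:GG ==> fm S (la S ga p) = lact (Fr M rh n V) ga (fm S p)"
 and fm_ra: "p:tot S ==> g:Gc n ==> fm S (ra S p g) = frame_ract n V (fm S p) (Adc n g)"
 using S by (auto simp: spin_kappa_structure_def case_prod_unfold Fr_def)

text \<open>A local trivialisation repackaged as a section \<open>s\<close> and a smooth division
  map \<open>d\<close> with \<open>p = s (pr p) d(p)\<close>; later arguments use only this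
  pair.\<close>

lemma local_section:
 assumes x: "x:mc M"
 obtains U s d where "opn M U" "x:U"
  "ALL y:U. s y:tot S & pr S (s y) = y & smap M (atl S) s y"
  "ALL p:tot S. pr S p:U --> d p:Gc n & ra S (s (pr S p)) (d p) = p & smap (atl S) (Spinc_atlas n) d p"
  "ALL y:U. ALL g:Gc n. d (ra S (s y) g) = g"
proof -
 have "ALL x:mcarrier M. \<exists>U ta. opn M U & x:U &
    diffeo (prod_atlas (restrict_atlas M U) (Spinc_atlas n))
     (restrict_atlas (atl S) {p:tot S. pr S p:U}) ta &
    (ALL y:U. ALL g:Gc n. pr S (ta (y, g)) = y &
     (ALL h:Gc n. ta (y, g \<cdot> h) = ra S (ta (y, g)) h))"
  using str_principal unfolding principal_bundle_def by (elim conjE)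
 from bspec[OF this x] obtain U ta where U: "opn M U" "x:U"
  and df: "diffeo (prod_atlas (restrict_atlas M U) (Spinc_atlas n))
     (restrict_atlas (atl S) {p:tot S. pr S p:U}) ta"
  and l0: "ALL y:U. ALL g:Gc n. pr S (ta (y, g)) = y &
     (ALL h:Gc n. ta (y, g \<cdot> h) = ra S (ta (y, g)) h)"
  by (elim exE conjE) (rule that; assumption)
 have l: "!!y g. y:U ==> g:Gc n ==> pr S (ta (y, g)) = y"
   "!!y g h. y:U ==> g:Gc n ==> h:Gc n ==> ta (y, g \<cdot> h) = ra S (ta (y, g)) h"
  using l0 by blast+
 let ?W = "{p:tot S. pr S p:U}"
 let ?PU = "prod_atlas (restrict_atlas M U) (Spinc_atlas n)"
 have W: "opn (atl S) ?W" by (rule opn_smap_preimage[OF atS smM pr_smap U(1)])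
 have UM: "U \<subseteq> mc M" by (rule opn_subset[OF smM U(1)])
 have cP: "mc ?PU = U \<times> Gc n" using UM by (auto simp: mc_prod mc_rst mc_Spinc)
 have cW: "mc (restrict_atlas (atl S) ?W) = ?W" by (auto simp: mc_rst)
 note R = sa_rst[OF smM U(1)] and RW = sa_rst[OF atS W]
 note PU = sa_prod[OF R sa_Spinc[of n]]
 have bij: "bij_betw ta (U \<times> Gc n) ?W" using df by (simp add: diffeo_def cP cW)
 have t1: "smap ?PU (atl S) ta q" if "q:U \<times> Gc n" for q
  using df that by (auto simp: diffeo_def smm_iff[OF PU RW] cP smap_rst_right[OF atS W])
 have t2: "smap (atl S) ?PU (inv_into (U \<times> Gc n) ta) p" if "p:?W" for p
  using df that by (auto simp: diffeo_def smm_iff[OF RW PU] cP cW smap_rst_left[OF atS W])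
 define s where "s y = ta (y, \<one>\<^bsub>Spinc n\<^esub>)" for y
 define d where "d p = snd (inv_into (U \<times> Gc n) ta p)" for p
 have tas: "ta (y, g) = ra S (s y) g" if "y:U" "g:Gc n" for y g
  using l(2)[OF that(1) G.one_closed that(2)] that(2) by (simp add: s_def)
 have ds: "d (ra S (s y) g) = g" if "y:U" "g:Gc n" for y g
  using bij_betw_imp_inj_on[OF bij] that by (simp add: d_def flip: tas)
 show thesis
 proof (rule that[OF U]; intro ballI impI)
  fix y assume y: "y:U"
  have yM: "y:mc M" using UM y by auto
  have yR: "y:mc (restrict_atlas M U)" using y yM by (simp add: mc_rst)
  have "smap M (restrict_atlas M U) (%y. y) y" using smap_id[OF yM] y by (simp add: smap_rst_right[OF smM U(1)])
  from smap_Pair[OF R sa_Spinc smM this smap_const[OF smM yM, of "\<one>\<^bsub>Spinc n\<^esub>"]]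
  have "smap M ?PU (%y. (y, \<one>\<^bsub>Spinc n\<^esub>)) y" by (simp add: mc_Spinc)
  from smap_comp[OF this t1] have sm: "smap M (atl S) s y" using y by (simp add: s_def[abs_def])
  thus "s y:tot S & pr S (s y) = y & smap M (atl S) s y"
   using smap_car(2)[OF sm] l(1)[OF y G.one_closed] by (simp add: s_def)
 next
  fix p assume p: "p:tot S" "pr S p:U"
  hence "p:ta ` (U \<times> Gc n)" using bij by (auto simp: bij_betw_def)
  then obtain y g where yg: "y:U" "g:Gc n" "p = ta (y, g)" by auto
  have "d p = g" "pr S p = y" using ds yg l(1) by (auto simp: tas)
  moreover have "smap (atl S) (Spinc_atlas n) d p"
   unfolding d_def[abs_def]
   by (rule smap_comp[OF t2 smap_fst_snd(2)[OF R sa_Spinc]]) (use p smap_car(2)[OF t2] in auto)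
  ultimately show "d p:Gc n & ra S (s (pr S p)) (d p) = p & smap (atl S) (Spinc_atlas n) d p"
   using yg by (simp add: tas)
 qed (rule ds)
qed

lemma ra_free:
 assumes p: "p:tot S" and g: "g:Gc n" "h:Gc n" and eq: "ra S p g = ra S p h"
 shows "g = h"
proof -
 obtain U s d where U: "pr S p:U"
  and s: "ALL y:U. s y:tot S & pr S (s y) = y & smap M (atl S) s y"
  and d: "ALL p:tot S. pr S p:U --> d p:Gc n & ra S (s (pr S p)) (d p) = p & smap (atl S) (Spinc_atlas n) d p"
  and ds: "ALL y:U. ALL g:Gc n. d (ra S (s y) g) = g"
  by (rule local_section[OF pr_mem[OF p]]) (rule that; assumption)
 note s = s[rule_format]
 note d = d[rule_format]
 note ds = ds[rule_format]
 note dp = d[OF p U] and sp = s[OF U]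
 have "d (ra S p k) = d p \<cdot> k" if "k:Gc n" for k
  using ra_mult[of "s (pr S p)" "d p" k] ds[OF U, of "d p \<cdot> k"] that dp sp by simp
 hence "d p \<cdot> g = d p \<cdot> h" using eq g by metis
 thus ?thesis using dp g by simp
qed

lemma ra_trans:
 assumes p: "p:tot S" and q: "q:tot S" and eq: "pr S p = pr S q"
 obtains g where "g:Gc n" "q = ra S p g"
proof -
 obtain U s d where U: "pr S p:U"
  and s: "ALL y:U. s y:tot S & pr S (s y) = y & smap M (atl S) s y"
  and d: "ALL p:tot S. pr S p:U --> d p:Gc n & ra S (s (pr S p)) (d p) = p & smap (atl S) (Spinc_atlas n) d p"
  by (rule local_section[OF pr_mem[OF p]]) (rule that; assumption)
 note s = s[rule_format]
 note d = d[rule_format]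
 have dp: "d p:Gc n" "ra S (s (pr S p)) (d p) = p" using d[OF p U] by auto
 have dq: "d q:Gc n" "ra S (s (pr S p)) (d q) = q" using d[OF q] U eq by auto
 have sp: "s (pr S p):tot S" using s[OF U] by blast
 have c: "inv\<^bsub>Spinc n\<^esub> d p \<cdot> d q:Gc n" using dp dq by simp
 have "ra S (ra S (s (pr S p)) (d p)) (inv\<^bsub>Spinc n\<^esub> d p \<cdot> d q) = ra S (s (pr S p)) (d q)"
  using ra_mult[OF sp dp(1) c] dp(1) dq(1) by (simp flip: G.m_assoc)
 thus thesis using that[OF c] dp dq by simp
qed

lemma pr_surj:
 assumes "x:mc M" obtains p where "p:tot S" "pr S p = x"
by (metis assms local_section)

subsection \<open>The action of \<open>U(1)\<close>\<close>

definition za :: "'p => complex => 'p" where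
 "za p z = ra S p (cz n z)"

lemma za_mem: "p:tot S ==> cmod z = 1 ==> za p z:tot S"
 and pr_za: "p:tot S ==> cmod z = 1 ==> pr S (za p z) = pr S p"
 and za_one: "p:tot S ==> za p 1 = p"
 and za_mult: "p:tot S ==> cmod z = 1 ==> cmod w = 1 ==> za (za p z) w = za p (z * w)"
 and za_ra: "p:tot S ==> cmod z = 1 ==> g:Gc n ==> za (ra S p g) z = ra S (za p z) g"
 and la_za: "ga:GG ==> p:tot S ==> cmod z = 1 ==> la S ga (za p z) = za (la S ga p) (kz ep ga z)"
 and fm_za: "p:tot S ==> cmod z = 1 ==> fm S (za p z) = fm S p"
 and za_inj: "p:tot S ==> cmod z = 1 ==> cmod w = 1 ==> za p z = za p w ==> z = w"
proof -
 show "p:tot S ==> cmod z = 1 ==> za p z:tot S" by (simp add: za_def ra_mem cz_mem)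
 show "p:tot S ==> cmod z = 1 ==> pr S (za p z) = pr S p" by (simp add: za_def pr_ra cz_mem)
 show "p:tot S ==> za p 1 = p" by (simp add: za_def cz_one ra_one)
 show "p:tot S ==> cmod z = 1 ==> cmod w = 1 ==> za (za p z) w = za p (z * w)"
  by (simp add: za_def cz_mem flip: ra_mult cz_mult)
 show "p:tot S ==> cmod z = 1 ==> g:Gc n ==> za (ra S p g) z = ra S (za p z) g"
  by (simp add: za_def cz_mem cz_central flip: ra_mult)
 show "ga:GG ==> p:tot S ==> cmod z = 1 ==> la S ga (za p z) = za (la S ga p) (kz ep ga z)"
  by (simp add: za_def la_ra cz_mem kappa_cz)
 show "p:tot S ==> cmod z = 1 ==> fm S (za p z) = fm S p"
  by (simp add: za_def fm_ra cz_mem Adc_cz frame_ract_one fm_frame)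
 show "p:tot S ==> cmod z = 1 ==> cmod w = 1 ==> za p z = za p w ==> z = w"
  using ra_free[of p "cz n z" "cz n w"] cz_inj[of z w n] by (simp add: za_def cz_mem)
qed

lemma za_smap:
 assumes C: "smooth_atlas C" and f: "smap C (atl S) f x" and z: "ngh C x (%y. cmod (z y) = 1)"
  "sm C (%y. Re (z y)) x" "sm C (%y. Im (z y)) x"
 shows "smap C (atl S) (%y. za (f y) (z y)) x"
 unfolding za_def by (rule ra_comp[OF f smap_cz[OF C smap_car(1)[OF f] z] C])

text \<open>Since \<open>f\<close> preserves fibres and frames, \<open>f p\<close> is
  \<open>p\<close> times an element of the kernel of \<open>Adc\<close>, a central circle element.
  Centrality together with equivariance makes it constant along fibres.\<close>

lemma gauge:
 assumes U: "opn M U"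
  and f: "!!p. p:tot S ==> pr S p:U ==> smap (atl S) (atl S) f p & pr S (f p) = pr S p & fm S (f p) = fm S p &
   (ALL g:Gc n. f (ra S p g) = ra S (f p) g)"
 obtains z where "ALL y:U. cmod (z y) = 1 & sm M (%y. Re (z y)) y & sm M (%y. Im (z y)) y"
  "ALL p:tot S. pr S p:U --> f p = za p (z (pr S p))"
proof -
 have ex: "\<exists>z. cmod z = 1 & f p = za p z" if p: "p:tot S" "pr S p:U" for p
 proof -
  note fp = f[OF p]
  hence "smap (atl S) (atl S) f p" by simp
  note fpm = smap_car(2)[OF this]
  have "pr S p = pr S (f p)" using fp by simp
  then obtain g where g: "g:Gc n" "f p = ra S p g" by (rule ra_trans[OF p(1) fpm])
  have "frame_ract n V (fm S p) (Adc n g) = frame_ract n V (fm S p) (1\<^sub>m n)"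
   using fp g fm_ra[OF p(1) g(1)] frame_ract_one[OF fm_frame[OF p(1)]] by simp
  hence "Adc n g = 1\<^sub>m n" using frame_ract_inj[OF fm_frame[OF p(1)]] Adc_SO[OF g(1)] by simp
  then obtain z where "cmod z = 1" "g = cz n z" by (rule Adc_kernel[OF g(1)])
  thus ?thesis using g by (auto simp: za_def)
 qed
 define P where "P y w \<longleftrightarrow> cmod w = 1 & (ALL p:tot S. pr S p = y --> f p = za p w)" for y w
 have P: "\<exists>w. P y w" if y: "y:U" for y
 proof -
  obtain q where q: "q:tot S" "pr S q = y" by (rule pr_surj) (use opn_subset[OF smM U] y in auto)
  obtain w where w: "cmod w = 1" "f q = za q w" using ex[OF q(1)] q(2) y by blast
  have "f p = za p w" if p: "p:tot S" "pr S p = y" for p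
  by (metis p q ra_trans f y w za_ra)
  thus ?thesis using w by (auto simp: P_def)
 qed
 define z where "z y = (SOME w. P y w)" for y
 have z: "P y (z y)" if "y:U" for y unfolding z_def by (rule someI_ex[OF P[OF that]])
 show thesis
 proof (rule that[of z]; intro ballI impI)
  fix y assume y: "y:U"
  have yM: "y:mc M" using opn_subset[OF smM U] y by auto
  obtain W s d where W: "opn M W" "y:W"
   and s: "ALL y:W. s y:tot S & pr S (s y) = y & smap M (atl S) s y"
   and d: "ALL p:tot S. pr S p:W --> d p:Gc n & ra S (s (pr S p)) (d p) = p & smap (atl S) (Spinc_atlas n) d p"
   and ds: "ALL y:W. ALL g:Gc n. d (ra S (s y) g) = g"
   by (rule local_section[OF yM]) (rule that; assumption)
  note s = s[rule_format]
  note d = d[rule_format]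
  note ds = ds[rule_format]
  have sy: "s y:tot S" "pr S (s y) = y" "smap M (atl S) s y" using s[OF W(2)] by auto
  have fs: "smap M (atl S) (%y. f (s y)) y"
   by (rule smap_comp[OF sy(3)]) (use f[OF sy(1)] sy(2) y in simp)
  have dfs: "smap M (Spinc_atlas n) (%y. d (f (s y))) y"
  by (metis smap_comp fs smap_car f sy y d W)
  have ev: "ngh M y (%y. y:U & y:W)"
   using nr_open[OF U y] nr_open[OF W] by eventually_elim simp
  \<comment> \<open>Smoothness of \<open>z\<close> is read off from the division map along a local
    section.\<close>
  hence "ngh M y (%y. d (f (s y)) = cz n (z y))"
  proof eventually_elim
   case (elim v)
   hence "s v:tot S" "pr S (s v) = v" using s by auto
   hence "f (s v) = ra S (s v) (cz n (z v))" "cmod (z v) = 1" using z[of v] elim by (auto simp: P_def za_def)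
   thus ?case using ds[of v "cz n (z v)"] elim by (simp add: cz_mem)
  qed
  from smap_cong[OF smM this dfs] have c: "smap M (Spinc_atlas n) (%y. cz n (z y)) y" .
  have n1: "ngh M y (%y. cmod (z y) = 1)" using ev by eventually_elim (use z in "auto simp: P_def")
  show "cmod (z y) = 1 & sm M (%y. Re (z y)) y & sm M (%y. Im (z y)) y"
   using sm_of_smap_cz[OF smM n1 c] z[OF y] by (auto simp: P_def)
 qed (use z in "auto simp: P_def")
qed

end

subsection \<open>Local isomorphisms\<close>

text \<open>Compatibility with the action of \<open>Gm\<close> is left out, as \<open>U\<close> is
  not assumed invariant. The definition covers one direction with a left inverse, so that statements
  about the inverse follow by exchanging the roles.\<close>

definition half_iso :: "('p,'v,'x,'g) sk => ('q,'v,'x,'g) sk => 'x set => ('p => 'q) => ('q => 'p) => bool" where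
 "half_iso S T U h k \<longleftrightarrow> (ALL p:tot S. pr S p:U --> smap (atl S) (atl T) h p & pr T (h p) = pr S p &
  fm T (h p) = fm S p & k (h p) = p & (ALL g:Gc n. h (ra S p g) = ra T (h p) g))"

definition liso :: "('p,'v,'x,'g) sk => ('q,'v,'x,'g) sk => 'x set => ('p => 'q) => ('q => 'p) => bool" where
 "liso S T U h k \<longleftrightarrow> half_iso S T U h k & half_iso T S U k h"

lemma liso_sym: "liso S T U h k ==> liso T S U k h"
 by (auto simp: liso_def)

lemma lisoD:
 assumes "liso S T U h k" "p:tot S" "pr S p:U"
 shows "smap (atl S) (atl T) h p" "h p:tot T" "pr T (h p) = pr S p" "fm T (h p) = fm S p" "k (h p) = p"
  "g:Gc n ==> h (ra S p g) = ra T (h p) g"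
 using assms smap_car(2)[of "atl S" "atl T" h p] unfolding liso_def half_iso_def by blast+

text \<open>Sections \<open>s\<close> and \<open>t\<close> whose frames match after correcting
  \<open>t\<close> by \<open>A\<close> determine the map that sends \<open>s y\<close> times
  \<open>g\<close> to \<open>t y\<close> times \<open>A y g\<close>.\<close>

lemma half_iso_exists:
 assumes S: "str (S :: ('p,'v,'x,'g) sk)" and T: "str (T :: ('q,'v,'x,'g) sk)"
  and U: "opn M U"
  and s: "!!y. y:U ==> s y:tot S"
  and d: "!!p. p:tot S ==> pr S p:U ==> d p:Gc n & ra S (s (pr S p)) (d p) = p & smap (atl S) (Spinc_atlas n) d p"
  and ds: "!!y g. y:U ==> g:Gc n ==> d (ra S (s y) g) = g"
  and t: "!!y. y:U ==> t y:tot T & pr T (t y) = y & smap M (atl T) t y"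
  and e: "!!y g. y:U ==> g:Gc n ==> e (ra T (t y) g) = g"
  and A: "!!y. y:U ==> A y:Gc n & smap M (Spinc_atlas n) A y & fm T (ra T (t y) (A y)) = fm S (s y)"
  and B: "!!y. y:U ==> B y:Gc n & B y \<cdot> A y = \<one>\<^bsub>Spinc n\<^esub>"
 shows "half_iso S T U (%p. ra T (ra T (t (pr S p)) (A (pr S p))) (d p))
  (%q. ra S (ra S (s (pr T q)) (B (pr T q))) (e q))"
 unfolding half_iso_def
proof (intro ballI impI conjI)
 fix p assume p: "p:tot S" "pr S p:U"
 let ?y = "pr S p"
 note dp = d[OF p] and ty = t[OF p(2)] and Ay = A[OF p(2)] and By = B[OF p(2)] and sy = s[OF p(2)]
 note C = atS[OF S]
 have tA: "ra T (t ?y) (A ?y):tot T" using ra_mem[OF T] ty Ay by blast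
 have prs: "smap (atl S) (atl T) (%p. t (pr S p)) p" "smap (atl S) (Spinc_atlas n) (%p. A (pr S p)) p"
  using smap_comp[OF pr_smap[OF S p(1)]] ty Ay by blast+
 show "smap (atl S) (atl T) (%p. ra T (ra T (t (pr S p)) (A (pr S p))) (d p)) p"
  using dp by (intro ra_comp[OF T] prs C) auto
 show prq: "pr T (ra T (ra T (t ?y) (A ?y)) (d p)) = ?y"
  using pr_ra[OF T tA] pr_ra[OF T] ty Ay dp by simp
 show "fm T (ra T (ra T (t ?y) (A ?y)) (d p)) = fm S p"
  using fm_ra[OF T tA] fm_ra[OF S sy] Ay dp by metis
 have q: "ra T (ra T (t ?y) (A ?y)) (d p) = ra T (t ?y) (A ?y \<cdot> d p)"
  using ra_mult[OF T] ty Ay dp by simp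
 have eq: "e (ra T (ra T (t ?y) (A ?y)) (d p)) = A ?y \<cdot> d p"
  unfolding q using e[OF p(2)] Ay dp by simp
 show "ra S (ra S (s (pr T (ra T (ra T (t ?y) (A ?y)) (d p)))) (B (pr T (ra T (ra T (t ?y) (A ?y)) (d p)))))
   (e (ra T (ra T (t ?y) (A ?y)) (d p))) = p"
 proof -
  have "ra S (ra S (s ?y) (B ?y)) (A ?y \<cdot> d p) = ra S (s ?y) (B ?y \<cdot> (A ?y \<cdot> d p))"
   using ra_mult[OF S sy] Ay By dp by simp
  also have "B ?y \<cdot> (A ?y \<cdot> d p) = d p"
   using Ay By dp by (simp flip: G.m_assoc)
  finally show ?thesis unfolding prq eq using dp by simp
 qed
 fix g assume g: "g:Gc n"
 have "ra S p g = ra S (s ?y) (d p \<cdot> g)" using ra_mult[OF S sy] dp g by simp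
 hence "d (ra S p g) = d p \<cdot> g" using ds[OF p(2)] dp g by simp
 thus "ra T (ra T (t (pr S (ra S p g))) (A (pr S (ra S p g)))) (d (ra S p g)) =
   ra T (ra T (ra T (t ?y) (A ?y)) (d p)) g"
  using ra_mult[OF T tA] dp g by (simp add: pr_ra[OF S p(1) g])
qed

lemma SO_cancel:
 assumes f: "f:frames M n V" and A: "A:carrier (SO n)" and B: "B:carrier (SO n)"
 shows "frame_ract n V (frame_ract n V f B) (transpose_mat B * A) = frame_ract n V f A"
proof -
 have c: "A:carrier_mat n n" "B:carrier_mat n n" using A B by (auto simp: SO_iff)
 have "frame_ract n V (frame_ract n V f B) (transpose_mat B * A) = frame_ract n V f (B * (transpose_mat B * A))"
  by (rule frame_ract_assoc[OF f c(2)]) (use c in auto)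
 also have "B * (transpose_mat B * A) = B * transpose_mat B * A" by (rule assoc_mult_mat[symmetric]) (use c in auto)
 also have "... = A" using B c by (simp add: SO_iff left_mult_one_mat[of _ n n])
 finally show ?thesis .
qed

text \<open>Two sections have frames that differ by a rotation at each point. Its value at
  \<open>x\<close> is lifted by surjectivity of the double cover; what remains is the identity at
  \<open>x\<close>, so the smooth section near the unit matrix lifts it.\<close>

lemma local_iso:
 assumes S: "str (S :: ('p,'v,'x,'g) sk)" and T: "str (T :: ('q,'v,'x,'g) sk)" and x: "x:mc M"
 obtains U h k where "opn M U" "x:U" "liso S T U h k"
proof -
 obtain U1 s d where U1: "opn M U1" "x:U1"
  and s: "ALL y:U1. s y:tot S & pr S (s y) = y & smap M (atl S) s y"
  and d: "ALL p:tot S. pr S p:U1 --> d p:Gc n & ra S (s (pr S p)) (d p) = p & smap (atl S) (Spinc_atlas n) d p"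
  and ds: "ALL y:U1. ALL g:Gc n. d (ra S (s y) g) = g"
  by (rule local_section[OF S x]) (rule that; assumption)
 note s = s[rule_format]
 note d = d[rule_format]
 note ds = ds[rule_format]
 obtain U2 t e where U2: "opn M U2" "x:U2"
  and t: "ALL y:U2. t y:tot T & pr T (t y) = y & smap M (atl T) t y"
  and e: "ALL p:tot T. pr T p:U2 --> e p:Gc n & ra T (t (pr T p)) (e p) = p & smap (atl T) (Spinc_atlas n) e p"
  and et: "ALL y:U2. ALL g:Gc n. e (ra T (t y) g) = g"
  by (rule local_section[OF T x]) (rule that; assumption)
 note t = t[rule_format]
 note e = e[rule_format]
 note et = et[rule_format]
 note sx = s[OF U1(2)] and tx = t[OF U2(2)]
 have sx': "s x:tot S" "smap M (atl S) s x" and tx': "t x:tot T" "smap M (atl T) t x" using sx tx by auto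
 have "(x, snd (fm T (t x))):frames M n V" "(x, snd (fm S (s x))):frames M n V"
  using fm_frame[OF S sx'(1)] fm_frame[OF T tx'(1)] fst_fm[OF S sx'(1)] fst_fm[OF T tx'(1)] sx tx
  by (metis prod.collapse)+
 then obtain C where C: "C:carrier (SO n)"
  "(x, snd (fm S (s x))) = frame_ract n V (x, snd (fm T (t x))) C"
  by (rule frames_trs)
 hence C2: "fm S (s x) = frame_ract n V (fm T (t x)) C"
  using fst_fm[OF S sx'(1)] fst_fm[OF T tx'(1)] sx tx by (metis prod.collapse)
 obtain g0 where g0: "g0:carrier (Spin n)" "clf.adm n g0 = C" using adm_surj[of C n] C(1) by (auto simp: SO_iff)
 \<comment> \<open>Corrected so that the frames of \<open>t0\<close> and \<open>s\<close> coincide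
   at \<open>x\<close>.\<close>
 define t0 where "t0 y = ra T (t y) (scl n g0)" for y
 have t0s: "smap M (atl T) t0 x"
  unfolding t0_def by (rule ra_comp[OF T tx'(2) smap_const[OF smM x] smM]) (simp add: mc_Spinc scl_mem g0)
 have t0x: "fm T (t0 x) = fm S (s x)" unfolding t0_def fm_ra[OF T tx'(1) scl_mem[OF g0(1)]] Adc_scl[OF g0(1)] g0(2) C2 ..
 have fS: "smap M (frame_atlas M n V) (%y. fm S (s y)) x" by (rule smap_comp[OF sx'(2) fm_smap[OF S sx'(1)]])
 have fT: "smap M (frame_atlas M n V) (%y. fm T (t0 y)) x"
  by (rule smap_comp[OF t0s fm_smap[OF T smap_car(2)[OF t0s]]])
 obtain l p where l: "l:lframes" "p:mc (latlas l)" "fm S (s x) = lmap l p"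
  by (rule frame_atlas_obtain[OF smap_car(2)[OF fS]])
 obtain A1 where A1: "A1 x = snd p" "!!i j. i < n ==> j < n ==> sm M (%y. A1 y $$ (i, j)) x"
  "ngh M x (%y. A1 y:carrier (SO n) & fst (fm S (s y)):fst l &
   fm S (s y) = frame_ract n V (fat l (fst (fm S (s y)))) (A1 y))"
  by (rule smap_frame_coord[OF smM fS l]) (rule that; (assumption | blast))
 have l3: "fm T (t0 x) = lmap l p" using l(3) t0x by simp
 obtain A2 where A2: "A2 x = snd p" "!!i j. i < n ==> j < n ==> sm M (%y. A2 y $$ (i, j)) x"
  "ngh M x (%y. A2 y:carrier (SO n) & fst (fm T (t0 y)):fst l &
   fm T (t0 y) = frame_ract n V (fat l (fst (fm T (t0 y)))) (A2 y))"
  by (rule smap_frame_coord[OF smM fT l(1,2) l3]) (rule that; (assumption | blast))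
 have px: "snd p:carrier (SO n)" using l(1,2) mc_SO[of n] by (auto simp: mc_latlas)
 \<comment> \<open>The rotation from the frame of \<open>t0 y\<close> to that of \<open>s y\<close>:
   \<open>A2\<close> and \<open>A1\<close> are their matrices relative to the same local frame, and
   they agree at \<open>x\<close>.\<close>
 define R where "R y i j = (transpose_mat (A2 y) * A1 y) $$ (i, j)" for y i j
 have Rsum: "ngh M x (%y. \<forall>i<n. \<forall>j<n. (\<Sum>k<n. A2 y $$ (k, i) * A1 y $$ (k, j)) = R y i j)"
  using A1(3) A2(3) by eventually_elim (auto simp: R_def scalar_prod_def atLeast0LessThan SO_iff)
 have Rsm: "sm M (%y. R y i j) x" if ij: "i < n" "j < n" for i j
 proof (rule sm_cong[OF smM])
  show "sm M (%y. \<Sum>k<n. A2 y $$ (k, i) * A1 y $$ (k, j)) x"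
   by (intro sm_sum[OF smM x] sm_mult A1(2) A2(2)) (use ij in auto)
  show "ngh M x (%y. (\<Sum>k<n. A2 y $$ (k, i) * A1 y $$ (k, j)) = R y i j)"
   using Rsum by eventually_elim (use ij in blast)
 qed
 have RSO: "ngh M x (%y. transpose_mat (A2 y) * A1 y:carrier (SO n))"
  using A1(3) A2(3) by eventually_elim (blast intro: SO_mult SO_transpose_mem)
 have Rorth: "ngh M x (%y. \<forall>i<n. \<forall>j<n. (\<Sum>k<n. R y k i * R y k j) = (if i = j then 1 else 0))"
  using RSO
 proof eventually_elim
  case (elim y)
  let ?D = "transpose_mat (A2 y) * A1 y"
  have c: "?D:carrier_mat n n" using elim by (simp add: SO_iff)
  have "(\<Sum>k<n. R y k i * R y k j) = (transpose_mat ?D * ?D) $$ (i, j)" if "i < n" "j < n" for i j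
   using c that by (subst index_mult_mat) (auto simp: R_def scalar_prod_def atLeast0LessThan simp del: index_mult_mat)
  thus ?case using SO_transpose[OF elim] by simp
 qed
 have "transpose_mat (A2 x) * A1 x = 1\<^sub>m n" unfolding A1(1) A2(1) by (rule SO_transpose[OF px])
 hence R1: "R x i j = (if i = j then 1 else 0)" if "i < n" "j < n" for i j using that by (simp add: R_def)
 obtain sig where sig: "csm M sig x" "ngh M x (%z. sig z:carrier (Spin n) & (\<forall>i<n. \<forall>j<n. amat n (sig z) i j = R z i j))"
  by (rule spin_section[where A = R, OF smM x Rsm Rorth R1])
 define H where "H y = cl_mult n g0 (sig y)" for y
 interpret clf n .
 have Hs: "csm M H x" unfolding H_def by (intro csm_mult[OF smM x] csm_const[OF smM x] sig(1))
 have H: "ngh M x (%y. H y:carrier (Spin n))"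
  using sig(2) by eventually_elim (simp add: H_def Spin_mul g0)
 have ev1: "ngh M x (%y. smap M (Spinc_atlas n) (%y. scl n (H y)) y)"
  by (rule smap_eventually[OF smM sa_Spinc smap_scl[OF smM x H Hs]])
 have "ngh M x (%y. cl_transpose (H y):carrier (Spin n))" using H by eventually_elim (rule Spin_tr)
 from smap_eventually[OF smM sa_Spinc smap_scl[OF smM x this csm_tr[OF smM x Hs]]]
 have ev2: "ngh M x (%y. smap M (Spinc_atlas n) (%y. scl n (cl_transpose (H y))) y)" .
 have "ngh M x (%y. y:U1 & y:U2)"
  using nr_open[OF U1] nr_open[OF U2] by eventually_elim simp
 hence "ngh M x (%y. y:U1 & y:U2 & H y:carrier (Spin n) &
   fm T (ra T (t y) (scl n (H y))) = fm S (s y) &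
   smap M (Spinc_atlas n) (%y. scl n (H y)) y & smap M (Spinc_atlas n) (%y. scl n (cl_transpose (H y))) y)"
  using A1(3) A2(3) RSO sig(2) H ev1 ev2
 proof eventually_elim
  case (elim y)
  let ?D = "transpose_mat (A2 y) * A1 y"
  have ty: "t y:tot T" "pr T (t y) = y" and sy: "s y:tot S" "pr S (s y) = y" using t s elim(1) by auto
  have t0y: "t0 y:tot T" "pr T (t0 y) = y" unfolding t0_def using ra_mem[OF T] pr_ra[OF T] ty scl_mem[OF g0(1)] by auto
  have "adm (sig y) = ?D"
  proof (rule eq_matI)
   have c: "?D:carrier_mat n n" using elim(4) by (simp add: SO_iff)
   thus "dim_row (adm (sig y)) = dim_row ?D" "dim_col (adm (sig y)) = dim_col ?D" by (auto simp: adm_amat)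
   fix i j assume "i < dim_row ?D" "j < dim_col ?D"
   hence "i < n" "j < n" using c by (metis carrier_matD)+
   hence "amat n (sig y) i j = R y i j" using elim(5) by blast
   thus "adm (sig y) $$ (i, j) = ?D $$ (i, j)" unfolding adm_amat R_def using \<open>i < n\<close> \<open>j < n\<close> by (metis case_prod_conv index_mat(1))
  qed
  have "fm T (ra T (t y) (scl n (H y))) = fm T (ra T (t0 y) (scl n (sig y)))"
   using ra_mult[OF T ty(1)] elim(5) g0 by (simp add: H_def t0_def scl_mem flip: sclm)
  also have "... = frame_ract n V (fm T (t0 y)) ?D"
   using fm_ra[OF T t0y(1)] elim(5) by (simp add: scl_mem Adc_scl \<open>adm (sig y) = ?D\<close>)
  also have "... = frame_ract n V (frame_ract n V (fat l y) (A2 y)) ?D"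
   using elim(3) fst_fm[OF T t0y(1)] t0y(2) by simp
  also have "... = frame_ract n V (fat l y) (A1 y)"
   by (rule SO_cancel) (use elim(2,3) fst_fm[OF T t0y(1)] t0y(2) lframe_mem[OF l(1)] in auto)
  also have "... = fm S (s y)" using elim(2) fst_fm[OF S sy(1)] sy(2) by simp
  finally show ?case using elim by blast
 qed
 then obtain U where U: "opn M U" "x:U" "!!y. y:U ==> y:U1 & y:U2 & H y:carrier (Spin n) &
   fm T (ra T (t y) (scl n (H y))) = fm S (s y) &
   smap M (Spinc_atlas n) (%y. scl n (H y)) y & smap M (Spinc_atlas n) (%y. scl n (cl_transpose (H y))) y"
  unfolding nr[OF smM x] by blast
 let ?A = "%y. scl n (H y)" and ?B = "%y. scl n (cl_transpose (H y))"
 have AB: "?A y:Gc n" "?B y:Gc n" "?B y \<cdot> ?A y = \<one>\<^bsub>Spinc n\<^esub>" "?A y \<cdot> ?B y = \<one>\<^bsub>Spinc n\<^esub>" if "y:U" for y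
  using U(3)[OF that] by (auto simp: scl_mem Spin_tr sclm Spin_left Spin_right scl_one)
 have fB: "fm S (ra S (s y) (?B y)) = fm T (t y)" if y: "y:U" for y
 proof -
  have ty: "t y:tot T" and sy: "s y:tot S" using U(3)[OF y] s t by auto
  have f: "fm T (ra T (t y) (?A y)) = fm S (s y)" using U(3)[OF y] by blast
  have Hy: "H y:carrier (Spin n)" using U(3)[OF y] by blast
  have "fm S (ra S (s y) (?B y)) = frame_ract n V (frame_ract n V (fm T (t y)) (adm (H y))) (transpose_mat (adm (H y)))"
   using fm_ra[OF S sy AB(2)[OF y]] fm_ra[OF T ty AB(1)[OF y]] f Hy by (simp add: Adc_scl Spin_tr adm_tr)
  also have "... = frame_ract n V (fm T (t y)) (adm (H y) * transpose_mat (adm (H y)))"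
   by (rule frame_ract_assoc[OF fm_frame[OF T ty]]) auto
  also have "... = fm T (t y)" using Hy by (simp add: adm_orth frame_ract_one[OF fm_frame[OF T ty]])
  finally show ?thesis .
 qed
 have "half_iso S T U (%p. ra T (ra T (t (pr S p)) (?A (pr S p))) (d p)) (%q. ra S (ra S (s (pr T q)) (?B (pr T q))) (e q))"
  by (rule half_iso_exists[OF S T U(1)]) (use U(3) AB s t d ds et in auto)
 moreover have "half_iso T S U (%q. ra S (ra S (s (pr T q)) (?B (pr T q))) (e q)) (%p. ra T (ra T (t (pr S p)) (?A (pr S p))) (d p))"
  by (rule half_iso_exists[OF T S U(1)]) (use U(3) AB s t e ds et fB in auto)
 ultimately show thesis using that[OF U(1,2)] unfolding liso_def by blast
qed

end

subsection \<open>Partitions of unity\<close>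

lemma flat_one: "flat 1 t = (if t > 0 then exp (- inverse t) else 0)"
 by (simp add: flat_def)

text \<open>The flat function of \<open>e^2\<close> minus the squared coordinate distance is
  positive only on a coordinate ball inside \<open>N\<close>. Regularity encloses \<open>N\<close>
  in a closed subset of the chart domain, so extension by zero stays smooth at the border of the
  chart.\<close>

lemma bump_exists:
 assumes A: "smooth_atlas A" and reg: "regular_space (mtop A)" and W: "opn A W" "x:W"
 obtains f where "!!y. f y \<ge> 0" "f x > 0" "!!y. y:mc A ==> sm A f y"
  "!!y. y:mc A ==> y \<notin> W ==> ngh A y (%z. f z = 0)"
proof -
 have xA: "x:mc A" using opn_subset[OF A W(1)] W(2) by auto
 obtain d U ph where c: "(d, U, ph):A" "x:U" by (rule sm_chartE[OF xA])
 have WU: "opn A (W \<inter> U)" "x:W \<inter> U" using W c chart_open[OF A c(1)] by auto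
 obtain N C where N: "opn A N" "x:N" "N \<subseteq> C" and C: "closedin (mtop A) C" "C \<subseteq> W \<inter> U"
  using reg[folded neighbourhood_base_of_closedin, unfolded neighbourhood_base_of, rule_format, OF conjI[OF WU]]
  by (elim exE conjE) (rule that)
 have NU: "N \<inter> U = N" using N C by auto
 have "opE d (ph ` N)" using chart_image_open[OF A c(1) N(1)] NU by simp
 from eucl_box[OF this, of "ph x"] N(2)
 obtain e where e: "e > 0" "!!y. y:eucl d ==> (\<forall>i<d. \<bar>y i - ph x i\<bar> < e) ==> y:ph ` N" by blast
 define h where "h y = e\<^sup>2 - (\<Sum>i<d. (ph y i - ph x i) * (ph y i - ph x i))" for y
 define f where "f y = (if y:U then flat 1 (h y) else 0)" for y
 have fN: "y:N" if "f y \<noteq> 0" for y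
 proof -
  have y: "y:U" "h y > 0" using that by (auto simp: f_def flat_one split: if_splits)
  have "\<bar>ph y i - ph x i\<bar> < e" if i: "i < d" for i
  proof -
   have "(ph y i - ph x i) * (ph y i - ph x i) \<le> (\<Sum>i<d. (ph y i - ph x i) * (ph y i - ph x i))"
    by (rule member_le_sum) (use i in auto)
   hence "\<bar>ph y i - ph x i\<bar>\<^sup>2 < e\<^sup>2" using y(2) unfolding h_def power2_eq_square abs_mult_self_eq by linarith
   thus ?thesis using e(1) by (simp add: power2_less_imp_less)
  qed
  hence "ph y:ph ` N" by (intro e(2)) (use chart_eucl[OF A c(1) y(1)] in auto)
  then obtain w where w: "w:N" "ph y = ph w" by auto
  have i: "inv_into U ph (ph y) = y" "inv_into U ph (ph w) = w" using chart_inv[OF A c(1)] y(1) w(1) NU by auto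
  have "y = w" using i(1)[unfolded w(2)] i(2) by (rule trans[OF sym])
  thus ?thesis using w(1) by (rule ssubst)
 qed
 have off: "ngh A y (%z. f z = 0)" if y: "y:mc A" "y \<notin> C" for y
 proof -
  have "opn A (mc A - C)" using C(1) topspace_mtop[OF A] by (simp add: closedin_def)
  from nr_open[OF this, of y] y have "ngh A y (%z. z:mc A - C)" by simp
  thus ?thesis by eventually_elim (use fN N(3) in blast)
 qed
 show thesis
 proof (rule that[of f])
  show "f y \<ge> 0" for y by (simp add: f_def flat_one)
  show "f x > 0" using e(1) c(2) by (simp add: f_def h_def flat_one)
  show "ngh A y (%z. f z = 0)" if "y:mc A" "y \<notin> W" for y using off that C by blast
  show "sm A f y" if y: "y:mc A" for y
  proof (cases "y:U")
   case True
   have "sm A h y" unfolding h_def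
    by (intro sm_diff[OF A] sm_const[OF A y] sm_sum[OF A y] sm_mult sm_coord[OF A c(1) True])
   from sm_flat[OF this, of 1] have s: "sm A (%z. flat 1 (h z)) y" .
   have "ngh A y (%z. flat 1 (h z) = f z)"
    using nr_open[OF chart_open[OF A c(1)] True] by eventually_elim (simp add: f_def)
   thus ?thesis by (rule sm_cong[OF A _ s])
  next
   case False
   have "ngh A y (%z. 0 = f z)" using off[OF y] False C(2) by (auto elim: eventually_mono)
   thus ?thesis by (rule sm_cong[OF A _ sm_const[OF A y]])
  qed
 qed
qed

text \<open>An index is a pair of a cover member and a bump function, so it remembers where its
  function lives. Vanishing near each point outside \<open>fst e\<close> is the support condition
  that makes products with functions defined only on \<open>fst e\<close> smooth.\<close>

lemma partition_of_unity:
 fixes A :: "'x atlas"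
 assumes A: "smooth_atlas A" and H: "Hausdorff_space (mtop A)" and K: "compact_space (mtop A)"
  and U: "\<U>:open_covers A"
 obtains I :: "('x set \<times> ('x => real)) set" and l where "finite I" "ALL e:I. fst e:\<U>"
  "ALL e:I. ALL x:mcarrier A. sm A (l e) x" "ALL e:I. ALL x:mcarrier A. x \<notin> fst e --> (ngh A x (%y. l e y = 0))"
  "ALL x:mcarrier A. (SUM e:I. l e x) = 1"
proof -
 have reg: "regular_space (mtop A)" by (rule compact_Hausdorff_imp_regular_space[OF K H])
 define P where "P x e \<longleftrightarrow> fst e:\<U> & (\<forall>y. snd e y \<ge> 0) & snd e x > 0 & (ALL y:mcarrier A. sm A (snd e) y) &
  (ALL y:mcarrier A. y \<notin> fst e --> (ngh A y (%z. snd e z = 0)))" for x and e :: "'x set \<times> ('x => real)"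
 have "\<exists>e. P x e" if x: "x:mc A" for x
 proof -
  obtain b where b: "b:\<U>" "x:b" using U x unfolding open_covers_def by blast
  have ob: "opn A b" using U b by (auto simp: open_covers_def)
  obtain f where "!!y. f y \<ge> 0" "f x > 0" "!!y. y:mc A ==> sm A f y"
   "!!y. y:mc A ==> y \<notin> b ==> ngh A y (%z. f z = 0)"
   using bump_exists[OF A reg ob b(2)] by blast
  hence "P x (b, f)" using b by (simp add: P_def)
  thus ?thesis by blast
 qed
 then obtain E where E: "P x (E x)" if "x:mc A" for x by metis
 define pos where "pos x = {y:mc A. snd (E x) y > 0}" for x
 have op: "opn A (pos x)" if x: "x:mc A" for x
 proof (rule opn_near[OF A])
  fix y assume y: "y:pos x"
  hence yA: "y:mc A" "snd (E x) y:{0<..}" by (auto simp: pos_def)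
  have "sm A (snd (E x)) y" using E[OF x] yA(1) by (simp add: P_def)
  from sm_near[OF A this open_greaterThan yA(2)] nr_open[OF opn_car[OF A] yA(1)]
  show "ngh A y (%z. z:pos x)" by eventually_elim (simp add: pos_def)
 qed (auto simp: pos_def)
 have "\<exists>\<F>. finite \<F> & \<F> \<subseteq> pos ` mc A & mc A \<subseteq> \<Union>\<F>"
 proof -
  have "mc A \<subseteq> \<Union>(pos ` mc A)" using E by (auto simp: pos_def P_def)
  moreover have "ALL u:pos ` mc A. opn A u" using op by blast
  ultimately show ?thesis using K[unfolded compact_space_alt topspace_mtop[OF A], rule_format, of "pos ` mc A"] by simp
 qed
 then obtain \<F> where F: "finite \<F>" "\<F> \<subseteq> pos ` mc A" "mc A \<subseteq> \<Union>\<F>" by blast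
 obtain K0 where K0: "K0 \<subseteq> mc A" "finite K0" "\<F> = pos ` K0" using F(1,2) by (meson finite_subset_image)
 define I where "I = E ` K0"
 define s where "s y = (SUM e:I. snd e y)" for y
 have fI: "finite I" by (simp add: I_def K0)
 have PI: "\<exists>x. P x e" if "e:I" for e using that E K0(1) by (auto simp: I_def)
 have s0: "s y > 0" if y: "y:mc A" for y
 proof -
  obtain x where x: "x:K0" "y:pos x" using F(3) K0(3) y by auto
  have "snd (E x) y \<le> s y" unfolding s_def
   by (rule member_le_sum) (use x fI PI in "auto simp: I_def P_def")
  thus ?thesis using x(2) by (simp add: pos_def)
 qed
 have sms: "sm A (snd e) y" if "e:I" "y:mc A" for e y using PI[OF that(1)] that(2) by (auto simp: P_def)
 have ss: "sm A s y" if "y:mc A" for y unfolding s_def by (rule sm_sum[OF A that sms]) (use that in auto)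
 show thesis
 proof (rule that[of I "%e y. snd e y / s y", OF fI]; intro ballI impI)
  fix e assume e: "e:I"
  show "fst e:\<U>" using PI[OF e] by (auto simp: P_def)
  fix x assume x: "x:mc A"
  show "sm A (%y. snd e y / s y) x" by (rule sm_divide[OF A sms[OF e x] ss[OF x]]) (use s0[OF x] in simp)
  assume "x \<notin> fst e"
  hence "ngh A x (%y. snd e y = 0)" using PI[OF e] x by (auto simp: P_def)
  thus "ngh A x (%y. snd e y / s y = 0)" by eventually_elim simp
 next
  fix x assume x: "x:mc A"
  show "(SUM e:I. snd e x / s x) = 1" using s0[OF x] by (simp add: s_def flip: sum_divide_distrib)
 qed
qed

subsection \<open>Vanishing of cohomology with real coefficients\<close>

context spc
begin

lemma Haus_M: "Hausdorff_space (mtop M)" and compact_M: "compact_space (mtop M)"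
 using ori by (auto simp: orientifold_def smooth_manifold_def)

lemma rho_inv: "ga:GG ==> x:mc M ==> rh ga (rh (iv ga) x) = x"
 and rho_inv': "ga:GG ==> x:mc M ==> rh (iv ga) (rh ga x) = x"
 by (simp_all add: rho_one flip: rho_mult)

lemma sm_rho: "ga:GG ==> x:mc M ==> sm M f (rh ga x) ==> sm M (%y. f (rh ga y)) x"
 by (rule smap_sm[OF rho_smap])

abbreviation cdom :: "'x set set => nat => ('x set list \<times> 'g list \<times> 'x) set" where
 "cdom \<equiv> cech_domain Gm rh"

abbreviation "cd1 \<U> a0 a1 ga x \<equiv> ([a0, a1], [ga], x):cdom \<U> (Suc 0)"
abbreviation "cd2 \<U> a0 a1 a2 ga de x \<equiv> ([a0, a1, a2], [ga, de], x):cdom \<U> 2"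
abbreviation "cd3 \<U> a0 a1 a2 a3 ga de et x \<equiv> ([a0, a1, a2, a3], [ga, de, et], x):cdom \<U> 3"

text \<open>The coboundary with coefficients in \<open>\<real>\<close> of a family \<open>r\<close> of smooth functions.\<close>

definition dr :: "('x set => 'x set => 'g => 'x => real) => 'x set => 'x set => 'x set => 'g => 'g => 'x => real" where
 "dr r a0 a1 a2 ga de x = r a1 a2 de (rh ga x) - r a0 a2 (de \<odot> ga) x + of_int (ep de) * r a0 a1 ga x"

definition smooth1 :: "'x set set => ('x set => 'x set => 'g => 'x => real) => bool" where
 "smooth1 \<U> r \<longleftrightarrow> (ALL a0:\<U>. ALL a1:\<U>. ALL ga:GG. ALL x:a0. rh ga x:a1 --> sm M (r a0 a1 ga) x)"

lemma cdom1_iff: "cd1 \<U> a0 a1 ga x \<longleftrightarrow>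
  a0:\<U> & a1:\<U> & ga:GG & x:a0 & rh ga x:a1"
 by (auto simp: cech_domain_def cech_index_def)

lemma cdom2_iff: "([a0, a1, a2], [ga, de], x):cdom \<U> 2 \<longleftrightarrow>
  a0:\<U> & a1:\<U> & a2:\<U> & ga:GG & de:GG & x:a0 & rh ga x:a1 & rh de (rh ga x):a2"
 by (auto simp: cech_domain_def cech_index_def)

lemma cdom3_iff: "cd3 \<U> a0 a1 a2 a3 ga de et x \<longleftrightarrow>
  a0:\<U> & a1:\<U> & a2:\<U> & a3:\<U> & ga:GG & de:GG & et:GG &
  x:a0 & rh ga x:a1 & rh de (rh ga x):a2 & rh et (rh de (rh ga x)):a3"
 by (auto simp: cech_domain_def cech_index_def)

definition subordinate :: "'x set set => ('x set \<times> ('x => real)) set \<times> ('x set \<times> ('x => real) => 'x => real) => bool" where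
 "subordinate \<U> = (%(I, l). finite I & (ALL e:I. fst e:\<U>) & (ALL e:I. ALL x:mcarrier M. sm M (l e) x) &
  (ALL e:I. ALL x:mcarrier M. x \<notin> fst e --> (ngh M x (%y. l e y = 0))) & (ALL x:mcarrier M. (SUM e:I. l e x) = 1))"

text \<open>Averaging over the group and over a partition of unity. It inserts a vertex and an edge at the
 beginning of a trail, where the coboundary is not twisted by \<open>\<epsilon>\<close>.\<close>

definition avg :: "'x set set => ('x set => 'g => 'x => real) => 'x => real" where
 "avg \<U> F x = (case SOME Il. subordinate \<U> Il of (I, l) =>
  (SUM de:GG. SUM e:I. l e (rh (iv de) x) * F (fst e) de (rh (iv de) x)) / real (card (GG)))"

context
 fixes \<U> assumes U: "\<U>:open_covers M"
begin

lemma avg_expand: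
 obtains I l where "subordinate \<U> (I, l)" "!!F x. avg \<U> F x = (SUM de:GG. SUM e:I. l e (rh (iv de) x) * F (fst e) de (rh (iv de) x)) / real (card (GG))"
proof -
 have "\<exists>Il. subordinate \<U> Il"
  by (rule partition_of_unity[OF smM Haus_M compact_M U]) (auto simp: subordinate_def)
 hence "subordinate \<U> (SOME Il. subordinate \<U> Il)" by (rule someI_ex)
 thus thesis using that by (cases "SOME Il. subordinate \<U> Il") (simp add: avg_def)
qed

lemma sm_avg:
 assumes x: "x:mc M"
  and F: "!!b de. b:\<U> ==> de:GG ==> rh (iv de) x:b ==> sm M (F b de) (rh (iv de) x)"
 shows "sm M (avg \<U> F) x"
proof -
 obtain I l where I: "subordinate \<U> (I, l)" and avg: "!!F x. avg \<U> F x = (SUM de:GG. SUM e:I. l e (rh (iv de) x) * F (fst e) de (rh (iv de) x)) / real (card (GG))"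
  by (rule avg_expand) blast
 have t: "sm M (%y. l e (rh (iv de) y) * F (fst e) de (rh (iv de) y)) x" if de: "de:GG" and e: "e:I" for de e
 proof -
  let ?y = "rh (iv de) x"
  have y: "?y:mc M" using rho_mem de x by simp
  have "sm M (%y. l e y * F (fst e) de y) ?y"
  proof (cases "?y:fst e")
   case True thus ?thesis using F I de e y by (intro sm_mult) (auto simp: subordinate_def)
  next
   case False
   \<comment> \<open>Off the cover member nothing is known about \<open>F\<close>, but the weight
     vanishes on a whole neighbourhood.\<close>
   hence "ngh M ?y (%y. l e y = 0)" using I e y by (auto simp: subordinate_def)
   hence "ngh M ?y (%y. 0 = l e y * F (fst e) de y)" by eventually_elim simp
   thus ?thesis by (rule sm_cong[OF smM _ sm_const[OF smM y]])
  qed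
  thus ?thesis by (rule sm_rho[where f = "%y. l e y * F (fst e) de y", rotated 2]) (use de x in auto)
 qed
 have "sm M (%y. inverse (real (card (GG))) * (SUM de:GG. SUM e:I. l e (rh (iv de) y) * F (fst e) de (rh (iv de) y))) x"
  by (intro sm_cmult[OF smM] sm_sum[OF smM x] t)
 thus ?thesis unfolding avg[abs_def] by (simp add: field_class.field_divide_inverse mult.commute)
qed

lemma avg_const:
 assumes x: "x:mc M"
  and F: "!!b de. b:\<U> ==> de:GG ==> rh (iv de) x:b ==> F b de (rh (iv de) x) = t"
 shows "avg \<U> F x = t"
proof -
 obtain I l where I: "subordinate \<U> (I, l)" and avg: "!!F x. avg \<U> F x = (SUM de:GG. SUM e:I. l e (rh (iv de) x) * F (fst e) de (rh (iv de) x)) / real (card (GG))"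
  by (rule avg_expand) blast
 have "(SUM e:I. l e (rh (iv de) x) * F (fst e) de (rh (iv de) x)) = t" if de: "de:GG" for de
 proof -
  let ?y = "rh (iv de) x"
  have y: "?y:mc M" using rho_mem de x by simp
  have "l e ?y * F (fst e) de ?y = l e ?y * t" if e: "e:I" for e
  proof (cases "?y:fst e")
   case False
   hence "ngh M ?y (%z. l e z = 0)" using I e y by (auto simp: subordinate_def)
   thus ?thesis using nr_self[OF _ smM y] by fastforce
  qed (use F de I e in "auto simp: subordinate_def")
  hence "(SUM e:I. l e ?y * F (fst e) de ?y) = (SUM e:I. l e ?y) * t"
   unfolding sum_distrib_right by (rule sum.cong[OF refl])
  thus ?thesis using I y by (simp add: subordinate_def)
 qed
 moreover have "card (GG) \<noteq> 0" using finite_Gamma Gam.one_closed by (auto simp: card_gt_0_iff)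
 ultimately show ?thesis by (simp add: avg)
qed

lemma avg_add: "avg \<U> F x + avg \<U> G x = avg \<U> (%b de y. F b de y + G b de y) x"
 and avg_cmult: "c * avg \<U> F x = avg \<U> (%b de y. c * F b de y) x"
 by (simp_all add: avg_def distrib_left sum.distrib add_divide_distrib sum_distrib_left mult.left_commute split: prod.split)

text \<open>Reindexing the group sum by \<open>ga\<close> moves the evaluation back from
  \<open>rh ga x\<close> to \<open>x\<close>, at the price of prolonging the inserted edge by
  \<open>ga\<close>.\<close>

lemma avg_shift:
 assumes ga: "ga:GG" and x: "x:mc M"
 shows "avg \<U> F (rh ga x) = avg \<U> (%b de. F b (ga \<odot> de)) x"
proof -
 have "bij_betw ((\<odot>) ga) (GG) (GG)"
  by (rule bij_betw_byWitness[where f' = "(\<odot>) (iv ga)"]) (use ga in "auto simp flip: Gam.m_assoc")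
 hence *: "sum f (GG) = (SUM de:GG. f (ga \<odot> de))" for f :: "'g => real"
  by (rule sum.reindex_bij_betw[symmetric])
 have "rh (iv (ga \<odot> de)) (rh ga x) = rh (iv de) x" if "de:GG" for de
  using ga x that by (simp add: Gam.inv_mult_group rho_mult rho_mem rho_inv')
 moreover obtain I l where E: "(SOME Il. subordinate \<U> Il) = (I, l)" by (cases "SOME Il. subordinate \<U> Il")
 ultimately show ?thesis unfolding avg_def E prod.case by (subst *) simp
qed

text \<open>The cocycle identity on the trail from \<open>rh (iv de) x\<close> through
  \<open>x\<close> to \<open>rh ga x\<close> gives \<open>r a0 a1 ga x\<close> as a difference of
  values with inserted start vertex \<open>b\<close> and edge \<open>de\<close>. Averaging over
  \<open>b\<close> and \<open>de\<close> leaves the left side unchanged.\<close>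

lemma real_H1_vanishes:
 assumes sm: "!!a0 a1 ga x. cd1 \<U> a0 a1 ga x ==> sm M (r a0 a1 ga) x"
  and cocycle: "!!a0 a1 a2 ga de x. cd2 \<U> a0 a1 a2 ga de x ==> dr r a0 a1 a2 ga de x = 0"
 obtains f where "ALL a:\<U>. ALL x:a. sm M (f a) x"
  "\<forall>a0 a1 ga x. cd1 \<U> a0 a1 ga x --> f a1 (rh ga x) - of_int (ep ga) * f a0 x = r a0 a1 ga x"
proof -
 have inM: "x:mc M" if "a:\<U>" "x:a" for a x using U that by (auto simp: open_covers_def)
 show thesis
 proof (rule that[of "%a. avg \<U> (%b. r b a)"]; intro allI ballI impI)
  fix a x assume a: "a:\<U>" "x:a"
  show "sm M (avg \<U> (%b. r b a)) x"
   by (rule sm_avg[OF inM[OF a]]) (rule sm, use a inM[OF a] in "auto simp: rho_inv cdom1_iff")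
 next
  fix a0 a1 ga x assume d: "cd1 \<U> a0 a1 ga x"
  hence ga: "ga:GG" and xM: "x:mc M" using inM by (auto simp: cdom1_iff)
  have "avg \<U> (%b. r b a1) (rh ga x) - of_int (ep ga) * avg \<U> (%b. r b a0) x =
    avg \<U> (%b de. r b a1 (ga \<odot> de)) x + - of_int (ep ga) * avg \<U> (%b. r b a0) x"
   by (simp add: avg_shift[OF ga xM])
  also have "... = r a0 a1 ga x" unfolding avg_cmult avg_add
  proof (rule avg_const[OF xM])
   fix b de assume "b:\<U>" "de:GG" "rh (iv de) x:b"
   thus "r b a1 (ga \<odot> de) (rh (iv de) x) + - of_int (ep ga) * r b a0 de (rh (iv de) x) = r a0 a1 ga x"
    using cocycle[of b a0 a1 de ga "rh (iv de) x"] d by (simp add: rho_inv xM cdom1_iff cdom2_iff dr_def)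
  qed
  finally show "avg \<U> (%b. r b a1) (rh ga x) - of_int (ep ga) * avg \<U> (%b. r b a0) x = r a0 a1 ga x" .
 qed
qed

text \<open>The same contraction one degree higher: the primitive is the average of \<open>c\<close>
  with a vertex and an edge inserted in front, and the cocycle identity for the prolonged trail
  holds for every inserted pair.\<close>

lemma real_H2_vanishes:
 assumes sm: "!!a0 a1 a2 ga de x. cd2 \<U> a0 a1 a2 ga de x ==> sm M (c a0 a1 a2 ga de) x"
  and cocycle: "!!a0 a1 a2 a3 ga de et x. cd3 \<U> a0 a1 a2 a3 ga de et x ==>
   c a1 a2 a3 de et (rh ga x) - c a0 a2 a3 (de \<odot> ga) et x + c a0 a1 a3 ga (et \<odot> de) x
    - of_int (ep et) * c a0 a1 a2 ga de x = (0::real)"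
 obtains r where "smooth1 \<U> r" "\<forall>a0 a1 a2 ga de x. cd2 \<U> a0 a1 a2 ga de x --> dr r a0 a1 a2 ga de x = c a0 a1 a2 ga de x"
proof -
 have inM: "x:mc M" if "a:\<U>" "x:a" for a x using U that by (auto simp: open_covers_def)
 define r where "r a0 a1 ga = avg \<U> (%b de. c b a0 a1 de ga)" for a0 a1 ga
 show thesis
 proof (rule that[of r]; (unfold smooth1_def)?; intro allI ballI impI)
  fix a0 a1 ga x assume a: "a0:\<U>" "a1:\<U>" and ga: "ga:GG" and x: "x:a0" "rh ga x:a1"
  note xM = inM[OF a(1) x(1)]
  show "sm M (r a0 a1 ga) x" unfolding r_def
   by (rule sm_avg[OF xM]) (rule sm, use a ga x xM in "auto simp: rho_inv cdom2_iff")
 next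
  fix a0 a1 a2 ga et x assume d: "cd2 \<U> a0 a1 a2 ga et x"
  hence ga: "ga:GG" and xM: "x:mc M" using inM by (auto simp: cdom2_iff)
  have "dr r a0 a1 a2 ga et x = avg \<U> (%b de. c b a1 a2 (ga \<odot> de) et) x +
    (-1 * avg \<U> (%b de. c b a0 a2 de (et \<odot> ga)) x + of_int (ep et) * r a0 a1 ga x)"
   by (simp add: r_def dr_def avg_shift[OF ga xM])
  also have "... = c a0 a1 a2 ga et x" unfolding r_def avg_cmult avg_add
  proof (rule avg_const[OF xM])
   fix b de assume b: "b:\<U>" "de:GG" "rh (iv de) x:b"
   let ?y = "rh (iv de) x"
   show "c b a1 a2 (ga \<odot> de) et ?y + (- 1 * c b a0 a2 de (et \<odot> ga) ?y + of_int (ep et) * c b a0 a1 de ga ?y) = c a0 a1 a2 ga et x"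
    using cocycle[of b a0 a1 a2 de ga et ?y] d b by (simp add: rho_inv xM cdom2_iff cdom3_iff)
  qed
  finally show "dr r a0 a1 a2 ga et x = c a0 a1 a2 ga et x" .
 qed
qed

end

end

subsection \<open>The exponential map of \<open>U(1)\<close>\<close>

definition uexp :: "real => complex" where
 "uexp t = cis (2 * pi * t)"

lemma nuexp [simp]: "cmod (uexp t) = 1"
 by (simp add: uexp_def)

lemma uexp_add: "uexp s * uexp t = uexp (s + t)"
 by (simp add: uexp_def cis_mult distrib_left)

lemma uexp_eq_iff: "uexp s = uexp t \<longleftrightarrow> (\<exists>k::int. s - t = of_int k)"
proof
 assume eq: "uexp s = uexp t"
 have "uexp (s - t) = uexp s * uexp (- t)" by (simp add: uexp_add)
 also have "... = uexp (t + - t)" unfolding eq by (rule uexp_add)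
 finally have "cos (2 * pi * (s - t)) = 1" by (simp add: uexp_def complex_eq_iff)
 then obtain k :: int where "2 * pi * (s - t) = of_int k * 2 * pi" unfolding cos_one_2pi_int by auto
 thus "\<exists>k::int. s - t = of_int k" by (auto intro: exI[of _ k])
next
 assume "\<exists>k::int. s - t = of_int k"
 then obtain k :: int where k: "s = of_int k + t" by (auto simp: algebra_simps)
 have "uexp (of_int k) = 1" unfolding uexp_def using cis_multiple_2pi[of "of_int k"] by (simp add: mult.commute)
 thus "uexp s = uexp t" unfolding k by (simp flip: uexp_add)
qed

lemma sm_uexp:
 assumes A: "smooth_atlas A" and f: "sm A f x"
 shows "sm A (%y. Re (uexp (f y))) x" "sm A (%y. Im (uexp (f y))) x"
 unfolding uexp_def by (simp_all add: sm_cos sm_sin sm_cmult[OF A f])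

text \<open>Divided by its value at \<open>x\<close>, the function has positive real part near
  \<open>x\<close>, where its argument is the arctangent of imaginary part over real part; the
  argument of \<open>w x\<close> is added as a constant.\<close>

lemma local_log:
 assumes A: "smooth_atlas A" and U: "opn A U" "x:U"
  and w: "!!y. y:U ==> cmod (w y) = 1 & sm A (%y. Re (w y)) y & sm A (%y. Im (w y)) y"
 obtains W u where "opn A W" "x:W" "W \<subseteq> U" "ALL y:W. sm A u y & w y = uexp (u y)"
proof -
 define v where "v y = w y * cnj (w x)" for y
 define u where "u y = (Arg (w x) + arctan (Im (v y) / Re (v y))) / (2 * pi)" for y
 have wx: "w x * cnj (w x) = 1" using w[OF U(2)] by (simp add: complex_norm_square[symmetric])
 have vs: "sm A (%y. Re (v y)) y" "sm A (%y. Im (v y)) y" if y: "y:U" for y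
 proof -
  have yA: "y:mc A" using opn_subset[OF A U(1)] y by auto
  show "sm A (%y. Re (v y)) y" "sm A (%y. Im (v y)) y"
   unfolding v_def times_complex.simps complex_cnj
   using w[OF y] by (auto intro!: sm_add sm_diff[OF A] sm_mult sm_const[OF A yA])
 qed
 have "Re (v x):{0<..}" using wx by (simp add: v_def)
 from sm_near[OF A vs(1)[OF U(2)] open_greaterThan this] nr_open[OF U]
 have "ngh A x (%y. y:U & Re (v y) > 0)" by eventually_elim simp
 then obtain W where W: "opn A W" "x:W" "!!y. y:W ==> y:U & Re (v y) > 0"
  using opn_subset[OF A U(1)] U(2) by (subst (asm) nr[OF A]) auto
 show thesis
 proof (rule that[OF W(1,2)]; intro ballI conjI subsetI)
  fix y assume y: "y:W"
  note yU = W(3)[OF y, THEN conjunct1] and pos = W(3)[OF y, THEN conjunct2]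
  have yA: "y:mc A" using opn_subset[OF A U(1)] yU by auto
  show "sm A u y" unfolding u_def
   by (intro sm_divide[OF A] sm_add sm_const[OF A yA] sm_arctan vs[OF yU]) (use pos in auto)
  let ?t = "Im (v y) / Re (v y)"
  have nv: "cmod (v y) = 1" using w[OF yU] w[OF U(2)] by (simp add: v_def norm_mult)
  hence "(Re (v y))\<^sup>2 + (Im (v y))\<^sup>2 = 1" by (simp add: cmod_def)
  hence "1 + ?t\<^sup>2 = 1 / (Re (v y))\<^sup>2" using pos by (simp add: field_simps)
  hence sq: "sqrt (1 + ?t\<^sup>2) = 1 / Re (v y)" using pos by (simp add: real_sqrt_divide)
  have vc: "cis (arctan ?t) = v y"
   using pos by (simp add: complex_eq_iff cos_arctan sin_arctan sq)
  have "uexp (u y) = cis (Arg (w x)) * cis (arctan ?t)" by (simp add: uexp_def u_def cis_mult)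
  also have "cis (Arg (w x)) = w x"
   using w[OF U(2)] rcis_cmod_Arg[of "w x"] by (simp add: rcis_def)
  also have "w x * cis (arctan ?t) = w y * (w x * cnj (w x))" unfolding vc by (simp add: v_def)
  also have "... = w y" using wx by simp
  finally show "w y = uexp (u y)" ..
 qed (use W(3) in blast)
qed

subsection \<open>Cech cochains of degree \<open>1\<close> and \<open>2\<close>\<close>

lemma length_2E: "length l = Suc (Suc 0) ==> \<exists>a b. l = [a, b]"
 by (auto simp: length_Suc_conv)

lemma length_3E: "length l = Suc (Suc (Suc 0)) ==> \<exists>a b c. l = [a, b, c]"
 by (auto simp: length_Suc_conv)

lemma length_4E: "length l = Suc (Suc (Suc (Suc 0))) ==> \<exists>a b c d. l = [a, b, c, d]"
 by (auto simp: length_Suc_conv)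

context spc
begin

lemma index1E:
 assumes "(as, gas):cech_index Gm \<U> (Suc 0)"
 obtains a0 a1 ga where "as = [a0, a1]" "gas = [ga]" "a0:\<U>" "a1:\<U>" "ga:GG"
proof -
 have "\<exists>a0 a1. as = [a0, a1]" by (rule length_2E) (use assms in "simp add: cech_index_def")
 moreover have "\<exists>ga. gas = [ga]" using assms by (auto simp: cech_index_def length_Suc_conv)
 ultimately show thesis using that assms by (auto simp: cech_index_def)
qed

lemma index2E:
 assumes "(as, gas):cech_index Gm \<U> 2"
 obtains a0 a1 a2 ga de where "as = [a0, a1, a2]" "gas = [ga, de]" "a0:\<U>" "a1:\<U>" "a2:\<U>" "ga:GG" "de:GG"
proof -
 have "\<exists>a0 a1 a2. as = [a0, a1, a2]" by (rule length_3E) (use assms in "simp add: cech_index_def")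
 moreover have "\<exists>ga de. gas = [ga, de]" by (rule length_2E) (use assms in "simp add: cech_index_def")
 ultimately show thesis using that assms by (auto simp: cech_index_def)
qed

lemma index3E:
 assumes "(as, gas):cech_index Gm \<U> 3"
 obtains a0 a1 a2 a3 ga de et where "as = [a0, a1, a2, a3]" "gas = [ga, de, et]"
proof -
 have "\<exists>a0 a1 a2 a3. as = [a0, a1, a2, a3]" by (rule length_4E) (use assms in "simp add: cech_index_def")
 moreover have "\<exists>ga de et. gas = [ga, de, et]"
  by (rule length_3E) (use assms in "simp add: cech_index_def")
 ultimately show thesis using that by auto
qed

lemma coboundary1:
 assumes "cd2 \<U> a0 a1 a2 ga de x"
 shows "coboundary Gm rh (iota ep) \<U> (Suc 0) c [a0, a1, a2] [ga, de] x =
  c [a1, a2] [de] (rh ga x) - c [a0, a2] [de \<odot> ga] x + ep de * c [a0, a1] [ga] x"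
 using assms unfolding coboundary_def
 by (simp add: alternate_def drop_vertex_def merge_edges_def iota_def numeral_2_eq_2)

lemma coboundary2:
 assumes "cd3 \<U> a0 a1 a2 a3 ga de et x"
 shows "coboundary Gm rh (iota ep) \<U> 2 c [a0, a1, a2, a3] [ga, de, et] x =
  c [a1, a2, a3] [de, et] (rh ga x) - c [a0, a2, a3] [de \<odot> ga, et] x
   + c [a0, a1, a3] [ga, et \<odot> de] x - ep et * c [a0, a1, a2] [ga, de] x"
proof -
 have "{1..2::nat} = {1, 2}" by auto
 moreover have "\<not> Suc (Suc 0) dvd Suc (Suc (Suc 0))" unfolding numeral_2_eq_2[symmetric] by simp
 ultimately show ?thesis using assms unfolding coboundary_def
  by (simp add: alternate_def drop_vertex_def merge_edges_def iota_def numeral_3_eq_3 numeral_2_eq_2)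
qed

text \<open>The coboundary squares to zero: \<open>rho_mult\<close> and associativity match the
  untwisted terms, multiplicativity of \<open>ep\<close> the twisted ones.\<close>

lemma dr_closed:
 assumes "ga:GG" "de:GG" "et:GG" "x:mc M"
 shows "dr r a1 a2 a3 de et (rh ga x) - dr r a0 a2 a3 (de \<odot> ga) et x + dr r a0 a1 a3 ga (et \<odot> de) x
  - of_int (ep et) * dr r a0 a1 a2 ga de x = 0"
 using assms by (simp add: dr_def rho_mult Gam.m_assoc eps_mult algebra_simps)

lemma cover_mem: "\<U>:open_covers M ==> a:\<U> ==> x:a ==> x:mc M"
 by (auto simp: open_covers_def)

lemma cover_open: "\<U>:open_covers M ==> a:\<U> ==> opn M a"
 by (auto simp: open_covers_def)

lemma cdom2_mem: "\<U>:open_covers M ==> cd2 \<U> a0 a1 a2 ga de x ==> x:mc M"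
 using cover_mem by (auto simp: cdom2_iff)

lemma cdom2_faces:
 assumes U: "\<U>:open_covers M" and d: "cd2 \<U> a0 a1 a2 ga de x"
 shows "a0:\<U>" "a1:\<U>" "a2:\<U>" "ga:GG" "de:GG" "de \<odot> ga:GG" "x:mc M"
  "x:a0" "rh ga x:a1" "rh de (rh ga x):a2" "rh (de \<odot> ga) x:a2"
 using d cdom2_mem[OF U d] by (auto simp: cdom2_iff rho_mult)

lemma sm_dr:
 assumes U: "\<U>:open_covers M" and r: "smooth1 \<U> r" and d: "cd2 \<U> a0 a1 a2 ga de x"
 shows "sm M (dr r a0 a1 a2 ga de) x"
proof -
 note f = cdom2_faces[OF U d]
 have "sm M (r a1 a2 de) (rh ga x)" "sm M (r a0 a2 (de \<odot> ga)) x" "sm M (r a0 a1 ga) x"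
  using r f unfolding smooth1_def by blast+
 thus ?thesis unfolding dr_def[abs_def]
  by (intro sm_add sm_diff[OF smM] sm_cmult[OF smM] sm_rho[OF f(4,7)])
qed

text \<open>The floor only converts an integral real value to type \<open>int\<close>; the value
  \<open>0\<close> off the domain is the convention of \<open>cochains\<close>.\<close>

definition fcocycle :: "'x set set => ('x set => 'x set => 'g => 'x => real) => ('x, 'g, int) cochain" where
 "fcocycle \<U> r as gas x = (if (as, gas, x):cdom \<U> 2 then \<lfloor>dr r (as ! 0) (as ! 1) (as ! 2) (gas ! 0) (gas ! 1) x\<rfloor> else 0)"

text \<open>By continuity \<open>g\<close> stays within distance less than one of its integral value
  at \<open>x\<close>, and on \<open>D\<close> it is integral.\<close>

lemma lc_floor:
 assumes "!!x. x:D ==> sm M g x & (\<exists>k::int. g x = of_int k)"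
 shows "locally_constant_on (mtop M) D (%x. \<lfloor>g x\<rfloor>)"
 unfolding locally_constant_on_def
proof
 fix x assume x: "x:D"
 obtain k :: int where k: "g x = of_int k" using assms[OF x] by blast
 have g: "sm M g x" using assms[OF x] by blast
 have "ngh M x (%y. g y:{of_int k - 1<..<of_int k + 1})" by (rule sm_near[OF smM g]) (auto simp: k)
 then obtain W where W: "opn M W" "x:W" "!!y. y:W ==> g y:{of_int k - 1<..<of_int k + 1}"
  unfolding nr[OF smM sm_car[OF g]] by blast
 have "\<lfloor>g y\<rfloor> = \<lfloor>g x\<rfloor>" if y: "y:W \<inter> D" for y
 proof -
  obtain l :: int where l: "g y = of_int l" using assms[of y] y by blast
  have "of_int k - 1 < g y" "g y < of_int k + 1" using W(3)[of y] y by auto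
  hence "l = k" unfolding l by linarith
  thus ?thesis by (simp add: k l)
 qed
 thus "\<exists>W. opn M W & x:W & (ALL y:W \<inter> D. \<lfloor>g y\<rfloor> = \<lfloor>g x\<rfloor>)" using W(1,2) by blast
qed

lemma lc_sm:
 assumes f: "locally_constant_on (mtop M) D (f :: 'x => int)" and D: "ngh M x (%y. y:D)" and x: "x:D" "x:mc M"
 shows "sm M (%y. of_int (f y)) x"
proof -
 obtain W where W: "opn M W" "x:W" "ALL y:W \<inter> D. f y = f x" using f x(1) unfolding locally_constant_on_def by blast
 have "ngh M x (%y. of_int (f x) = (of_int (f y) :: real))"
  using nr_open[OF W(1,2)] D by eventually_elim (use W(3) in simp)
 thus ?thesis by (rule sm_cong[OF smM _ sm_const[OF smM x(2)]])
qed

lemma rho_near: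
 "ga:GG ==> opn M b ==> x:mc M ==> rh ga x:b ==> ngh M x (%y. rh ga y:b)"
 by (rule smap_near[OF smM smM rho_smap nr_open])

lemma cdom2_near:
 assumes U: "\<U>:open_covers M" and d: "cd2 \<U> a0 a1 a2 ga de x"
 shows "ngh M x (%y. cd2 \<U> a0 a1 a2 ga de y)"
proof -
 note f = cdom2_faces[OF U d]
 from nr_open[OF cover_open[OF U f(1)] f(8)] rho_near[OF f(4) cover_open[OF U f(2)] f(7,9)]
  rho_near[OF f(6) cover_open[OF U f(3)] f(7,11)]
 show ?thesis
 proof eventually_elim
  case (elim y)
  hence "y:mc M" using cover_mem[OF U f(1)] by simp
  thus ?case using f elim by (simp add: cdom2_iff rho_mult)
 qed
qed

lemma trail_cdom: "(as, gas):cech_index Gm \<U> p ==> trail rh as gas x \<longleftrightarrow> (as, gas, x):cdom \<U> p"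
 by (simp add: cech_domain_def)

lemma fcocycle_eq:
 "cd2 \<U> a0 a1 a2 ga de x ==> \<exists>k::int. dr r a0 a1 a2 ga de x = of_int k ==>
  of_int (fcocycle \<U> r [a0, a1, a2] [ga, de] x) = dr r a0 a1 a2 ga de x"
 by (auto simp: fcocycle_def)

lemma fcocycle_cocycle:
 assumes U: "\<U>:open_covers M" and r: "smooth1 \<U> r"
  and int: "!!a0 a1 a2 ga de x. cd2 \<U> a0 a1 a2 ga de x ==> \<exists>k::int. dr r a0 a1 a2 ga de x = of_int k"
 shows "fcocycle \<U> r:cocycles Gm M rh (iota ep) \<U> 2"
proof -
 have lc: "locally_constant_on (mtop M) {x. trail rh as gas x} (fcocycle \<U> r as gas)" if i: "(as, gas):cech_index Gm \<U> 2" for as gas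
 proof -
  obtain a0 a1 a2 ga de where l: "as = [a0, a1, a2]" "gas = [ga, de]" by (rule index2E[OF i])
  have "locally_constant_on (mtop M) {x. trail rh as gas x} (%x. \<lfloor>dr r a0 a1 a2 ga de x\<rfloor>)"
  proof (rule lc_floor)
   fix x assume "x:{x. trail rh as gas x}"
   hence "cd2 \<U> a0 a1 a2 ga de x" using trail_cdom[OF i] l by simp
   thus "sm M (dr r a0 a1 a2 ga de) x & (\<exists>k::int. dr r a0 a1 a2 ga de x = of_int k)" using sm_dr[OF U r] int by blast
  qed
  thus ?thesis unfolding locally_constant_on_def using trail_cdom[OF i] by (simp add: fcocycle_def l)
 qed
 have cb: "coboundary Gm rh (iota ep) \<U> 2 (fcocycle \<U> r) as gas x = 0" for as gas x
 proof (cases "(as, gas, x):cdom \<U> 3")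
  case False thus ?thesis by (simp add: coboundary_def)
 next
  case True
  hence "(as, gas):cech_index Gm \<U> 3" by (simp add: cech_domain_def)
  then obtain a0 a1 a2 a3 ga de et where l: "as = [a0, a1, a2, a3]" "gas = [ga, de, et]" by (rule index3E)
  note d = True[unfolded l, unfolded cdom3_iff]
  have x: "x:mc M" using d cover_mem[OF U] by blast
  have ds: "cd2 \<U> a1 a2 a3 de et (rh ga x)" "cd2 \<U> a0 a2 a3 (de \<odot> ga) et x"
    "cd2 \<U> a0 a1 a3 ga (et \<odot> de) x" "cd2 \<U> a0 a1 a2 ga de x"
   using d x by (auto simp: cdom2_iff rho_mult rho_mem)
  note eqs = fcocycle_eq[OF ds(1) int[OF ds(1)]] fcocycle_eq[OF ds(2) int[OF ds(2)]]
   fcocycle_eq[OF ds(3) int[OF ds(3)]] fcocycle_eq[OF ds(4) int[OF ds(4)]]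
  have "real_of_int (coboundary Gm rh (iota ep) \<U> 2 (fcocycle \<U> r) as gas x) = 0"
   unfolding l coboundary2[OF True[unfolded l]] of_int_add of_int_diff of_int_mult eqs
   by (rule dr_closed) (use d x in auto)
  thus ?thesis by linarith
 qed
 show ?thesis unfolding cocycles_def cochains_def using lc cb by (auto simp: fcocycle_def fun_eq_iff)
qed

subsection \<open>Structures as twists of a fixed one\<close>

lemma kz_uexp: "ga:GG ==> kz ep ga (uexp t) = uexp (of_int (ep ga) * t)"
 using eps_cases[of ga] by (auto simp: kz_def uexp_def cis_cnj)

lemma eps_inv: "ga:GG ==> ep (iv ga) = ep ga"
 using eps_mult[of ga "iv ga"] eps_cases[of ga] eps_cases[of "iv ga"] by (auto simp: eps_one)

lemma kappa_mem: "g:Gc n ==> kappa ep ga g:Gc n"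
 and kappa_inv: "ga:GG ==> g:Gc n ==> kappa ep (iv ga) (kappa ep ga g) = g"
proof -
 have *: "EX p:carrier (su n). g = scls n p & kappa ep ga g = scls n (fst p, kz ep ga (snd p)) &
   (fst p, kz ep ga (snd p)):carrier (su n)" if g: "g:Gc n" for g ga
 proof -
  obtain p where p: "p:carrier (su n)" "g = scls n p" using g unfolding Spinc_car by blast
  have "(fst p, kz ep ga (snd p)):carrier (su n)" using p(1) unfolding su_simps by auto
  moreover have "kappa ep ga g = scls n (fst p, kz ep ga (snd p))"
   using p kappa_cls[OF p(1), of ep ga] by (simp add: kz_def)
  ultimately show ?thesis using p by blast
 qed
 show "g:Gc n ==> kappa ep ga g:Gc n" using *[of g ga] by (auto simp: Spinc_car)
 assume ga: "ga:GG" and g: "g:Gc n"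
 obtain p where p: "p:carrier (su n)" "g = scls n p" "kappa ep ga g = scls n (fst p, kz ep ga (snd p))"
  "(fst p, kz ep ga (snd p)):carrier (su n)" using *[OF g] by blast
 show "kappa ep (iv ga) (kappa ep ga g) = g"
  unfolding p(3) kappa_cls[OF p(4)] using p(2) by (simp add: kz_def eps_inv[OF ga] split: if_splits)
qed

lemma la_inv: "str S ==> ga:GG ==> p:tot S ==> la S (iv ga) (la S ga p) = p"
 and la_inv': "str S ==> ga:GG ==> p:tot S ==> la S ga (la S (iv ga) p) = p"
 by (simp_all add: la_one flip: la_mult)

lemma liso_za:
 assumes S: "str S" and T: "str T" and l: "liso S T U h k" and p: "p:tot S" "pr S p:U" and z: "cmod z = 1"
 shows "h (za S p z) = za T (h p) z"
 using lisoD(6)[OF l p cz_mem[OF z]] by (simp add: za_def[OF S] za_def[OF T])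

text \<open>Going to \<open>T\<close> by \<open>h\<close>, acting with \<open>ga\<close>, returning
  by \<open>k'\<close> and acting with the inverse of \<open>ga\<close> is an automorphism of
  \<open>S\<close> over the frames, hence a phase by \<open>gauge\<close>. Moving this phase past
  \<open>ga\<close> applies \<open>kz\<close>.\<close>

lemma gauge_pair:
 assumes S: "str S" and T: "str T" and ga: "ga:GG" and U: "opn M U" and U': "opn M U'"
  and l: "liso S T U h k" and l': "liso S T U' h' k'"
 obtains z where "ALL y:U. rh ga y:U' --> cmod (z y) = 1 & sm M (%y. Re (z y)) y & sm M (%y. Im (z y)) y"
  "ALL p:tot S. pr S p:U --> rh ga (pr S p):U' --> la T ga (h p) = za T (h' (la S ga p)) (z (pr S p))"
proof -
 let ?f = "%p. la S (iv ga) (k' (la T ga (h p)))"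
 let ?U = "{y:mc M. rh ga y:U'} \<inter> U"
 have iG: "iv ga:GG" using ga by simp
 have oU: "opn M ?U" by (intro openin_Int opn_smap_preimage[OF smM smM rho_smap[OF ga] U'] U)
 have facts: "h p:tot T" "la T ga (h p):tot T" "pr T (la T ga (h p)) = rh ga (pr S p)" "rh ga (pr S p):U'"
   "k' (la T ga (h p)):tot S" "pr S (k' (la T ga (h p))) = rh ga (pr S p)" "fm S (k' (la T ga (h p))) = fm S (la S ga p)"
   "h' (k' (la T ga (h p))) = la T ga (h p)"
  if p: "p:tot S" "pr S p:?U" for p
 proof -
  have pU: "pr S p:U" and U'p: "rh ga (pr S p):U'" using p(2) by auto
  show *: "h p:tot T" "la T ga (h p):tot T" "pr T (la T ga (h p)) = rh ga (pr S p)" "rh ga (pr S p):U'"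
   using lisoD(2,3)[OF l p(1) pU] la_mem[OF T ga] pr_la[OF T ga] U'p by auto
  note d = lisoD[OF liso_sym[OF l'] *(2), unfolded *(3), OF U'p]
  show "k' (la T ga (h p)):tot S" "pr S (k' (la T ga (h p))) = rh ga (pr S p)" "h' (k' (la T ga (h p))) = la T ga (h p)"
   using d by auto
  show "fm S (k' (la T ga (h p))) = fm S (la S ga p)"
   using d(4) fm_la[OF T *(1) ga] fm_la[OF S p(1) ga] lisoD(4)[OF l p(1) pU] by simp
 qed
 obtain z where z: "ALL y:?U. cmod (z y) = 1 & sm M (%y. Re (z y)) y & sm M (%y. Im (z y)) y"
  "ALL p:tot S. pr S p:?U --> ?f p = za S p (z (pr S p))"
 proof (rule gauge[OF S oU, of ?f])
  fix p assume p: "p:tot S" "pr S p:?U"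
  note f = facts[OF p]
  have pU: "pr S p:U" using p(2) by auto
  have "smap (atl S) (atl S) ?f p"
   by (intro smap_comp[OF smap_comp[OF smap_comp[OF lisoD(1)[OF l p(1) pU] la_smap[OF T ga f(1)]]
    lisoD(1)[OF liso_sym[OF l'] f(2)]] la_smap[OF S iG f(5)]]) (use f in simp)
  moreover have "pr S (?f p) = pr S p" using pr_la[OF S iG f(5)] f(6) rho_inv'[OF ga pr_mem[OF S p(1)]] by simp
  moreover have "fm S (?f p) = fm S p"
   using fm_la[OF S f(5) iG] f(7) fm_la[OF S la_mem[OF S ga p(1)] iG] la_inv[OF S ga p(1)] by simp
  moreover have "?f (ra S p g) = ra S (?f p) g" if g: "g:Gc n" for g
  proof -
   have "h (ra S p g) = ra T (h p) g" by (rule lisoD(6)[OF l p(1) pU g])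
   moreover have "la T ga (ra T (h p) g) = ra T (la T ga (h p)) (kappa ep ga g)" by (rule la_ra[OF T ga f(1) g])
   moreover have "k' (ra T (la T ga (h p)) (kappa ep ga g)) = ra S (k' (la T ga (h p))) (kappa ep ga g)"
    by (rule lisoD(6)[OF liso_sym[OF l'] f(2) _ kappa_mem[OF g]]) (use f in simp)
   moreover have "la S (iv ga) (ra S (k' (la T ga (h p))) (kappa ep ga g)) = ra S (?f p) (kappa ep (iv ga) (kappa ep ga g))"
    by (rule la_ra[OF S iG f(5) kappa_mem[OF g]])
   ultimately show ?thesis using kappa_inv[OF ga g] by simp
  qed
  ultimately show "smap (atl S) (atl S) ?f p & pr S (?f p) = pr S p & fm S (?f p) = fm S p &
   (ALL g:Gc n. ?f (ra S p g) = ra S (?f p) g)" by blast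
 qed
 have UM: "U \<subseteq> mc M" by (rule opn_subset[OF smM U])
 show thesis
 proof (rule that[of "%y. kz ep ga (z y)"]; intro ballI impI)
  fix y assume "y:U" "rh ga y:U'"
  hence "y:?U" using UM by auto
  thus "cmod (kz ep ga (z y)) = 1 & sm M (%y. Re (kz ep ga (z y))) y & sm M (%y. Im (kz ep ga (z y))) y"
   using z(1) by (auto simp: kz_def sm_minus[OF smM])
 next
  fix p assume p: "p:tot S" "pr S p:U" "rh ga (pr S p):U'"
  hence pU: "pr S p:?U" using UM by auto
  note f = facts[OF p(1) pU]
  have nz: "cmod (z (pr S p)) = 1" using z(1) pU by blast
  have "la S ga (?f p) = la S ga (za S p (z (pr S p)))" using z(2) p(1) pU by simp
  hence "k' (la T ga (h p)) = za S (la S ga p) (kz ep ga (z (pr S p)))"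
   using la_inv'[OF S ga f(5)] la_za[OF S ga p(1) nz] by simp
  hence "la T ga (h p) = h' (za S (la S ga p) (kz ep ga (z (pr S p))))" using f(8) by simp
  also have "... = za T (h' (la S ga p)) (kz ep ga (z (pr S p)))"
   by (rule liso_za[OF S T l' la_mem[OF S ga p(1)]]) (use p(3) nz pr_la[OF S ga p(1)] in simp_all)
  finally show "la T ga (h p) = za T (h' (la S ga p)) (kz ep ga (z (pr S p)))" .
 qed
qed

text \<open>Local data of \<open>T\<close> relative to \<open>S\<close>, with the gauge functions
  already in logarithmic form. At the neutral element the last condition compares the local
  isomorphisms over two cover members.\<close>

definition trv :: "('p,'v,'x,'g) sk => ('q,'v,'x,'g) sk => 'x set set =>
  ('x set => 'p => 'q) => ('x set => 'q => 'p) => ('x set => 'x set => 'g => 'x => real) => bool" where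
 "trv S T \<U> h k r \<longleftrightarrow> (ALL a:\<U>. liso S T a (h a) (k a)) & smooth1 \<U> r &
  (ALL a:\<U>. ALL b:\<U>. ALL ga:GG. ALL p:tot S. pr S p:a --> rh ga (pr S p):b -->
   la T ga (h a p) = za T (h b (la S ga p)) (uexp (r a b ga (pr S p))))"

lemma trvD:
 assumes "trv S T \<U> h k r"
 shows "a:\<U> ==> liso S T a (h a) (k a)" "smooth1 \<U> r"
  "a:\<U> ==> b:\<U> ==> ga:GG ==> p:tot S ==> pr S p:a ==> rh ga (pr S p):b ==>
   la T ga (h a p) = za T (h b (la S ga p)) (uexp (r a b ga (pr S p)))"
 using assms by (auto simp: trv_def)

text \<open>Acting with the product of \<open>de\<close> and \<open>ga\<close> on
  \<open>h a0 p\<close> in one step and in two steps gives the same point, so the two phases agree.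
  Pulling the first phase through \<open>de\<close> produces the sign \<open>ep de\<close>.\<close>

lemma trv_integral:
 assumes S: "str S" and T: "str T" and U: "\<U>:open_covers M" and t: "trv S T \<U> h k r"
  and d: "cd2 \<U> a0 a1 a2 ga de x"
 shows "\<exists>k::int. dr r a0 a1 a2 ga de x = of_int k"
proof -
 note f = cdom2_faces[OF U d]
 obtain p where p: "p:tot S" "pr S p = x" by (rule pr_surj[OF S f(7)])
 note gp = la_mem[OF S f(4) p(1)] and dgp = la_mem[OF S f(5) la_mem[OF S f(4) p(1)]]
 have prs: "pr S (la S ga p) = rh ga x" "pr S (la S de (la S ga p)) = rh de (rh ga x)"
  using pr_la[OF S f(4) p(1)] pr_la[OF S f(5) gp] p(2) by auto
 note l0 = lisoD[OF trvD(1)[OF t f(1)] p(1), unfolded p(2), OF f(8)]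
 note l1 = lisoD[OF trvD(1)[OF t f(2)] gp, unfolded prs, OF f(9)]
 note l2 = lisoD[OF trvD(1)[OF t f(3)] dgp, unfolded prs, OF f(10)]
 have "za T (h a2 (la S de (la S ga p))) (uexp (r a0 a2 (de \<odot> ga) x)) = la T (de \<odot> ga) (h a0 p)"
  using trvD(3)[OF t f(1,3,6) p(1)] f p by (simp add: la_mult[OF S])
 also have "... = la T de (la T ga (h a0 p))" by (rule la_mult[OF T f(5,4) l0(2)])
 also have "... = la T de (za T (h a1 (la S ga p)) (uexp (r a0 a1 ga x)))"
  using trvD(3)[OF t f(1,2,4) p(1)] f p by simp
 also have "... = za T (la T de (h a1 (la S ga p))) (uexp (of_int (ep de) * r a0 a1 ga x))"
  using la_za[OF T f(5) l1(2) nuexp] by (simp add: kz_uexp[OF f(5)])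
 also have "la T de (h a1 (la S ga p)) = za T (h a2 (la S de (la S ga p))) (uexp (r a1 a2 de (rh ga x)))"
  using trvD(3)[OF t f(2,3,5) gp] f prs by simp
 also have "za T ... (uexp (of_int (ep de) * r a0 a1 ga x)) =
   za T (h a2 (la S de (la S ga p))) (uexp (r a1 a2 de (rh ga x) + of_int (ep de) * r a0 a1 ga x))"
  by (simp add: za_mult[OF T l2(2)] uexp_add)
 finally have "uexp (r a1 a2 de (rh ga x) + of_int (ep de) * r a0 a1 ga x) = uexp (r a0 a2 (de \<odot> ga) x)"
  by (rule za_inj[OF T l2(2) nuexp nuexp, symmetric])
 thus ?thesis unfolding uexp_eq_iff dr_def by (simp add: algebra_simps)
qed

text \<open>A relation and not a function of \<open>T\<close>, since the cover, the local
  isomorphisms and the logarithms are all choices.\<close>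

definition tcl :: "('p,'v,'x,'g) sk => ('q,'v,'x,'g) sk => 'x set set \<times> ('x, 'g, int) cochain => bool" where
 "tcl S T = (%(\<U>, m). \<exists>h k r. trv S T \<U> h k r &
  (\<forall>a0 a1 a2 ga de x. cd2 \<U> a0 a1 a2 ga de x --> dr r a0 a1 a2 ga de x = of_int (m [a0, a1, a2] [ga, de] x)))"

lemma open_Inter_choice:
 assumes x: "x:mc M" and F: "finite F" and ex: "!!e. e:F ==> \<exists>W. opn M W & x:W & P e W"
  and mono: "!!e W W'. e:F ==> P e W ==> W' \<subseteq> W ==> P e W'"
 shows "\<exists>W. opn M W & x:W & (ALL e:F. P e W)"
proof -
 obtain W where W: "opn M (W e) & x:W e & P e (W e)" if "e:F" for e using ex by metis
 let ?W = "mc M \<inter> (INT e:F. W e)"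
 have "opn M ?W"
 proof (cases "F = {}")
  case True thus ?thesis by (simp add: opn_car[OF smM])
 next
  case False
  thus ?thesis using F W by (intro openin_Int opn_car[OF smM] openin_INT2) auto
 qed
 moreover have "P e ?W" if "e:F" for e by (rule mono[OF that]) (use W that in auto)
 ultimately show ?thesis using W x by (intro exI[of _ ?W]) auto
qed

text \<open>The gap between \<open>C i\<close> and \<open>U i\<close> provides the dichotomy used
  for logarithms: a small set is moved either off the closed \<open>C j\<close> or into the open
  \<open>U j\<close>.\<close>

lemma shrunk_cover:
 assumes U: "!!x. x:mc M ==> opn M (U x) & x:U x"
 obtains I N C where "finite I" "I \<subseteq> mc M" "mc M \<subseteq> (UN i:I. N i)"
  "ALL i:I. opn M (N i) & closedin (mtop M) (C i) & N i \<subseteq> C i & C i \<subseteq> U i"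
proof -
 have reg: "regular_space (mtop M)" by (rule compact_Hausdorff_imp_regular_space[OF compact_M Haus_M])
 have "\<exists>N C. opn M N & closedin (mtop M) C & x:N & N \<subseteq> C & C \<subseteq> U x" if "x:mc M" for x
  by (rule reg[folded neighbourhood_base_of_closedin, unfolded neighbourhood_base_of, rule_format]) (rule U[OF that])
 then obtain N C where NC: "opn M (N x) & closedin (mtop M) (C x) & x:N x & N x \<subseteq> C x & C x \<subseteq> U x"
  if "x:mc M" for x by metis
 have "\<exists>\<F>. finite \<F> & \<F> \<subseteq> N ` mc M & mc M \<subseteq> \<Union>\<F>"
  using compact_M[unfolded compact_space_alt topspace_mtop[OF smM], rule_format, of "N ` mc M"] NC by blast
 then obtain \<F> where F: "finite \<F>" "\<F> \<subseteq> N ` mc M" "mc M \<subseteq> \<Union>\<F>" by blast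
 obtain I where I: "I \<subseteq> mc M" "finite I" "\<F> = N ` I" using F(1,2) by (meson finite_subset_image)
 show thesis
 proof (rule that[OF I(2,1), of N C])
  show "mc M \<subseteq> (UN i:I. N i)" using F(3) I(3) by simp
  show "ALL i:I. opn M (N i) & closedin (mtop M) (C i) & N i \<subseteq> C i & C i \<subseteq> U i"
   using NC I(1) by blast
 qed
qed

lemma liso_mono: "liso S T U h k ==> W \<subseteq> U ==> liso S T W h k"
 unfolding liso_def half_iso_def by blast

text \<open>The new cover must admit logarithms for all pairs of its own members and all group
  elements. Each member is made small against the finitely many pairs of a group element and an
  index in \<open>I\<close>, so its size does not depend on the other members.\<close>

lemma tcl_exists:
 assumes S: "str (S :: ('p,'v,'x,'g) sk)" and T: "str (T :: ('q,'v,'x,'g) sk)"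
 shows "\<exists>\<W> m. \<W>:open_covers M & m:cocycles Gm M rh (iota ep) \<W> 2 & tcl S T (\<W>, m)"
proof -
 have "\<exists>U h k. opn M U & x:U & liso S T U h k" if x: "x:mc M" for x
  by (rule local_iso[OF S T x]) blast
 then obtain U h k where Uhk: "opn M (U x) & x:U x & liso S T (U x) (h x) (k x)" if "x:mc M" for x
  by metis
 have "!!x. x:mc M ==> opn M (U x) & x:U x" using Uhk by blast
 then obtain I N C where I: "finite I" "I \<subseteq> mc M" "mc M \<subseteq> (UN i:I. N i)"
  and NC: "ALL i:I. opn M (N i) & closedin (mtop M) (C i) & N i \<subseteq> C i & C i \<subseteq> U i"
  by (rule shrunk_cover)
 define P where "P i j ga z \<longleftrightarrow>
   (ALL y:U i. rh ga y:U j --> cmod (z y) = 1 & sm M (%y. Re (z y)) y & sm M (%y. Im (z y)) y) &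
   (ALL p:tot S. pr S p:U i --> rh ga (pr S p):U j --> la T ga (h i p) = za T (h j (la S ga p)) (z (pr S p)))"
  for i j ga and z :: "'x => complex"
 have Pex: "\<exists>z. P i j ga z" if ij: "i:I" "j:I" "ga:GG" for i j ga
 proof -
  have u: "opn M (U i)" "liso S T (U i) (h i) (k i)" "opn M (U j)" "liso S T (U j) (h j) (k j)"
   using Uhk ij I(2) by blast+
  show ?thesis unfolding P_def by (rule gauge_pair[OF S T ij(3) u(1,3,2,4)]) blast
 qed
 define z where "z i j ga = (SOME z. P i j ga z)" for i j ga
 have z: "P i j ga (z i j ga)" if "i:I" "j:I" "ga:GG" for i j ga
  unfolding z_def by (rule someI_ex[OF Pex[OF that]])
 \<comment> \<open>The logarithm lives on all of \<open>W\<close>, which must be moved entirely into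
   \<open>U j\<close>.\<close>
 define good where "good W i ga j u \<longleftrightarrow> (ALL y:W. rh ga y:U j & sm M u y & z i j ga y = uexp (u y))" for W i ga j u
 \<comment> \<open>If a point of \<open>W\<close> is moved into a member contained in
   \<open>N j\<close>, hence into \<open>C j\<close>, the first alternative fails and a logarithm is
   available.\<close>
 define ok where "ok i = (%(ga, j) W. (ALL y:W. rh ga y \<notin> C j) \<or> (\<exists>u. good W i ga j u))" for i
 define \<W> where "\<W> = {W. opn M W & (EX i:I. W \<subseteq> N i & (ALL e:GG \<times> I. ok i e W))}"
 have cover: "EX W:\<W>. x:W" if x: "x:mc M" for x
 proof -
  obtain i where i: "i:I" "x:N i" using I(3) x by blast
  have Ni: "opn M (N i)" "N i \<subseteq> U i" using NC i(1) by blast+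
  have "\<exists>W. opn M W & x:W & (ALL e:GG \<times> I. ok i e W)"
  proof (rule open_Inter_choice[OF x])
   show "finite (GG \<times> I)" using finite_Gamma I(1) by simp
   show "ok i e W'" if "ok i e W" "W' \<subseteq> W" for e W W'
    using that unfolding ok_def good_def by (cases e) blast
  next
   fix e assume "e:GG \<times> I"
   then obtain ga j where e: "e = (ga, j)" "ga:GG" "j:I" by blast
   have j: "closedin (mtop M) (C j)" "C j \<subseteq> U j" "opn M (U j)" using NC Uhk I(2) e(3) by blast+
   show "\<exists>W. opn M W & x:W & ok i e W"
   proof (cases "rh ga x:C j")
    case False
    have "opn M (mc M - C j)" using j(1) topspace_mtop[OF smM] by (simp add: closedin_def)
    from opn_smap_preimage[OF smM smM rho_smap[OF e(2)] this]
    have "opn M {y:mc M. rh ga y:mc M - C j}" .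
    moreover have "ok i e {y:mc M. rh ga y:mc M - C j}" unfolding ok_def e(1) by simp
    ultimately show ?thesis using x False rho_mem[OF e(2) x] by (intro exI[of _ "{y:mc M. rh ga y:mc M - C j}"]) simp
   next
    case True
    let ?V = "U i \<inter> {y:mc M. rh ga y:U j}"
    have V: "opn M ?V" "x:?V"
     using opn_smap_preimage[OF smM smM rho_smap[OF e(2)] j(3)] Uhk I(2) i Ni(2) True j(2) x by auto
    have "cmod (z i j ga y) = 1 & sm M (%y. Re (z i j ga y)) y & sm M (%y. Im (z i j ga y)) y" if "y:?V" for y
     using z[OF i(1) e(3,2)] that unfolding P_def by blast
    then obtain W u where W: "opn M W" "x:W" "W \<subseteq> ?V" "ALL y:W. sm M u y & z i j ga y = uexp (u y)"
     by (rule local_log[OF smM V])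
    have "good W i ga j u" unfolding good_def using W(3,4) by blast
    hence "ok i e W" unfolding ok_def e(1) by blast
    thus ?thesis using W(1,2) by blast
   qed
  qed
  then obtain W where W: "opn M W" "x:W" "ALL e:GG \<times> I. ok i e W" by blast
  have "ALL e:GG \<times> I. ok i e (W \<inter> N i)" using W(3) unfolding ok_def good_def by fast
  hence "W \<inter> N i:\<W>" unfolding \<W>_def using i W(1) Ni(1) by blast
  thus ?thesis using W(2) i(2) by blast
 qed
 have oW: "opn M W" if "W:\<W>" for W using that by (simp add: \<W>_def)
 have \<W>: "\<W>:open_covers M"
  unfolding open_covers_def using cover oW opn_subset[OF smM] by blast
 have "\<exists>i. i:I & W \<subseteq> N i & (ALL e:GG \<times> I. ok i e W)" if "W:\<W>" for W using that unfolding \<W>_def by blast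
 then obtain io where io: "io W:I & W \<subseteq> N (io W) & (ALL e:GG \<times> I. ok (io W) e W)" if "W:\<W>" for W by metis
 define u where "u W ga j = (SOME u. good W (io W) ga j u)" for W ga j
 have u: "good W (io W) ga (io W') (u W ga (io W'))"
  if W: "W:\<W>" "W':\<W>" "ga:GG" and x: "x:W" "rh ga x:W'" for W W' ga x
 proof -
  have "rh ga x:C (io W')" using io[OF W(2)] NC x(2) by blast
  moreover have "ok (io W) (ga, io W') W" using io[OF W(1)] io[OF W(2)] W(3) by blast
  ultimately have "\<exists>u. good W (io W) ga (io W') u" unfolding ok_def using x(1) by auto
  thus ?thesis unfolding u_def by (rule someI_ex)
 qed
 \<comment> \<open>The logarithm depends on \<open>W'\<close> only through its index in the finite
   cover.\<close>
 define r where "r W W' ga = u W ga (io W')" for W W' ga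
 have t: "trv S T \<W> (%W. h (io W)) (%W. k (io W)) r"
  unfolding trv_def smooth1_def
 proof (intro conjI ballI impI)
  fix W assume W: "W:\<W>"
  have "liso S T (U (io W)) (h (io W)) (k (io W))" "W \<subseteq> U (io W)" using Uhk io[OF W] NC I(2) by blast+
  thus "liso S T W (h (io W)) (k (io W))" by (rule liso_mono)
 next
  fix W W' ga x assume "W:\<W>" "W':\<W>" "ga:GG" "x:W" "rh ga x:W'"
  from u[OF this] \<open>x:W\<close> show "sm M (r W W' ga) x" unfolding good_def r_def by blast
 next
  fix W W' ga p assume W: "W:\<W>" "W':\<W>" "ga:GG" and p: "p:tot S" and x: "pr S p:W" "rh ga (pr S p):W'"
  have g: "rh ga (pr S p):U (io W')" "z (io W) (io W') ga (pr S p) = uexp (r W W' ga (pr S p))"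
   using u[OF W x] x(1) unfolding good_def r_def by blast+
  have "pr S p:U (io W)" using io[OF W(1)] NC x(1) by blast
  hence "la T ga (h (io W) p) = za T (h (io W') (la S ga p)) (z (io W) (io W') ga (pr S p))"
   using z[of "io W" "io W'" ga] io[OF W(1)] io[OF W(2)] W(3) p g(1) unfolding P_def by blast
  thus "la T ga (h (io W) p) = za T (h (io W') (la S ga p)) (uexp (r W W' ga (pr S p)))" unfolding g(2) .
 qed
 note int = trv_integral[OF S T \<W> t]
 have "tcl S T (\<W>, fcocycle \<W> r)"
  unfolding tcl_def case_prod_conv using t fcocycle_eq int by metis
 thus ?thesis using \<W> fcocycle_cocycle[OF \<W> trvD(2)[OF t] int] by blast
qed

end

subsection \<open>Isomorphism of structures and cohomology classes\<close>

lemma smap_cong_car: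
 assumes "smooth_atlas A" "!!y. y:mc A ==> f y = g y" "smap A B f x"
 shows "smap A B g x"
proof -
 have "ngh A x (%y. f y = g y)"
  using nr_open[OF opn_car[OF assms(1)] smap_car(1)[OF assms(3)]] by eventually_elim (rule assms(2))
 thus ?thesis using assms by (intro smap_cong[of A f g x B])
qed

context spc
begin

abbreviation siso :: "('p,'v,'x,'g) sk => ('q,'v,'x,'g) sk => bool" where
 "siso \<equiv> spin_kappa_iso Gm n"

text \<open>An isomorphism is a local isomorphism over the whole base that commutes with the action;
  in this form the results on \<open>liso\<close> apply.\<close>

lemma siso_iff:
 assumes S: "str (S :: ('p,'v,'x,'g) sk)" and T: "str (T :: ('q,'v,'x,'g) sk)"
 shows "siso S T \<longleftrightarrow> (\<exists>f g. liso S T (mc M) f g & (ALL ga:GG. ALL p:tot S. f (la S ga p) = la T ga (f p)))"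
proof
 assume "siso S T"
 then obtain f where df: "diffeo (atl S) (atl T) f"
  and f: "ALL p:tot S. pr T (f p) = pr S p & fm T (f p) = fm S p &
    (ALL ga:GG. f (la S ga p) = la T ga (f p)) & (ALL g:Gc n. f (ra S p g) = ra T (f p) g)"
  unfolding spin_kappa_iso_def case_prod_unfold by blast
 define g where "g = inv_into (tot S) f"
 have bij: "bij_betw f (tot S) (tot T)" using df by (simp add: diffeo_def)
 have gf: "g (f p) = p" if "p:tot S" for p unfolding g_def by (rule bij_betw_inv_into_left[OF bij that])
 have fg: "f (g q) = q" if "q:tot T" for q unfolding g_def by (rule bij_betw_inv_into_right[OF bij that])
 have gm: "g q:tot S" if "q:tot T" for q using bij_betwE[OF bij_betw_inv_into[OF bij]] that by (simp add: g_def)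
 have fs: "smap (atl S) (atl T) f p" if "p:tot S" for p
  using df that by (simp add: diffeo_def smm_iff[OF atS[OF S] atS[OF T]])
 have gs: "smap (atl T) (atl S) g q" if "q:tot T" for q
  using df that by (simp add: diffeo_def smm_iff[OF atS[OF T] atS[OF S]] g_def)
 have "half_iso S T (mc M) f g" unfolding half_iso_def using fs f gf by blast
 moreover have "half_iso T S (mc M) g f" unfolding half_iso_def
 proof (intro ballI impI conjI)
  fix q assume q: "q:tot T"
  note gq = gm[OF q]
  show "smap (atl T) (atl S) g q" by (rule gs[OF q])
  show "f (g q) = q" by (rule fg[OF q])
  show "pr S (g q) = pr T q" "fm S (g q) = fm T q" using f gq fg[OF q] by metis+
  fix c assume c: "c:Gc n"
  have "ra T q c = f (ra S (g q) c)" using f gq c fg[OF q] by simp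
  thus "g (ra T q c) = ra S (g q) c" using gf[OF ra_mem[OF S gq c]] by simp
 qed
 ultimately show "\<exists>f g. liso S T (mc M) f g & (ALL ga:GG. ALL p:tot S. f (la S ga p) = la T ga (f p))"
  using f unfolding liso_def by blast
next
 assume "\<exists>f g. liso S T (mc M) f g & (ALL ga:GG. ALL p:tot S. f (la S ga p) = la T ga (f p))"
 then obtain f g where l: "liso S T (mc M) f g" and la: "ALL ga:GG. ALL p:tot S. f (la S ga p) = la T ga (f p)" by blast
 note d = lisoD[OF l _ pr_mem[OF S]] and d' = lisoD[OF liso_sym[OF l] _ pr_mem[OF T]]
 have bij: "bij_betw f (tot S) (tot T)"
  by (rule bij_betw_byWitness[where f' = g]) (use d d' in auto)
 have inv: "inv_into (tot S) f q = g q" if q: "q:tot T" for q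
  using inv_into_f_f[OF bij_betw_imp_inj_on[OF bij] d'(2)[OF q q]] d'(5)[OF q q] by simp
 have "smap (atl T) (atl S) (inv_into (tot S) f) q" if q: "q:tot T" for q
  by (rule smap_cong_car[OF atS[OF T] inv[symmetric] d'(1)[OF q q]])
 hence "diffeo (atl S) (atl T) f" using bij d(1)
  by (simp add: diffeo_def smm_iff[OF atS[OF S] atS[OF T]] smm_iff[OF atS[OF T] atS[OF S]])
 thus "siso S T" unfolding spin_kappa_iso_def case_prod_unfold using d la by blast
qed

lemma liso_trans:
 assumes l: "liso S T U h k" and l': "liso T R U h' k'"
 shows "liso S R U (%p. h' (h p)) (%q. k (k' q))"
proof -
 have *: "half_iso S R U (%p. h' (h p)) (%q. k (k' q))" if l: "liso S T U h k" and l': "liso T R U h' k'"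
  for S :: "('p,'v,'x,'g) sk" and T :: "('q,'v,'x,'g) sk" and R :: "('s,'v,'x,'g) sk" and h h' k k'
  unfolding half_iso_def
 proof (intro ballI impI)
  fix p assume p: "p:tot S" "pr S p:U"
  note d = lisoD[OF l p]
  note d' = lisoD[OF l' d(2), unfolded d(3), OF p(2)]
  show "smap (atl S) (atl R) (%p. h' (h p)) p & pr R (h' (h p)) = pr S p & fm R (h' (h p)) = fm S p &
   k (k' (h' (h p))) = p & (ALL g:Gc n. h' (h (ra S p g)) = ra R (h' (h p)) g)"
   using smap_comp[OF d(1) d'(1)] d d' by simp
 qed
 show ?thesis unfolding liso_def using *[OF l l'] *[OF liso_sym[OF l'] liso_sym[OF l]] by blast
qed

lemma siso_refl: "str S ==> siso S S"
 unfolding siso_iff liso_def half_iso_def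
 by (intro exI[of _ "%p. p"]) (simp add: smap_id)

lemma siso_sym:
 assumes S: "str S" and T: "str T" and "siso S T" shows "siso T S"
proof -
 obtain f g where l: "liso S T (mc M) f g" and f: "ALL ga:GG. ALL p:tot S. f (la S ga p) = la T ga (f p)"
  using assms(3) unfolding siso_iff[OF S T] by blast
 note d = lisoD[OF l _ pr_mem[OF S]] and d' = lisoD[OF liso_sym[OF l] _ pr_mem[OF T]]
 have "g (la T ga q) = la S ga (g q)" if ga: "ga:GG" and q: "q:tot T" for ga q
 proof -
  note gq = d'(2)[OF q q]
  have "la T ga q = f (la S ga (g q))" using f ga gq d'(5)[OF q q] by simp
  thus ?thesis using d(5)[OF la_mem[OF S ga gq] la_mem[OF S ga gq]] by simp
 qed
 thus ?thesis unfolding siso_iff[OF T S] using liso_sym[OF l] by blast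
qed

lemma siso_trans:
 assumes S: "str S" and T: "str T" and R: "str R" and "siso S T" "siso T R" shows "siso S R"
proof -
 obtain f g where l: "liso S T (mc M) f g" and f: "ALL ga:GG. ALL p:tot S. f (la S ga p) = la T ga (f p)"
  using assms(4) unfolding siso_iff[OF S T] by blast
 obtain f' g' where l': "liso T R (mc M) f' g'" and f': "ALL ga:GG. ALL p:tot T. f' (la T ga p) = la R ga (f' p)"
  using assms(5) unfolding siso_iff[OF T R] by blast
 have "f p:tot T" if "p:tot S" for p using lisoD(2)[OF l that pr_mem[OF S that]] .
 hence "ALL ga:GG. ALL p:tot S. f' (f (la S ga p)) = la R ga (f' (f p))" using f f' by simp
 thus ?thesis unfolding siso_iff[OF S R]
  by (intro exI[of _ "%p. f' (f p)"] exI[of _ "%q. g (g' q)"]) (simp add: liso_trans[OF l l'])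
qed

lemma gauge_pair1:
 assumes S: "str S" and T: "str T" and U: "opn M U" and U': "opn M U'"
  and l: "liso S T U h k" and l': "liso S T U' h' k'"
 obtains z where "ALL y:U \<inter> U'. cmod (z y) = 1 & sm M (%y. Re (z y)) y & sm M (%y. Im (z y)) y"
  "ALL p:tot S. pr S p:U \<inter> U' --> h p = za T (h' p) (z (pr S p))"
proof -
 obtain z where z: "ALL y:U. rh e1 y:U' --> cmod (z y) = 1 & sm M (%y. Re (z y)) y & sm M (%y. Im (z y)) y"
  "ALL p:tot S. pr S p:U --> rh e1 (pr S p):U' --> la T e1 (h p) = za T (h' (la S e1 p)) (z (pr S p))"
  by (rule gauge_pair[OF S T Gam.one_closed U U' l l'])
 have "h p = za T (h' p) (z (pr S p))" if p: "p:tot S" "pr S p:U" "pr S p:U'" for p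
  using z(2) p pr_mem[OF S p(1)] la_one[OF T lisoD(2)[OF l p(1,2)]] by (simp add: rho_one la_one[OF S])
 moreover have "y:mc M" if "y:U" for y using opn_subset[OF smM U] that by auto
 ultimately show thesis using z(1) by (intro that[of z]) (auto simp: rho_one)
qed

text \<open>The route from \<open>Q\<close> back to \<open>S\<close> and on to \<open>R\<close>,
  corrected by the phase \<open>uexp u\<close>. The phase commutes with all the maps, so the
  opposite phase corrects the inverse.\<close>

lemma half_iso_twist:
 assumes S: "str (S :: ('p,'v,'x,'g) sk)" and Q: "str (Q :: ('q,'v,'x,'g) sk)" and R: "str (R :: ('s,'v,'x,'g) sk)"
  and l: "liso S Q W h k" and l': "liso S R W h' k'" and u: "!!x. x:W ==> sm M u x"
 shows "half_iso Q R W (%q. za R (h' (k q)) (uexp (u (pr Q q)))) (%q. za Q (h (k' q)) (uexp (- u (pr R q))))"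
 unfolding half_iso_def
proof (intro ballI impI)
 fix q assume q: "q:tot Q" "pr Q q:W"
 note d = lisoD[OF liso_sym[OF l] q]
 note d' = lisoD[OF l' d(2), unfolded d(3), OF q(2)]
 let ?p = "k q"
 have us: "sm (atl Q) (%q. u (pr Q q)) q" by (rule smap_sm[OF pr_smap[OF Q q(1)] u[OF q(2)]])
 have "smap (atl Q) (atl R) (%q. za R (h' (k q)) (uexp (u (pr Q q)))) q"
  by (rule za_smap[OF R atS[OF Q] smap_comp[OF d(1) d'(1)] always_eventually sm_uexp[OF atS[OF Q] us]]) simp
 moreover have "pr R (za R (h' ?p) (uexp (u (pr Q q)))) = pr Q q" using pr_za[OF R d'(2) nuexp] d'(3) by simp
 moreover have "fm R (za R (h' ?p) (uexp (u (pr Q q)))) = fm Q q" using fm_za[OF R d'(2) nuexp] d'(4) d(4) by simp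
 moreover have "k' (za R (h' ?p) w) = za S ?p w" if "cmod w = 1" for w
  using liso_za[OF R S liso_sym[OF l'] d'(2) _ that] d' q(2) by simp
 hence "za Q (h (k' (za R (h' ?p) (uexp (u (pr Q q)))))) (uexp (- u (pr Q q))) = q"
  using liso_za[OF S Q l d(2), unfolded d(3), OF q(2) nuexp] d(5) za_mult[OF Q q(1) nuexp nuexp] za_one[OF Q q(1)]
  by (simp add: uexp_add) (simp add: uexp_def)
 moreover have "za R (h' (k (ra Q q g))) (uexp (u (pr Q (ra Q q g)))) = ra R (za R (h' ?p) (uexp (u (pr Q q)))) g" if g: "g:Gc n" for g
  using d(6)[OF g] d'(6)[OF g] za_ra[OF R d'(2) nuexp g] pr_ra[OF Q q(1) g] by simp
 ultimately show "smap (atl Q) (atl R) (%q. za R (h' (k q)) (uexp (u (pr Q q)))) q &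
   pr R (za R (h' ?p) (uexp (u (pr Q q)))) = pr Q q & fm R (za R (h' ?p) (uexp (u (pr Q q)))) = fm Q q &
   za Q (h (k' (za R (h' ?p) (uexp (u (pr Q q)))))) (uexp (- u (pr R (za R (h' ?p) (uexp (u (pr Q q))))))) = q &
   (ALL g:Gc n. za R (h' (k (ra Q q g))) (uexp (u (pr Q (ra Q q g)))) = ra R (za R (h' ?p) (uexp (u (pr Q q)))) g)"
  by simp
qed

lemma liso_twist:
 assumes S: "str S" and Q: "str Q" and R: "str R"
  and l: "liso S Q W h k" and l': "liso S R W h' k'" and u: "!!x. x:W ==> sm M u x"
 shows "liso Q R W (%q. za R (h' (k q)) (uexp (u (pr Q q)))) (%q. za Q (h (k' q)) (uexp (- u (pr R q))))"
 unfolding liso_def using half_iso_twist[OF S Q R l l' u] half_iso_twist[OF S R Q l' l sm_minus[OF smM u]] by simp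

lemma liso_glue:
 assumes Q: "str (Q :: ('q,'v,'x,'g) sk)" and R: "str (R :: ('s,'v,'x,'g) sk)"
  and W: "\<W>:open_covers M" and l: "!!W. W:\<W> ==> liso Q R W (F W) (G W)"
  and agree: "!!W W' q. W:\<W> ==> W':\<W> ==> q:tot Q ==> pr Q q:W ==> pr Q q:W' ==> F W q = F W' q"
 obtains f g where "liso Q R (mc M) f g" "ALL W:\<W>. ALL q:tot Q. pr Q q:W --> f q = F W q"
proof -
 have "\<exists>W. W:\<W> & x:W" if "x:mc M" for x using W that unfolding open_covers_def by blast
 then obtain c where c: "c x:\<W> & x:c x" if "x:mc M" for x by metis
 have half: "half_iso Q R (mc M) (%q. F (c (pr Q q)) q) (%q. G (c (pr R q)) q)"
  if Q: "str Q" and R: "str R" and l: "!!W. W:\<W> ==> liso Q R W (F W) (G W)"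
  and agree: "!!W W' q. W:\<W> ==> W':\<W> ==> q:tot Q ==> pr Q q:W ==> pr Q q:W' ==> F W q = F W' q"
  for Q :: "('q2, 'v, 'x, 'g) spin_kappa" and R :: "('s2, 'v, 'x, 'g) spin_kappa" and F G
  unfolding half_iso_def
 proof (intro ballI impI)
  fix q assume q: "q:tot Q"
  note x = pr_mem[OF Q q]
  let ?W = "c (pr Q q)"
  have W': "?W:\<W>" "pr Q q:?W" using c[OF x] by auto
  note d = lisoD[OF l[OF W'(1)] q W'(2)]
  have "opn (atl Q) {p:tot Q. pr Q p:?W}"
   by (rule opn_smap_preimage[OF atS[OF Q] smM pr_smap[OF Q] cover_open[OF W W'(1)]])
  from nr_open[OF this] q W'(2) have "ngh (atl Q) q (%p. p:{p:tot Q. pr Q p:?W})" by simp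
  hence "ngh (atl Q) q (%p. F ?W p = F (c (pr Q p)) p)"
  proof eventually_elim
   case (elim p)
   hence p: "p:tot Q" "pr Q p:?W" by auto
   show ?case using agree[OF W'(1) _ p] c[OF pr_mem[OF Q p(1)]] by blast
  qed
  from smap_cong[OF atS[OF Q] this d(1)]
  show "smap (atl Q) (atl R) (%q. F (c (pr Q q)) q) q & pr R (F ?W q) = pr Q q & fm R (F ?W q) = fm Q q &
   G (c (pr R (F ?W q))) (F ?W q) = q & (ALL g:Gc n. F (c (pr Q (ra Q q g))) (ra Q q g) = ra R (F ?W q) g)"
   using d pr_ra[OF Q q] by simp
 qed
 have agree': "G W q = G W' q" if WW: "W:\<W>" "W':\<W>" and q: "q:tot R" "pr R q:W" "pr R q:W'" for W W' q
 proof -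
  note d = lisoD[OF liso_sym[OF l[OF WW(1)]] q(1,2)]
  have "F W' (G W q) = q" using agree[OF WW d(2)] d(3,5) q by simp
  moreover have "G W' (F W' (G W q)) = G W q" using lisoD(5)[OF l[OF WW(2)] d(2)] d(3) q by simp
  ultimately show ?thesis by simp
 qed
 show thesis
 proof (rule that)
  show "liso Q R (mc M) (%q. F (c (pr Q q)) q) (%q. G (c (pr R q)) q)"
   unfolding liso_def using half[OF Q R l agree] half[OF R Q liso_sym[OF l] agree'] by blast
  show "ALL W:\<W>. ALL q:tot Q. pr Q q:W --> F (c (pr Q q)) q = F W q"
   using agree c pr_mem[OF Q] by blast
 qed
qed

text \<open>Over the intersection of two members, \<open>f\<close> after \<open>h a\<close> differs
  from \<open>h' a'\<close> by a phase; \<open>u\<close> is its logarithm on a finer cover.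
  Equivariance of \<open>f\<close> then equates the two gauge functions up to the coboundary of
  \<open>u\<close>, and their logarithms up to an integer.\<close>

lemma siso_imp_compare:
 assumes S: "str (S :: ('p,'v,'x,'g) sk)" and Q: "str (Q :: ('q,'v,'x,'g) sk)" and R: "str (R :: ('s,'v,'x,'g) sk)"
  and U: "\<U>:open_covers M" "\<U>':open_covers M" and t: "trv S Q \<U> h k r" "trv S R \<U>' h' k' r'" and iso: "siso Q R"
 obtains \<W> al be u where "\<W>:open_covers M" "refinement \<W> \<U> al" "refinement \<W> \<U>' be" "ALL W:\<W>. ALL x:W. sm M (u W) x"
  "ALL W:\<W>. ALL W':\<W>. ALL ga:GG. ALL x:W. rh ga x:W' --> (\<exists>i::int.
   r (al W) (al W') ga x - r' (be W) (be W') ga x + (u W' (rh ga x) - of_int (ep ga) * u W x) = of_int i)"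
proof -
 obtain f g where fg: "liso Q R (mc M) f g" and fla: "ALL ga:GG. ALL p:tot Q. f (la Q ga p) = la R ga (f p)"
  using iso unfolding siso_iff[OF Q R] by blast
 define P where "P a a' w \<longleftrightarrow> (ALL y:a \<inter> a'. cmod (w y) = 1 & sm M (%y. Re (w y)) y & sm M (%y. Im (w y)) y) &
  (ALL p:tot S. pr S p:a \<inter> a' --> f (h a p) = za R (h' a' p) (w (pr S p)))" for a a' and w :: "'x => complex"
 have fh: "liso S R a (%p. f (h a p)) (%q. k a (g q))" if a: "a:\<U>" for a
  by (rule liso_trans[OF trvD(1)[OF t(1) a] liso_mono[OF fg opn_subset[OF smM cover_open[OF U(1) a]]]])
 have Pex: "\<exists>w. P a a' w" if a: "a:\<U>" "a':\<U>'" for a a'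
  unfolding P_def
  by (rule gauge_pair1[OF S R cover_open[OF U(1) a(1)] cover_open[OF U(2) a(2)] fh[OF a(1)] trvD(1)[OF t(2) a(2)]]) blast
 define w where "w a a' = (SOME w. P a a' w)" for a a'
 have w: "P a a' (w a a')" if "a:\<U>" "a':\<U>'" for a a' unfolding w_def by (rule someI_ex[OF Pex[OF that]])
 define ok where "ok W a a' u \<longleftrightarrow> a:\<U> & a':\<U>' & W \<subseteq> a & W \<subseteq> a' & (ALL y:W. sm M u y & w a a' y = uexp (u y))" for W a a' u
 define \<W> where "\<W> = {W. opn M W & (\<exists>a a' u. ok W a a' u)}"
 have cover: "EX W:\<W>. x:W" if x: "x:mc M" for x
 proof -
  obtain a a' where a: "a:\<U>" "x:a" "a':\<U>'" "x:a'" using U x unfolding open_covers_def by blast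
  have o: "opn M (a \<inter> a')" "x:a \<inter> a'" using cover_open[OF U(1) a(1)] cover_open[OF U(2) a(3)] a by auto
  have "cmod (w a a' y) = 1 & sm M (%y. Re (w a a' y)) y & sm M (%y. Im (w a a' y)) y" if "y:a \<inter> a'" for y
   using w[OF a(1,3)] that unfolding P_def by blast
  then obtain W u where W: "opn M W" "x:W" "W \<subseteq> a \<inter> a'" "ALL y:W. sm M u y & w a a' y = uexp (u y)"
   by (rule local_log[OF smM o])
  hence "ok W a a' u" unfolding ok_def using a by blast
  thus ?thesis unfolding \<W>_def using W by blast
 qed
 have oW: "opn M W" if "W:\<W>" for W using that by (simp add: \<W>_def)
 have \<W>: "\<W>:open_covers M" unfolding open_covers_def using cover oW opn_subset[OF smM] by blast
 have "\<exists>a a' u. ok W a a' u" if "W:\<W>" for W using that by (simp add: \<W>_def)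
 then obtain al be u where ok: "ok W (al W) (be W) (u W)" if "W:\<W>" for W by metis
 have fw: "f (h (al W) p) = za R (h' (be W) p) (uexp (u W (pr S p)))" if W: "W:\<W>" and p: "p:tot S" "pr S p:W" for W p
 proof -
  have "pr S p:al W \<inter> be W" "w (al W) (be W) (pr S p) = uexp (u W (pr S p))" "al W:\<U>" "be W:\<U>'"
   using ok[OF W] p unfolding ok_def by blast+
  thus ?thesis using w[of "al W" "be W"] p(1) unfolding P_def by metis
 qed
 show thesis
 proof (rule that[OF \<W>])
  show "refinement \<W> \<U> al" "refinement \<W> \<U>' be" unfolding refinement_def using ok unfolding ok_def by blast+
  show "ALL W:\<W>. ALL x:W. sm M (u W) x" using ok unfolding ok_def by blast
  show "ALL W:\<W>. ALL W':\<W>. ALL ga:GG. ALL x:W. rh ga x:W' --> (\<exists>i::int.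
   r (al W) (al W') ga x - r' (be W) (be W') ga x + (u W' (rh ga x) - of_int (ep ga) * u W x) = of_int i)"
  proof (intro ballI impI)
   fix W W' ga x assume W: "W:\<W>" "W':\<W>" and ga: "ga:GG" and x: "x:W" "rh ga x:W'"
   have a: "al W:\<U>" "al W':\<U>" "be W:\<U>'" "be W':\<U>'" "x:al W" "x:be W" "rh ga x:al W'" "rh ga x:be W'"
    using ok[OF W(1)] ok[OF W(2)] x unfolding ok_def by blast+
   obtain p where p: "p:tot S" "pr S p = x" by (rule pr_surj[OF S cover_mem[OF \<W> W(1) x(1)]])
   note gp = la_mem[OF S ga p(1)]
   have pg: "pr S (la S ga p) = rh ga x" using pr_la[OF S ga p(1)] p(2) by simp
   note q = lisoD(2,3)[OF trvD(1)[OF t(1) a(1)] p(1), unfolded p(2), OF a(5)]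
   note qg = lisoD(2,3)[OF trvD(1)[OF t(1) a(2)] gp, unfolded pg, OF a(7)]
   note s = lisoD(2)[OF trvD(1)[OF t(2) a(3)] p(1), unfolded p(2), OF a(6)]
   note sg = lisoD(2)[OF trvD(1)[OF t(2) a(4)] gp, unfolded pg, OF a(8)]
   let ?B = "h' (be W') (la S ga p)"
   have "f (la Q ga (h (al W) p)) = f (za Q (h (al W') (la S ga p)) (uexp (r (al W) (al W') ga x)))"
    using trvD(3)[OF t(1) a(1,2) ga p(1)] a p(2) by simp
   also have "... = za R (f (h (al W') (la S ga p))) (uexp (r (al W) (al W') ga x))"
    by (rule liso_za[OF Q R fg qg(1) pr_mem[OF Q qg(1)] nuexp])
   also have "... = za R ?B (uexp (u W' (rh ga x) + r (al W) (al W') ga x))"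
    using fw[OF W(2) gp] x(2) za_mult[OF R sg nuexp nuexp] by (simp add: pg uexp_add)
   finally have 1: "f (la Q ga (h (al W) p)) = za R ?B (uexp (u W' (rh ga x) + r (al W) (al W') ga x))" .
   have "la R ga (f (h (al W) p)) = la R ga (za R (h' (be W) p) (uexp (u W x)))" using fw[OF W(1) p(1)] x(1) p(2) by simp
   also have "... = za R (la R ga (h' (be W) p)) (uexp (of_int (ep ga) * u W x))"
    using la_za[OF R ga s nuexp] by (simp add: kz_uexp[OF ga])
   also have "... = za R ?B (uexp (r' (be W) (be W') ga x + of_int (ep ga) * u W x))"
    using trvD(3)[OF t(2) a(3,4) ga p(1)] a p(2) za_mult[OF R sg nuexp nuexp] by (simp add: uexp_add)
   finally have "uexp (u W' (rh ga x) + r (al W) (al W') ga x) = uexp (r' (be W) (be W') ga x + of_int (ep ga) * u W x)"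
    using 1 fla ga q(1) za_inj[OF R sg nuexp nuexp] by simp
   thus "\<exists>i::int. r (al W) (al W') ga x - r' (be W) (be W') ga x + (u W' (rh ga x) - of_int (ep ga) * u W x) = of_int i"
    unfolding uexp_eq_iff by (simp add: algebra_simps)
  qed
 qed
qed

text \<open>Over \<open>W\<close> the isomorphism is the identification through \<open>S\<close>
  corrected by \<open>uexp (u W)\<close>. The integrality hypothesis says exactly that these local
  maps commute with the action across any two members.\<close>

lemma compare_imp_siso:
 assumes S: "str (S :: ('p,'v,'x,'g) sk)" and Q: "str (Q :: ('q,'v,'x,'g) sk)" and R: "str (R :: ('s,'v,'x,'g) sk)"
  and t: "trv S Q \<U> h k r" "trv S R \<U>' h' k' r'"
  and W: "\<W>:open_covers M" and ref: "refinement \<W> \<U> al" "refinement \<W> \<U>' be" and u: "ALL W:\<W>. ALL x:W. sm M (u W) x"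
  and cmp: "ALL W:\<W>. ALL W':\<W>. ALL ga:GG. ALL x:W. rh ga x:W' --> (\<exists>i::int.
   r (al W) (al W') ga x - r' (be W) (be W') ga x + (u W' (rh ga x) - of_int (ep ga) * u W x) = of_int i)"
 shows "siso Q R"
proof -
 define F where "F W q = za R (h' (be W) (k (al W) q)) (uexp (u W (pr Q q)))" for W q
 define G where "G W q = za Q (h (al W) (k' (be W) q)) (uexp (- u W (pr R q)))" for W q
 have ab: "al W:\<U>" "W \<subseteq> al W" "be W:\<U>'" "W \<subseteq> be W" if "W:\<W>" for W using ref that by (auto simp: refinement_def)
 have lh: "liso S Q W (h (al W)) (k (al W))" and lh': "liso S R W (h' (be W)) (k' (be W))" if "W:\<W>" for W
  using liso_mono[OF trvD(1)[OF t(1) ab(1)[OF that]] ab(2)[OF that]] liso_mono[OF trvD(1)[OF t(2) ab(3)[OF that]] ab(4)[OF that]] .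
 have l: "liso Q R W (F W) (G W)" if "W:\<W>" for W
  unfolding F_def[abs_def] G_def[abs_def] by (rule liso_twist[OF S Q R lh[OF that] lh'[OF that]]) (use u that in blast)
 have key: "F W' (la Q ga q) = la R ga (F W q)"
  if W: "W:\<W>" "W':\<W>" and ga: "ga:GG" and q: "q:tot Q" and x: "pr Q q:W" "rh ga (pr Q q):W'" for W W' ga q
 proof -
  let ?x = "pr Q q" and ?p = "k (al W) q"
  let ?r = "r (al W) (al W') ga ?x" and ?r' = "r' (be W) (be W') ga ?x"
  note d = lisoD[OF liso_sym[OF lh[OF W(1)]] q x(1)]
  note gp = la_mem[OF S ga d(2)]
  have pg: "pr S (la S ga ?p) = rh ga ?x" using pr_la[OF S ga d(2)] d(3) by simp
  note e = lisoD[OF lh[OF W(2)] gp, unfolded pg, OF x(2)]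
  note e' = lisoD[OF lh'[OF W(2)] gp, unfolded pg, OF x(2)]
  note s = lisoD[OF lh'[OF W(1)] d(2), unfolded d(3), OF x(1)]
  have a: "?x:al W" "rh ga ?x:al W'" "?x:be W" "rh ga ?x:be W'" using ab W x by blast+
  have "la Q ga q = za Q (h (al W') (la S ga ?p)) (uexp ?r)"
   using trvD(3)[OF t(1) ab(1)[OF W(1)] ab(1)[OF W(2)] ga d(2)] d(3,5) a by simp
  moreover have "k (al W') (za Q (h (al W') (la S ga ?p)) (uexp ?r)) = za S (la S ga ?p) (uexp ?r)"
   using liso_za[OF Q S liso_sym[OF lh[OF W(2)]] e(2) _ nuexp] e x(2) by simp
  moreover have "h' (be W') (za S (la S ga ?p) (uexp ?r)) = za R (h' (be W') (la S ga ?p)) (uexp ?r)"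
   using liso_za[OF S R lh'[OF W(2)] gp _ nuexp] pg x(2) by simp
  ultimately have "F W' (la Q ga q) = za R (h' (be W') (la S ga ?p)) (uexp (?r + u W' (rh ga ?x)))"
   using za_mult[OF R e'(2) nuexp nuexp] pr_la[OF Q ga q] by (simp add: F_def uexp_add)
  also have "uexp (?r + u W' (rh ga ?x)) = uexp (?r' + of_int (ep ga) * u W ?x)"
   unfolding uexp_eq_iff using cmp[rule_format, OF W ga x] by (simp add: algebra_simps)
  also have "za R (h' (be W') (la S ga ?p)) ... = za R (la R ga (h' (be W) ?p)) (uexp (of_int (ep ga) * u W ?x))"
   using trvD(3)[OF t(2) ab(3)[OF W(1)] ab(3)[OF W(2)] ga d(2)] d(3) a za_mult[OF R e'(2) nuexp nuexp] by (simp add: uexp_add)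
  also have "... = la R ga (F W q)"
   unfolding F_def using la_za[OF R ga s(2) nuexp] by (simp add: kz_uexp[OF ga])
  finally show ?thesis .
 qed
 \<comment> \<open>Agreement on overlaps is the case of the neutral group element in
   \<open>key\<close>.\<close>
 have agree: "F W q = F W' q" if "W:\<W>" "W':\<W>" "q:tot Q" "pr Q q:W" "pr Q q:W'" for W W' q
 proof -
  have "F W q:tot R" by (rule lisoD(2)[OF l[OF that(1)] that(3,4)])
  thus ?thesis using key[OF that(1,2) Gam.one_closed that(3,4)] that(5) rho_one[OF pr_mem[OF Q that(3)]]
   by (simp add: la_one[OF Q that(3)] la_one[OF R])
 qed
 obtain f g where fg: "liso Q R (mc M) f g" "ALL W:\<W>. ALL q:tot Q. pr Q q:W --> f q = F W q"
  by (rule liso_glue[OF Q R W l agree])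
 have "f (la Q ga q) = la R ga (f q)" if ga: "ga:GG" and q: "q:tot Q" for ga q
 proof -
  have x: "pr Q q:mc M" "rh ga (pr Q q):mc M" using pr_mem[OF Q q] rho_mem[OF ga] by auto
  then obtain W1 W2 where W12: "W1:\<W>" "pr Q q:W1" "W2:\<W>" "rh ga (pr Q q):W2"
   using W unfolding open_covers_def by blast
  hence "f q = F W1 q" "f (la Q ga q) = F W2 (la Q ga q)" using fg(2) q la_mem[OF Q ga q] pr_la[OF Q ga q] by auto
  thus ?thesis using key[OF W12(1,3) ga q W12(2,4)] by simp
 qed
 thus ?thesis unfolding siso_iff[OF Q R] using fg(1) by blast
qed

lemma coboundaries2: "coboundaries Gm M rh \<theta> \<W> 2 = coboundary Gm rh \<theta> \<W> (Suc 0) ` cochains Gm M rh \<W> (Suc 0)"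
 by (simp add: coboundaries_def numeral_2_eq_2)

lemma cdom_refine:
 "refinement \<W> \<U> al ==> cd2 \<W> a0 a1 a2 ga de x ==> cd2 \<U> (al a0) (al a1) (al a2) ga de x"
 by (auto simp: cdom2_iff refinement_def)

lemma difference_coboundary_iff:
 fixes c d :: "('x, 'g, int) cochain"
 shows "(%as gas x. pullback_cochain Gm rh \<W> 2 al c as gas x - pullback_cochain Gm rh \<W> 2 be d as gas x) =
   coboundary Gm rh (iota ep) \<W> (Suc 0) e \<longleftrightarrow>
  (\<forall>a0 a1 a2 ga de x. cd2 \<W> a0 a1 a2 ga de x -->
   c [al a0, al a1, al a2] [ga, de] x - d [be a0, be a1, be a2] [ga, de] x =
   e [a1, a2] [de] (rh ga x) - e [a0, a2] [de \<odot> ga] x + ep de * e [a0, a1] [ga] x)" (is "?L = ?R \<longleftrightarrow> ?E")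
proof
 assume eq: "?L = ?R"
 show ?E
 proof (intro allI impI)
  fix a0 a1 a2 ga de x assume d: "cd2 \<W> a0 a1 a2 ga de x"
  from fun_cong[OF fun_cong[OF fun_cong[OF eq, of "[a0, a1, a2]"], of "[ga, de]"], of x]
  show "c [al a0, al a1, al a2] [ga, de] x - d [be a0, be a1, be a2] [ga, de] x =
   e [a1, a2] [de] (rh ga x) - e [a0, a2] [de \<odot> ga] x + ep de * e [a0, a1] [ga] x"
   unfolding coboundary1[OF d] using d by (simp add: pullback_cochain_def)
 qed
next
 assume E: ?E
 show "?L = ?R"
 proof (intro ext)
  fix as gas x
  show "?L as gas x = ?R as gas x"
  proof (cases "(as, gas, x):cdom \<W> 2")
   case False thus ?thesis by (simp add: pullback_cochain_def coboundary_def numeral_2_eq_2)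
  next
   case True
   hence "(as, gas):cech_index Gm \<W> 2" by (simp add: cech_domain_def)
   then obtain a0 a1 a2 ga de where l: "as = [a0, a1, a2]" "gas = [ga, de]" by (rule index2E)
   show ?thesis unfolding l coboundary1[OF True[unfolded l]] using E True by (simp add: pullback_cochain_def l)
  qed
 qed
qed

text \<open>Isomorphism means that the logarithms \<open>r\<close> and \<open>r'\<close> differ by
  an integral cochain up to a real coboundary. Taking coboundaries removes the real part and relates
  \<open>m\<close> and \<open>m'\<close>; conversely the vanishing of real cohomology in degree
  \<open>1\<close> restores it.\<close>

lemma tcl_iso_iff:
 assumes S: "str (S :: ('p,'v,'x,'g) sk)" and Q: "str (Q :: ('q,'v,'x,'g) sk)" and R: "str (R :: ('s,'v,'x,'g) sk)"
  and U: "\<U>:open_covers M" "\<U>':open_covers M"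
  and m: "m:cocycles Gm M rh (iota ep) \<U> 2" "m':cocycles Gm M rh (iota ep) \<U>' 2"
  and tw: "tcl S Q (\<U>, m)" "tcl S R (\<U>', m')"
 shows "siso Q R \<longleftrightarrow> ((\<U>, m), (\<U>', m')):cech_rel Gm M rh (iota ep) 2"
proof -
 obtain h k r where t: "trv S Q \<U> h k r"
  and rm: "!!a0 a1 a2 ga de x. cd2 \<U> a0 a1 a2 ga de x ==> dr r a0 a1 a2 ga de x = of_int (m [a0, a1, a2] [ga, de] x)"
  using tw(1) unfolding tcl_def by blast
 obtain h' k' r' where t': "trv S R \<U>' h' k' r'"
  and rm': "!!a0 a1 a2 ga de x. cd2 \<U>' a0 a1 a2 ga de x ==> dr r' a0 a1 a2 ga de x = of_int (m' [a0, a1, a2] [ga, de] x)"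
  using tw(2) unfolding tcl_def by blast
 note sr = trvD(2)[OF t] trvD(2)[OF t']
 show ?thesis
 proof
  assume "siso Q R"
  then obtain \<W> al be u where W: "\<W>:open_covers M" and ref: "refinement \<W> \<U> al" "refinement \<W> \<U>' be"
   and u: "ALL W:\<W>. ALL x:W. sm M (u W) x"
   and cmp: "ALL W:\<W>. ALL W':\<W>. ALL ga:GG. ALL x:W. rh ga x:W' --> (\<exists>i::int.
    r (al W) (al W') ga x - r' (be W) (be W') ga x + (u W' (rh ga x) - of_int (ep ga) * u W x) = of_int i)"
   by (rule siso_imp_compare[OF S Q R U t t'])
  \<comment> \<open>Integral by \<open>cmp\<close>; its coboundary is that of \<open>r - r'\<close>,
    because the terms in \<open>u\<close> form a coboundary themselves.\<close>
  define D where "D W W' ga x = r (al W) (al W') ga x - r' (be W) (be W') ga x + (u W' (rh ga x) - of_int (ep ga) * u W x)" for W W' ga x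
  have Dint: "\<exists>i::int. D W W' ga x = of_int i" if "cd1 \<W> W W' ga x" for W W' ga x
   using cmp that unfolding D_def cdom1_iff by blast
  have Dsm: "sm M (D W W' ga) x" if "cd1 \<W> W W' ga x" for W W' ga x
  proof -
   have d: "W:\<W>" "W':\<W>" "ga:GG" "x:W" "rh ga x:W'" using that by (auto simp: cdom1_iff)
   have rf: "al W:\<U>" "al W':\<U>" "x:al W" "rh ga x:al W'" "be W:\<U>'" "be W':\<U>'" "x:be W" "rh ga x:be W'"
    using ref d unfolding refinement_def by auto
   have "sm M (r (al W) (al W') ga) x" "sm M (r' (be W) (be W') ga) x"
    by (rule sr(1)[unfolded smooth1_def, rule_format, OF rf(1,2) d(3) rf(3,4)],
      rule sr(2)[unfolded smooth1_def, rule_format, OF rf(5,6) d(3) rf(7,8)])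
   moreover have "sm M (u W) x" "sm M (u W') (rh ga x)" using u d by blast+
   ultimately show ?thesis unfolding D_def[abs_def]
    by (intro sm_add sm_diff[OF smM] sm_cmult[OF smM] sm_rho[OF d(3) cover_mem[OF W d(1,4)]])
  qed
  define e where "e as gas x = (if (as, gas, x):cdom \<W> (Suc 0) then \<lfloor>D (as ! 0) (as ! 1) (gas ! 0) x\<rfloor> else 0)" for as gas x
  have eD: "of_int (e [W, W'] [ga] x) = D W W' ga x" if "cd1 \<W> W W' ga x" for W W' ga x
   using Dint[OF that] that by (auto simp: e_def)
  have "locally_constant_on (mtop M) {x. trail rh as gas x} (e as gas)" if i: "(as, gas):cech_index Gm \<W> (Suc 0)" for as gas
  proof -
   obtain a0 a1 ga where l: "as = [a0, a1]" "gas = [ga]" by (rule index1E[OF i])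
   have "locally_constant_on (mtop M) {x. trail rh as gas x} (%x. \<lfloor>D a0 a1 ga x\<rfloor>)"
   proof (rule lc_floor)
    fix x assume "x:{x. trail rh as gas x}"
    hence "cd1 \<W> a0 a1 ga x" using trail_cdom[OF i] l by simp
    thus "sm M (D a0 a1 ga) x & (\<exists>k::int. D a0 a1 ga x = of_int k)" using Dsm Dint by blast
   qed
   thus ?thesis unfolding locally_constant_on_def using trail_cdom[OF i] by (simp add: e_def l)
  qed
  hence ec: "e:cochains Gm M rh \<W> (Suc 0)" unfolding cochains_def by (auto simp: e_def)
  have "m [al a0, al a1, al a2] [ga, de] x - m' [be a0, be a1, be a2] [ga, de] x =
   e [a1, a2] [de] (rh ga x) - e [a0, a2] [de \<odot> ga] x + ep de * e [a0, a1] [ga] x"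
   if d: "cd2 \<W> a0 a1 a2 ga de x" for a0 a1 a2 ga de x
  proof -
   note f = cdom2_faces[OF W d]
   have ds: "cd1 \<W> a1 a2 de (rh ga x)" "cd1 \<W> a0 a2 (de \<odot> ga) x" "cd1 \<W> a0 a1 ga x"
    using f by (auto simp: cdom1_iff)
   have "real_of_int (m [al a0, al a1, al a2] [ga, de] x - m' [be a0, be a1, be a2] [ga, de] x) =
    dr r (al a0) (al a1) (al a2) ga de x - dr r' (be a0) (be a1) (be a2) ga de x"
    using rm[OF cdom_refine[OF ref(1) d]] rm'[OF cdom_refine[OF ref(2) d]] by simp
   also have "... = D a1 a2 de (rh ga x) - D a0 a2 (de \<odot> ga) x + of_int (ep de) * D a0 a1 ga x"
    using f by (simp add: dr_def D_def rho_mult eps_mult algebra_simps)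
   also have "... = real_of_int (e [a1, a2] [de] (rh ga x) - e [a0, a2] [de \<odot> ga] x + ep de * e [a0, a1] [ga] x)"
    unfolding of_int_add of_int_diff of_int_mult eD[OF ds(1)] eD[OF ds(2)] eD[OF ds(3)] ..
   finally show ?thesis unfolding of_int_eq_iff .
  qed
  hence "(%as gas x. pullback_cochain Gm rh \<W> 2 al m as gas x - pullback_cochain Gm rh \<W> 2 be m' as gas x) =
   coboundary Gm rh (iota ep) \<W> (Suc 0) e" unfolding difference_coboundary_iff by blast
  hence "(%as gas x. pullback_cochain Gm rh \<W> 2 al m as gas x - pullback_cochain Gm rh \<W> 2 be m' as gas x)
  :coboundaries Gm M rh (iota ep) \<W> 2" unfolding coboundaries2 using ec by (rule image_eqI)
  thus "((\<U>, m), (\<U>', m')):cech_rel Gm M rh (iota ep) 2"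
   unfolding cech_rel_def using U m W ref by blast
 next
  assume "((\<U>, m), (\<U>', m')):cech_rel Gm M rh (iota ep) 2"
  then obtain \<W> al be e where W: "\<W>:open_covers M" and ref: "refinement \<W> \<U> al" "refinement \<W> \<U>' be"
   and e: "e:cochains Gm M rh \<W> (Suc 0)"
   and eq: "(%as gas x. pullback_cochain Gm rh \<W> 2 al m as gas x - pullback_cochain Gm rh \<W> 2 be m' as gas x) =
    coboundary Gm rh (iota ep) \<W> (Suc 0) e"
   unfolding cech_rel_def coboundaries2 by blast
  \<comment> \<open>Removing the integral cochain \<open>e\<close> leaves a real cocycle, since the
    coboundary of \<open>r - r'\<close> is \<open>m - m'\<close>, which is that of
    \<open>e\<close>.\<close>
  define D where "D W W' ga x = r (al W) (al W') ga x - r' (be W) (be W') ga x - of_int (e [W, W'] [ga] x)" for W W' ga x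
  obtain f where f: "ALL a:\<W>. ALL x:a. sm M (f a) x"
   "\<forall>a0 a1 ga x. cd1 \<W> a0 a1 ga x --> f a1 (rh ga x) - of_int (ep ga) * f a0 x = D a0 a1 ga x"
  proof (rule real_H1_vanishes[OF W, of D])
   fix a0 a1 ga x assume "cd1 \<W> a0 a1 ga x"
   hence d: "a0:\<W>" "a1:\<W>" "ga:GG" "x:a0" "rh ga x:a1" by (auto simp: cdom1_iff)
   note x = cover_mem[OF W d(1,4)]
   have rf: "al a0:\<U>" "al a1:\<U>" "x:al a0" "rh ga x:al a1" "be a0:\<U>'" "be a1:\<U>'" "x:be a0" "rh ga x:be a1"
    using ref d unfolding refinement_def by auto
   have "sm M (r (al a0) (al a1) ga) x" "sm M (r' (be a0) (be a1) ga) x"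
    by (rule sr(1)[unfolded smooth1_def, rule_format, OF rf(1,2) d(3) rf(3,4)],
      rule sr(2)[unfolded smooth1_def, rule_format, OF rf(5,6) d(3) rf(7,8)])
   moreover have "sm M (%x. of_int (e [a0, a1] [ga] x)) x"
   proof (rule lc_sm[OF _ _ _ x])
    have i: "([a0, a1], [ga]):cech_index Gm \<W> (Suc 0)" using d by (simp add: cech_index_def)
    thus "locally_constant_on (mtop M) {x. trail rh [a0, a1] [ga] x} (e [a0, a1] [ga])" using e unfolding cochains_def by blast
    show "x:{x. trail rh [a0, a1] [ga] x}" using d by simp
    show "ngh M x (%y. y:{x. trail rh [a0, a1] [ga] x})"
     using nr_open[OF cover_open[OF W d(1)] d(4)] rho_near[OF d(3) cover_open[OF W d(2)] x d(5)]
     by eventually_elim simp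
   qed
   ultimately show "sm M (D a0 a1 ga) x" unfolding D_def[abs_def] by (intro sm_diff[OF smM])
  next
   fix a0 a1 a2 ga de x assume d: "cd2 \<W> a0 a1 a2 ga de x"
   have "dr D a0 a1 a2 ga de x =
    dr r (al a0) (al a1) (al a2) ga de x - dr r' (be a0) (be a1) (be a2) ga de x -
    real_of_int (e [a1, a2] [de] (rh ga x) - e [a0, a2] [de \<odot> ga] x + ep de * e [a0, a1] [ga] x)"
    by (simp add: dr_def D_def algebra_simps)
   also have "e [a1, a2] [de] (rh ga x) - e [a0, a2] [de \<odot> ga] x + ep de * e [a0, a1] [ga] x =
    m [al a0, al a1, al a2] [ga, de] x - m' [be a0, be a1, be a2] [ga, de] x"
    using eq[unfolded difference_coboundary_iff] d by simp
   finally show "dr D a0 a1 a2 ga de x = 0"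
    using rm[OF cdom_refine[OF ref(1) d]] rm'[OF cdom_refine[OF ref(2) d]] by simp
  qed
  show "siso Q R"
  \<comment> \<open>As \<open>r - r' - e\<close> is the coboundary of \<open>f\<close>, correcting
    by \<open>- f\<close> leaves the integer \<open>e\<close>.\<close>
  proof (rule compare_imp_siso[OF S Q R t t' W ref, of "%W x. - f W x"])
   show "ALL W:\<W>. ALL x:W. sm M (%x. - f W x) x" using f(1) sm_minus[OF smM] by blast
   show "ALL W:\<W>. ALL W':\<W>. ALL ga:GG. ALL x:W. rh ga x:W' --> (\<exists>i::int.
    r (al W) (al W') ga x - r' (be W) (be W') ga x + (- f W' (rh ga x) - of_int (ep ga) * - f W x) = of_int i)"
   proof (intro ballI impI)
    fix W W' ga x assume "W:\<W>" "W':\<W>" "ga:GG" "x:W" "rh ga x:W'"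
    hence "f W' (rh ga x) - of_int (ep ga) * f W x = D W W' ga x" using f(2) by (simp add: cdom1_iff)
    thus "\<exists>i::int. r (al W) (al W') ga x - r' (be W) (be W') ga x + (- f W' (rh ga x) - of_int (ep ga) * - f W x) = of_int i"
     by (intro exI[of _ "e [W, W'] [ga] x"]) (simp add: D_def)
   qed
  qed
 qed
qed

end

subsection \<open>Twisting by a cocycle\<close>

text \<open>The twist lives on the same set as \<open>S\<close>. The function \<open>al\<close>
  picks a local copy of the bundle for each base point; it is an arbitrary choice without continuity
  and only names the points of the reglued space.\<close>

locale twisting = spc Gm ep M rh V n
 for Gm :: "('g, 'b) monoid_scheme" and ep :: "'g => int" and M :: "'x atlas" and rh :: "'g => 'x => 'x"
  and V :: "('v, 'x, 'g) vbundle" and n :: nat +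
 fixes S :: "('p,'v,'x,'g) sk" and \<U> :: "'x set set"
  and r :: "'x set => 'x set => 'g => 'x => real" and al :: "'x => 'x set"
 assumes S: "str S" and U: "\<U>:open_covers M" and r: "smooth1 \<U> r"
  and int: "cd2 \<U> a0 a1 a2 ga de x ==> \<exists>k::int. dr r a0 a1 a2 ga de x = of_int k"
  and al: "x:mc M ==> al x:\<U> & x:al x"
begin

lemma al_mem: "x:mc M ==> al x:\<U>" "x:mc M ==> x:al x"
 using al by auto

abbreviation E :: "'x set => 'p set" where
 "E a \<equiv> {p:tot S. pr S p:a}"

text \<open>The copy of \<open>S\<close> over \<open>a\<close>, expressed in the copy selected by
  \<open>al\<close>. It is discontinuous for the old atlas and serves to define the new one.\<close>

definition H :: "'x set => 'p => 'p" where
 "H a p = za S p (uexp (r a (al (pr S p)) e1 (pr S p)))"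

definition K :: "'x set => 'p => 'p" where
 "K a p = za S p (uexp (- r a (al (pr S p)) e1 (pr S p)))"

text \<open>The new action between the copies selected by \<open>al\<close> at the base point and at
  its image.\<close>

definition tact :: "'g => 'p => 'p" where
 "tact ga p = za S (la S ga p) (uexp (r (al (pr S p)) (al (rh ga (pr S p))) ga (pr S p)))"

lemma uexp_0: "uexp 0 = 1"
 by (simp add: uexp_def)

lemma H_mem: "p:tot S ==> H a p:tot S" and pr_H: "p:tot S ==> pr S (H a p) = pr S p"
 and fm_H: "p:tot S ==> fm S (H a p) = fm S p" and H_ra: "p:tot S ==> g:Gc n ==> H a (ra S p g) = ra S (H a p) g"
 and K_mem: "p:tot S ==> K a p:tot S" and pr_K: "p:tot S ==> pr S (K a p) = pr S p"
 and fm_K: "p:tot S ==> fm S (K a p) = fm S p" and K_ra: "p:tot S ==> g:Gc n ==> K a (ra S p g) = ra S (K a p) g"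
 by (simp_all add: H_def K_def za_mem[OF S] pr_za[OF S] fm_za[OF S] za_ra[OF S] pr_ra[OF S])

lemma K_H: "p:tot S ==> K a (H a p) = p" and H_K: "p:tot S ==> H a (K a p) = p"
 by (simp_all add: H_def K_def za_mem[OF S] pr_za[OF S] za_mult[OF S] uexp_add uexp_0 za_one[OF S])

lemma tact_mem: "ga:GG ==> p:tot S ==> tact ga p:tot S"
 and pr_tact: "ga:GG ==> p:tot S ==> pr S (tact ga p) = rh ga (pr S p)"
 by (simp_all add: tact_def za_mem[OF S] la_mem[OF S] pr_za[OF S] pr_la[OF S])

lemma int1:
 assumes "a:\<U>" "b:\<U>" "c:\<U>" "x:a" "x:b" "x:c"
 shows "\<exists>k::int. r b c e1 x - r a c e1 x + r a b e1 x = of_int k"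
proof -
 have x: "x:mc M" by (rule cover_mem[OF U assms(1,4)])
 hence "cd2 \<U> a b c e1 e1 x" using assms by (simp add: cdom2_iff rho_one)
 from int[OF this] x show ?thesis by (simp add: dr_def rho_one eps_one)
qed

text \<open>The choice \<open>al\<close> cancels up to an integer by \<open>int1\<close>, so the
  change of copy is the phase of \<open>r a b\<close> at the neutral element, which is
  smooth.\<close>

lemma H_trs:
 assumes a: "a:\<U>" "b:\<U>" and p: "p:tot S" "pr S p:a" "pr S p:b"
 shows "H b (za S p (uexp (r a b e1 (pr S p)))) = H a p"
proof -
 note x = al_mem[OF pr_mem[OF S p(1)]]
 obtain k :: int where "r b (al (pr S p)) e1 (pr S p) - r a (al (pr S p)) e1 (pr S p) + r a b e1 (pr S p) = of_int k"
  using int1[OF a x(1) p(2,3) x(2)] by blast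
 hence "uexp (r a b e1 (pr S p) + r b (al (pr S p)) e1 (pr S p)) = uexp (r a (al (pr S p)) e1 (pr S p))"
  unfolding uexp_eq_iff by (intro exI[of _ k]) linarith
 thus ?thesis by (simp add: H_def p(1) za_mem[OF S] pr_za[OF S] za_mult[OF S] uexp_add)
qed

lemma E_open: "a:\<U> ==> opn (atl S) (E a)"
 by (rule opn_smap_preimage[OF atS[OF S] smM pr_smap[OF S] cover_open[OF U]])

abbreviation A :: "'x set => 'p atlas" where
 "A a \<equiv> restrict_atlas (atl S) (E a)"

lemma A_car: "mc (A a) = E a"
 by (auto simp: mc_rst)

sublocale gl: glueing \<U> A H
proof
 show sa: "smooth_atlas (A a)" if "a:\<U>" for a by (rule sa_rst[OF atS[OF S] E_open[OF that]])
 fix a b p q assume a: "a:\<U>" "b:\<U>" and p: "p:mc (A a)" and q: "q:mc (A b)" and eq: "H a p = H b q"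
 have p': "p:tot S" "pr S p:a" and q': "q:tot S" "pr S q:b" using p q by (auto simp: A_car)
 have "pr S (H a p) = pr S (H b q)" using eq by simp
 hence pb: "pr S p:b" using pr_H p' q' by simp
 let ?g = "%p. za S p (uexp (r a b e1 (pr S p)))"
 have gp: "?g p:tot S" "pr S (?g p) = pr S p" using p'(1) by (simp_all add: za_mem[OF S] pr_za[OF S])
 have "H b (?g p) = H b q" using H_trs[OF a p' pb] eq by simp
 from arg_cong[OF this, of "K b"] have gq: "?g p = q" unfolding K_H[OF gp(1)] K_H[OF q'(1)] .
 have "sm M (r a b e1) (pr S p)" using r a p' pb rho_one[OF pr_mem[OF S p'(1)]] unfolding smooth1_def by simp
 from smap_sm[OF pr_smap[OF S p'(1)] this] have us: "sm (atl S) (%p. r a b e1 (pr S p)) p" .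
 have "smap (atl S) (atl S) ?g p"
  by (rule za_smap[OF S atS[OF S] smap_id[OF p'(1)] always_eventually sm_uexp[OF atS[OF S] us]]) simp
 hence "smap (A a) (A b) ?g p"
  unfolding smap_rst_left[OF atS[OF S] E_open[OF a(1)]] smap_rst_right[OF atS[OF S] E_open[OF a(2)]]
  using gp p' pb by simp
 moreover have "ngh (A a) p (%p'. H b (?g p') = H a p')"
 proof -
  have "ngh (atl S) p (%p'. p':E a & p':E b)"
   using nr_open[OF E_open[OF a(1)]] nr_open[OF E_open[OF a(2)]] p' pb
   by (simp add: eventually_conj_iff)
  hence "ngh (atl S) p (%p'. H b (?g p') = H a p')"
   by eventually_elim (use H_trs[OF a] in blast)
  thus ?thesis using near_rst[OF atS[OF S] E_open[OF a(1)], of p] p' by simp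
 qed
 ultimately show "\<exists>g. smap (A a) (A b) g p & g p = q & (ngh (A a) p (%p'. H b (g p') = H a p'))"
  using gq by blast
qed

abbreviation N :: "'p atlas" where
 "N \<equiv> gl.glued"

lemma NS: "smooth_atlas N"
 by (rule gl.sa_glued)

lemma linj: "a:\<U> ==> p:tot S ==> pr S p:a ==> gl.linj a p"
 by (rule gl.smap_glued_inverse(1)) (auto simp: A_car inj_on_def dest: arg_cong[of "H a _" _ "K a"] simp: K_H)

lemma N_car: "mc N = tot S"
proof (rule equalityI; rule subsetI)
 fix q assume "q:mc N"
 thus "q:tot S" using H_mem by (auto simp: gl.mc_glued A_car)
next
 fix q assume q: "q:tot S"
 note x = al_mem[OF pr_mem[OF S q]]
 have "H (al (pr S q)) (K (al (pr S q)) q):mc N"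
  by (rule gl.glued_carI[OF x(1) linj[OF x(1) K_mem[OF q]]]) (use x pr_K[OF q] in simp)
 thus "q:mc N" by (simp add: H_K[OF q])
qed

lemma H_smap:
 assumes "a:\<U>" "p:tot S" "pr S p:a" shows "smap (atl S) N (H a) p"
 using gl.smap_into_glued[OF assms(1) linj[OF assms]] unfolding smap_rst_left[OF atS[OF S] E_open[OF assms(1)]] by blast

lemma N_near:
 assumes a: "a:\<U>" and q: "q:tot S" "pr S q:a"
 shows "ngh N q (%p. p:E a)"
proof -
 have Kq: "K a q:tot S" "pr S (K a q):a" using K_mem[OF q(1)] pr_K[OF q(1)] q by auto
 have "ngh (A a) (K a q) (%p. p:E a)"
  using nr_open[OF E_open[OF a], of "K a q"] Kq by (simp add: near_rst[OF atS[OF S] E_open[OF a]])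
 hence "ngh (A a) (K a q) (%p. H a p:E a)" by eventually_elim (simp add: H_mem pr_H)
 hence "eventually (%p. p:E a) (near N (H a (K a q)))" unfolding gl.near_glued[OF a linj[OF a Kq]] .
 thus ?thesis by (simp add: H_K[OF q(1)])
qed

lemma K_smap:
 assumes a: "a:\<U>" and q: "q:tot S" "pr S q:a" shows "smap N (atl S) (K a) q"
proof -
 have Kq: "K a q:tot S" "pr S (K a q):a" using K_mem[OF q(1)] pr_K[OF q(1)] q by auto
 have "smap (A a) (atl S) (%p. K a (H a p)) (K a q)"
 proof (rule smap_cong_car[OF gl.sa[OF a]])
  show "p = K a (H a p)" if "p:mc (A a)" for p using that by (simp add: A_car K_H)
  show "smap (A a) (atl S) (%p. p) (K a q)"
   unfolding smap_rst_left[OF atS[OF S] E_open[OF a]] using smap_id[OF Kq(1)] Kq by simp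
 qed
 hence "smap N (atl S) (K a) (H a (K a q))" unfolding gl.smap_from_glued[OF a linj[OF a Kq]] .
 thus ?thesis by (simp add: H_K[OF q(1)])
qed

text \<open>Seen in the copies over \<open>a\<close> and \<open>b\<close>, the action is that of
  \<open>S\<close> times the phase of the smooth function \<open>r a b ga\<close>. This is what
  shows the new action to be smooth despite \<open>al\<close>.\<close>

lemma tact_eq:
 assumes a: "a:\<U>" "b:\<U>" and ga: "ga:GG" and q: "q:tot S" "pr S q:a" "rh ga (pr S q):b"
 shows "tact ga q = H b (za S (la S ga (K a q)) (uexp (r a b ga (pr S q))))"
proof -
 let ?x = "pr S q" and ?y = "rh ga (pr S q)"
 have x: "?x:mc M" "?y:mc M" using pr_mem[OF S q(1)] rho_mem[OF ga] by auto
 \<comment> \<open>Both triangles contain the edge from \<open>a\<close> to \<open>al ?y\<close>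
   along \<open>ga\<close>; subtracting their integrality relations eliminates it.\<close>
 have "cd2 \<U> a b (al ?y) ga e1 ?x" "cd2 \<U> a (al ?x) (al ?y) e1 ga ?x"
  using a ga q x by (auto simp: cdom2_iff rho_one al_mem)
 from int[OF this(1)] int[OF this(2)] x ga
 obtain k l :: int where k: "r b (al ?y) e1 ?y - r a (al ?y) ga ?x + r a b ga ?x = of_int k"
  and l: "r (al ?x) (al ?y) ga ?x - r a (al ?y) ga ?x + of_int (ep ga) * r a (al ?x) e1 ?x = of_int l"
  by (auto simp: dr_def rho_one eps_one)
 let ?t = "of_int (ep ga) * - r a (al ?x) e1 ?x + r a b ga ?x + r b (al ?y) e1 ?y"
 have "la S ga (K a q) = za S (la S ga q) (uexp (of_int (ep ga) * - r a (al ?x) e1 ?x))"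
  unfolding K_def by (simp add: la_za[OF S ga q(1)] kz_uexp[OF ga])
 hence "H b (za S (la S ga (K a q)) (uexp (r a b ga ?x))) = za S (la S ga q) (uexp ?t)"
  by (simp add: H_def la_mem[OF S ga q(1)] za_mem[OF S] pr_za[OF S] za_mult[OF S] uexp_add pr_la[OF S ga q(1)])
 moreover have "uexp ?t = uexp (r (al ?x) (al ?y) ga ?x)"
  unfolding uexp_eq_iff by (rule exI[of _ "k - l"]) (use k l in simp)
 ultimately show ?thesis by (simp add: tact_def)
qed

lemma pr_N: assumes q: "q:tot S" shows "smap N M (pr S) q"
proof -
 note x = al_mem[OF pr_mem[OF S q]]
 show ?thesis
  by (rule smap_cong_car[OF NS _ smap_comp[OF K_smap[OF x(1) q x(2)] pr_smap[OF S K_mem[OF q]]]]) (simp add: N_car pr_K)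
qed

lemma fm_N: assumes q: "q:tot S" shows "smap N (frame_atlas M n V) (fm S) q"
proof -
 note x = al_mem[OF pr_mem[OF S q]]
 show ?thesis
  by (rule smap_cong_car[OF NS _ smap_comp[OF K_smap[OF x(1) q x(2)] fm_smap[OF S K_mem[OF q]]]]) (simp add: N_car fm_K)
qed

lemma ra_N:
 assumes z: "z:mc (prod_atlas N (Spinc_atlas n))"
 shows "smap (prod_atlas N (Spinc_atlas n)) N (%(p, g). ra S p g) z"
proof -
 let ?P = "prod_atlas N (Spinc_atlas n)"
 note P = sa_prod[OF NS sa_Spinc]
 have q: "fst z:tot S" "snd z:Gc n" using z by (auto simp: mc_prod N_car mc_Spinc)
 note x = al_mem[OF pr_mem[OF S q(1)]]
 let ?a = "al (pr S (fst z))"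
 note fs = smap_fst_snd[OF NS sa_Spinc z]
 have "smap ?P (atl S) (%z. ra S (K ?a (fst z)) (snd z)) z"
  by (rule ra_comp[OF S smap_comp[OF fs(1) K_smap[OF x(1) q(1) x(2)]] fs(2) P])
 hence s: "smap ?P N (%z. H ?a (ra S (K ?a (fst z)) (snd z))) z"
  by (rule smap_comp[OF _ H_smap[OF x(1)]]) (use q x in "simp_all add: ra_mem[OF S] K_mem pr_ra[OF S] pr_K")
 show ?thesis
 proof (rule smap_cong_car[OF P _ s])
  fix y assume "y:mc ?P"
  hence "fst y:tot S" "snd y:Gc n" by (auto simp: mc_prod N_car mc_Spinc)
  thus "H ?a (ra S (K ?a (fst y)) (snd y)) = (case y of (p, g) => ra S p g)"
   by (simp add: H_ra K_mem H_K case_prod_unfold)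
 qed
qed

lemma tact_N:
 assumes ga: "ga:GG" and q: "q:tot S" shows "smap N N (tact ga) q"
proof -
 note x = al_mem[OF pr_mem[OF S q]] and y = al_mem[OF rho_mem[OF ga pr_mem[OF S q]]]
 let ?a = "al (pr S q)" and ?b = "al (rh ga (pr S q))"
 have "sm M (r ?a ?b ga) (pr S q)" using r x y ga unfolding smooth1_def by blast
 from smap_sm[OF pr_N[OF q] this] have us: "sm N (%q. r ?a ?b ga (pr S q)) q" .
 have "smap N (atl S) (%q. za S (la S ga (K ?a q)) (uexp (r ?a ?b ga (pr S q)))) q"
  by (rule za_smap[OF S NS smap_comp[OF K_smap[OF x(1) q x(2)] la_smap[OF S ga K_mem[OF q]]] always_eventually
   sm_uexp[OF NS us]]) simp
 hence s: "smap N N (%q. H ?b (za S (la S ga (K ?a q)) (uexp (r ?a ?b ga (pr S q))))) q"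
  by (rule smap_comp[OF _ H_smap[OF y(1)]])
   (use q y(2) in "simp_all add: za_mem[OF S] la_mem[OF S ga] K_mem pr_za[OF S] pr_la[OF S ga] pr_K")
 have "ngh N q (%p. rh ga (pr S p):?b)"
  by (rule smap_near[OF NS smM smap_comp[OF pr_N[OF q] rho_smap[OF ga pr_mem[OF S q]]] nr_open[OF cover_open[OF U y(1)] y(2)]])
 with N_near[OF x(1) q x(2)]
 have "ngh N q (%p. H ?b (za S (la S ga (K ?a p)) (uexp (r ?a ?b ga (pr S p)))) = tact ga p)"
  by eventually_elim (use tact_eq[OF x(1) y(1) ga] in simp)
 thus ?thesis by (rule smap_cong[OF NS _ s])
qed

lemma K_preimage_open:
 assumes a: "a:\<U>" and B: "opn (atl S) B"
 shows "opn N {q:E a. K a q:B}"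
proof (rule opn_near[OF NS])
 fix q assume "q:{q:E a. K a q:B}"
 hence q: "q:tot S" "pr S q:a" "K a q:B" by auto
 from smap_near[OF NS atS[OF S] K_smap[OF a q(1,2)] nr_open[OF B q(3)]] N_near[OF a q(1,2)]
 show "ngh N q (%y. y:{q:E a. K a q:B})" by eventually_elim simp
qed (auto simp: N_car)

text \<open>Points over different base points are separated in \<open>M\<close>; points over the
  same base point lie in one copy, where the old topology separates them.\<close>

lemma Hausdorff_N: "Hausdorff_space (mtop N)"
 unfolding Hausdorff_space_def topspace_mtop[OF NS] N_car
proof (intro allI impI)
 fix p q assume pq: "p:tot S & q:tot S & p \<noteq> q"
 show "\<exists>U V. opn N U & opn N V & p:U & q:V & disjnt U V"
 proof (cases "pr S p = pr S q")
  case False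
  then obtain U V where UV: "opn M U" "opn M V" "pr S p:U" "pr S q:V" "disjnt U V"
   using Haus_M pr_mem[OF S] pq unfolding Hausdorff_space_def topspace_mtop[OF smM] by meson
  have o: "opn N {z:mc N. pr S z:U}" if "opn M U" for U
   by (rule opn_smap_preimage[OF NS smM _ that]) (simp add: N_car pr_N)
  show ?thesis
   by (intro exI conjI) (rule o[OF UV(1)], rule o[OF UV(2)], use UV pq in "auto simp: N_car disjnt_def")
 next
  case True
  note x = al_mem[OF pr_mem[OF S pq[THEN conjunct1]]]
  let ?a = "al (pr S p)"
  have "K ?a p \<noteq> K ?a q" using pq H_K by metis
  moreover have "Hausdorff_space (mtop (atl S))" using str_manifold[OF S] by (simp add: smooth_manifold_def)
  ultimately obtain U V where UV: "opn (atl S) U" "opn (atl S) V" "K ?a p:U" "K ?a q:V" "disjnt U V"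
   using K_mem pq unfolding Hausdorff_space_def topspace_mtop[OF atS[OF S]] by meson
  show ?thesis
   by (intro exI conjI) (rule K_preimage_open[OF x(1) UV(1)], rule K_preimage_open[OF x(1) UV(2)],
    use UV pq x True in "auto simp: disjnt_def")
 qed
qed

text \<open>By compactness finitely many members of the cover suffice, and on each of them
  \<open>K a\<close> transports the old countable base.\<close>

lemma second_countable_N: "second_countable (mtop N)"
proof -
 have "second_countable (mtop (atl S))" using str_manifold[OF S] by (simp add: smooth_manifold_def)
 then obtain \<B> where B: "countable \<B>" "!!V. V:\<B> ==> opn (atl S) V"
   "!!U x. opn (atl S) U ==> x:U ==> EX V:\<B>. x:V & V \<subseteq> U"
  unfolding second_countable_def by metis
 have "\<exists>\<F>. finite \<F> & \<F> \<subseteq> \<U> & mc M \<subseteq> \<Union>\<F>"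
  using compact_M[unfolded compact_space_alt topspace_mtop[OF smM], rule_format, of \<U>] U by (simp add: open_covers_def)
 then obtain \<F> where F: "finite \<F>" "\<F> \<subseteq> \<U>" "mc M \<subseteq> \<Union>\<F>" by blast
 let ?\<C> = "(%(a, B). {q:E a. K a q:B}) ` (\<F> \<times> \<B>)"
 have c: "countable ?\<C>" by (rule countable_image[OF countable_SIGMA[OF countable_finite[OF F(1)] B(1)]])
 have o: "opn N V" if V: "V:?\<C>" for V
 proof -
  obtain a B where aB: "a:\<F>" "B:\<B>" and V': "V = {q:E a. K a q:B}" using V by blast
  show ?thesis unfolding V' by (rule K_preimage_open) (use aB F(2) B(2) in auto)
 qed
 have n: "EX V:?\<C>. q:V & V \<subseteq> W" if W: "opn N W" "q:W" for W q
 proof -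
  have q: "q:tot S" using opn_subset[OF NS W(1)] W(2) N_car by auto
  obtain a where a: "a:\<F>" "pr S q:a" using F(3) pr_mem[OF S q] by blast
  have aU: "a:\<U>" using a F(2) by blast
  let ?O = "{p:E a. H a p:W}"
  have "opn (atl S) ?O"
  proof (rule opn_near[OF atS[OF S]])
   fix p assume "p:?O"
   hence p: "p:tot S" "pr S p:a" "H a p:W" by auto
   have pE: "p:E a" using p by simp
   from smap_near[OF atS[OF S] NS H_smap[OF aU p(1,2)] nr_open[OF W(1) p(3)]] nr_open[OF E_open[OF aU] pE]
   show "ngh (atl S) p (%y. y:?O)" by eventually_elim simp
  qed auto
  moreover have "K a q:?O" using q a(2) W(2) by (simp add: K_mem pr_K H_K)
  ultimately obtain B0 where B0: "B0:\<B>" "K a q:B0" "B0 \<subseteq> ?O" using B(3) by meson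
  have "{q:E a. K a q:B0} \<subseteq> W" using B0(3) H_K by force
  moreover have "q:{q:E a. K a q:B0}" using q a(2) B0(2) by simp
  moreover have "{q:E a. K a q:B0}:?\<C>" using a(1) B0(1) by (intro image_eqI[of _ _ "(a, B0)"]) auto
  ultimately show ?thesis by (intro bexI[of _ "{q:E a. K a q:B0}"] conjI)
 qed
 show ?thesis unfolding second_countable_def
  by (intro exI[of _ ?\<C>] conjI ballI allI impI c) (erule o | (erule conjE, rule n; assumption))+
qed

text \<open>A trivialisation of \<open>S\<close>, restricted to a single cover member and
  transported by \<open>H\<close>, which commutes with the right action.\<close>

lemma N_trivial:
 assumes x: "x:mc M"
 shows "\<exists>U ta. opn M U & x:U &
    diffeo (prod_atlas (restrict_atlas M U) (Spinc_atlas n))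
     (restrict_atlas N {p:mc N. pr S p:U}) ta &
    (ALL y:U. ALL g:Gc n. pr S (ta (y, g)) = y &
     (ALL h:Gc n. ta (y, g \<cdot> h) = ra S (ta (y, g)) h))"
proof -
 obtain U0 s d where U0: "opn M U0" "x:U0"
  and s0: "ALL y:U0. s y:tot S & pr S (s y) = y & smap M (atl S) s y"
  and d0: "ALL p:tot S. pr S p:U0 --> d p:Gc n & ra S (s (pr S p)) (d p) = p & smap (atl S) (Spinc_atlas n) d p"
  and ds0: "ALL y:U0. ALL g:Gc n. d (ra S (s y) g) = g"
  by (rule local_section[OF S x]) (rule that; assumption)
 note a = al_mem[OF x]
 let ?a = "al x" and ?U = "U0 \<inter> al x"
 let ?W = "{p:mc N. pr S p:?U}"
 let ?PU = "prod_atlas (restrict_atlas M ?U) (Spinc_atlas n)"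
 have U': "opn M ?U" using U0(1) cover_open[OF U a(1)] by (rule openin_Int)
 have s: "s y:tot S" "pr S (s y) = y" "smap M (atl S) s y" "d (ra S (s y) g) = g" if "y:?U" "g:Gc n" for y g using s0 ds0 that by auto
 have d: "d p:Gc n" "ra S (s (pr S p)) (d p) = p" "smap (atl S) (Spinc_atlas n) d p" if "p:tot S" "pr S p:?U" for p using d0 that by auto
 have UM: "?U \<subseteq> mc M" by (rule opn_subset[OF smM U'])
 have W: "opn N ?W" by (rule opn_smap_preimage[OF NS smM _ U']) (simp add: N_car pr_N)
 have cP: "mc ?PU = ?U \<times> Gc n" using UM by (auto simp: mc_prod mc_rst mc_Spinc)
 have cW: "mc (restrict_atlas N ?W) = ?W" by (auto simp: mc_rst)
 note R = sa_rst[OF smM U'] and RW = sa_rst[OF NS W]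
 note PU = sa_prod[OF R sa_Spinc[of n]]
 define ta where "ta z = H ?a (ra S (s (fst z)) (snd z))" for z
 define sig where "sig q = (pr S q, d (K ?a q))" for q
 have ta: "ta z:?W" "pr S (ta z) = fst z" "sig (ta z) = z" if z: "z:?U \<times> Gc n" for z
 proof -
  have f: "fst z:?U" "snd z:Gc n" using z by auto
  note sz = s[OF f]
  have m: "ra S (s (fst z)) (snd z):tot S" "pr S (ra S (s (fst z)) (snd z)) = fst z" using ra_mem[OF S sz(1) f(2)] pr_ra[OF S sz(1) f(2)] sz(2) by auto
  show p: "pr S (ta z) = fst z" unfolding ta_def pr_H[OF m(1)] m(2) ..
  show "ta z:?W" using p f(1) H_mem[OF m(1)] by (simp add: N_car ta_def)
  show "sig (ta z) = z" unfolding sig_def p unfolding ta_def K_H[OF m(1)] sz(4) by simp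
 qed
 have sig: "sig q:?U \<times> Gc n" "ta (sig q) = q" if q: "q:?W" for q
 proof -
  have q': "q:tot S" "pr S q:?U" using q by (auto simp: N_car)
  have k: "K ?a q:tot S" "pr S (K ?a q):?U" using q' K_mem pr_K by auto
  show "sig q:?U \<times> Gc n" using d(1)[OF k] q'(2) by (simp add: sig_def)
  show "ta (sig q) = q" using d(2)[OF k] by (simp add: ta_def sig_def pr_K[OF q'(1)] H_K[OF q'(1)])
 qed
 have bij: "bij_betw ta (?U \<times> Gc n) ?W"
  by (rule bij_betw_byWitness[where f' = sig]) (use ta sig in blast)+
 have inv: "inv_into (?U \<times> Gc n) ta q = sig q" if q: "q:?W" for q
  using inv_into_f_f[OF bij_betw_imp_inj_on[OF bij] sig(1)[OF q]] sig(2)[OF q] by simp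
 have t1: "smap ?PU (restrict_atlas N ?W) ta z" if z: "z:?U \<times> Gc n" for z
 proof -
  have f: "fst z:?U" "snd z:Gc n" using z by auto
  note sz = s[OF f]
  have zP: "z:mc ?PU" using z cP by simp
  note fs = smap_fst_snd[OF R sa_Spinc zP]
  have "smap (restrict_atlas M ?U) (atl S) s (fst z)" unfolding smap_rst_left[OF smM U'] using sz(3) f(1) by blast
  from ra_comp[OF S smap_comp[OF fs(1) this] fs(2) PU]
  have "smap ?PU (atl S) (%z. ra S (s (fst z)) (snd z)) z" .
  hence "smap ?PU N ta z" unfolding ta_def[abs_def]
   by (rule smap_comp[OF _ H_smap[OF a(1)]]) (use ra_mem[OF S sz(1) f(2)] pr_ra[OF S sz(1) f(2)] sz(2) f(1) in simp_all)
  thus ?thesis unfolding smap_rst_right[OF NS W] using ta(1)[OF z] by blast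
 qed
 have t2: "smap (restrict_atlas N ?W) ?PU (inv_into (?U \<times> Gc n) ta) q" if q: "q:?W" for q
 proof (rule smap_cong_car[OF RW])
  show "sig y = inv_into (?U \<times> Gc n) ta y" if "y:mc (restrict_atlas N ?W)" for y using inv that by (simp only: cW)
  have q': "q:tot S" "pr S q:?U" "pr S q:?a" using q by (auto simp: N_car)
  have k: "K ?a q:tot S" "pr S (K ?a q):?U" using q' K_mem pr_K by auto
  have "smap N (restrict_atlas M ?U) (pr S) q" unfolding smap_rst_right[OF smM U'] using pr_N[OF q'(1)] q'(2) by blast
  from smap_Pair[OF R sa_Spinc NS this smap_comp[OF K_smap[OF a(1) q'(1,3)] d(3)[OF k]]]
  have "smap N ?PU sig q" unfolding sig_def[abs_def] .
  thus "smap (restrict_atlas N ?W) ?PU sig q" unfolding smap_rst_left[OF NS W] using q by blast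
 qed
 have "diffeo ?PU (restrict_atlas N ?W) ta"
  unfolding diffeo_def smm_iff[OF PU RW] smm_iff[OF RW PU] cP cW using bij t1 t2 by blast
 moreover have "pr S (ta (y, g)) = y & (ALL h:Gc n. ta (y, g \<cdot> h) = ra S (ta (y, g)) h)" if y: "y:?U" "g:Gc n" for y g
  using ta(2)[of "(y, g)"] y s[OF y] by (simp add: ta_def ra_mult[OF S] H_ra ra_mem[OF S])
 ultimately show ?thesis using U' U0(2) a(2) by (intro exI[of _ ?U] exI[of _ ta]) blast
qed

definition twist :: "('p,'v,'x,'g) sk" where
 "twist = (\<lparr>ptot = N, pproj = pr S, ract = ra S, lact = tact\<rparr>, fm S)"

lemma twist_simps: "atl twist = N" "pr twist = pr S" "ra twist = ra S" "la twist = tact" "fm twist = fm S"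
 by (simp_all add: twist_def)

lemma tact_one: assumes p: "p:tot S" shows "tact e1 p = p"
proof -
 note x = pr_mem[OF S p] and a = al_mem[OF pr_mem[OF S p]]
 \<comment> \<open>With three equal vertices the integrality relation reduces to one term.\<close>
 obtain k :: int where "r (al (pr S p)) (al (pr S p)) e1 (pr S p) = of_int k" using int1[OF a(1) a(1) a(1) a(2) a(2) a(2)] by auto
 hence "uexp (r (al (pr S p)) (al (pr S p)) e1 (pr S p)) = uexp 0" unfolding uexp_eq_iff by simp
 thus ?thesis by (simp add: tact_def rho_one[OF x] la_one[OF S p] uexp_0 za_one[OF S p])
qed

lemma tact_mult:
 assumes g: "ga:GG" "de:GG" and p: "p:tot S" shows "tact (ga \<odot> de) p = tact ga (tact de p)"
proof -
 let ?x = "pr S p"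
 have x: "?x:mc M" "rh de ?x:mc M" "rh ga (rh de ?x):mc M" using pr_mem[OF S p] rho_mem g by auto
 let ?a = "al ?x" and ?b = "al (rh de ?x)" and ?c = "al (rh ga (rh de ?x))"
 \<comment> \<open>The action law is integrality of the coboundary on the triangle of the three
   selected members.\<close>
 have "cd2 \<U> ?a ?b ?c de ga ?x" using x g by (simp add: cdom2_iff al_mem)
 from int[OF this] obtain k :: int where
  "r ?b ?c ga (rh de ?x) - r ?a ?c (ga \<odot> de) ?x + of_int (ep ga) * r ?a ?b de ?x = of_int k" by (auto simp: dr_def)
 hence e: "uexp (of_int (ep ga) * r ?a ?b de ?x + r ?b ?c ga (rh de ?x)) = uexp (r ?a ?c (ga \<odot> de) ?x)"
  unfolding uexp_eq_iff by (intro exI[of _ k]) linarith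
 note dp = la_mem[OF S g(2) p]
 have "tact ga (tact de p) = za S (la S ga (za S (la S de p) (uexp (r ?a ?b de ?x)))) (uexp (r ?b ?c ga (rh de ?x)))"
  by (simp add: tact_def[of ga] pr_tact[OF g(2) p]) (simp add: tact_def)
 also have "... = za S (la S ga (la S de p)) (uexp (r ?a ?c (ga \<odot> de) ?x))"
  by (simp add: la_za[OF S g(1) dp] kz_uexp[OF g(1)] za_mult[OF S la_mem[OF S g(1) dp]] uexp_add e)
 also have "... = tact (ga \<odot> de) p" by (simp add: tact_def la_mult[OF S g p] rho_mult[OF g x(1)])
 finally show ?thesis ..
qed

lemma str_twist: "str twist"
proof -
 note RA = smm_iff[OF sa_prod[OF NS sa_Spinc] NS]
 have "principal_bundle M (Spinc n) (Spinc_atlas n) (fst twist)"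
  unfolding principal_bundle_def twist_simps
 proof (intro conjI ballI)
  show "smooth_manifold N" unfolding smooth_manifold_def using NS Hausdorff_N second_countable_N by blast
  show "smooth_map N M (pr S)" unfolding smm_iff[OF NS smM] N_car using pr_N by blast
  show "smooth_map (prod_atlas N (Spinc_atlas n)) N (%(p, g). ra S p g)" unfolding RA using ra_N by blast
 qed (simp_all only: N_car ra_one[OF S] pr_ra[OF S] ra_mult[OF S] N_trivial[unfolded N_car])
 moreover have "smooth_action Gm N tact"
  unfolding smooth_action_def smm_iff[OF NS NS] N_car using tact_N tact_one tact_mult by blast
 moreover have "tact ga (ra S p g) = ra S (tact ga p) (kappa ep ga g)" if "ga:GG" "p:tot S" "g:Gc n" for ga p g
  using that by (simp add: tact_def pr_ra[OF S] la_ra[OF S] za_ra[OF S] la_mem[OF S] kappa_mem)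
 moreover have "smooth_map N (frame_atlas M n V) (fm S)"
  unfolding smm_iff[OF NS sa_frame] N_car using fm_N by blast
 moreover have "fm S (tact ga p) = lact (Fr M rh n V) ga (fm S p)" if "ga:GG" "p:tot S" for ga p
  using that by (simp add: tact_def fm_za[OF S] la_mem[OF S] fm_la[OF S])
 moreover have "ptot (Fr M rh n V) = frame_atlas M n V" "pproj (Fr M rh n V) = fst" "ract (Fr M rh n V) = frame_ract n V"
  by (simp_all add: Fr_def)
 ultimately show ?thesis
  unfolding spin_kappa_structure_def semi_equivariant_bundle_def case_prod_unfold twist_simps
  by (simp add: N_car pr_tact fst_fm[OF S] fm_ra[OF S])
qed

lemma trv_twist: "trv S twist \<U> H K r"
 unfolding trv_def
proof (intro conjI ballI impI)
 fix a assume a: "a:\<U>"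
 show "liso S twist a (H a) (K a)" unfolding liso_def half_iso_def twist_simps N_car
  using H_smap[OF a] K_smap[OF a] by (auto simp: pr_H fm_H K_H H_ra pr_K fm_K H_K K_ra)
next
 fix a b ga p assume a: "a:\<U>" "b:\<U>" and ga: "ga:GG" and p: "p:tot S" "pr S p:a" "rh ga (pr S p):b"
 have "tact ga (H a p) = H b (za S (la S ga p) (uexp (r a b ga (pr S p))))"
  using tact_eq[OF a ga H_mem[OF p(1)]] p by (simp add: pr_H K_H)
 also have "... = za twist (H b (la S ga p)) (uexp (r a b ga (pr S p)))"
  by (simp add: za_def[OF str_twist] za_def[OF S] H_ra la_mem[OF S ga p(1)] cz_mem twist_simps)
 finally show "la twist ga (H a p) = za twist (H b (la S ga p)) (uexp (r a b ga (pr S p)))" unfolding twist_simps .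
qed (rule r)

end

section \<open>Realisation of every class, and the resulting bijection\<close>

context spc
begin

text \<open>Read with real values, \<open>m\<close> is the coboundary of a smooth \<open>r\<close>
  by \<open>real_H2_vanishes\<close>. As this coboundary is integral, \<open>r\<close> is admissible
  for twisting \<open>S\<close>, and by construction the twist has class \<open>m\<close>.\<close>

lemma tcl_attained:
 assumes S: "str (S :: ('p,'v,'x,'g) sk)" and U: "\<U>:open_covers M" and m: "m:cocycles Gm M rh (iota ep) \<U> 2"
 shows "\<exists>T :: ('p,'v,'x,'g) sk. str T & tcl S T (\<U>, m)"
proof -
 let ?c = "%a0 a1 a2 ga de x. real_of_int (m [a0, a1, a2] [ga, de] x)"
 obtain r where r1: "smooth1 \<U> r" and r2: "\<forall>a0 a1 a2 ga de x. cd2 \<U> a0 a1 a2 ga de x --> dr r a0 a1 a2 ga de x = ?c a0 a1 a2 ga de x"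
 proof (rule real_H2_vanishes[OF U, of ?c])
  fix a0 a1 a2 ga de x assume d: "cd2 \<U> a0 a1 a2 ga de x"
  hence i: "([a0, a1, a2], [ga, de]):cech_index Gm \<U> 2" by (simp add: cech_domain_def)
  show "sm M (?c a0 a1 a2 ga de) x"
  proof (rule lc_sm[OF _ _ _ cdom2_mem[OF U d]])
   show "locally_constant_on (mtop M) {x. trail rh [a0, a1, a2] [ga, de] x} (m [a0, a1, a2] [ga, de])"
    using m i unfolding cocycles_def cochains_def by blast
   show "x:{x. trail rh [a0, a1, a2] [ga, de] x}" using d trail_cdom[OF i] by simp
   show "ngh M x (%y. y:{x. trail rh [a0, a1, a2] [ga, de] x})"
    using cdom2_near[OF U d] by eventually_elim (use trail_cdom[OF i] in simp)
  qed
 next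
  fix a0 a1 a2 a3 ga de et x assume d: "cd3 \<U> a0 a1 a2 a3 ga de et x"
  have "coboundary Gm rh (iota ep) \<U> 2 m [a0, a1, a2, a3] [ga, de, et] x = 0" using m by (simp add: cocycles_def)
  from arg_cong[OF this[unfolded coboundary2[OF d]], of real_of_int]
  show "?c a1 a2 a3 de et (rh ga x) - ?c a0 a2 a3 (de \<odot> ga) et x + ?c a0 a1 a3 ga (et \<odot> de) x
    - of_int (ep et) * ?c a0 a1 a2 ga de x = 0" by simp
 qed
 have rm: "dr r a0 a1 a2 ga de x = of_int (m [a0, a1, a2] [ga, de] x)" if "cd2 \<U> a0 a1 a2 ga de x" for a0 a1 a2 ga de x
  using r2 that by blast
 have "\<exists>a. a:\<U> & x:a" if "x:mc M" for x using U that unfolding open_covers_def by blast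
 then obtain al where al: "al x:\<U> & x:al x" if "x:mc M" for x by metis
 interpret tw: twisting Gm ep M rh V n S \<U> r al
  by unfold_locales (use S U r1 rm al in auto)
 have "tcl S tw.twist (\<U>, m)" unfolding tcl_def case_prod_conv using tw.trv_twist rm by blast
 thus ?thesis using tw.str_twist by blast
qed

end

text \<open>A relation total on both sides that matches \<open>R\<close> with \<open>R'\<close>
  descends to a bijection of classes. It also transports symmetry and transitivity from
  \<open>R\<close> to \<open>R'\<close>; for \<open>cech_rel\<close> this takes the place of an
  argument with common refinements.\<close>

lemma quotient_bij:
 assumes eq: "equiv S R" and R': "R' \<subseteq> T \<times> T"
  and ex: "!!s. s:S ==> EX t:T. P s t" "!!t. t:T ==> EX s:S. P s t"
  and iff: "!!s s' t t'. s:S ==> s':S ==> t:T ==> t':T ==> P s t ==> P s' t' ==> (s, s'):R \<longleftrightarrow> (t, t'):R'"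
 shows "\<exists>f. bij_betw f (S // R) (T // R')"
proof -
 note E = equivE[OF eq]
 have R: "R \<subseteq> S \<times> S" "!!s. s:S ==> (s, s):R" "!!a b. (a, b):R ==> (b, a):R" "!!a b c. (a, b):R ==> (b, c):R ==> (a, c):R"
  using eq by (auto simp: equiv_def refl_on_def dest: symD transD)
 have eq': "equiv T R'"
 proof (rule equivI)
  show "R' \<subseteq> T \<times> T" by (rule R')
  show "refl_on T R'" unfolding refl_on_def using ex(2) iff R(2) by metis
  show "sym R'"
  proof (rule symI)
   fix a b assume ab: "(a, b):R'"
   hence "a:T" "b:T" using R' by auto
   then obtain s t where "s:S" "P s a" "t:S" "P t b" using ex(2) by blast
   thus "(b, a):R'" using iff[of s t a b] iff[of t s b a] ab \<open>a:T\<close> \<open>b:T\<close> R(3) by blast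
  qed
  show "trans R'"
  proof (rule transI)
   fix a b c assume ab: "(a, b):R'" "(b, c):R'"
   hence T: "a:T" "b:T" "c:T" using R' by auto
   then obtain s t u where S: "s:S" "P s a" "t:S" "P t b" "u:S" "P u c" using ex(2) by meson
   have "(s, t):R" "(t, u):R" using iff[of s t a b] iff[of t u b c] ab S T by blast+
   thus "(a, c):R'" using iff[of s u a c] S T R(4) by blast
  qed
 qed
 define f where "f C = R' `` {SOME t. t:T & (EX s:C. P s t)}" for C
 have f: "f (R `` {s}) = R' `` {t}" if s: "s:S" and t: "t:T" and P: "P s t" for s t
 proof -
  let ?t = "SOME t. t:T & (EX s:R `` {s}. P s t)"
  have "t:T & (EX s:R `` {s}. P s t)" using t P R(2)[OF s] by blast
  hence "?t:T & (EX s:R `` {s}. P s ?t)" by (rule someI)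
  then obtain s' where s': "(s, s'):R" "P s' ?t" "?t:T" by blast
  have "(t, ?t):R'" using iff[OF s _ t s'(3) P s'(2)] s'(1) R(1) by blast
  thus ?thesis unfolding f_def by (rule equiv_class_eq[OF eq', symmetric])
 qed
 have "bij_betw f (S // R) (T // R')" unfolding bij_betw_def
 proof
  show "inj_on f (S // R)"
  proof (rule inj_onI)
   fix C D assume "C:S // R" "D:S // R" and fCD: "f C = f D"
   then obtain s s' where s: "s:S" "C = R `` {s}" "s':S" "D = R `` {s'}" by (auto elim!: quotientE)
   obtain t t' where t: "t:T" "P s t" "t':T" "P s' t'" using ex(1) s by blast
   have "R' `` {t} = R' `` {t'}" using fCD f[OF s(1) t(1,2)] f[OF s(3) t(3,4)] s by simp
   hence "(t, t'):R'" using eq_equiv_class[OF _ eq'] t by blast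
   hence "(s, s'):R" using iff[OF s(1,3) t(1,3,2,4)] by blast
   thus "C = D" unfolding s by (rule equiv_class_eq[OF eq])
  qed
  show "f ` (S // R) = T // R'"
  proof (rule equalityI; rule subsetI)
   fix D assume "D:f ` (S // R)"
   then obtain s where s: "s:S" "D = f (R `` {s})" by (auto elim!: quotientE)
   obtain t where "t:T" "P s t" using ex(1) s(1) by blast
   thus "D:T // R'" unfolding s(2) f[OF s(1) \<open>t:T\<close> \<open>P s t\<close>] by (intro quotientI)
  next
   fix D assume "D:T // R'"
   then obtain t where t: "t:T" "D = R' `` {t}" by (auto elim!: quotientE)
   obtain s where s: "s:S" "P s t" using ex(2) t(1) by blast
   show "D:f ` (S // R)" unfolding t(2) f[OF s(1) t(1) s(2), symmetric] by (intro imageI quotientI s)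
  qed
 qed
 thus ?thesis by blast
qed

theorem corollary38:
  fixes \<Gamma> :: "('g, 'b) monoid_scheme" and \<epsilon> :: "'g \<Rightarrow> int"
    and M :: "'x atlas" and \<rho> :: "'g \<Rightarrow> 'x \<Rightarrow> 'x"
    and V :: "('v, 'x, 'g) vbundle" and n :: nat
  assumes "orientifold \<Gamma> \<epsilon> M \<rho>"
    and "equivariant_oriented_bundle \<Gamma> M \<rho> n V"
    and "\<exists>s :: ('p, 'v, 'x, 'g) spin_kappa. spin_kappa_structure \<Gamma> \<epsilon> M \<rho> n V s"
  shows "\<exists>f. bij_betw f
    (spin_kappa_classes \<Gamma> \<epsilon> M \<rho> n V :: ('p, 'v, 'x, 'g) spin_kappa set set)
    (equivariant_cohomology \<Gamma> M \<rho> (iota \<epsilon>) 2)"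
proof -
  interpret spc \<Gamma> \<epsilon> M \<rho> V n by unfold_locales (rule assms)+
  obtain S :: "('p,'v,'x,'g) sk" where S: "str S" using assms(3) by blast
  show ?thesis
    unfolding spin_kappa_classes_def equivariant_cohomology_def
  proof (rule quotient_bij[where P = "tcl S"])
    show "equiv (spin_kappa_structures \<Gamma> \<epsilon> M \<rho> n V) {(s, t). s \<in> spin_kappa_structures \<Gamma> \<epsilon> M \<rho> n V \<and>
        t \<in> spin_kappa_structures \<Gamma> \<epsilon> M \<rho> n V \<and> siso (s :: ('p,'v,'x,'g) sk) (t :: ('p,'v,'x,'g) sk)}"
      unfolding spin_kappa_structures_def
      by (intro equivI refl_onI symI transI) (auto intro: siso_refl siso_sym siso_trans)
    show "cech_rel \<Gamma> M \<rho> (iota \<epsilon>) 2 \<subseteq> (SIGMA \<U>:open_covers M. cocycles \<Gamma> M \<rho> (iota \<epsilon>) \<U> 2) \<times> (SIGMA \<U>:open_covers M. cocycles \<Gamma> M \<rho> (iota \<epsilon>) \<U> 2)"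
      by (auto simp: cech_rel_def)
  next
    fix T :: "('p,'v,'x,'g) sk" assume "T \<in> spin_kappa_structures \<Gamma> \<epsilon> M \<rho> n V"
    hence "str T" by (simp add: spin_kappa_structures_def)
    from tcl_exists[OF S this]
    show "\<exists>t\<in>(SIGMA \<U>:open_covers M. cocycles \<Gamma> M \<rho> (iota \<epsilon>) \<U> 2). tcl S T t" by blast
  next
    fix t assume "t \<in> (SIGMA \<U>:open_covers M. cocycles \<Gamma> M \<rho> (iota \<epsilon>) \<U> 2)"
    then obtain \<U> m where t: "t = (\<U>, m)" and U: "\<U> \<in> open_covers M" and m: "m \<in> cocycles \<Gamma> M \<rho> (iota \<epsilon>) \<U> 2" by blast
    show "\<exists>T\<in>(spin_kappa_structures \<Gamma> \<epsilon> M \<rho> n V :: ('p,'v,'x,'g) sk set). tcl S T t"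
      using tcl_attained[OF S U m] by (simp add: t spin_kappa_structures_def Bex_def)
  next
    fix Q R :: "('p,'v,'x,'g) sk" and t t'
    assume QR: "Q \<in> spin_kappa_structures \<Gamma> \<epsilon> M \<rho> n V" "R \<in> spin_kappa_structures \<Gamma> \<epsilon> M \<rho> n V"
      and t: "t \<in> (SIGMA \<U>:open_covers M. cocycles \<Gamma> M \<rho> (iota \<epsilon>) \<U> 2)" "t' \<in> (SIGMA \<U>:open_covers M. cocycles \<Gamma> M \<rho> (iota \<epsilon>) \<U> 2)"
      and tw: "tcl S Q t" "tcl S R t'"
    obtain \<U> m \<U>' m' where tt: "t = (\<U>, m)" "t' = (\<U>', m')" by (metis prod.exhaust)
    have "siso Q R \<longleftrightarrow> (t, t') \<in> cech_rel \<Gamma> M \<rho> (iota \<epsilon>) 2"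
      unfolding tt by (rule tcl_iso_iff[OF S]) (use QR t tw in \<open>simp_all add: tt spin_kappa_structures_def\<close>)
    thus "(Q, R) \<in> {(s, t). s \<in> spin_kappa_structures \<Gamma> \<epsilon> M \<rho> n V \<and> t \<in> spin_kappa_structures \<Gamma> \<epsilon> M \<rho> n V \<and> siso s t} \<longleftrightarrow>
        (t, t') \<in> cech_rel \<Gamma> M \<rho> (iota \<epsilon>) 2" using QR by simp
  qed
qed

end
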